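(* Let $\mathbb{K}\in\{\mathbb{R},\mathbb{C}\}$, let $\mathcal{H}$ be a graded and connected Hopf algebra over $\mathbb{K}$ and let $B$ be a commutative Mackey complete locally convex algebra over $\mathbb{K}$. (a) The Lie group $G(\mathcal{H},B)$ of $B$-valued characters of $\mathcal{H}$ is $C^1$-regular. (b) If, in addition, $B$ is sequentially complete, then $G(\mathcal{H},B)$ is even $C^0$-regular. In both cases, the associated evolution map is even a $\mathbb{K}$-analytic map.
   Context: Algebras are unital associative $\mathbb{K}$-algebras. A locally convex space is a Hausdorff locally convex topological $\mathbb{K}$-vector space; it is Mackey complete if every Mackey--Cauchy sequence converges (equivalently, every smooth curve $[0,1]\to E$ has a Riemann integral in $E$). A locally convex algebra is an algebra with a locally convex vector space topology for which multiplication $B\times B\to B$ is continuous. Graded connected Hopf algebra: a Hopf algebra $\mathcal{H}$ with a decomposition $\mathcal{H}=\bigoplus_{n\in\mathbb{N}_0}\mathcal{H}_n$ such that $1_{\mathcal{H}}\in\mathcal{H}_0$, $\mathcal{H}_n\mathcal{H}_m\subseteq\mathcal{H}_{n+m}$, $\Delta(\mathcal{H}_n)\subseteq\bigoplus_{i+j=n}\mathcal{H}_i\otimes\mathcal{H}_j$, $\bigoplus_{n\ge1}\mathcal{H}_n\subseteq\ker\epsilon$, and $\dim\mathcal{H}_0=1$. Put $A:=\mathrm{Hom}_{\mathbb{K}}(\mathcal{H},B)$ with the topology of pointwise convergence and convolution $\phi\star\psi=m_B\circ(\phi\otimes\psi)\circ\Delta_{\mathcal{H}}$. $G(\mathcal{H},B)\subseteq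 A$ is the group (under $\star$) of unital algebra homomorphisms $\mathcal{H}\to B$. It carries the $\mathbb{K}$-analytic Lie group structure inherited as a $\mathbb{K}$-analytic submanifold of $A$ (locally, in suitable $\mathbb{K}$-analytic charts of the affine subspace $\{\phi\in A:\phi(1_{\mathcal{H}})=1_B\}$, it corresponds to a closed vector subspace); its topology is that of pointwise convergence, and its Lie algebra is $\mathfrak{g}(\mathcal{H},B)=\{\phi\in A:\phi(ab)=\epsilon_{\mathcal{H}}(a)\phi(b)+\epsilon_{\mathcal{H}}(b)\phi(a)\ \forall a,b\}$ with the commutator bracket of $\star$. Calculus (Keller's $C^r_c$-theory): $f:U\to F$, $U\subseteq E$ open, between locally convex spaces is $C^r$ if its iterated directional derivatives $d^{(k)}f:U\times E^k\to F$ ($k\le r$) exist and are continuous; smooth means $C^\infty$. $\mathbb{K}$-analytic means $C^\infty_{\mathbb{C}}$ if $\mathbb{K}=\mathbb{C}$, and extendable to a $C^\infty_{\mathbb{C}}$-map on an open neighbourhood in the complexification if $\mathbb{K}=\mathbb{R}$. $C^r$-regularity ($r\in\mathbb{N}_0\cup\{\infty\}$): let $G$ be a Lie group modelled on a locally convex space, $\mathbf{L}(G)=T_{\mathbf 1}G$, $\lambda_g(x)=gx$ and $g.v:=T_{\mathbf 1}\lambda_g(v)$. $G$ is $C^r$-regular if for each $C^r$-curve $\gamma:[0,1]\to\mathbf{L}(G)$ the initial value problem $\eta'(t)=\eta(t).\gamma(t)$, $\eta(0)=\mathbf 1$ has a (necessarily unique) $C^{r+1}$-solution $\mathrm{Evol}(\gamma):[0,1]\to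 G$, and the evolution map $\mathrm{evol}:C^r([0,1],\mathbf{L}(G))\to G$, $\gamma\mapsto\mathrm{Evol}(\gamma)(1)$, is smooth (with the topology of uniform convergence of derivatives up to order $r$ on $C^r([0,1],\mathbf{L}(G))$). *)

theory Defs
  imports
    "HOL-Analysis.Analysis"
    "HOL-Algebra.Group"
    "HOL-Library.Function_Algebras"
    "HOL-Library.Poly_Mapping"
begin

section \<open>The ground field\<close>

text \<open>
  The class of the two fields \<open>\<real>\<close> and \<open>\<complex>\<close>: since the norm is multiplicative, every type of this
  class is isometrically isomorphic to one of them.
\<close>

class real_or_complex_field = real_normed_field +
  assumes real_or_complex:
    "(\<forall>x. \<exists>a. x = a *\<^sub>R 1) \<or> (\<exists>i. i * i = - 1 \<and> (\<forall>x. \<exists>a b. x = a *\<^sub>R 1 + b *\<^sub>R i))"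

instance real :: real_or_complex_field
  by standard auto

instance complex :: real_or_complex_field
proof
  have "\<i> * \<i> = - 1 \<and> (\<forall>x. \<exists>a b. x = a *\<^sub>R 1 + b *\<^sub>R \<i>)"
    by (auto simp: complex_eq_iff)
  then show "(\<forall>x::complex. \<exists>a. x = a *\<^sub>R 1) \<or>
      (\<exists>i::complex. i * i = - 1 \<and> (\<forall>x. \<exists>a b. x = a *\<^sub>R 1 + b *\<^sub>R i))"
    by blast
qed


section \<open>Locally convex spaces\<close>

text \<open>
  The carrier of \<open>E\<close> is \<open>pts E\<close>, in general a proper linear subspace of the type \<open>'e\<close>.
\<close>

record ('k, 'e) tvs =
  smul :: "'k \<Rightarrow> 'e \<Rightarrow> 'e"
  topol :: "'e topology"

abbreviation pts :: "('k, 'e) tvs \<Rightarrow> 'e set" where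
  "pts E \<equiv> topspace (topol E)"

definition locally_convex_space :: "('k::real_normed_field, 'e::ab_group_add) tvs \<Rightarrow> bool" where
  "locally_convex_space E \<longleftrightarrow>
     vector_space (smul E) \<and>
     module.subspace (smul E) (pts E) \<and>
     Hausdorff_space (topol E) \<and>
     continuous_map (prod_topology (topol E) (topol E)) (topol E) (\<lambda>(x, y). x + y) \<and>
     continuous_map (prod_topology euclidean (topol E)) (topol E) (\<lambda>(a, x). smul E a x) \<and>
     (\<forall>U. openin (topol E) U \<and> 0 \<in> U \<longrightarrow>
       (\<exists>C. openin (topol E) C \<and> 0 \<in> C \<and> C \<subseteq> U \<and>
         (\<forall>x\<in>C. \<forall>y\<in>C. \<forall>t\<in>{0..1::real}.
            smul E (of_real t) x + smul E (of_real (1 - t)) y \<in> C)))"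

definition bounded_in :: "('k::real_normed_field, 'e::ab_group_add) tvs \<Rightarrow> 'e set \<Rightarrow> bool" where
  "bounded_in E S \<longleftrightarrow> S \<subseteq> pts E \<and>
     (\<forall>U. openin (topol E) U \<and> 0 \<in> U \<longrightarrow>
       (\<exists>r>0. \<forall>a. r \<le> norm a \<longrightarrow> S \<subseteq> smul E a ` U))"

definition mackey_cauchy :: "('k::real_normed_field, 'e::ab_group_add) tvs \<Rightarrow> (nat \<Rightarrow> 'e) \<Rightarrow> bool" where
  "mackey_cauchy E x \<longleftrightarrow> range x \<subseteq> pts E \<and>
     (\<exists>S (\<mu> :: nat \<Rightarrow> nat \<Rightarrow> real). bounded_in E S \<and>
        (\<forall>e>0. \<exists>N. \<forall>m\<ge>N. \<forall>n\<ge>N. \<bar>\<mu> m n\<bar> < e) \<and>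
        (\<forall>m n. x m - x n \<in> smul E (of_real (\<mu> m n)) ` S))"

definition mackey_complete :: "('k::real_normed_field, 'e::ab_group_add) tvs \<Rightarrow> bool" where
  "mackey_complete E \<longleftrightarrow>
     (\<forall>x. mackey_cauchy E x \<longrightarrow> (\<exists>l. limitin (topol E) x l sequentially))"

definition cauchy_seq :: "('k::real_normed_field, 'e::ab_group_add) tvs \<Rightarrow> (nat \<Rightarrow> 'e) \<Rightarrow> bool" where
  "cauchy_seq E x \<longleftrightarrow> range x \<subseteq> pts E \<and>
     (\<forall>U. openin (topol E) U \<and> 0 \<in> U \<longrightarrow> (\<exists>N. \<forall>m\<ge>N. \<forall>n\<ge>N. x m - x n \<in> U))"

definition sequentially_complete :: "('k::real_normed_field, 'e::ab_group_add) tvs \<Rightarrow> bool" where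
  "sequentially_complete E \<longleftrightarrow>
     (\<forall>x. cauchy_seq E x \<longrightarrow> (\<exists>l. limitin (topol E) x l sequentially))"

definition subspace_tvs :: "('k, 'e) tvs \<Rightarrow> 'e set \<Rightarrow> ('k, 'e) tvs" where
  "subspace_tvs E F = \<lparr>smul = smul E, topol = subtopology (topol E) F\<rparr>"

definition prod_tvs :: "('k, 'e) tvs \<Rightarrow> ('k, 'f) tvs \<Rightarrow> ('k, 'e \<times> 'f) tvs" where
  "prod_tvs E F =
     \<lparr>smul = (\<lambda>a (x, y). (smul E a x, smul F a y)), topol = prod_topology (topol E) (topol F)\<rparr>"

text \<open>
  The sort \<open>{ring, monoid_mult}\<close> is that of unital rings that may be zero; \<open>ring_1\<close> would force
  \<open>0 \<noteq> 1\<close>.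
\<close>

definition unital_algebra :: "('k::field \<Rightarrow> 'a::{ring, monoid_mult} \<Rightarrow> 'a) \<Rightarrow> bool" where
  "unital_algebra s \<longleftrightarrow> vector_space s \<and>
     (\<forall>c x y. s c x * y = s c (x * y) \<and> x * s c y = s c (x * y))"

definition locally_convex_algebra :: "('k::real_normed_field, 'b::{ring, monoid_mult}) tvs \<Rightarrow> bool" where
  "locally_convex_algebra B \<longleftrightarrow>
     locally_convex_space B \<and> pts B = UNIV \<and> unital_algebra (smul B) \<and>
     continuous_map (prod_topology (topol B) (topol B)) (topol B) (\<lambda>(x, y). x * y)"


section \<open>Calculus in locally convex spaces\<close>

definition has_dir_deriv ::
  "('k::real_normed_field, 'e::ab_group_add) tvs \<Rightarrow> ('k, 'f::ab_group_add) tvs \<Rightarrow>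
    ('e \<Rightarrow> 'f) \<Rightarrow> 'e \<Rightarrow> 'e \<Rightarrow> 'f \<Rightarrow> bool" where
  "has_dir_deriv E F f x v y \<longleftrightarrow>
     limitin (topol F) (\<lambda>t. smul F (inverse t) (f (x + smul E t v) - f x)) y (at 0)"

definition dir_deriv ::
  "('k::real_normed_field, 'e::ab_group_add) tvs \<Rightarrow> ('k, 'f::ab_group_add) tvs \<Rightarrow>
    ('e \<Rightarrow> 'f) \<Rightarrow> 'e \<Rightarrow> 'e \<Rightarrow> 'f" where
  "dir_deriv E F f x v = (THE y. has_dir_deriv E F f x v y)"

text \<open>
  \<open>iter_dir_deriv E F f k x v\<close> only depends on \<open>v 0, \<dots>, v (k - 1)\<close>, which are the directions.
\<close>

primrec iter_dir_deriv ::
  "('k::real_normed_field, 'e::ab_group_add) tvs \<Rightarrow> ('k, 'f::ab_group_add) tvs \<Rightarrow>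
    ('e \<Rightarrow> 'f) \<Rightarrow> nat \<Rightarrow> 'e \<Rightarrow> (nat \<Rightarrow> 'e) \<Rightarrow> 'f" where
  "iter_dir_deriv E F f 0 x v = f x"
| "iter_dir_deriv E F f (Suc k) x v = dir_deriv E F (\<lambda>y. iter_dir_deriv E F f k y v) x (v k)"

definition Cr_on ::
  "('k::real_normed_field, 'e::ab_group_add) tvs \<Rightarrow> ('k, 'f::ab_group_add) tvs \<Rightarrow>
    enat \<Rightarrow> 'e set \<Rightarrow> ('e \<Rightarrow> 'f) \<Rightarrow> bool" where
  "Cr_on E F r U f \<longleftrightarrow> openin (topol E) U \<and>
     (\<forall>k. enat k < r \<longrightarrow> (\<forall>x\<in>U. \<forall>v\<in>{..k} \<rightarrow> pts E.
        \<exists>y. has_dir_deriv E F (\<lambda>z. iter_dir_deriv E F f k z v) x (v k) y)) \<and>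
     (\<forall>k. enat k \<le> r \<longrightarrow>
        continuous_map
          (prod_topology (subtopology (topol E) U) (product_topology (\<lambda>_. topol E) {..<k}))
          (topol F) (\<lambda>(x, v). iter_dir_deriv E F f k x v))"

definition complexification ::
  "('k::real_algebra_1, 'e::ab_group_add) tvs \<Rightarrow> (complex, 'e \<times> 'e) tvs" where
  "complexification E =
     \<lparr>smul = (\<lambda>z (x, y). (smul E (of_real (Re z)) x - smul E (of_real (Im z)) y,
                          smul E (of_real (Re z)) y + smul E (of_real (Im z)) x)),
      topol = prod_topology (topol E) (topol E)\<rparr>"

text \<open>The condition \<open>\<exists>i::'k. i * i = - 1\<close> separates the complex from the real case.\<close>

definition K_analytic_on ::
  "('k::real_or_complex_field, 'e::ab_group_add) tvs \<Rightarrow> ('k, 'f::ab_group_add) tvs \<Rightarrow>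
    'e set \<Rightarrow> ('e \<Rightarrow> 'f) \<Rightarrow> bool" where
  "K_analytic_on E F U f \<longleftrightarrow>
     (if \<exists>i::'k. i * i = - 1 then Cr_on E F \<infinity> U f
      else openin (topol E) U \<and>
        (\<exists>W g. (\<forall>x\<in>U. (x, 0) \<in> W \<and> g (x, 0) = (f x, 0)) \<and>
               Cr_on (complexification E) (complexification F) \<infinity> W g))"

text \<open>
  Curves have a real parameter, also over \<open>\<complex>\<close>. Below, \<open>J\<close> is always relatively open in \<open>[0,1]\<close>,
  and derivatives at the end points are one-sided.
\<close>

definition has_curve_deriv ::
  "('k::real_normed_field, 'e::ab_group_add) tvs \<Rightarrow> real set \<Rightarrow> (real \<Rightarrow> 'e) \<Rightarrow> real \<Rightarrow> 'e \<Rightarrow> bool" where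
  "has_curve_deriv E J c t y \<longleftrightarrow>
     limitin (topol E) (\<lambda>s. smul E (of_real (inverse (s - t))) (c s - c t)) y (at t within J)"

definition curve_deriv ::
  "('k::real_normed_field, 'e::ab_group_add) tvs \<Rightarrow> real set \<Rightarrow> (real \<Rightarrow> 'e) \<Rightarrow> real \<Rightarrow> 'e" where
  "curve_deriv E J c t = (THE y. has_curve_deriv E J c t y)"

definition iter_curve_deriv ::
  "('k::real_normed_field, 'e::ab_group_add) tvs \<Rightarrow> real set \<Rightarrow> nat \<Rightarrow> (real \<Rightarrow> 'e) \<Rightarrow> real \<Rightarrow> 'e" where
  "iter_curve_deriv E J k = curve_deriv E J ^^ k"

definition Cr_curve ::
  "('k::real_normed_field, 'e::ab_group_add) tvs \<Rightarrow> enat \<Rightarrow> real set \<Rightarrow> (real \<Rightarrow> 'e) \<Rightarrow> bool" where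
  "Cr_curve E r J c \<longleftrightarrow>
     (\<forall>k. enat k < r \<longrightarrow> (\<forall>t\<in>J. \<exists>y. has_curve_deriv E J (iter_curve_deriv E J k c) t y)) \<and>
     (\<forall>k. enat k \<le> r \<longrightarrow> continuous_map (top_of_set J) (topol E) (iter_curve_deriv E J k c))"

text \<open>
  The space \<open>C\<^sup>r([0,1], E)\<close>; its elements are extended by \<open>0\<close> to the real line, so that they form a
  linear subspace of \<open>real \<Rightarrow> 'e\<close>. A basic neighbourhood of \<open>c\<close> consists of the \<open>d\<close> whose derivatives
  up to some finite order \<open>k \<le> r\<close> are uniformly \<open>U\<close>-close to those of \<open>c\<close>.
\<close>

definition Cr_curves ::
  "('k::real_normed_field, 'e::ab_group_add) tvs \<Rightarrow> enat \<Rightarrow> (real \<Rightarrow> 'e) set" where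
  "Cr_curves E r = {c. Cr_curve E r {0..1} c \<and> (\<forall>t. t \<notin> {0..1} \<longrightarrow> c t = 0)}"

definition Cr_curves_nbhd ::
  "('k::real_normed_field, 'e::ab_group_add) tvs \<Rightarrow> enat \<Rightarrow> nat \<Rightarrow> 'e set \<Rightarrow> (real \<Rightarrow> 'e) \<Rightarrow> (real \<Rightarrow> 'e) set" where
  "Cr_curves_nbhd E r k U c =
     {d \<in> Cr_curves E r. \<forall>j\<le>k. \<forall>t\<in>{0..1}.
        iter_curve_deriv E {0..1} j d t - iter_curve_deriv E {0..1} j c t \<in> U}"

definition Cr_curves_open ::
  "('k::real_normed_field, 'e::ab_group_add) tvs \<Rightarrow> enat \<Rightarrow> (real \<Rightarrow> 'e) set \<Rightarrow> bool" where
  "Cr_curves_open E r W \<longleftrightarrow> W \<subseteq> Cr_curves E r \<and>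
     (\<forall>c\<in>W. \<exists>k U. enat k \<le> r \<and> openin (topol E) U \<and> 0 \<in> U \<and> Cr_curves_nbhd E r k U c \<subseteq> W)"

lemma istopology_Cr_curves_open: "istopology (Cr_curves_open E r)"
  unfolding istopology_def
proof (rule conjI; intro allI impI)
  fix S T assume S: "Cr_curves_open E r S" and T: "Cr_curves_open E r T"
  have "\<exists>k U. enat k \<le> r \<and> openin (topol E) U \<and> 0 \<in> U \<and> Cr_curves_nbhd E r k U c \<subseteq> S \<inter> T"
    if c: "c \<in> S \<inter> T" for c
  proof -
    from S c obtain k U where kU: "enat k \<le> r" "openin (topol E) U" "0 \<in> U"
      "Cr_curves_nbhd E r k U c \<subseteq> S"
      unfolding Cr_curves_open_def by blast
    from T c obtain l V where lV: "enat l \<le> r" "openin (topol E) V" "0 \<in> V"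
      "Cr_curves_nbhd E r l V c \<subseteq> T"
      unfolding Cr_curves_open_def by blast
    have "Cr_curves_nbhd E r (max k l) (U \<inter> V) c \<subseteq> Cr_curves_nbhd E r k U c"
      unfolding Cr_curves_nbhd_def using max.cobounded1[of k l] order_trans by blast
    moreover have "Cr_curves_nbhd E r (max k l) (U \<inter> V) c \<subseteq> Cr_curves_nbhd E r l V c"
      unfolding Cr_curves_nbhd_def using max.cobounded2[of l k] order_trans by blast
    ultimately have "Cr_curves_nbhd E r (max k l) (U \<inter> V) c \<subseteq> S \<inter> T"
      using kU(4) lV(4) by blast
    moreover have "enat (max k l) \<le> r" using kU(1) lV(1) by (simp add: max_def)
    moreover have "openin (topol E) (U \<inter> V)" "0 \<in> U \<inter> V" using kU lV by auto
    ultimately show ?thesis by blast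
  qed
  moreover have "S \<inter> T \<subseteq> Cr_curves E r" using S by (auto simp: Cr_curves_open_def)
  ultimately show "Cr_curves_open E r (S \<inter> T)" by (simp add: Cr_curves_open_def)
next
  fix \<K> assume K: "\<forall>S\<in>\<K>. Cr_curves_open E r S"
  have "\<exists>k U. enat k \<le> r \<and> openin (topol E) U \<and> 0 \<in> U \<and> Cr_curves_nbhd E r k U c \<subseteq> \<Union>\<K>"
    if c: "c \<in> S" "S \<in> \<K>" for c S
  proof -
    from K c obtain k U where "enat k \<le> r" "openin (topol E) U" "0 \<in> U"
      "Cr_curves_nbhd E r k U c \<subseteq> S"
      unfolding Cr_curves_open_def by blast
    with c show ?thesis by (meson Union_upper order_trans)
  qed
  moreover have "\<Union>\<K> \<subseteq> Cr_curves E r" using K by (auto simp: Cr_curves_open_def)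
  ultimately show "Cr_curves_open E r (\<Union>\<K>)" unfolding Cr_curves_open_def by blast
qed

definition Cr_curve_space ::
  "('k::real_normed_field, 'e::ab_group_add) tvs \<Rightarrow> enat \<Rightarrow> ('k, real \<Rightarrow> 'e) tvs" where
  "Cr_curve_space E r =
     \<lparr>smul = (\<lambda>a c t. smul E a (c t)), topol = topology (Cr_curves_open E r)\<rparr>"

lemma openin_Cr_curve_space: "openin (topol (Cr_curve_space E r)) = Cr_curves_open E r"
  unfolding Cr_curve_space_def by (simp add: topology_inverse' istopology_Cr_curves_open)

lemma pts_Cr_curve_space:
  assumes "locally_convex_space E"
  shows "pts (Cr_curve_space E r) = Cr_curves E r"
proof
  interpret vector_space "smul E" using assms by (simp add: locally_convex_space_def)
  have 0: "0 \<in> pts E"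
    using assms unfolding locally_convex_space_def by (auto simp: subspace_def)
  have "Cr_curves_nbhd E r 0 (pts E) c \<subseteq> Cr_curves E r" for c
    by (auto simp: Cr_curves_nbhd_def)
  moreover have "enat 0 \<le> r" by (simp flip: zero_enat_def)
  ultimately have "Cr_curves_open E r (Cr_curves E r)"
    unfolding Cr_curves_open_def using 0 by blast
  then show "Cr_curves E r \<subseteq> pts (Cr_curve_space E r)"
    by (simp add: openin_subset openin_Cr_curve_space)
  have "Cr_curves_open E r (pts (Cr_curve_space E r))"
    by (metis openin_Cr_curve_space openin_topspace)
  then show "pts (Cr_curve_space E r) \<subseteq> Cr_curves E r" by (simp add: Cr_curves_open_def)
qed


section \<open>Manifolds and Lie groups modelled on locally convex spaces\<close>

type_synonym ('m, 'e) chart = "'m set \<times> ('m \<Rightarrow> 'e)"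

record ('k, 'm, 'e) mfd =
  mtop :: "'m topology"
  model :: "('k, 'e) tvs"
  atlas :: "('m, 'e) chart set"

definition K_analytic_manifold :: "('k::real_or_complex_field, 'm, 'e::ab_group_add) mfd \<Rightarrow> bool" where
  "K_analytic_manifold M \<longleftrightarrow>
     locally_convex_space (model M) \<and> Hausdorff_space (mtop M) \<and>
     (\<Union>(U, \<kappa>)\<in>atlas M. U) = topspace (mtop M) \<and>
     (\<forall>(U, \<kappa>)\<in>atlas M. openin (mtop M) U \<and> openin (topol (model M)) (\<kappa> ` U) \<and>
        homeomorphic_map (subtopology (mtop M) U) (subtopology (topol (model M)) (\<kappa> ` U)) \<kappa>) \<and>
     (\<forall>(U, \<kappa>)\<in>atlas M. \<forall>(V, \<mu>)\<in>atlas M.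
        K_analytic_on (model M) (model M) (\<kappa> ` (U \<inter> V)) (\<mu> \<circ> inv_into U \<kappa>))"

definition tvs_mfd :: "('k, 'e) tvs \<Rightarrow> ('k, 'e, 'e) mfd" where
  "tvs_mfd E = \<lparr>mtop = topol E, model = E, atlas = {(pts E, id)}\<rparr>"

definition prod_mfd ::
  "('k, 'm, 'e) mfd \<Rightarrow> ('k, 'n, 'f) mfd \<Rightarrow> ('k, 'm \<times> 'n, 'e \<times> 'f) mfd" where
  "prod_mfd M N =
     \<lparr>mtop = prod_topology (mtop M) (mtop N), model = prod_tvs (model M) (model N),
      atlas = {(U \<times> V, map_prod \<kappa> \<mu>) | U \<kappa> V \<mu>. (U, \<kappa>) \<in> atlas M \<and> (V, \<mu>) \<in> atlas N}\<rparr>"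

definition Cr_mfd_map ::
  "('k::real_normed_field, 'm, 'e::ab_group_add) mfd \<Rightarrow> ('k, 'n, 'f::ab_group_add) mfd \<Rightarrow>
    enat \<Rightarrow> ('m \<Rightarrow> 'n) \<Rightarrow> bool" where
  "Cr_mfd_map M N r f \<longleftrightarrow> continuous_map (mtop M) (mtop N) f \<and>
     (\<forall>(U, \<kappa>)\<in>atlas M. \<forall>(V, \<mu>)\<in>atlas N.
        Cr_on (model M) (model N) r (\<kappa> ` {x \<in> U. f x \<in> V}) (\<mu> \<circ> f \<circ> inv_into U \<kappa>))"

definition K_analytic_mfd_map ::
  "('k::real_or_complex_field, 'm, 'e::ab_group_add) mfd \<Rightarrow> ('k, 'n, 'f::ab_group_add) mfd \<Rightarrow>
    ('m \<Rightarrow> 'n) \<Rightarrow> bool" where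
  "K_analytic_mfd_map M N f \<longleftrightarrow> continuous_map (mtop M) (mtop N) f \<and>
     (\<forall>(U, \<kappa>)\<in>atlas M. \<forall>(V, \<mu>)\<in>atlas N.
        K_analytic_on (model M) (model N) (\<kappa> ` {x \<in> U. f x \<in> V}) (\<mu> \<circ> f \<circ> inv_into U \<kappa>))"

definition Cr_mfd_curve ::
  "('k::real_normed_field, 'm, 'e::ab_group_add) mfd \<Rightarrow> enat \<Rightarrow> (real \<Rightarrow> 'm) \<Rightarrow> bool" where
  "Cr_mfd_curve M r \<eta> \<longleftrightarrow> continuous_map (top_of_set {0..1}) (mtop M) \<eta> \<and>
     (\<forall>(U, \<kappa>)\<in>atlas M. Cr_curve (model M) r {t \<in> {0..1}. \<eta> t \<in> U} (\<kappa> \<circ> \<eta>))"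

definition charts_at :: "('k, 'm, 'e) mfd \<Rightarrow> 'm \<Rightarrow> ('m, 'e) chart set" where
  "charts_at M x = {c \<in> atlas M. x \<in> fst c}"

text \<open>
  A tangent vector at \<open>x\<close> is the family of its coordinate vectors in the charts around \<open>x\<close>, related
  by the differentials of the chart changes (and \<open>0\<close> at all other charts). Each coordinate is a
  linear bijection of the tangent space onto the model space, and the topology is the one turning
  these bijections into homeomorphisms.
\<close>

definition tangent_vectors ::
  "('k::real_normed_field, 'm, 'e::ab_group_add) mfd \<Rightarrow> 'm \<Rightarrow> (('m, 'e) chart \<Rightarrow> 'e) set" where
  "tangent_vectors M x =
     {v. (\<forall>c\<in>charts_at M x. v c \<in> pts (model M)) \<and>
         (\<forall>c. c \<notin> charts_at M x \<longrightarrow> v c = 0) \<and>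
         (\<forall>c\<in>charts_at M x. \<forall>d\<in>charts_at M x.
            v d = dir_deriv (model M) (model M) (snd d \<circ> inv_into (fst c) (snd c)) (snd c x) (v c))}"

definition tangent_space ::
  "('k::real_normed_field, 'm, 'e::ab_group_add) mfd \<Rightarrow> 'm \<Rightarrow> ('k, ('m, 'e) chart \<Rightarrow> 'e) tvs" where
  "tangent_space M x =
     \<lparr>smul = (\<lambda>a v c. smul (model M) a (v c)),
      topol = subtopology (product_topology (\<lambda>_. topol (model M)) UNIV) (tangent_vectors M x)\<rparr>"

text \<open>The value of \<open>T\<^sub>x f\<close> at \<open>v\<close> does not depend on the chosen chart around \<open>x\<close>.\<close>

definition tangent_map ::
  "('k::real_normed_field, 'm, 'e::ab_group_add) mfd \<Rightarrow> ('k, 'n, 'f::ab_group_add) mfd \<Rightarrow>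
    ('m \<Rightarrow> 'n) \<Rightarrow> 'm \<Rightarrow> (('m, 'e) chart \<Rightarrow> 'e) \<Rightarrow> (('n, 'f) chart \<Rightarrow> 'f)" where
  "tangent_map M N f x v =
     (\<lambda>d. if d \<in> charts_at N (f x)
          then let c = (SOME c. c \<in> charts_at M x) in
            dir_deriv (model M) (model N) (snd d \<circ> f \<circ> inv_into (fst c) (snd c)) (snd c x) (v c)
          else 0)"

definition velocity ::
  "('k::real_normed_field, 'm, 'e::ab_group_add) mfd \<Rightarrow> (real \<Rightarrow> 'm) \<Rightarrow> real \<Rightarrow>
    (('m, 'e) chart \<Rightarrow> 'e)" where
  "velocity M \<eta> t =
     (\<lambda>c. if c \<in> charts_at M (\<eta> t)
          then curve_deriv (model M) {s \<in> {0..1}. \<eta> s \<in> fst c} (snd c \<circ> \<eta>) t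
          else 0)"

definition K_analytic_lie_group ::
  "'m monoid \<Rightarrow> ('k::real_or_complex_field, 'm, 'e::ab_group_add) mfd \<Rightarrow> bool" where
  "K_analytic_lie_group G M \<longleftrightarrow>
     group G \<and> K_analytic_manifold M \<and> carrier G = topspace (mtop M) \<and>
     K_analytic_mfd_map (prod_mfd M M) M (\<lambda>(x, y). x \<otimes>\<^bsub>G\<^esub> y) \<and>
     K_analytic_mfd_map M M (\<lambda>x. inv\<^bsub>G\<^esub> x)"

abbreviation lie_algebra_space ::
  "'m monoid \<Rightarrow> ('k::real_normed_field, 'm, 'e::ab_group_add) mfd \<Rightarrow> ('k, ('m, 'e) chart \<Rightarrow> 'e) tvs" where
  "lie_algebra_space G M \<equiv> tangent_space M \<one>\<^bsub>G\<^esub>"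

text \<open>
  Solutions of the initial value problem \<open>\<eta>'(t) = \<eta>(t).\<gamma>(t)\<close>, \<open>\<eta>(0) = 1\<close> on \<open>[0,1]\<close>, represented by
  functions that are \<open>undefined\<close> off \<open>[0,1]\<close>.
\<close>

definition is_evolution ::
  "'m monoid \<Rightarrow> ('k::real_normed_field, 'm, 'e::ab_group_add) mfd \<Rightarrow> enat \<Rightarrow>
    (real \<Rightarrow> ('m, 'e) chart \<Rightarrow> 'e) \<Rightarrow> (real \<Rightarrow> 'm) \<Rightarrow> bool" where
  "is_evolution G M r \<gamma> \<eta> \<longleftrightarrow>
     \<eta> \<in> extensional {0..1} \<and> Cr_mfd_curve M (r + 1) \<eta> \<and> \<eta> 0 = \<one>\<^bsub>G\<^esub> \<and>
     (\<forall>t\<in>{0..1}. velocity M \<eta> t = tangent_map M M (\<lambda>x. \<eta> t \<otimes>\<^bsub>G\<^esub> x) \<one>\<^bsub>G\<^esub> (\<gamma> t))"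

definition Evol ::
  "'m monoid \<Rightarrow> ('k::real_normed_field, 'm, 'e::ab_group_add) mfd \<Rightarrow> enat \<Rightarrow>
    (real \<Rightarrow> ('m, 'e) chart \<Rightarrow> 'e) \<Rightarrow> real \<Rightarrow> 'm" where
  "Evol G M r \<gamma> = (THE \<eta>. is_evolution G M r \<gamma> \<eta>)"

definition evol ::
  "'m monoid \<Rightarrow> ('k::real_normed_field, 'm, 'e::ab_group_add) mfd \<Rightarrow> enat \<Rightarrow>
    (real \<Rightarrow> ('m, 'e) chart \<Rightarrow> 'e) \<Rightarrow> 'm" where
  "evol G M r \<gamma> = Evol G M r \<gamma> 1"

definition Cr_regular_lie_group ::
  "'m monoid \<Rightarrow> ('k::real_or_complex_field, 'm, 'e::ab_group_add) mfd \<Rightarrow> enat \<Rightarrow> bool" where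
  "Cr_regular_lie_group G M r \<longleftrightarrow>
     K_analytic_lie_group G M \<and>
     (\<forall>\<gamma>\<in>pts (Cr_curve_space (lie_algebra_space G M) r). \<exists>!\<eta>. is_evolution G M r \<gamma> \<eta>) \<and>
     Cr_mfd_map (tvs_mfd (Cr_curve_space (lie_algebra_space G M) r)) M \<infinity> (evol G M r)"

definition K_analytic_evol ::
  "'m monoid \<Rightarrow> ('k::real_or_complex_field, 'm, 'e::ab_group_add) mfd \<Rightarrow> enat \<Rightarrow> bool" where
  "K_analytic_evol G M r \<longleftrightarrow>
     K_analytic_mfd_map (tvs_mfd (Cr_curve_space (lie_algebra_space G M) r)) M (evol G M r)"

text \<open>
  The structure that \<open>N\<close> inherits as a submanifold of \<open>E\<close> modelled on the closed vector subspace \<open>F\<close>: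
  the charts are the restrictions to \<open>N\<close> of the \<open>K\<close>-analytic charts of \<open>E\<close> that take \<open>N\<close> to \<open>F\<close>.
\<close>

definition submanifold ::
  "('k::real_or_complex_field, 'e::ab_group_add) tvs \<Rightarrow> 'e set \<Rightarrow> 'e set \<Rightarrow> ('k, 'e, 'e) mfd" where
  "submanifold E F N =
     \<lparr>mtop = subtopology (topol E) N, model = subspace_tvs E F,
      atlas = {(U \<inter> N, \<kappa>) | U \<kappa>. inj_on \<kappa> U \<and>
                 K_analytic_on E E U \<kappa> \<and> K_analytic_on E E (\<kappa> ` U) (inv_into U \<kappa>) \<and>
                 \<kappa> ` (U \<inter> N) = \<kappa> ` U \<inter> F}\<rparr>"


section \<open>Graded connected Hopf algebras\<close>

text \<open>
  The tensor powers \<open>H \<otimes> H\<close> and \<open>H \<otimes> H \<otimes> H\<close> are the quotients of the free vector spaces on pairs and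
  triples by the spans of the multilinearity relations. Their elements are given by
  representatives, and \<open>tensor2_eq\<close> and \<open>tensor3_eq\<close> are the equality in the quotient.
\<close>

definition free_smul :: "'k::field \<Rightarrow> ('x \<Rightarrow>\<^sub>0 'k) \<Rightarrow> ('x \<Rightarrow>\<^sub>0 'k)" where
  "free_smul c u = Poly_Mapping.map ((*) c) u"

abbreviation gen :: "'x \<Rightarrow> ('x \<Rightarrow>\<^sub>0 'k::field)" where
  "gen x \<equiv> Poly_Mapping.single x 1"

definition lin_ext :: "('k::field \<Rightarrow> 'v::ab_group_add \<Rightarrow> 'v) \<Rightarrow> ('x \<Rightarrow> 'v) \<Rightarrow> ('x \<Rightarrow>\<^sub>0 'k) \<Rightarrow> 'v" where
  "lin_ext s f u = (\<Sum>x\<in>Poly_Mapping.keys u. s (Poly_Mapping.lookup u x) (f x))"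

definition tensor2_eq ::
  "('k::field \<Rightarrow> 'h::ab_group_add \<Rightarrow> 'h) \<Rightarrow> ('h \<times> 'h \<Rightarrow>\<^sub>0 'k) \<Rightarrow> ('h \<times> 'h \<Rightarrow>\<^sub>0 'k) \<Rightarrow> bool" where
  "tensor2_eq s u v \<longleftrightarrow> u - v \<in> module.span free_smul
     ({gen (a + a', b) - gen (a, b) - gen (a', b) | a a' b. True} \<union>
      {gen (a, b + b') - gen (a, b) - gen (a, b') | a b b'. True} \<union>
      {gen (s c a, b) - free_smul c (gen (a, b)) | c a b. True} \<union>
      {gen (a, s c b) - free_smul c (gen (a, b)) | c a b. True})"

definition tensor3_eq ::
  "('k::field \<Rightarrow> 'h::ab_group_add \<Rightarrow> 'h) \<Rightarrow> ('h \<times> 'h \<times> 'h \<Rightarrow>\<^sub>0 'k) \<Rightarrow> ('h \<times> 'h \<times> 'h \<Rightarrow>\<^sub>0 'k) \<Rightarrow> bool" where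
  "tensor3_eq s u v \<longleftrightarrow> u - v \<in> module.span free_smul
     ({gen (a + a', b, d) - gen (a, b, d) - gen (a', b, d) | a a' b d. True} \<union>
      {gen (a, b + b', d) - gen (a, b, d) - gen (a, b', d) | a b b' d. True} \<union>
      {gen (a, b, d + d') - gen (a, b, d) - gen (a, b, d') | a b d d'. True} \<union>
      {gen (s c a, b, d) - free_smul c (gen (a, b, d)) | c a b d. True} \<union>
      {gen (a, s c b, d) - free_smul c (gen (a, b, d)) | c a b d. True} \<union>
      {gen (a, b, s c d) - free_smul c (gen (a, b, d)) | c a b d. True})"

locale hopf_algebra =
  fixes s :: "'k::field \<Rightarrow> 'h::{ring, monoid_mult} \<Rightarrow> 'h"
    and \<Delta> :: "'h \<Rightarrow> ('h \<times> 'h \<Rightarrow>\<^sub>0 'k)"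
    and \<epsilon> :: "'h \<Rightarrow> 'k"
    and S :: "'h \<Rightarrow> 'h"
  assumes algebra: "unital_algebra s"
    and comult_add: "tensor2_eq s (\<Delta> (x + y)) (\<Delta> x + \<Delta> y)"
    and comult_scale: "tensor2_eq s (\<Delta> (s c x)) (free_smul c (\<Delta> x))"
    and counit_linear: "Vector_Spaces.linear s (*) \<epsilon>"
    and coassoc: "tensor3_eq s
      (lin_ext free_smul (\<lambda>(a, b). lin_ext free_smul (\<lambda>(p, q). gen (p, q, b)) (\<Delta> a)) (\<Delta> x))
      (lin_ext free_smul (\<lambda>(a, b). lin_ext free_smul (\<lambda>(p, q). gen (a, p, q)) (\<Delta> b)) (\<Delta> x))"
    and counit_left: "lin_ext s (\<lambda>(a, b). s (\<epsilon> a) b) (\<Delta> x) = x"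
    and counit_right: "lin_ext s (\<lambda>(a, b). s (\<epsilon> b) a) (\<Delta> x) = x"
    and comult_mult: "tensor2_eq s (\<Delta> (x * y))
      (lin_ext free_smul (\<lambda>(a, b). lin_ext free_smul (\<lambda>(c, d). gen (a * c, b * d)) (\<Delta> y)) (\<Delta> x))"
    and comult_one: "tensor2_eq s (\<Delta> 1) (gen (1, 1))"
    and counit_mult: "\<epsilon> (x * y) = \<epsilon> x * \<epsilon> y"
    and counit_one: "\<epsilon> 1 = 1"
    and antipode_linear: "Vector_Spaces.linear s s S"
    and antipode_left: "lin_ext s (\<lambda>(a, b). S a * b) (\<Delta> x) = s (\<epsilon> x) 1"
    and antipode_right: "lin_ext s (\<lambda>(a, b). a * S b) (\<Delta> x) = s (\<epsilon> x) 1"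

locale graded_connected_hopf_algebra = hopf_algebra s \<Delta> \<epsilon> S
  for s :: "'k::field \<Rightarrow> 'h::{ring, monoid_mult} \<Rightarrow> 'h" and \<Delta> \<epsilon> S +
  fixes gr :: "nat \<Rightarrow> 'h set"
  assumes gr_subspace: "module.subspace s (gr n)"
    and gr_direct_sum: "\<exists>!f :: nat \<Rightarrow> 'h. (\<forall>n. f n \<in> gr n) \<and> finite {n. f n \<noteq> 0} \<and>
      x = (\<Sum>n | f n \<noteq> 0. f n)"
    and gr_one: "1 \<in> gr 0"
    and gr_mult: "a \<in> gr n \<Longrightarrow> b \<in> gr m \<Longrightarrow> a * b \<in> gr (n + m)"
    and gr_comult: "a \<in> gr n \<Longrightarrow>
      \<exists>u. tensor2_eq s (\<Delta> a) u \<and> Poly_Mapping.keys u \<subseteq> (\<Union>(i, j)\<in>{(i, j). i + j = n}. gr i \<times> gr j)"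
    and gr_counit: "1 \<le> n \<Longrightarrow> a \<in> gr n \<Longrightarrow> \<epsilon> a = 0"
    and gr_connected: "vector_space.dim s (gr 0) = 1"


section \<open>The character group\<close>

definition hom_tvs ::
  "('k::field \<Rightarrow> 'h::ab_group_add \<Rightarrow> 'h) \<Rightarrow> ('k, 'b::ab_group_add) tvs \<Rightarrow> ('k, 'h \<Rightarrow> 'b) tvs" where
  "hom_tvs s B =
     \<lparr>smul = (\<lambda>c \<phi> x. smul B c (\<phi> x)),
      topol = subtopology (product_topology (\<lambda>_. topol B) UNIV)
                {\<phi>. Vector_Spaces.linear s (smul B) \<phi>}\<rparr>"

definition convolution ::
  "('k::field, 'b::{ring, monoid_mult}) tvs \<Rightarrow> ('h \<Rightarrow> ('h \<times> 'h \<Rightarrow>\<^sub>0 'k)) \<Rightarrow>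
    ('h \<Rightarrow> 'b) \<Rightarrow> ('h \<Rightarrow> 'b) \<Rightarrow> ('h \<Rightarrow> 'b)" where
  "convolution B \<Delta> \<phi> \<psi> = (\<lambda>x. lin_ext (smul B) (\<lambda>(a, b). \<phi> a * \<psi> b) (\<Delta> x))"

definition characters ::
  "('k::field \<Rightarrow> 'h::{ring, monoid_mult} \<Rightarrow> 'h) \<Rightarrow> ('k, 'b::{ring, monoid_mult}) tvs \<Rightarrow>
    ('h \<Rightarrow> 'b) set" where
  "characters s B =
     {\<phi>. Vector_Spaces.linear s (smul B) \<phi> \<and> \<phi> 1 = 1 \<and> (\<forall>a b. \<phi> (a * b) = \<phi> a * \<phi> b)}"

definition infinitesimal_characters ::
  "('k::field \<Rightarrow> 'h::{ring, monoid_mult} \<Rightarrow> 'h) \<Rightarrow> ('h \<Rightarrow> 'k) \<Rightarrow> ('k, 'b::{ring, monoid_mult}) tvs \<Rightarrow>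
    ('h \<Rightarrow> 'b) set" where
  "infinitesimal_characters s \<epsilon> B =
     {\<phi>. Vector_Spaces.linear s (smul B) \<phi> \<and>
         (\<forall>a b. \<phi> (a * b) = smul B (\<epsilon> a) (\<phi> b) + smul B (\<epsilon> b) (\<phi> a))}"

definition character_group ::
  "('k::field \<Rightarrow> 'h::{ring, monoid_mult} \<Rightarrow> 'h) \<Rightarrow> ('h \<Rightarrow> ('h \<times> 'h \<Rightarrow>\<^sub>0 'k)) \<Rightarrow> ('h \<Rightarrow> 'k) \<Rightarrow>
    ('k, 'b::{ring, monoid_mult}) tvs \<Rightarrow> ('h \<Rightarrow> 'b) monoid" where
  "character_group s \<Delta> \<epsilon> B =
     \<lparr>carrier = characters s B, mult = convolution B \<Delta>, one = (\<lambda>x. smul B (\<epsilon> x) 1)\<rparr>"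

definition character_mfd ::
  "('k::real_or_complex_field \<Rightarrow> 'h::{ring, monoid_mult} \<Rightarrow> 'h) \<Rightarrow> ('h \<Rightarrow> 'k) \<Rightarrow>
    ('k, 'b::{ring, monoid_mult}) tvs \<Rightarrow> ('k, 'h \<Rightarrow> 'b, 'h \<Rightarrow> 'b) mfd" where
  "character_mfd s \<epsilon> B =
     submanifold (hom_tvs s B) (infinitesimal_characters s \<epsilon> B) (characters s B)"

end

theory Submission
 imports Defs
begin

text \<open>
  The logarithmic derivative along the grading turns the affine space of unital linear maps into a
  linear space: the fixed point equation \<open>\<phi> \<circ> Y = \<phi> \<star> (\<psi> \<circ> Y)\<close>, where \<open>Y\<close> multiplies degree \<open>n\<close> by \<open>n\<close>,
  is solved by recursion on the degree, so that \<open>\<psi> \<mapsto> \<phi>\<close> and its inverse are analytic, being given in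
  each degree by finitely many convolutions. This chart takes characters to infinitesimal characters
  and is global. In the same way the evolution equation \<open>\<eta>' = \<eta> \<star> \<gamma>\<close> is equivalent to the
  integral equation \<open>\<eta> = 1 + \<integral> \<eta> \<star> \<gamma>\<close>, which by \<open>\<gamma> 1 = 0\<close> is triangular with
  respect to the grading: finitely many Picard iterations give the solution in each degree. Only
  primitives of curves in the target algebra are needed, and these exist for Lipschitz curves under
  Mackey completeness and for continuous ones under sequential completeness.
\<close>

text \<open>The inherited atlas consists of restrictions of analytic charts of the space of all
  linear maps. The global chart is therefore defined on all of them, with the value at 1 carried
  along in a separate summand, and every other chart is compared with this one. Codomains are
  restricted to the infinitesimal characters by a continuous projection; it exists because these are
  the linear maps vanishing on a fixed subspace of the Hopf algebra, which has a linear complement.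
  Over the reals, analyticity asks for a complex extension with values in linear maps. Infinitely
  many components are extended at once, so their domains must not shrink; for this reason the basic
  maps are shown to have extensions to the whole complexification. At the unit the differential of
  the inverse chart is the identity. This turns the intrinsic equation
  \<open>\<eta>' = \<eta>.\<gamma>\<close> into \<open>\<eta>' = \<eta> \<star> \<gamma>\<close> in
  the space of linear maps. A solution has one derivative more than \<open>\<gamma>\<close>, hence
  at most two are asked for, and the calculus of curves stops there.\<close>

abbreviation "tlim E \<equiv> limitin (topol E)"
abbreviation "topen E \<equiv> openin (topol E)"
abbreviation "cont E F \<equiv> continuous_map (topol E) (topol F)"
abbreviation "cont01 E \<equiv> continuous_map (top_of_set {0..1::real}) (topol E)"
abbreviation "deriv01 E \<equiv> has_curve_deriv E {0..1}"
abbreviation "iterD \<equiv> iter_dir_deriv"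

section \<open>Locally convex spaces\<close>

lemma limitin_continuous:
 assumes "continuous_map X Y g" "limitin X f l F"
 shows "limitin Y (\<lambda>s. g (f s)) (g l) F"
 using continuous_map_limit[OF assms] by (simp add: o_def)

lemma limitin_atin_id: "x \<in> topspace X \<Longrightarrow> limitin X (\<lambda>y. y) x (atin X x)"
 using continuous_map_id[of X] unfolding continuous_map_atin id_def by blast

lemma limitin_Pair:
 assumes "limitin X f a F" "limitin Y g b F"
 shows "limitin (prod_topology X Y) (\<lambda>s. (f s, g s)) (a, b) F"
 using assms by (simp add: limitin_pairwise o_def)

lemma limitin_fst: "limitin (prod_topology X Y) f l F \<Longrightarrow> limitin X (\<lambda>s. fst (f s)) (fst l) F"
 by (simp add: limitin_pairwise o_def)

lemma limitin_snd: "limitin (prod_topology X Y) f l F \<Longrightarrow> limitin Y (\<lambda>s. snd (f s)) (snd l) F"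
 by (simp add: limitin_pairwise o_def)

lemma limitin_prod_iff:
 "limitin (prod_topology X Y) f l F \<longleftrightarrow>
   limitin X (\<lambda>s. fst (f s)) (fst l) F \<and> limitin Y (\<lambda>s. snd (f s)) (snd l) F"
 by (simp add: limitin_pairwise o_def)

lemma limitin_in_topspace: "limitin X f l F \<Longrightarrow> eventually (\<lambda>s. f s \<in> topspace X) F"
 by (rule limitinD[OF _ openin_topspace limitin_topspace])

lemma limitin_filterlim_compose:
 "limitin X f l F \<Longrightarrow> filterlim g F G \<Longrightarrow> limitin X (\<lambda>s. f (g s)) l G"
 unfolding limitin_def by (auto simp: filterlim_iff)

text \<open>The set need not contain 0: translates of a convex neighbourhood to a limit point serve
  as target sets for slopes.\<close>

definition convex_nbhd :: "('k::real_normed_field, 'e::ab_group_add) tvs \<Rightarrow> 'e set \<Rightarrow> bool" where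
 "convex_nbhd E C \<longleftrightarrow> topen E C \<and>
   (\<forall>x\<in>C. \<forall>y\<in>C. \<forall>t\<in>{0..1::real}. smul E (of_real t) x + smul E (of_real (1 - t)) y \<in> C)"

locale lcs =
 fixes E :: "('k::real_normed_field, 'e::ab_group_add) tvs"
 assumes lcs: "locally_convex_space E"
begin

sublocale vs: vector_space "smul E"
 using lcs by (simp add: locally_convex_space_def)

lemma subspace_pts: "vs.subspace (pts E)"
 using lcs by (simp add: locally_convex_space_def)

lemma hausdorff: "Hausdorff_space (topol E)"
 using lcs by (simp add: locally_convex_space_def)

lemma zero_pts[simp]: "0 \<in> pts E"
 using subspace_pts vs.subspace_0 by blast

lemma add_pts[simp]: "x \<in> pts E \<Longrightarrow> y \<in> pts E \<Longrightarrow> x + y \<in> pts E"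
 using subspace_pts vs.subspace_add by blast

lemma diff_pts[simp]: "x \<in> pts E \<Longrightarrow> y \<in> pts E \<Longrightarrow> x - y \<in> pts E"
 using subspace_pts vs.subspace_diff by blast

lemma minus_pts[simp]: "x \<in> pts E \<Longrightarrow> - x \<in> pts E"
 using subspace_pts vs.subspace_neg by blast

lemma smul_pts[simp]: "x \<in> pts E \<Longrightarrow> smul E a x \<in> pts E"
 using subspace_pts vs.subspace_scale by blast

lemma sum_pts: "(\<And>i. i \<in> I \<Longrightarrow> f i \<in> pts E) \<Longrightarrow> sum f I \<in> pts E"
 using subspace_pts vs.subspace_sum by blast

lemma lim_add:
 assumes "tlim E f a F" "tlim E g b F"
 shows "tlim E (\<lambda>s. f s + g s) (a + b) F"
proof -
 have "continuous_map (prod_topology (topol E) (topol E)) (topol E) (\<lambda>(x, y). x + y)"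
  using lcs by (simp add: locally_convex_space_def)
 from limitin_continuous[OF this limitin_Pair[OF assms]] show ?thesis by simp
qed

lemma lim_smul:
 assumes "(c \<longlongrightarrow> a) F" "tlim E f b F"
 shows "tlim E (\<lambda>s. smul E (c s) (f s)) (smul E a b) F"
proof -
 have "continuous_map (prod_topology euclidean (topol E)) (topol E) (\<lambda>(a, x). smul E a x)"
  using lcs by (simp add: locally_convex_space_def)
 from limitin_continuous[OF this limitin_Pair, of c a F f b] assms show ?thesis by simp
qed

lemma lim_minus: "tlim E f a F \<Longrightarrow> tlim E (\<lambda>s. - f s) (- a) F"
 using lim_smul[of "\<lambda>_. - 1" "- 1" F f a] by simp

lemma lim_diff:
 assumes "tlim E f a F" "tlim E g b F"
 shows "tlim E (\<lambda>s. f s - g s) (a - b) F"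
 using lim_add[OF assms(1) lim_minus[OF assms(2)]] by simp

lemma lim_sum:
 assumes "\<And>i. i \<in> I \<Longrightarrow> tlim E (f i) (a i) F"
 shows "tlim E (\<lambda>s. \<Sum>i\<in>I. f i s) (\<Sum>i\<in>I. a i) F"
 using assms by (induction I rule: infinite_finite_induct) (auto intro!: lim_add)

lemma lim_unique:
 "tlim E f a F \<Longrightarrow> tlim E f b F \<Longrightarrow> F \<noteq> bot \<Longrightarrow> a = b"
 using limitin_Hausdorff_unique[OF _ _ _ hausdorff] by blast

lemma convex_nbhd_base:
 assumes "topen E U" "0 \<in> U"
 obtains C where "convex_nbhd E C" "0 \<in> C" "C \<subseteq> U"
proof -
 have "\<forall>U. topen E U \<and> 0 \<in> U \<longrightarrow>
    (\<exists>C. topen E C \<and> 0 \<in> C \<and> C \<subseteq> U \<and>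
     (\<forall>x\<in>C. \<forall>y\<in>C. \<forall>t\<in>{0..1::real}.
      smul E (of_real t) x + smul E (of_real (1 - t)) y \<in> C))"
  using lcs by (simp add: locally_convex_space_def)
 with assms that show thesis unfolding convex_nbhd_def by metis
qed

lemma openin_preimage:
 assumes "\<And>x. x \<in> pts E \<Longrightarrow> tlim E f (f x) (atin (topol E) x)" "topen E U"
 shows "topen E {x \<in> pts E. f x \<in> U}"
 using assms by (intro openin_continuous_map_preimage) (auto simp: continuous_map_atin)

lemma openin_translate:
 assumes "topen E U" "a \<in> pts E"
 shows "topen E {x \<in> pts E. x - a \<in> U}"
 by (rule openin_preimage) (use assms in "auto intro!: lim_diff limitin_atin_id")

lemma openin_scale:
 assumes "topen E U"
 shows "topen E {x \<in> pts E. smul E c x \<in> U}"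
 by (rule openin_preimage) (use assms in "auto intro!: lim_smul limitin_atin_id")

section \<open>Convex neighbourhoods and a mean value theorem\<close>

lemma convex_nbhdD:
 "convex_nbhd E C \<Longrightarrow> x \<in> C \<Longrightarrow> y \<in> C \<Longrightarrow> 0 \<le> t \<Longrightarrow> t \<le> 1 \<Longrightarrow>
   smul E (of_real t) x + smul E (of_real (1 - t)) y \<in> C"
 unfolding convex_nbhd_def by auto

lemma convex_nbhd_pts: "convex_nbhd E C \<Longrightarrow> x \<in> C \<Longrightarrow> x \<in> pts E"
 unfolding convex_nbhd_def using openin_subset by blast

lemma convex_nbhd_open: "convex_nbhd E C \<Longrightarrow> topen E C"
 unfolding convex_nbhd_def by blast

lemma convex_nbhd_translate:
 assumes C: "convex_nbhd E C" and a: "a \<in> pts E"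
 shows "convex_nbhd E {x \<in> pts E. x - a \<in> C}"
proof -
 have "smul E (of_real t) x + smul E (of_real (1 - t)) y - a \<in> C"
  if "x - a \<in> C" "y - a \<in> C" "0 \<le> t" "t \<le> 1" for x y t
 proof -
  have "smul E (of_real t) (x - a) + smul E (of_real (1 - t)) (y - a) \<in> C"
   using that C convex_nbhdD by blast
  moreover have "smul E (of_real t) (x - a) + smul E (of_real (1 - t)) (y - a) =
   smul E (of_real t) x + smul E (of_real (1 - t)) y - smul E (of_real t + of_real (1 - t)) a"
   by (simp only: vs.scale_right_diff_distrib vs.scale_left_distrib) simp
  ultimately show ?thesis by (simp flip: of_real_add)
 qed
 then show ?thesis
  unfolding convex_nbhd_def using openin_translate[OF convex_nbhd_open[OF C] a] by auto
qed

lemma convex_nbhd_scale: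
 assumes C: "convex_nbhd E C"
 shows "convex_nbhd E {x \<in> pts E. smul E c x \<in> C}"
proof -
 have "smul E c (smul E (of_real t) x + smul E (of_real (1 - t)) y) \<in> C"
  if "smul E c x \<in> C" "smul E c y \<in> C" "0 \<le> t" "t \<le> 1" for x y t
  using convex_nbhdD[OF C that] by (simp add: vs.scale_right_distrib mult.commute)
 then show ?thesis
  unfolding convex_nbhd_def using openin_scale[OF convex_nbhd_open[OF C]] by auto
qed

lemma convex_nbhd_Int:
 "convex_nbhd E C \<Longrightarrow> convex_nbhd E D \<Longrightarrow> convex_nbhd E (C \<inter> D)"
 unfolding convex_nbhd_def by auto

text \<open>Convex neighbourhoods of 0 take the place of seminorms in the estimates below; this
  criterion turns such estimates into limits.\<close>

lemma lim_iff:
 "tlim E f l F \<longleftrightarrow>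
   l \<in> pts E \<and> (\<forall>C. convex_nbhd E C \<and> 0 \<in> C \<longrightarrow> eventually (\<lambda>s. f s - l \<in> C) F)"
proof
 assume L: "tlim E f l F"
 then have l: "l \<in> pts E" by (rule limitin_topspace)
 have "tlim E (\<lambda>s. f s - l) 0 F" using lim_diff[OF L, of "\<lambda>_. l" l] l by simp
 then show "l \<in> pts E \<and> (\<forall>C. convex_nbhd E C \<and> 0 \<in> C \<longrightarrow> eventually (\<lambda>s. f s - l \<in> C) F)"
  using l by (auto intro: limitinD[OF _ convex_nbhd_open])
next
 assume R: "l \<in> pts E \<and> (\<forall>C. convex_nbhd E C \<and> 0 \<in> C \<longrightarrow> eventually (\<lambda>s. f s - l \<in> C) F)"
 show "tlim E f l F"
  unfolding limitin_def
 proof (intro conjI allI impI)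
  fix U assume U: "topen E U \<and> l \<in> U"
  have "topen E {x \<in> pts E. x - (- l) \<in> U}"
   using U R by (intro openin_translate) auto
  then obtain C where C: "convex_nbhd E C" "0 \<in> C" "C \<subseteq> {x \<in> pts E. x - (- l) \<in> U}"
   by (rule convex_nbhd_base) (use U in auto)
  then have "eventually (\<lambda>s. f s - l \<in> C) F" using R by blast
  then show "eventually (\<lambda>s. f s \<in> U) F"
   by eventually_elim (use C in auto)
 qed (use R in blast)
qed

text \<open>A mean value theorem with values in a convex set. The slope over an interval is a convex
  combination of the slopes over two subintervals, so by bisection it is enough to treat short
  intervals containing a point \<open>x\<close>; there slopes are close to \<open>c' x\<close>, and
  \<open>C\<close> is open.\<close>

lemma slope_in_convex:
 assumes C: "convex_nbhd E C" and ab: "a < b" and J: "{a..b} \<subseteq> J"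
  and d: "\<And>u. u \<in> {a..b} \<Longrightarrow> has_curve_deriv E J c u (c' u)"
  and c': "\<And>u. u \<in> {a..b} \<Longrightarrow> c' u \<in> C"
 shows "smul E (of_real (inverse (b - a))) (c b - c a) \<in> C"
proof -
 define sl where "sl x y = smul E (of_real (inverse (y - x))) (c y - c x)" for x y
 define P where "P x y \<longleftrightarrow> (a \<le> x \<and> y \<le> b \<and> x < y \<longrightarrow> sl x y \<in> C)" for x y
 have avg: "sl x z = smul E (of_real t) (sl x y) + smul E (of_real (1 - t)) (sl y z)"
  if "x < y" "y < z" "t = (y - x) / (z - x)" for x y z t
 proof -
  have 1: "t * inverse (y - x) = inverse (z - x)" using that by (simp add: field_simps)
  have 2: "(1 - t) * inverse (z - y) = inverse (z - x)"
   unfolding that(3) using that(1,2) by (simp add: divide_simps)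
  have "sl x z = smul E (of_real (inverse (z - x))) (c y - c x) + smul E (of_real (inverse (z - x))) (c z - c y)"
   unfolding sl_def by (simp flip: vs.scale_right_distrib)
  also have "\<dots> = smul E (of_real (t * inverse (y - x))) (c y - c x) +
   smul E (of_real ((1 - t) * inverse (z - y))) (c z - c y)"
   by (simp only: 1 2)
  finally show ?thesis unfolding sl_def by (simp only: vs.scale_scale of_real_mult)
 qed
 have avgC: "sl x z \<in> C" if "x < y" "y < z" "sl x y \<in> C" "sl y z \<in> C" for x y z
  unfolding avg[OF that(1,2) refl]
  by (rule convex_nbhdD[OF C that(3,4)]) (use that in "auto simp: field_simps")
 have "P a b"
 proof (rule Bolzano)
  show "a \<le> b" using ab by simp
 next
  fix x y z assume "P x y" "P y z" "x \<le> y" "y \<le> z"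
  note P = this
  show "P x z"
  proof (cases "x = y \<or> y = z")
   case True then show ?thesis using P by blast
  next
   case False
   then have "x < y" "y < z" using P by auto
   show ?thesis unfolding P_def
   proof
    assume "a \<le> x \<and> z \<le> b \<and> x < z"
    then show "sl x z \<in> C" using P \<open>x < y\<close> \<open>y < z\<close> unfolding P_def by (intro avgC[of x y z]) linarith+
   qed
  qed
 next
  fix x assume x: "a \<le> x" "x \<le> b"
  then have "has_curve_deriv E J c x (c' x)" "c' x \<in> C" using d c' by auto
  then have "eventually (\<lambda>y. sl x y \<in> C) (at x within J)"
   unfolding has_curve_deriv_def sl_def using limitinD[OF _ convex_nbhd_open[OF C]] by simp
  then obtain e where e: "e > 0" "\<And>y. y \<in> J \<Longrightarrow> y \<noteq> x \<Longrightarrow> dist y x < e \<Longrightarrow> sl x y \<in> C"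
   unfolding eventually_at by blast
  have sym: "sl y x = sl x y" for y
  proof -
   have "inverse (x - y) = - inverse (y - x)" by (metis inverse_minus_eq minus_diff_eq)
   then show ?thesis unfolding sl_def
    by (metis (no_types) minus_diff_eq of_real_minus vs.scale_minus_left vs.scale_minus_right verit_minus_simplify(4))
  qed
  \<comment> \<open>The derivative at \<open>x\<close> controls only slopes with one end at
    \<open>x\<close>; an interval around \<open>x\<close> is split there.\<close>
  have "P y z" if "y \<le> x \<and> x \<le> z \<and> z - y < e" for y z
   unfolding P_def
  proof
   assume yz: "a \<le> y \<and> z \<le> b \<and> y < z"
   have 1: "sl y x \<in> C" if "y < x"
    unfolding sym using that yz \<open>y \<le> x \<and> _\<close> J x by (intro e(2)) (auto simp: dist_real_def)
   have 2: "sl x z \<in> C" if "x < z"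
    using that yz \<open>y \<le> x \<and> _\<close> J x by (intro e(2)) (auto simp: dist_real_def)
   show "sl y z \<in> C"
   proof (cases "y = x \<or> x = z")
    case True then show ?thesis using 1 2 yz that by auto
   next
    case False then show ?thesis using 1 2 that by (intro avgC[of y x z]) linarith+
   qed
  qed
  with e(1) show "\<exists>d>0. \<forall>a b. a \<le> x \<and> x \<le> b \<and> b - a < d \<longrightarrow> P a b" by blast
 qed
 then show ?thesis using ab unfolding P_def sl_def by simp
qed

end

section \<open>Smooth maps\<close>

abbreviation smooth_on ::
 "('k::real_normed_field, 'e::ab_group_add) tvs \<Rightarrow> ('k, 'f::ab_group_add) tvs \<Rightarrow> 'e set \<Rightarrow> ('e \<Rightarrow> 'f) \<Rightarrow> bool"
 where "smooth_on E F U f \<equiv> Cr_on E F \<infinity> U f"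

lemma continuous_map_prod_subtopology_mono:
 assumes "continuous_map (prod_topology (subtopology T U) X) Y g" "V \<subseteq> U"
 shows "continuous_map (prod_topology (subtopology T V) X) Y g"
proof -
 have "continuous_map (subtopology (prod_topology T X) (U \<times> topspace X)) Y g"
  using assms(1) by (simp add: prod_topology_subtopology)
 then have "continuous_map (subtopology (prod_topology T X) (V \<times> topspace X)) Y g"
  by (rule continuous_map_from_subtopology_mono) (use assms(2) in auto)
 then show ?thesis by (simp add: prod_topology_subtopology)
qed

lemma smooth_on_subset:
 "smooth_on E F U f \<Longrightarrow> topen E V \<Longrightarrow> V \<subseteq> U \<Longrightarrow> smooth_on E F V f"
 unfolding Cr_on_def using continuous_map_prod_subtopology_mono by (meson subsetD)

text \<open>Limits along this product filter are the limits along \<open>F\<close> that are uniform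
  over \<open>A\<close>; below, \<open>A\<close> is the parameter interval of a segment.\<close>

lemma eventually_prod_principal_iff:
 "eventually P (F \<times>\<^sub>F principal A) \<longleftrightarrow> eventually (\<lambda>s. \<forall>u\<in>A. P (s, u)) F"
proof
 assume "eventually P (F \<times>\<^sub>F principal A)"
 then obtain Pf Pg where "eventually Pf F" "eventually Pg (principal A)" "\<And>x y. Pf x \<Longrightarrow> Pg y \<Longrightarrow> P (x, y)"
  unfolding eventually_prod_filter by blast
 then show "eventually (\<lambda>s. \<forall>u\<in>A. P (s, u)) F"
  by (auto simp: eventually_principal elim!: eventually_mono)
next
 assume "eventually (\<lambda>s. \<forall>u\<in>A. P (s, u)) F"
 then show "eventually P (F \<times>\<^sub>F principal A)"
  unfolding eventually_prod_filter
  by (intro exI[of _ "\<lambda>s. \<forall>u\<in>A. P (s, u)"] exI[of _ "\<lambda>u. u \<in> A"]) (auto simp: eventually_principal)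
qed

lemma iter_dir_deriv_cong_dirs:
 "(\<And>i. i < k \<Longrightarrow> v i = w i) \<Longrightarrow> iterD E F f k x v = iterD E F f k x w"
proof (induction k arbitrary: x)
 case (Suc k)
 then have "(\<lambda>y. iterD E F f k y v) = (\<lambda>y. iterD E F f k y w)" by auto
 with Suc.prems[of k] show ?case by simp
qed simp

declare iter_dir_deriv.simps(2)[simp del]

lemma (in lcs) lim_line:
 "x \<in> pts E \<Longrightarrow> v \<in> pts E \<Longrightarrow> tlim E (\<lambda>t. x + smul E t v) x (at 0)"
 using lim_add[OF _ lim_smul[OF tendsto_ident_at], of "\<lambda>_. x" x "0" UNIV "\<lambda>_. v" v] by simp

lemma (in lcs) eventually_line:
 assumes "topen E U" "x \<in> U" "v \<in> pts E"
 shows "eventually (\<lambda>t. x + smul E t v \<in> U) (at 0)"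
proof -
 have "x \<in> pts E" using assms openin_subset by blast
 from limitinD[OF lim_line[OF this assms(3)] assms(1,2)] show ?thesis .
qed

section \<open>Directional derivatives between two spaces\<close>

locale lcs2 = E: lcs E + F: lcs F
 for E :: "('k::real_normed_field, 'e::ab_group_add) tvs" and F :: "('k, 'f::ab_group_add) tvs"
begin

lemma has_dir_deriv_unique: "has_dir_deriv E F f x v y \<Longrightarrow> has_dir_deriv E F f x v z \<Longrightarrow> y = z"
 unfolding has_dir_deriv_def by (erule F.lim_unique) auto

lemma dir_deriv_eq: "has_dir_deriv E F f x v y \<Longrightarrow> dir_deriv E F f x v = y"
 unfolding dir_deriv_def by (rule the_equality) (auto intro: has_dir_deriv_unique)

lemma has_dir_deriv_transform:
 assumes "topen E U" "x \<in> U" "v \<in> pts E" "\<And>z. z \<in> U \<Longrightarrow> f z = g z"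
  and "has_dir_deriv E F f x v y"
 shows "has_dir_deriv E F g x v y"
 using assms(5) unfolding has_dir_deriv_def
 by (rule limitin_transform_eventually[rotated])
  (use E.eventually_line[OF assms(1-3)] assms(2,4) in "auto elim!: eventually_mono")

lemma has_dir_deriv_add:
 assumes "has_dir_deriv E F f x v y" "has_dir_deriv E F g x v z"
 shows "has_dir_deriv E F (\<lambda>u. f u + g u) x v (y + z)"
 using F.lim_add[OF assms[unfolded has_dir_deriv_def]] unfolding has_dir_deriv_def
 by (simp add: algebra_simps F.vs.scale_right_diff_distrib F.vs.scale_right_distrib)

lemma has_dir_deriv_smul:
 assumes "has_dir_deriv E F f x v y"
 shows "has_dir_deriv E F (\<lambda>u. smul F c (f u)) x v (smul F c y)"
 using F.lim_smul[OF tendsto_const assms[unfolded has_dir_deriv_def], of c] unfolding has_dir_deriv_def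
 by (simp add: F.vs.scale_right_diff_distrib mult.commute)

lemma has_dir_deriv_const: "has_dir_deriv E F (\<lambda>u. c) x v 0"
 unfolding has_dir_deriv_def by simp

lemma smooth_on_open: "smooth_on E F U f \<Longrightarrow> topen E U"
 unfolding Cr_on_def by blast

lemma smooth_on_pts: "smooth_on E F U f \<Longrightarrow> x \<in> U \<Longrightarrow> x \<in> pts E"
 using smooth_on_open openin_subset by blast

lemma smooth_on_deriv:
 assumes "smooth_on E F U f" "x \<in> U" "\<And>i. i \<le> k \<Longrightarrow> v i \<in> pts E"
 shows "has_dir_deriv E F (\<lambda>z. iterD E F f k z v) x (v k) (iterD E F f (Suc k) x v)"
proof -
 have "\<forall>x\<in>U. \<forall>v\<in>{..k} \<rightarrow> pts E. \<exists>y. has_dir_deriv E F (\<lambda>z. iterD E F f k z v) x (v k) y"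
  using assms(1) by (simp add: Cr_on_def)
 moreover have "v \<in> {..k} \<rightarrow> pts E" using assms(3) by auto
 ultimately obtain y where "has_dir_deriv E F (\<lambda>z. iterD E F f k z v) x (v k) y"
  using assms(2) by meson
 with dir_deriv_eq[OF this] show ?thesis by (simp add: iter_dir_deriv.simps(2))
qed

text \<open>\<open>Cr_on\<close> states continuity on extensional tuples of directions. This form
  takes arbitrary sequences, asks for convergence of the first \<open>k\<close> entries, and works
  along any filter.\<close>

lemma iter_lim:
 assumes f: "smooth_on E F U f" and y: "tlim E y y0 G" "y0 \<in> U"
  and w: "\<And>i. i < k \<Longrightarrow> tlim E (\<lambda>s. w s i) (w0 i) G"
 shows "tlim F (\<lambda>s. iterD E F f k (y s) (w s)) (iterD E F f k y0 w0) G"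
proof -
 have c: "continuous_map
     (prod_topology (subtopology (topol E) U) (product_topology (\<lambda>_. topol E) {..<k}))
     (topol F) (\<lambda>(x, v). iterD E F f k x v)"
  using f unfolding Cr_on_def by auto
 have 1: "limitin (subtopology (topol E) U) y y0 G"
  using y limitinD[OF y(1) smooth_on_open[OF f] y(2)] by (simp add: limitin_subtopology)
 have "\<forall>i\<in>{..<k}. eventually (\<lambda>s. w s i \<in> pts E) G"
  using limitin_in_topspace[OF w] by simp
 then have "eventually (\<lambda>s. \<forall>i\<in>{..<k}. w s i \<in> pts E) G"
  by (simp add: eventually_ball_finite_distrib)
 then have ev: "eventually (\<lambda>s. restrict (w s) {..<k} \<in> topspace (product_topology (\<lambda>_. topol E) {..<k})) G"
  by eventually_elim auto
 have "limitin (product_topology (\<lambda>_. topol E) {..<k}) (\<lambda>s. restrict (w s) {..<k}) (restrict w0 {..<k}) G"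
  using ev w by (simp add: limitin_componentwise)
 from limitin_continuous[OF c limitin_Pair[OF 1 this]]
 have "tlim F (\<lambda>s. iterD E F f k (y s) (restrict (w s) {..<k}))
   (iterD E F f k y0 (restrict w0 {..<k})) G" by simp
 moreover have "iterD E F f k z (restrict v {..<k}) = iterD E F f k z v" for z v
  by (rule iter_dir_deriv_cong_dirs) simp
 ultimately show ?thesis by simp
qed

lemma iter_pts:
 assumes "smooth_on E F U f" "x \<in> U" "\<And>i. i < k \<Longrightarrow> v i \<in> pts E"
 shows "iterD E F f k x v \<in> pts F"
 \<comment> \<open>Along \<open>bot\<close> a limit statement says nothing but that the limit point
   lies in the space.\<close>
 using iter_lim[of U f "\<lambda>_::unit. x" x bot k "\<lambda>_. v" v] assms smooth_on_pts[OF assms(1,2)]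
 by (auto dest: limitin_topspace)

lemma smooth_on_image: "smooth_on E F U f \<Longrightarrow> x \<in> U \<Longrightarrow> f x \<in> pts F"
 using iter_pts[of U f x 0] by simp

lemma smooth_on_lim:
 "smooth_on E F U f \<Longrightarrow> tlim E y y0 G \<Longrightarrow> y0 \<in> U \<Longrightarrow> tlim F (\<lambda>s. f (y s)) (f y0) G"
 using iter_lim[of U f y y0 G 0] by simp

text \<open>The difference quotients of the mth derivative, with moving base point and moving directions,
  converge locally uniformly: along each segment their deviation from the limit is controlled by
  the mean value theorem.\<close>

lemma iter_moving_base:
 assumes f: "smooth_on E F U f" and y: "tlim E y y0 G" "y0 \<in> U"
  and w: "\<And>i. i < m \<Longrightarrow> tlim E (\<lambda>s. w s i) (w0 i) G"
  and q: "tlim E q q0 G" and \<tau>: "(\<tau> \<longlongrightarrow> 0) G" "eventually (\<lambda>s. \<tau> s \<noteq> 0) G"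
 shows "tlim F (\<lambda>s. smul F (inverse (\<tau> s))
      (iterD E F f m (y s + smul E (\<tau> s) (q s)) (w s) - iterD E F f m (y s) (w s)))
      (iterD E F f (Suc m) y0 (w0(m := q0))) G"
  (is "limitin _ ?Q ?D0 G")
proof -
 \<comment> \<open>The second factor carries the position \<open>u\<close> on the segment from
   \<open>y s\<close> to \<open>y s + \<tau> s q s\<close>; limits along \<open>H\<close> are
   uniform in \<open>u\<close>.\<close>
 define H where "H = G \<times>\<^sub>F principal {0..1::real}"
 define z where "z = (\<lambda>(s, u). y s + smul E (of_real u * \<tau> s) (q s))"
 define D where "D = (\<lambda>(s, u). iterD E F f (Suc m) (z (s, u)) ((w s)(m := q s)))"
 have fstH: "filterlim fst G H" unfolding H_def by (rule filterlim_fst)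
 have q0: "q0 \<in> pts E" using q by (rule limitin_topspace)
 have null: "((\<lambda>(s, u). of_real u * \<tau> s) \<longlongrightarrow> 0) H"
 proof (rule Lim_null_comparison)
  show "\<forall>\<^sub>F x in H. norm (case x of (s, u) \<Rightarrow> of_real u * \<tau> s) \<le> norm (\<tau> (fst x))"
   unfolding H_def eventually_prod_principal_iff
   by (auto simp: norm_mult intro!: always_eventually mult_left_le_one_le)
  show "((\<lambda>x. norm (\<tau> (fst x))) \<longlongrightarrow> 0) H"
   using tendsto_norm_zero[OF filterlim_compose[OF \<tau>(1) fstH]] by simp
 qed
 have zlim: "tlim E z y0 H"
  using E.lim_add[OF limitin_filterlim_compose[OF y(1) fstH] E.lim_smul[OF null limitin_filterlim_compose[OF q fstH]]]
  by (simp add: z_def case_prod_beta')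
 have Dlim: "tlim F D ?D0 H"
 proof -
  have "tlim F (\<lambda>x. iterD E F f (Suc m) (z x) ((w (fst x))(m := q (fst x)))) ?D0 H"
   by (rule iter_lim[OF f zlim y(2)])
    (use limitin_filterlim_compose[OF q fstH] limitin_filterlim_compose[OF w fstH] in "auto simp: less_Suc_eq")
  then show ?thesis by (simp add: D_def case_prod_beta')
 qed
 have D0: "?D0 \<in> pts F" using Dlim by (rule limitin_topspace)
 have "\<forall>i\<in>{..<m}. eventually (\<lambda>s. w s i \<in> pts E) G"
  using limitin_in_topspace[OF w] by simp
 then have wpts: "eventually (\<lambda>s. \<forall>i\<in>{..<m}. w s i \<in> pts E) G"
  by (simp add: eventually_ball_finite_distrib)
 show ?thesis
  unfolding F.lim_iff
 proof (intro conjI allI impI)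
  fix C assume C: "convex_nbhd F C \<and> 0 \<in> C"
  have "eventually (\<lambda>x. D x - ?D0 \<in> C) H" using Dlim C unfolding F.lim_iff by blast
  then have evD: "eventually (\<lambda>s. \<forall>u\<in>{0..1}. D (s, u) - ?D0 \<in> C) G"
   unfolding H_def eventually_prod_principal_iff .
  have "eventually (\<lambda>x. z x \<in> U) H" using limitinD[OF zlim smooth_on_open[OF f] y(2)] .
  then have evz: "eventually (\<lambda>s. \<forall>u\<in>{0..1}. z (s, u) \<in> U) G"
   unfolding H_def eventually_prod_principal_iff .
  show "eventually (\<lambda>s. ?Q s - ?D0 \<in> C) G"
   using evD evz wpts limitin_in_topspace[OF q] \<tau>(2)
  proof eventually_elim
   case (elim s)
   define C' where "C' = {x \<in> pts F. x - ?D0 \<in> C}"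
   define c where "c u = smul F (inverse (\<tau> s)) (iterD E F f m (z (s, u)) (w s))" for u
   have C': "convex_nbhd F C'" unfolding C'_def using F.convex_nbhd_translate[OF _ D0] C by blast
   have dirs: "((w s)(m := q s)) i \<in> pts E" if "i \<le> m" for i
    using that elim(3,4) by auto
   \<comment> \<open>\<open>c\<close> has derivative \<open>D (s, u)\<close> at \<open>u\<close>,
     which lies in the translate \<open>C'\<close> of \<open>C\<close> to the expected limit; the
     slope of \<open>c\<close> over the whole interval is the difference quotient in
     question.\<close>
   have "smul F (of_real (inverse (1 - 0))) (c 1 - c 0) \<in> C'"
   proof (rule F.slope_in_convex[OF C', of 0 1 "{0..1}" c "\<lambda>u. D (s, u)"])
    fix u :: real assume u: "u \<in> {0..1}"
    let ?h = "\<lambda>x. iterD E F f m x ((w s)(m := q s))"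
    have "has_dir_deriv E F ?h (z (s, u)) (q s) (D (s, u))"
     using smooth_on_deriv[OF f, of "z (s, u)" m "(w s)(m := q s)"] elim(2) u dirs
     by (simp add: D_def)
    then have L: "tlim F (\<lambda>t. smul F (inverse t) (?h (z (s, u) + smul E t (q s)) - ?h (z (s, u)))) (D (s, u)) (at 0)"
     unfolding has_dir_deriv_def .
    have "filterlim (\<lambda>u'. of_real (u' - u) * \<tau> s) (at 0) (at u within {0..1})"
     unfolding filterlim_at
     by (intro conjI) (use elim(5) in "auto intro!: tendsto_eq_intros simp: eventually_at intro: exI[of _ 1]")
    from limitin_filterlim_compose[OF L this]
    have "tlim F (\<lambda>u'. smul F (inverse (of_real (u' - u) * \<tau> s))
      (?h (z (s, u) + smul E (of_real (u' - u) * \<tau> s) (q s)) - ?h (z (s, u)))) (D (s, u)) (at u within {0..1})" .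
    moreover have "z (s, u) + smul E (of_real (u' - u) * \<tau> s) (q s) = z (s, u')" for u'
     by (simp add: z_def algebra_simps E.vs.scale_left_diff_distrib)
    moreover have "?h x = iterD E F f m x (w s)" for x
     by (rule iter_dir_deriv_cong_dirs) simp
    moreover have "smul F (inverse (of_real (u' - u) * \<tau> s)) a = smul F (of_real (inverse (u' - u))) (smul F (inverse (\<tau> s)) a)" for u' a
     by (simp only: inverse_mult_distrib of_real_inverse F.vs.scale_scale)
    ultimately show "deriv01 F c u (D (s, u))"
     unfolding has_curve_deriv_def c_def by (simp only: F.vs.scale_right_diff_distrib)
    show "D (s, u) \<in> C'"
     using elim(1) u iter_pts[OF f, of "z (s, u)" "Suc m" "(w s)(m := q s)"] elim(2) dirs
     by (simp add: C'_def D_def)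
   qed auto
   then show ?case
    by (simp add: C'_def c_def z_def F.vs.scale_right_diff_distrib)
  qed
 qed (rule D0)
qed

text \<open>The difference quotient along \<open>a + b\<close> splits at \<open>x + t b\<close>. The
  first part has this moving base point, and \<open>iter_moving_base\<close> says that it still
  converges to the derivative at \<open>x\<close>.\<close>

lemma iter_add_last:
 assumes f: "smooth_on E F U f" and x: "x \<in> U" and v: "\<And>i. i < m \<Longrightarrow> v i \<in> pts E"
  and ab: "a \<in> pts E" "b \<in> pts E"
 shows "iterD E F f (Suc m) x (v(m := a + b)) =
   iterD E F f (Suc m) x (v(m := a)) + iterD E F f (Suc m) x (v(m := b))"
proof (rule F.lim_unique)
 let ?g = "\<lambda>z. iterD E F f m z v"
 note xp = smooth_on_pts[OF f x]
 have t: "((\<lambda>t. t) \<longlongrightarrow> (0::'k)) (at 0)" "eventually (\<lambda>t::'k. t \<noteq> 0) (at 0)"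
  by (auto simp: eventually_at intro!: tendsto_eq_intros exI[of _ 1])
 show "tlim F (\<lambda>t. smul F (inverse t) (?g (x + smul E t (a + b)) - ?g x))
   (iterD E F f (Suc m) x (v(m := a + b))) (at 0)"
  by (rule iter_moving_base[OF f _ x _ _ t, where w = "\<lambda>_. v" and y = "\<lambda>_. x" and q = "\<lambda>_. a + b"]) (use xp v ab in auto)
 have "tlim F (\<lambda>t. smul F (inverse t) (?g ((x + smul E t b) + smul E t a) - ?g (x + smul E t b)))
   (iterD E F f (Suc m) x (v(m := a))) (at 0)"
  by (rule iter_moving_base[OF f _ x _ _ t, where w = "\<lambda>_. v" and y = "\<lambda>t. x + smul E t b" and q = "\<lambda>_. a"])
   (use xp v ab E.lim_line in auto)
 moreover have "tlim F (\<lambda>t. smul F (inverse t) (?g (x + smul E t b) - ?g x))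
   (iterD E F f (Suc m) x (v(m := b))) (at 0)"
  by (rule iter_moving_base[OF f _ x _ _ t, where w = "\<lambda>_. v" and y = "\<lambda>t. x" and q = "\<lambda>_. b"]) (use xp v ab in auto)
 ultimately have "tlim F (\<lambda>t. smul F (inverse t) (?g ((x + smul E t b) + smul E t a) - ?g (x + smul E t b))
   + smul F (inverse t) (?g (x + smul E t b) - ?g x))
   (iterD E F f (Suc m) x (v(m := a)) + iterD E F f (Suc m) x (v(m := b))) (at 0)"
  by (rule F.lim_add)
 moreover have "(x + smul E t b) + smul E t a = x + smul E t (a + b)" for t
  by (simp add: E.vs.scale_right_distrib algebra_simps)
 ultimately show "tlim F (\<lambda>t. smul F (inverse t) (?g (x + smul E t (a + b)) - ?g x))
   (iterD E F f (Suc m) x (v(m := a)) + iterD E F f (Suc m) x (v(m := b))) (at 0)"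
  by (simp flip: F.vs.scale_right_distrib)
qed simp

text \<open>The parameter change from \<open>t\<close> to \<open>c t\<close> handles
  \<open>c \<noteq> 0\<close>; for \<open>c = 0\<close> the quotient is constantly 0.\<close>

lemma iter_smul_last:
 assumes f: "smooth_on E F U f" and x: "x \<in> U" and v: "\<And>i. i < m \<Longrightarrow> v i \<in> pts E"
  and a: "a \<in> pts E"
 shows "iterD E F f (Suc m) x (v(m := smul E c a)) = smul F c (iterD E F f (Suc m) x (v(m := a)))"
proof (rule F.lim_unique)
 let ?g = "\<lambda>z. iterD E F f m z v"
 note xp = smooth_on_pts[OF f x]
 have t: "((\<lambda>t. t) \<longlongrightarrow> (0::'k)) (at 0)" "eventually (\<lambda>t::'k. t \<noteq> 0) (at 0)"
  by (auto simp: eventually_at intro!: tendsto_eq_intros exI[of _ 1])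
 show "tlim F (\<lambda>t. smul F (inverse t) (?g (x + smul E t (smul E c a)) - ?g x))
   (iterD E F f (Suc m) x (v(m := smul E c a))) (at 0)"
  by (rule iter_moving_base[OF f _ x _ _ t, where w = "\<lambda>_. v" and y = "\<lambda>_. x" and q = "\<lambda>_. smul E c a"]) (use xp v a in auto)
 show "tlim F (\<lambda>t. smul F (inverse t) (?g (x + smul E t (smul E c a)) - ?g x))
   (smul F c (iterD E F f (Suc m) x (v(m := a)))) (at 0)"
 proof (cases "c = 0")
  case False
  have "tlim F (\<lambda>t. smul F (inverse (c * t)) (?g (x + smul E (c * t) a) - ?g x))
   (iterD E F f (Suc m) x (v(m := a))) (at 0)"
   by (rule iter_moving_base[OF f _ x, where w = "\<lambda>_. v" and y = "\<lambda>_. x" and q = "\<lambda>_. a"])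
    (use xp v a t False in "auto intro!: tendsto_eq_intros elim!: eventually_mono")
  moreover have "c * inverse (c * t) = inverse t" for t using False by (simp add: field_simps)
  ultimately show ?thesis
   using F.lim_smul[OF tendsto_const[of c]] by (force simp: mult.commute[of _ c] simp del: inverse_mult_distrib)
 qed simp
qed simp

text \<open>Additivity in an earlier slot survives differentiation, because it holds on the whole
  open set and derivatives are limits of difference quotients.\<close>

lemma iter_add:
 assumes f: "smooth_on E F U f" and x: "x \<in> U" and v: "\<And>i. i < k \<Longrightarrow> v i \<in> pts E"
  and ab: "a \<in> pts E" "b \<in> pts E" and j: "j < k"
 shows "iterD E F f k x (v(j := a + b)) =
   iterD E F f k x (v(j := a)) + iterD E F f k x (v(j := b))"
 using x v j
proof (induction k arbitrary: x)
 case (Suc k)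
 show ?case
 proof (cases "j = k")
  case True show ?thesis unfolding True by (rule iter_add_last[OF f Suc.prems(1) _ ab]) (use Suc.prems(2) in simp)
 next
  case False
  then have jk: "j < k" using Suc by simp
  let ?h = "\<lambda>a z. iterD E F f k z (v(j := a))"
  have d: "has_dir_deriv E F (?h c) x (v k) (iterD E F f (Suc k) x (v(j := c)))" if "c \<in> pts E" for c
   using smooth_on_deriv[OF f Suc.prems(1), of k "v(j := c)"] Suc.prems(2) that False by auto
  have "has_dir_deriv E F (?h (a + b)) x (v k)
    (iterD E F f (Suc k) x (v(j := a)) + iterD E F f (Suc k) x (v(j := b)))"
  proof (rule has_dir_deriv_transform[OF smooth_on_open[OF f] Suc.prems(1) _ _ has_dir_deriv_add[OF d[OF ab(1)] d[OF ab(2)]]])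
   show "?h a z + ?h b z = ?h (a + b) z" if "z \<in> U" for z
    by (rule Suc.IH[OF that _ jk, symmetric]) (use Suc.prems(2) in simp)
  qed (use Suc.prems(2) in simp)
  with d[OF E.add_pts[OF ab]] show ?thesis using has_dir_deriv_unique by blast
 qed
qed simp

lemma iter_smul:
 assumes f: "smooth_on E F U f" and x: "x \<in> U" and v: "\<And>i. i < k \<Longrightarrow> v i \<in> pts E"
  and a: "a \<in> pts E" and j: "j < k"
 shows "iterD E F f k x (v(j := smul E c a)) = smul F c (iterD E F f k x (v(j := a)))"
 using x v j
proof (induction k arbitrary: x)
 case (Suc k)
 show ?case
 proof (cases "j = k")
  case True show ?thesis unfolding True by (rule iter_smul_last[OF f Suc.prems(1) _ a]) (use Suc.prems(2) in simp)
 next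
  case False
  then have jk: "j < k" using Suc by simp
  let ?h = "\<lambda>a z. iterD E F f k z (v(j := a))"
  have d: "has_dir_deriv E F (?h c) x (v k) (iterD E F f (Suc k) x (v(j := c)))" if "c \<in> pts E" for c
   using smooth_on_deriv[OF f Suc.prems(1), of k "v(j := c)"] Suc.prems(2) that False by auto
  have "has_dir_deriv E F (?h (smul E c a)) x (v k) (smul F c (iterD E F f (Suc k) x (v(j := a))))"
  proof (rule has_dir_deriv_transform[OF smooth_on_open[OF f] Suc.prems(1) _ _ has_dir_deriv_smul[OF d[OF a]]])
   show "smul F c (?h a z) = ?h (smul E c a) z" if "z \<in> U" for z
    by (rule Suc.IH[OF that _ jk, symmetric]) (use Suc.prems(2) in simp)
  qed (use Suc.prems(2) in simp)
  with d[OF E.smul_pts[OF a]] show ?thesis using has_dir_deriv_unique by blast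
 qed
qed simp

lemma iter_diff:
 assumes f: "smooth_on E F U f" and x: "x \<in> U" and v: "\<And>i. i < k \<Longrightarrow> v i \<in> pts E"
  and ab: "a \<in> pts E" "b \<in> pts E" and j: "j < k"
 shows "iterD E F f k x (v(j := a - b)) =
   iterD E F f k x (v(j := a)) - iterD E F f k x (v(j := b))"
proof -
 have "iterD E F f k x (v(j := (a - b) + b)) =
   iterD E F f k x (v(j := a - b)) + iterD E F f k x (v(j := b))"
  by (rule iter_add[OF f x v]) (use ab j in auto)
 then show ?thesis by simp
qed

text \<open>\<open>y - y0\<close> is \<open>\<tau>\<close> times a convergent quotient, and
  \<open>\<tau>\<close> tends to 0.\<close>

lemma lim_of_quotient:
 assumes "tlim E (\<lambda>s. smul E (inverse (\<tau> s)) (y s - y0)) y' G" "y0 \<in> pts E"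
  and "(\<tau> \<longlongrightarrow> 0) G" "eventually (\<lambda>s. \<tau> s \<noteq> (0::'k)) G"
 shows "tlim E y y0 G"
proof -
 have "tlim E (\<lambda>s. y0 + smul E (\<tau> s) (smul E (inverse (\<tau> s)) (y s - y0))) (y0 + smul E 0 y') G"
  by (intro E.lim_add E.lim_smul assms) (use assms in simp)
 then have "tlim E (\<lambda>s. y0 + smul E (\<tau> s) (smul E (inverse (\<tau> s)) (y s - y0))) y0 G" by simp
 then show ?thesis
  by (rule limitin_transform_eventually[rotated]) (use assms(4) in "auto elim!: eventually_mono")
qed

text \<open>Common source of the chain rules for maps and for curves. The motion of the base point
  contributes the derivative of the next order with \<open>y'\<close> in the new slot; the motion of
  each direction contributes, by multilinearity, the same derivative with that direction replaced by
  its velocity.\<close>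

lemma iter_quotient_lim:
 assumes f: "smooth_on E F U f" and y0: "y0 \<in> U" and w0: "\<And>i. i < m \<Longrightarrow> w0 i \<in> pts E"
  and \<tau>: "(\<tau> \<longlongrightarrow> 0) G" "eventually (\<lambda>s. \<tau> s \<noteq> 0) G"
  and y: "tlim E (\<lambda>s. smul E (inverse (\<tau> s)) (y s - y0)) y' G"
  and w: "\<And>i. i < m \<Longrightarrow> tlim E (\<lambda>s. smul E (inverse (\<tau> s)) (w s i - w0 i)) (w' i) G"
 shows "tlim F
   (\<lambda>s. smul F (inverse (\<tau> s)) (iterD E F f m (y s) (w s) - iterD E F f m y0 w0))
   (iterD E F f (Suc m) y0 (w0(m := y')) + (\<Sum>i<m. iterD E F f m y0 (w0(i := w' i)))) G"
proof -
 let ?d = "iterD E F f"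
 have y0p: "y0 \<in> pts E" using smooth_on_pts[OF f y0] .
 have ylim: "tlim E y y0 G" using lim_of_quotient[OF y y0p \<tau>] .
 have wlim: "tlim E (\<lambda>s. w s i) (w0 i) G" if "i < m" for i
  using lim_of_quotient[OF w[OF that] w0[OF that] \<tau>] .
 have "tlim F (\<lambda>s. smul F (inverse (\<tau> s)) (?d m (y0 + smul E (\<tau> s) (smul E (inverse (\<tau> s)) (y s - y0))) (w s) - ?d m y0 (w s)))
   (?d (Suc m) y0 (w0(m := y'))) G"
  by (rule iter_moving_base[OF f _ y0 wlim y \<tau>]) (use y0p in auto)
 then have A: "tlim F (\<lambda>s. smul F (inverse (\<tau> s)) (?d m (y s) (w s) - ?d m y0 (w s)))
   (?d (Suc m) y0 (w0(m := y'))) G"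
  by (rule limitin_transform_eventually[rotated]) (use \<tau>(2) in "auto elim!: eventually_mono")
 \<comment> \<open>In \<open>W s j\<close> the first \<open>j\<close> directions have moved already.
   The sum over \<open>j\<close> telescopes, each term changing a single slot.\<close>
 define W where "W s j = (\<lambda>i. if i < j then w s i else w0 i)" for s j
 have "\<forall>i\<in>{..<m}. eventually (\<lambda>s. w s i \<in> pts E) G"
  using limitin_in_topspace[OF wlim] by simp
 then have wpts: "eventually (\<lambda>s. \<forall>i\<in>{..<m}. w s i \<in> pts E) G"
  by (simp add: eventually_ball_finite_distrib)
 have Wlim: "tlim E (\<lambda>s. ((W s j)(j := smul E (inverse (\<tau> s)) (w s j - w0 j))) i) ((w0(j := w' j)) i) G"
  if "i < m" "j < m" for i j
  using that wlim[of i] w[of j] w0[of i] by (cases "i < j") (auto simp: W_def)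
 have "tlim F (\<lambda>s. \<Sum>j<m. ?d m y0 ((W s j)(j := smul E (inverse (\<tau> s)) (w s j - w0 j))))
   (\<Sum>i<m. ?d m y0 (w0(i := w' i))) G"
  by (intro F.lim_sum iter_lim[OF f _ y0] Wlim) (use y0p in auto)
 moreover have "eventually (\<lambda>s. (\<Sum>j<m. ?d m y0 ((W s j)(j := smul E (inverse (\<tau> s)) (w s j - w0 j)))) =
   smul F (inverse (\<tau> s)) (?d m y0 (w s) - ?d m y0 w0)) G"
  using wpts
 proof eventually_elim
  case (elim s)
  have Wp: "W s j i \<in> pts E" if "i < m" for i j using that elim w0 by (auto simp: W_def)
  have "?d m y0 ((W s j)(j := smul E (inverse (\<tau> s)) (w s j - w0 j))) =
    smul F (inverse (\<tau> s)) (?d m y0 (W s (Suc j)) - ?d m y0 (W s j))" if j: "j < m" for j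
  proof -
   have e: "(W s j)(j := w s j) = W s (Suc j)" "(W s j)(j := w0 j) = W s j"
    by (auto simp: W_def fun_eq_iff less_Suc_eq)
   have "?d m y0 ((W s j)(j := w s j - w0 j)) = ?d m y0 ((W s j)(j := w s j)) - ?d m y0 ((W s j)(j := w0 j))"
    by (rule iter_diff[OF f y0 _ _ _ j]) (use elim w0 j in "simp_all add: Wp")
   moreover have "?d m y0 ((W s j)(j := smul E (inverse (\<tau> s)) (w s j - w0 j))) =
     smul F (inverse (\<tau> s)) (?d m y0 ((W s j)(j := w s j - w0 j)))"
    by (rule iter_smul[OF f y0 _ _ j]) (use elim w0 j in "simp_all add: Wp")
   ultimately show ?thesis by (simp only: e)
  qed
  then have "(\<Sum>j<m. ?d m y0 ((W s j)(j := smul E (inverse (\<tau> s)) (w s j - w0 j)))) =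
   smul F (inverse (\<tau> s)) (\<Sum>j<m. ?d m y0 (W s (Suc j)) - ?d m y0 (W s j))"
   by (simp add: F.vs.scale_sum_right)
  also have "(\<Sum>j<m. ?d m y0 (W s (Suc j)) - ?d m y0 (W s j)) = ?d m y0 (W s m) - ?d m y0 (W s 0)"
   by (rule sum_lessThan_telescope)
  also have "?d m y0 (W s m) = ?d m y0 (w s)" by (rule iter_dir_deriv_cong_dirs) (simp add: W_def)
  also have "W s 0 = w0" by (simp add: W_def)
  finally show ?case .
 qed
 ultimately have "tlim F (\<lambda>s. smul F (inverse (\<tau> s)) (?d m y0 (w s) - ?d m y0 w0))
   (\<Sum>i<m. ?d m y0 (w0(i := w' i))) G"
  by (rule limitin_transform_eventually[rotated])
 from F.lim_add[OF A this] show ?thesis by (simp add: F.vs.scale_right_diff_distrib)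
qed

end

text \<open>Families closed under derivatives replace the recursion over iterated tangent bundles, whose
  types grow.\<close>

definition deriv_family ::
 "('k::real_normed_field, 'e::ab_group_add) tvs \<Rightarrow> ('k, 'f::ab_group_add) tvs \<Rightarrow> 'e set \<Rightarrow>
  ('e \<Rightarrow> (nat \<Rightarrow> 'e) \<Rightarrow> 'f) set \<Rightarrow> bool" where
 "deriv_family E F U H \<longleftrightarrow>
   (\<forall>h\<in>H. continuous_map (prod_topology (subtopology (topol E) U) (product_topology (\<lambda>_. topol E) UNIV))
    (topol F) (\<lambda>(x, v). h x v)) \<and>
   (\<forall>h\<in>H. \<forall>k. \<exists>h'\<in>H. \<forall>x\<in>U. \<forall>v. range v \<subseteq> pts E \<longrightarrow> has_dir_deriv E F (\<lambda>z. h z v) x (v k) (h' x v))"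

lemma deriv_familyD:
 assumes "deriv_family E F U H" "h \<in> H"
 obtains h' where "h' \<in> H" "\<And>x v. x \<in> U \<Longrightarrow> range v \<subseteq> pts E \<Longrightarrow> has_dir_deriv E F (\<lambda>z. h z v) x (v k) (h' x v)"
 using assms unfolding deriv_family_def by meson

lemma deriv_family_lim:
 assumes "deriv_family E F U H" "h \<in> H" "topen E U" "tlim E y y0 G" "y0 \<in> U"
  and "limitin (product_topology (\<lambda>_. topol E) UNIV) w w0 G"
 shows "tlim F (\<lambda>s. h (y s) (w s)) (h y0 w0) G"
proof -
 have c: "continuous_map (prod_topology (subtopology (topol E) U) (product_topology (\<lambda>_. topol E) UNIV))
    (topol F) (\<lambda>(x, v). h x v)" using assms unfolding deriv_family_def by blast
 have "limitin (subtopology (topol E) U) y y0 G"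
  using assms(4,5) limitinD[OF assms(4,3,5)] by (simp add: limitin_subtopology)
 from limitin_continuous[OF c limitin_Pair[OF this assms(6)]] show ?thesis by simp
qed

text \<open>The reindexing \<open>\<sigma>\<close> lets the next direction be any entry
  \<open>v k\<close> of the sequence, also one that occurs already, as closure under derivatives
  requires.\<close>

definition deriv_terms ::
 "('k::real_normed_field, 'e::ab_group_add) tvs \<Rightarrow> ('k, 'f::ab_group_add) tvs \<Rightarrow> ('e \<Rightarrow> 'f) \<Rightarrow>
  ('e \<Rightarrow> (nat \<Rightarrow> 'e) \<Rightarrow> 'f) set" where
 "deriv_terms E F f = {\<lambda>x v. iterD E F f m x (\<lambda>j. v (\<sigma> j)) | m \<sigma>. True}"

lemma limitin_atin_dom:
 assumes "p \<in> topspace (prod_topology (subtopology (topol E) U) (product_topology (\<lambda>_. topol E) I))"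
 defines "G \<equiv> atin (prod_topology (subtopology (topol E) U) (product_topology (\<lambda>_. topol E) I)) p"
 shows "tlim E fst (fst p) G" "fst p \<in> U" "limitin (product_topology (\<lambda>_. topol E) I) snd (snd p) G"
  "i \<in> I \<Longrightarrow> tlim E (\<lambda>q. snd q i) (snd p i) G" "eventually (\<lambda>q. fst q \<in> U) G"
  "fst p \<in> pts E" "i \<in> I \<Longrightarrow> snd p i \<in> pts E"
proof -
 note L = limitin_atin_id[OF assms(1), folded G_def]
 from limitin_fst[OF L] show "tlim E fst (fst p) G" "fst p \<in> U" "eventually (\<lambda>q. fst q \<in> U) G"
  by (auto simp: limitin_subtopology)
 from limitin_snd[OF L] show S: "limitin (product_topology (\<lambda>_. topol E) I) snd (snd p) G" by simp
 show "i \<in> I \<Longrightarrow> tlim E (\<lambda>q. snd q i) (snd p i) G" using S by (simp add: limitin_componentwise)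
 show "fst p \<in> pts E" "i \<in> I \<Longrightarrow> snd p i \<in> pts E" using assms by auto
qed

context lcs2
begin

text \<open>By induction each iterated derivative agrees on \<open>U\<close> with a member of the
  family, and the family supplies both the existence of the next derivative and joint
  continuity.\<close>

lemma smooth_on_family:
 assumes U: "topen E U" and H: "deriv_family E F U H" and h: "h \<in> H"
  and hf: "\<And>x v. x \<in> U \<Longrightarrow> h x v = f x"
 shows "smooth_on E F U f"
proof -
 have ex: "\<exists>g\<in>H. \<forall>x\<in>U. \<forall>v. range v \<subseteq> pts E \<longrightarrow> iterD E F f k x v = g x v" for k
 proof (induction k)
  case 0 show ?case using h hf by (intro bexI[of _ h]) auto
 next
  case (Suc k)
  then obtain g where g: "g \<in> H" "\<And>x v. x \<in> U \<Longrightarrow> range v \<subseteq> pts E \<Longrightarrow> iterD E F f k x v = g x v" by blast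
  obtain g' where g': "g' \<in> H" "\<And>x v. x \<in> U \<Longrightarrow> range v \<subseteq> pts E \<Longrightarrow> has_dir_deriv E F (\<lambda>z. g z v) x (v k) (g' x v)"
   using deriv_familyD[OF H g(1)] by metis
  have "iterD E F f (Suc k) x v = g' x v" if "x \<in> U" "range v \<subseteq> pts E" for x v
   unfolding iter_dir_deriv.simps(2)
   by (rule dir_deriv_eq, rule has_dir_deriv_transform[OF U that(1) _ _ g'(2)[OF that]]) (use that g(2) in auto)
  with g'(1) show ?case by blast
 qed
 have ext: "iterD E F f k x (\<lambda>i. if i < l then v i else 0) = iterD E F f k x v" if "k \<le> l" for k l x v
  by (rule iter_dir_deriv_cong_dirs) (use that in auto)
 show ?thesis unfolding Cr_on_def
 proof (intro conjI allI ballI impI)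
  fix k :: nat and x v assume x: "x \<in> U" and v: "v \<in> {..k} \<rightarrow> pts E"
  obtain g where g: "g \<in> H" "\<And>x v. x \<in> U \<Longrightarrow> range v \<subseteq> pts E \<Longrightarrow> iterD E F f k x v = g x v" using ex by blast
  obtain g' where g': "g' \<in> H" "\<And>x v. x \<in> U \<Longrightarrow> range v \<subseteq> pts E \<Longrightarrow> has_dir_deriv E F (\<lambda>z. g z v) x (v k) (g' x v)"
   using deriv_familyD[OF H g(1)] by metis
  \<comment> \<open>Members of the family see a whole sequence of directions; the entries beyond
    \<open>k\<close> are set to 0 so that all of them lie in the space.\<close>
  define w where "w = (\<lambda>i. if i < Suc k then v i else 0)"
  have w: "range w \<subseteq> pts E" using v by (auto simp: w_def Pi_iff)
  have "has_dir_deriv E F (\<lambda>z. iterD E F f k z v) x (w k) (g' x w)"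
  proof (rule has_dir_deriv_transform[OF U x _ _ g'(2)[OF x w]])
   show "g z w = iterD E F f k z v" if "z \<in> U" for z
    using g(2)[OF that w] ext[of k "Suc k" z v] by (simp add: w_def)
  qed (use w in auto)
  then show "\<exists>y. has_dir_deriv E F (\<lambda>z. iterD E F f k z v) x (v k) y" by (auto simp: w_def)
 next
  fix k :: nat
  let ?T = "prod_topology (subtopology (topol E) U) (product_topology (\<lambda>_. topol E) {..<k})"
  obtain g where g: "g \<in> H" "\<And>x v. x \<in> U \<Longrightarrow> range v \<subseteq> pts E \<Longrightarrow> iterD E F f k x v = g x v" using ex by blast
  let ?r = "\<lambda>v i. if i < k then v i else 0"
  show "continuous_map ?T (topol F) (\<lambda>(x, v). iterD E F f k x v)"
  proof (rule continuous_map_eq[of _ _ "\<lambda>p. g (fst p) (?r (snd p))"])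
   show "continuous_map ?T (topol F) (\<lambda>p. g (fst p) (?r (snd p)))"
    unfolding continuous_map_atin
   proof
    fix p assume p: "p \<in> topspace ?T"
    note D = limitin_atin_dom[OF p]
    have "tlim E (\<lambda>q. ?r (snd q) i) (?r (snd p) i) (atin ?T p)" for i
     using D(4)[of i] by (cases "i < k") auto
    moreover from this have "eventually (\<lambda>q. ?r (snd q) i \<in> pts E) (atin ?T p)" for i
     by (rule limitin_in_topspace)
    moreover have "eventually (\<lambda>q. q \<in> topspace ?T) (atin ?T p)"
     using limitin_in_topspace[OF limitin_atin_id[OF p]] .
    then have "eventually (\<lambda>q. ?r (snd q) \<in> topspace (product_topology (\<lambda>_. topol E) UNIV)) (atin ?T p)"
     by eventually_elim (simp add: PiE_iff mem_Times_iff)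
    ultimately have "limitin (product_topology (\<lambda>_. topol E) UNIV) (\<lambda>q. ?r (snd q)) (?r (snd p)) (atin ?T p)"
     by (simp add: limitin_componentwise)
    then show "tlim F (\<lambda>p. g (fst p) (?r (snd p))) (g (fst p) (?r (snd p))) (atin ?T p)"
     by (rule deriv_family_lim[OF H g(1) U D(1,2)])
   qed
   fix p assume p: "p \<in> topspace ?T"
   then have "g (fst p) (?r (snd p)) = iterD E F f k (fst p) (?r (snd p))"
    by (intro g(2)[symmetric]) (simp_all add: PiE_iff mem_Times_iff image_subset_iff)
   then show "g (fst p) (?r (snd p)) = (\<lambda>(x, v). iterD E F f k x v) p"
    using ext[of k k "fst p" "snd p"] by (simp add: case_prod_beta')
  qed
 qed (rule U)
qed

lemma continuous_map_dirs:
 assumes "\<And>p. p \<in> topspace (prod_topology (subtopology (topol E) U) (product_topology (\<lambda>_. topol E) UNIV)) \<Longrightarrow>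
   tlim F (\<lambda>q. h (fst q) (snd q)) (h (fst p) (snd p))
    (atin (prod_topology (subtopology (topol E) U) (product_topology (\<lambda>_. topol E) (UNIV::nat set))) p)"
 shows "continuous_map (prod_topology (subtopology (topol E) U) (product_topology (\<lambda>_. topol E) UNIV))
    (topol F) (\<lambda>(x, v). h x v)"
 using assms unfolding continuous_map_atin case_prod_beta' by blast

text \<open>Every smooth map has a closed family, made of its own derivatives: differentiating along
  \<open>v k\<close> raises the order by one, and \<open>\<sigma>(m := k)\<close> points the new
  slot to that entry.\<close>

lemma canonical_family:
 assumes f: "smooth_on E F U f"
 shows "deriv_family E F U (deriv_terms E F f)"
 unfolding deriv_family_def
proof (intro conjI ballI allI)
 fix h assume "h \<in> deriv_terms E F f"
 then obtain m \<sigma> where h: "h = (\<lambda>x v. iterD E F f m x (\<lambda>j. v (\<sigma> j)))"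
  unfolding deriv_terms_def by blast
 show "continuous_map (prod_topology (subtopology (topol E) U) (product_topology (\<lambda>_. topol E) UNIV))
    (topol F) (\<lambda>(x, v). h x v)"
 proof (rule continuous_map_dirs)
  fix p assume p: "p \<in> topspace (prod_topology (subtopology (topol E) U) (product_topology (\<lambda>_. topol E) (UNIV::nat set)))"
  note D = limitin_atin_dom[OF p]
  show "tlim F (\<lambda>q. h (fst q) (snd q)) (h (fst p) (snd p))
    (atin (prod_topology (subtopology (topol E) U) (product_topology (\<lambda>_. topol E) UNIV)) p)"
   unfolding h by (rule iter_lim[OF f D(1,2) D(4)]) simp
 qed
 fix k
 let ?s = "\<sigma>(m := k)"
 show "\<exists>h'\<in>deriv_terms E F f. \<forall>x\<in>U. \<forall>v.
   range v \<subseteq> pts E \<longrightarrow> has_dir_deriv E F (\<lambda>z. h z v) x (v k) (h' x v)"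
 proof (intro bexI[of _ "\<lambda>x v. iterD E F f (Suc m) x (\<lambda>j. v (?s j))"] ballI allI impI)
  fix x and v :: "nat \<Rightarrow> 'e" assume x: "x \<in> U" "range v \<subseteq> pts E"
  have "iterD E F f m z (\<lambda>j. v (?s j)) = iterD E F f m z (\<lambda>j. v (\<sigma> j))" for z
   by (rule iter_dir_deriv_cong_dirs) simp
  then show "has_dir_deriv E F (\<lambda>z. h z v) x (v k) (iterD E F f (Suc m) x (\<lambda>j. v (?s j)))"
   using smooth_on_deriv[OF f x(1), of m "\<lambda>j. v (?s j)"] x(2) unfolding h by auto
 next
  show "(\<lambda>x v. iterD E F f (Suc m) x (\<lambda>j. v (?s j))) \<in> deriv_terms E F f"
   unfolding deriv_terms_def by blast
 qed
qed

lemma canonical_family_mem: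
 "(\<lambda>x v. f x) \<in> deriv_terms E F f"
 unfolding deriv_terms_def by (auto intro!: exI[of _ 0])

lemma smooth_on_cong:
 assumes f: "smooth_on E F U f" and fg: "\<And>x. x \<in> U \<Longrightarrow> f x = g x"
 shows "smooth_on E F U g"
proof -
 have e: "iterD E F f k x v = iterD E F g k x v" if "x \<in> U" "\<forall>i<k. v i \<in> pts E" for k x v
  using that
 proof (induction k arbitrary: x)
  case (Suc k)
  have "has_dir_deriv E F (\<lambda>z. iterD E F g k z v) x (v k) (iterD E F f (Suc k) x v)"
   by (rule has_dir_deriv_transform[OF smooth_on_open[OF f] Suc.prems(1) _ _ smooth_on_deriv[OF f Suc.prems(1)]])
    (use Suc in auto)
  then show ?case by (simp add: iter_dir_deriv.simps(2) dir_deriv_eq)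
 qed (use fg in simp)
 show ?thesis unfolding Cr_on_def
 proof (intro conjI allI ballI impI)
  fix k :: nat and x v assume x: "x \<in> U" and v: "v \<in> {..k} \<rightarrow> pts E"
  have v: "v i \<in> pts E" if "i \<le> k" for i using v that by (auto simp: Pi_iff)
  have "has_dir_deriv E F (\<lambda>z. iterD E F g k z v) x (v k) (iterD E F f (Suc k) x v)"
   by (rule has_dir_deriv_transform[OF smooth_on_open[OF f] x _ _ smooth_on_deriv[OF f x]])
    (use v e in auto)
  then show "\<exists>y. has_dir_deriv E F (\<lambda>z. iterD E F g k z v) x (v k) y" by blast
 next
  fix k :: nat
  let ?T = "prod_topology (subtopology (topol E) U) (product_topology (\<lambda>_. topol E) {..<k})"
  have "continuous_map ?T (topol F) (\<lambda>(x, v). iterD E F f k x v)" using f unfolding Cr_on_def by simp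
  then show "continuous_map ?T (topol F) (\<lambda>(x, v). iterD E F g k x v)"
   by (rule continuous_map_eq) (simp add: e PiE_iff case_prod_beta' mem_Times_iff)
 qed (rule smooth_on_open[OF f])
qed

lemma smooth_on_add:
 assumes f: "smooth_on E F U f" and g: "smooth_on E F U g"
 shows "smooth_on E F U (\<lambda>x. f x + g x)"
proof (rule smooth_on_family[OF smooth_on_open[OF f]])
 let ?A = "deriv_terms E F f"
 let ?B = "deriv_terms E F g"
 note A = canonical_family[OF f] and B = canonical_family[OF g]
 show "deriv_family E F U {\<lambda>x v. a x v + b x v | a b. a \<in> ?A \<and> b \<in> ?B}"
  unfolding deriv_family_def
 proof (intro conjI ballI allI)
  fix h assume "h \<in> {\<lambda>x v. a x v + b x v | a b. a \<in> ?A \<and> b \<in> ?B}"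
  then obtain a b where h: "h = (\<lambda>x v. a x v + b x v)" and a: "a \<in> ?A" and b: "b \<in> ?B" by blast
  show "continuous_map (prod_topology (subtopology (topol E) U) (product_topology (\<lambda>_. topol E) UNIV))
    (topol F) (\<lambda>(x, v). h x v)"
   unfolding h
   by (rule continuous_map_dirs, intro F.lim_add deriv_family_lim[OF A a smooth_on_open[OF f]]
      deriv_family_lim[OF B b smooth_on_open[OF f]]) (use limitin_atin_dom in blast)+
  fix k
  obtain a' where a': "a' \<in> ?A" "\<And>x v. x \<in> U \<Longrightarrow> range v \<subseteq> pts E \<Longrightarrow> has_dir_deriv E F (\<lambda>z. a z v) x (v k) (a' x v)"
   using deriv_familyD[OF A a, where k = k] by metis
  obtain b' where b': "b' \<in> ?B" "\<And>x v. x \<in> U \<Longrightarrow> range v \<subseteq> pts E \<Longrightarrow> has_dir_deriv E F (\<lambda>z. b z v) x (v k) (b' x v)"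
   using deriv_familyD[OF B b, where k = k] by metis
  show "\<exists>h'\<in>{\<lambda>x v. a x v + b x v | a b. a \<in> ?A \<and> b \<in> ?B}. \<forall>x\<in>U. \<forall>v. range v \<subseteq> pts E \<longrightarrow>
    has_dir_deriv E F (\<lambda>z. h z v) x (v k) (h' x v)"
  proof (rule bexI[of _ "\<lambda>x v. a' x v + b' x v"])
   show "\<forall>x\<in>U. \<forall>v. range v \<subseteq> pts E \<longrightarrow> has_dir_deriv E F (\<lambda>z. h z v) x (v k) (a' x v + b' x v)"
    unfolding h by (intro ballI allI impI has_dir_deriv_add a'(2) b'(2))
   show "(\<lambda>x v. a' x v + b' x v) \<in> {\<lambda>x v. a x v + b x v | a b. a \<in> ?A \<and> b \<in> ?B}"
    using a'(1) b'(1) by blast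
  qed
 qed
 show "(\<lambda>x v. f x + g x) \<in> {\<lambda>x v. a x v + b x v | a b. a \<in> ?A \<and> b \<in> ?B}"
  using canonical_family_mem[of f] canonical_family_mem[of g] by auto
qed simp

end

text \<open>The summands of the higher chain rule: derivatives of \<open>g\<close> at
  \<open>f x\<close>, evaluated at derivatives of \<open>f\<close>.\<close>

inductive_set comp_family ::
 "('k::real_normed_field, 'f::ab_group_add) tvs \<Rightarrow> ('k, 'g::ab_group_add) tvs \<Rightarrow> ('e \<Rightarrow> 'f) \<Rightarrow> ('f \<Rightarrow> 'g) \<Rightarrow>
  ('e \<Rightarrow> (nat \<Rightarrow> 'e) \<Rightarrow> 'f) set \<Rightarrow> ('e \<Rightarrow> (nat \<Rightarrow> 'e) \<Rightarrow> 'g) set"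
 for F G f g H where
 base: "(\<And>i. W i \<in> H) \<Longrightarrow> (\<lambda>x v. iterD F G g m (f x) (\<lambda>i. W i x v)) \<in> comp_family F G f g H"
| zero: "(\<lambda>x v. 0) \<in> comp_family F G f g H"
| add: "a \<in> comp_family F G f g H \<Longrightarrow> b \<in> comp_family F G f g H \<Longrightarrow> (\<lambda>x v. a x v + b x v) \<in> comp_family F G f g H"

lemma comp_family_sum:
 "finite I \<Longrightarrow> (\<And>i. i \<in> I \<Longrightarrow> a i \<in> comp_family F G f g H) \<Longrightarrow>
   (\<lambda>x v. \<Sum>i\<in>I. a i x v) \<in> comp_family F G f g H"
 by (induction I rule: finite_induct) (auto intro: comp_family.intros)

text \<open>By \<open>iter_quotient_lim\<close> the derivative of a summand of the higher chain rule
  is a finite sum of such summands, so \<open>comp_family\<close> is closed under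
  derivatives.\<close>

theorem smooth_on_compose:
 fixes E :: "('k::real_normed_field, 'e::ab_group_add) tvs" and F :: "('k, 'f::ab_group_add) tvs"
  and G :: "('k, 'g::ab_group_add) tvs"
 assumes "lcs E" "lcs F" "lcs G"
  and f: "smooth_on E F U f" and g: "smooth_on F G V g" and fU: "f ` U \<subseteq> V"
 shows "smooth_on E G U (\<lambda>x. g (f x))"
proof -
 interpret EF: lcs2 E F using assms by (simp add: lcs2_def)
 interpret FG: lcs2 F G using assms by (simp add: lcs2_def)
 interpret EG: lcs2 E G using assms by (simp add: lcs2_def)
 let ?A = "deriv_terms E F f"
 note A = EF.canonical_family[OF f] and U = EF.smooth_on_open[OF f]
 let ?C = "comp_family F G f g ?A"
 have cont: "continuous_map (prod_topology (subtopology (topol E) U) (product_topology (\<lambda>_. topol E) UNIV))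
    (topol G) (\<lambda>(x, v). h x v)" if "h \<in> ?C" for h
 proof (rule EG.continuous_map_dirs)
  fix p assume p: "p \<in> topspace (prod_topology (subtopology (topol E) U) (product_topology (\<lambda>_. topol E) (UNIV::nat set)))"
  note D = limitin_atin_dom[OF p]
  show "tlim G (\<lambda>q. h (fst q) (snd q)) (h (fst p) (snd p))
    (atin (prod_topology (subtopology (topol E) U) (product_topology (\<lambda>_. topol E) UNIV)) p)"
   using that
  proof induction
   case (base W m)
   show ?case
    by (rule FG.iter_lim[OF g EF.smooth_on_lim[OF f D(1,2)]])
     (use D(2) fU deriv_family_lim[OF A base U D(1,2,3)] in auto)
  qed (auto intro: FG.F.lim_add)
 qed
 have der: "\<exists>h'\<in>?C. \<forall>x\<in>U. \<forall>v. range v \<subseteq> pts E \<longrightarrow> has_dir_deriv E G (\<lambda>z. h z v) x (v k) (h' x v)"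
  if "h \<in> ?C" for h k
  using that
 proof induction
  case (base W m)
  have "\<exists>W'. W' \<in> ?A \<and> (\<forall>x\<in>U. \<forall>v. range v \<subseteq> pts E \<longrightarrow> has_dir_deriv E F (\<lambda>z. W i z v) x (v k) (W' x v))" for i
   using deriv_familyD[OF A base[of i], where k = k] by metis
  then obtain W' where W': "\<And>i. W' i \<in> ?A"
   "\<And>i x v. x \<in> U \<Longrightarrow> range v \<subseteq> pts E \<Longrightarrow> has_dir_deriv E F (\<lambda>z. W i z v) x (v k) (W' i x v)" by metis
  obtain f' where f': "f' \<in> ?A"
   "\<And>x v. x \<in> U \<Longrightarrow> range v \<subseteq> pts E \<Longrightarrow> has_dir_deriv E F f x (v k) (f' x v)"
   using deriv_familyD[OF A EF.canonical_family_mem, where k = k] by metis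
  \<comment> \<open>\<open>h1\<close> comes from moving the point \<open>f x\<close>, and
    \<open>h2 j\<close> from moving the direction with index \<open>j\<close>.\<close>
  define h1 where "h1 = (\<lambda>x v. iterD F G g (Suc m) (f x) (\<lambda>i. (W(m := f')) i x v))"
  define h2 where "h2 j = (\<lambda>x v. iterD F G g m (f x) (\<lambda>i. (W(j := W' j)) i x v))" for j
  have mem: "(\<lambda>x v. h1 x v + (\<Sum>j<m. h2 j x v)) \<in> ?C"
   unfolding h1_def h2_def
   by (rule comp_family.add, rule comp_family.base)
    (use base W'(1) f'(1) in "auto intro!: comp_family_sum comp_family.base")
  show ?case
  proof (rule bexI[OF _ mem], intro ballI allI impI)
   fix x and v :: "nat \<Rightarrow> 'e" assume x: "x \<in> U" and v: "range v \<subseteq> pts E"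
   have v': "limitin (product_topology (\<lambda>_. topol E) UNIV) (\<lambda>_. v) v bot"
    using v by (auto simp: limitin_componentwise)
   have t: "((\<lambda>t. t) \<longlongrightarrow> (0::'k)) (at 0)" "eventually (\<lambda>t::'k. t \<noteq> 0) (at 0)"
    by (auto simp: eventually_at intro!: tendsto_eq_intros exI[of _ 1])
   have Wp: "W i x v \<in> pts F" for i
    using limitin_topspace[OF deriv_family_lim[OF A base[of i] U _ x v', of "\<lambda>_::unit. x"]] EF.smooth_on_pts[OF f x] by simp
   have "tlim G
    (\<lambda>t. smul G (inverse t) (iterD F G g m (f (x + smul E t (v k))) (\<lambda>i. W i (x + smul E t (v k)) v)
      - iterD F G g m (f x) (\<lambda>i. W i x v)))
    (iterD F G g (Suc m) (f x) ((\<lambda>i. W i x v)(m := f' x v)) +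
    (\<Sum>i<m. iterD F G g m (f x) ((\<lambda>i. W i x v)(i := W' i x v)))) (at 0)"
    by (rule FG.iter_quotient_lim[OF g _ Wp t])
     (use W'(2)[OF x v] f'(2)[OF x v] fU x in "auto simp: has_dir_deriv_def")
   moreover have "(\<lambda>i. W i x v)(m := f' x v) = (\<lambda>i. (W(m := f')) i x v)"
    "(\<lambda>i. W i x v)(j := W' j x v) = (\<lambda>i. (W(j := W' j)) i x v)" for j by auto
   ultimately show "has_dir_deriv E G (\<lambda>z. iterD F G g m (f z) (\<lambda>i. W i z v)) x (v k) (h1 x v + (\<Sum>j<m. h2 j x v))"
    unfolding has_dir_deriv_def h1_def h2_def by simp
  qed
 next
  case zero
  show ?case by (intro bexI[OF _ comp_family.zero] ballI allI impI EG.has_dir_deriv_const)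
 next
  case (add a b)
  then obtain a' b' where a': "a' \<in> ?C" "\<forall>x\<in>U. \<forall>v. range v \<subseteq> pts E \<longrightarrow> has_dir_deriv E G (\<lambda>z. a z v) x (v k) (a' x v)"
   and b': "b' \<in> ?C" "\<forall>x\<in>U. \<forall>v. range v \<subseteq> pts E \<longrightarrow> has_dir_deriv E G (\<lambda>z. b z v) x (v k) (b' x v)" by meson
  show ?case
   by (intro bexI[OF _ comp_family.add[OF a'(1) b'(1)]] ballI allI impI EG.has_dir_deriv_add) (use a' b' in auto)
 qed
 have "(\<lambda>x v. iterD F G g 0 (f x) (\<lambda>i. f x)) \<in> ?C"
  using comp_family.base[of "\<lambda>_ x v. f x" ?A F G g 0 f] EF.canonical_family_mem by blast
 then show ?thesis
  by (rule EG.smooth_on_family[OF U, rotated]) (use cont der in "auto simp: deriv_family_def")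
qed

section \<open>Constructions with locally convex spaces\<close>

abbreviation cx where "cx \<equiv> complexification"

definition pow_tvs :: "('k, 'e) tvs \<Rightarrow> ('k, 'i \<Rightarrow> 'e) tvs" where
 "pow_tvs E = \<lparr>smul = (\<lambda>a f i. smul E a (f i)), topol = product_topology (\<lambda>_. topol E) UNIV\<rparr>"

text \<open>The continuity axioms in terms of limits along \<open>atin\<close>, which is the form in
  which the constructions below verify them.\<close>

lemma lcs_of_limits:
 fixes E :: "('k::real_normed_field, 'e::ab_group_add) tvs"
 assumes "vector_space (smul E)" "module.subspace (smul E) (pts E)" "Hausdorff_space (topol E)"
  and "\<And>p. fst p \<in> pts E \<Longrightarrow> snd p \<in> pts E \<Longrightarrow>
    tlim E (\<lambda>q. fst q + snd q) (fst p + snd p) (atin (prod_topology (topol E) (topol E)) p)"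
  and "\<And>p. snd p \<in> pts E \<Longrightarrow>
    tlim E (\<lambda>q. smul E (fst q) (snd q)) (smul E (fst p) (snd p)) (atin (prod_topology euclidean (topol E)) p)"
  and "\<And>U. topen E U \<Longrightarrow> 0 \<in> U \<Longrightarrow> \<exists>C. convex_nbhd E C \<and> 0 \<in> C \<and> C \<subseteq> U"
 shows "lcs E"
proof -
 have "continuous_map (prod_topology (topol E) (topol E)) (topol E) (\<lambda>(x, y). x + y)"
  using assms(4) by (auto simp: continuous_map_atin case_prod_beta')
 moreover have "continuous_map (prod_topology euclidean (topol E)) (topol E) (\<lambda>(a, x). smul E a x)"
  using assms(5) by (auto simp: continuous_map_atin case_prod_beta')
 moreover have "\<forall>U. topen E U \<and> 0 \<in> U \<longrightarrow>
    (\<exists>C. topen E C \<and> 0 \<in> C \<and> C \<subseteq> U \<and>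
     (\<forall>x\<in>C. \<forall>y\<in>C. \<forall>t\<in>{0..1::real}.
      smul E (of_real t) x + smul E (of_real (1 - t)) y \<in> C))"
  using assms(6) unfolding convex_nbhd_def by metis
 ultimately show ?thesis using assms(1-3) by (simp add: lcs_def locally_convex_space_def)
qed

lemma atin_prod_limits:
 assumes "fst p \<in> topspace X" "snd p \<in> topspace Y"
 shows "limitin X fst (fst p) (atin (prod_topology X Y) p)" "limitin Y snd (snd p) (atin (prod_topology X Y) p)"
proof -
 have "p \<in> topspace (prod_topology X Y)" using assms by (simp add: mem_Times_iff)
 from limitin_atin_id[OF this] show "limitin X fst (fst p) (atin (prod_topology X Y) p)"
  "limitin Y snd (snd p) (atin (prod_topology X Y) p)" by (auto simp: limitin_prod_iff)
qed

lemma openin_prod_zeroE: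
 assumes "openin (prod_topology X Y) U" "0 \<in> U"
 obtains A B where "openin X A" "openin Y B" "0 \<in> A" "0 \<in> B" "A \<times> B \<subseteq> U"
proof -
 from assms(1) have "\<And>x y. (x, y) \<in> U \<Longrightarrow> \<exists>A B. openin X A \<and> openin Y B \<and> x \<in> A \<and> y \<in> B \<and> A \<times> B \<subseteq> U"
  by (simp add: openin_prod_topology_alt)
 with assms(2) that show thesis unfolding zero_prod_def by meson
qed

lemma tvs_simps[simp]:
 "smul (pow_tvs E) = (\<lambda>a f i. smul E a (f i))" "topol (pow_tvs E) = product_topology (\<lambda>_. topol E) UNIV"
 "smul (prod_tvs E F) = (\<lambda>a (x, y). (smul E a x, smul F a y))"
 "topol (prod_tvs E F) = prod_topology (topol E) (topol F)"
 "smul (subspace_tvs E V) = smul E" "topol (subspace_tvs E V) = subtopology (topol E) V"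
 "topol (complexification G) = prod_topology (topol G) (topol G)"
 by (simp_all add: pow_tvs_def prod_tvs_def subspace_tvs_def complexification_def)

lemma smul_cx: "smul (complexification E) =
  (\<lambda>z (x, y). (smul E (of_real (Re z)) x - smul E (of_real (Im z)) y,
        smul E (of_real (Re z)) y + smul E (of_real (Im z)) x))"
 by (simp add: complexification_def)

lemma vector_space_pow:
 assumes "vector_space s" shows "vector_space (\<lambda>a f i. s a (f i))"
proof -
 interpret vector_space s by fact
 show ?thesis
  by unfold_locales (auto simp: fun_eq_iff scale_right_distrib scale_left_distrib)
qed

lemma lcs_subspace:
 assumes "lcs E" "module.subspace (smul E) V"
 shows "lcs (subspace_tvs E V)"
proof -
 interpret lcs E by fact
 note sub = vs.subspace_0[OF assms(2)] vs.subspace_add[OF assms(2)] vs.subspace_scale[OF assms(2)]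
 show ?thesis
 proof (rule lcs_of_limits)
  show "vector_space (smul (subspace_tvs E V))" by (simp add: vs.vector_space_axioms)
  show "module.subspace (smul (subspace_tvs E V)) (pts (subspace_tvs E V))"
   using vs.subspace_inter[OF subspace_pts assms(2)] by simp
  show "Hausdorff_space (topol (subspace_tvs E V))" using hausdorff by (simp add: Hausdorff_space_subtopology)
 next
  fix p :: "'b \<times> 'b"
  let ?G = "atin (prod_topology (topol (subspace_tvs E V)) (topol (subspace_tvs E V))) p"
  assume "fst p \<in> pts (subspace_tvs E V)" "snd p \<in> pts (subspace_tvs E V)"
  from atin_prod_limits[OF this]
  have L: "tlim E fst (fst p) ?G" "tlim E snd (snd p) ?G"
   "fst p \<in> V" "snd p \<in> V" "eventually (\<lambda>q. fst q \<in> V) ?G" "eventually (\<lambda>q. snd q \<in> V) ?G"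
   by (simp_all add: limitin_subtopology)
  have "eventually (\<lambda>q. fst q + snd q \<in> V) ?G" using L(5,6) by eventually_elim (rule sub)
  then show "tlim (subspace_tvs E V) (\<lambda>q. fst q + snd q) (fst p + snd p) ?G"
   using L sub by (auto simp: limitin_subtopology intro: lim_add)
 next
  fix p :: "'a \<times> 'b"
  let ?G = "atin (prod_topology euclidean (topol (subspace_tvs E V))) p"
  assume "snd p \<in> pts (subspace_tvs E V)"
  from atin_prod_limits[OF _ this, of euclidean]
  have L: "(fst \<longlongrightarrow> fst p) ?G" "tlim E snd (snd p) ?G"
   "snd p \<in> V" "eventually (\<lambda>q. snd q \<in> V) ?G"
   by (simp_all add: limitin_subtopology)
  have "eventually (\<lambda>q. smul E (fst q) (snd q) \<in> V) ?G" using L(4) by eventually_elim (rule sub)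
  then show "tlim (subspace_tvs E V) (\<lambda>q. smul (subspace_tvs E V) (fst q) (snd q)) (smul (subspace_tvs E V) (fst p) (snd p)) ?G"
   using L sub by (auto simp: limitin_subtopology intro: lim_smul)
 next
  fix U assume "topen (subspace_tvs E V) U" "0 \<in> U"
  then obtain T where T: "topen E T" "U = T \<inter> V" by (auto simp: openin_subtopology)
  with \<open>0 \<in> U\<close> obtain C where C: "convex_nbhd E C" "0 \<in> C" "C \<subseteq> T" using convex_nbhd_base by blast
  have "convex_nbhd (subspace_tvs E V) (C \<inter> V)"
   using C(1) sub unfolding convex_nbhd_def by (auto intro: openin_subtopology_Int)
  then show "\<exists>C. convex_nbhd (subspace_tvs E V) C \<and> 0 \<in> C \<and> C \<subseteq> U" using C T sub by blast
 qed
qed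

lemma lcs_pow:
 assumes "lcs E" shows "lcs (pow_tvs E :: (_, 'i \<Rightarrow> _) tvs)"
proof -
 interpret lcs E by fact
 let ?P = "pow_tvs E :: (_, 'i \<Rightarrow> _) tvs"
 show ?thesis
 proof (rule lcs_of_limits)
  show "vector_space (smul ?P)" by (simp add: vector_space_pow[OF vs.vector_space_axioms])
  then interpret P: vector_space "smul ?P" .
  show "module.subspace (smul ?P) (pts ?P)"
   by (rule P.subspaceI) (auto simp: PiE_iff)
  show "Hausdorff_space (topol ?P)" using hausdorff by (simp add: Hausdorff_space_product_topology)
 next
  fix p :: "('i \<Rightarrow> _) \<times> _"
  let ?G = "atin (prod_topology (topol ?P) (topol ?P)) p"
  assume "fst p \<in> pts ?P" "snd p \<in> pts ?P"
  from atin_prod_limits[OF this]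
  have L: "tlim E (\<lambda>q. fst q i) (fst p i) ?G" "tlim E (\<lambda>q. snd q i) (snd p i) ?G"
    "eventually (\<lambda>q. \<forall>i. fst q i \<in> pts E) ?G" "eventually (\<lambda>q. \<forall>i. snd q i \<in> pts E) ?G" for i
   by (simp_all add: limitin_componentwise PiE_iff)
  have "eventually (\<lambda>q. \<forall>i. (fst q + snd q) i \<in> pts E) ?G" using L(3,4) by eventually_elim simp
  then show "tlim ?P (\<lambda>q. fst q + snd q) (fst p + snd p) ?G"
   using L by (auto simp: limitin_componentwise PiE_iff intro: lim_add)
 next
  fix p :: "'a \<times> ('i \<Rightarrow> 'b)"
  let ?G = "atin (prod_topology euclidean (topol ?P)) p"
  assume "snd p \<in> pts ?P"
  from atin_prod_limits[OF _ this, of euclidean]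
  have L: "(fst \<longlongrightarrow> fst p) ?G" "tlim E (\<lambda>q. snd q i) (snd p i) ?G"
   "eventually (\<lambda>q. \<forall>i. snd q i \<in> pts E) ?G" for i
   by (simp_all add: limitin_componentwise PiE_iff)
  have "eventually (\<lambda>q. \<forall>i. smul ?P (fst q) (snd q) i \<in> pts E) ?G" using L(3) by eventually_elim simp
  then show "tlim ?P (\<lambda>q. smul ?P (fst q) (snd q)) (smul ?P (fst p) (snd p)) ?G"
   using L by (auto simp: limitin_componentwise PiE_iff intro: lim_smul)
 next
  fix U assume U: "topen ?P U" "0 \<in> U"
  then obtain T where T: "finite {i. T i \<noteq> pts E}" "\<And>i. topen E (T i)" "0 \<in> PiE UNIV T" "PiE UNIV T \<subseteq> U"
   unfolding tvs_simps openin_product_topology_alt by force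
  \<comment> \<open>The whole space is kept wherever \<open>T i\<close> is the whole space, so that
    the product of the sets \<open>C i\<close> is again open.\<close>
  have "\<exists>C. convex_nbhd E C \<and> 0 \<in> C \<and> C \<subseteq> T i \<and> (T i = pts E \<longrightarrow> C = pts E)" for i
  proof (cases "T i = pts E")
   case True
   then show ?thesis by (intro exI[of _ "pts E"]) (auto simp: convex_nbhd_def)
  next
   case False
   have "0 \<in> T i" using T(3) by (auto simp: PiE_iff zero_fun_def)
   with T(2) obtain C where "convex_nbhd E C" "0 \<in> C" "C \<subseteq> T i" using convex_nbhd_base by blast
   with False show ?thesis by blast
  qed
  then obtain C where C: "\<And>i. convex_nbhd E (C i)" "\<And>i. 0 \<in> C i" "\<And>i. C i \<subseteq> T i" "\<And>i. T i = pts E \<Longrightarrow> C i = pts E"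
   by metis
  have "finite {i. C i \<noteq> pts E}" by (rule finite_subset[OF _ T(1)]) (use C(4) in auto)
  then have "topen ?P (PiE UNIV C)"
   using C(1) by (auto simp: openin_PiE_gen convex_nbhd_open)
  then have "convex_nbhd ?P (PiE UNIV C)"
   using C(1) unfolding convex_nbhd_def by (auto simp: PiE_iff)
  moreover have "PiE UNIV C \<subseteq> U" by (rule order_trans[OF PiE_mono T(4)]) (rule C(3))
  moreover have "0 \<in> PiE UNIV C" using C(2) by (auto simp: PiE_iff)
  ultimately show "\<exists>C. convex_nbhd ?P C \<and> 0 \<in> C \<and> C \<subseteq> U" by blast
 qed
qed

lemma lcs_prod:
 assumes "lcs E" "lcs F" shows "lcs (prod_tvs E F)"
proof -
 interpret E: lcs E by fact
 interpret F: lcs F by fact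
 let ?P = "prod_tvs E F"
 show ?thesis
 proof (rule lcs_of_limits)
  show "vector_space (smul ?P)"
   by unfold_locales (auto simp: E.vs.scale_right_distrib E.vs.scale_left_distrib F.vs.scale_right_distrib F.vs.scale_left_distrib)
  then interpret P: vector_space "smul ?P" .
  show "module.subspace (smul ?P) (pts ?P)"
   by (rule P.subspaceI) (auto simp: zero_prod_def)
  show "Hausdorff_space (topol ?P)" using E.hausdorff F.hausdorff by (simp add: Hausdorff_space_prod_topology)
 next
  fix p :: "('b \<times> 'c) \<times> ('b \<times> 'c)"
  let ?G = "atin (prod_topology (topol ?P) (topol ?P)) p"
  assume "fst p \<in> pts ?P" "snd p \<in> pts ?P"
  from atin_prod_limits[OF this]
  show "tlim ?P (\<lambda>q. fst q + snd q) (fst p + snd p) ?G"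
   by (auto simp: limitin_prod_iff intro: E.lim_add F.lim_add)
 next
  fix p :: "'a \<times> ('b \<times> 'c)"
  let ?G = "atin (prod_topology euclidean (topol ?P)) p"
  assume "snd p \<in> pts ?P"
  from atin_prod_limits[OF _ this, of euclidean]
  show "tlim ?P (\<lambda>q. smul ?P (fst q) (snd q)) (smul ?P (fst p) (snd p)) ?G"
   by (auto simp: limitin_prod_iff case_prod_beta' intro: E.lim_smul F.lim_smul)
 next
  fix U assume "topen ?P U" "0 \<in> U"
  then obtain A B where AB: "topen E A" "topen F B" "0 \<in> A" "0 \<in> B" "A \<times> B \<subseteq> U"
   by (auto elim: openin_prod_zeroE)
  obtain C where C: "convex_nbhd E C" "0 \<in> C" "C \<subseteq> A" by (rule E.convex_nbhd_base[OF AB(1,3)])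
  obtain D where D: "convex_nbhd F D" "0 \<in> D" "D \<subseteq> B" by (rule F.convex_nbhd_base[OF AB(2,4)])
  have "convex_nbhd ?P (C \<times> D)"
   using C(1) D(1) unfolding convex_nbhd_def by (auto simp: openin_prod_Times_iff)
  then show "\<exists>C. convex_nbhd ?P C \<and> 0 \<in> C \<and> C \<subseteq> U"
   using C D AB(5) by (intro exI[of _ "C \<times> D"]) (auto simp: zero_prod_def)
 qed
qed

lemma lcs_cx:
 assumes "lcs E" shows "lcs (complexification E)"
proof -
 interpret E: lcs E by fact
 let ?P = "complexification E"
 show ?thesis
 proof (rule lcs_of_limits)
  show "vector_space (smul ?P)"
   by unfold_locales (auto simp: smul_cx E.vs.scale_right_distrib E.vs.scale_left_distrib
     E.vs.scale_left_diff_distrib E.vs.scale_right_diff_distrib algebra_simps)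
  then interpret P: vector_space "smul ?P" .
  show "module.subspace (smul ?P) (pts ?P)"
   by (rule P.subspaceI) (auto simp: zero_prod_def smul_cx)
  show "Hausdorff_space (topol ?P)" using E.hausdorff by (simp add: Hausdorff_space_prod_topology)
 next
  fix p :: "('b \<times> 'b) \<times> ('b \<times> 'b)"
  let ?G = "atin (prod_topology (topol ?P) (topol ?P)) p"
  assume "fst p \<in> pts ?P" "snd p \<in> pts ?P"
  from atin_prod_limits[OF this]
  show "tlim ?P (\<lambda>q. fst q + snd q) (fst p + snd p) ?G"
   by (auto simp: limitin_prod_iff intro: E.lim_add)
 next
  fix p :: "complex \<times> ('b \<times> 'b)"
  let ?G = "atin (prod_topology euclidean (topol ?P)) p"
  assume "snd p \<in> pts ?P"
  from atin_prod_limits[OF _ this, of euclidean]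
  show "tlim ?P (\<lambda>q. smul ?P (fst q) (snd q)) (smul ?P (fst p) (snd p)) ?G"
   by (auto simp: limitin_prod_iff case_prod_beta' smul_cx intro!: E.lim_smul E.lim_add E.lim_diff
     tendsto_of_real tendsto_Re tendsto_Im)
 next
  fix U assume "topen ?P U" "0 \<in> U"
  then obtain A B where AB: "topen E A" "topen E B" "0 \<in> A" "0 \<in> B" "A \<times> B \<subseteq> U"
   by (auto elim: openin_prod_zeroE)
  obtain C where C: "convex_nbhd E C" "0 \<in> C" "C \<subseteq> A" by (rule E.convex_nbhd_base[OF AB(1,3)])
  obtain D where D: "convex_nbhd E D" "0 \<in> D" "D \<subseteq> B" by (rule E.convex_nbhd_base[OF AB(2,4)])
  have "convex_nbhd ?P (C \<times> D)"
   using C(1) D(1) unfolding convex_nbhd_def by (auto simp: openin_prod_Times_iff smul_cx)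
  then show "\<exists>C. convex_nbhd ?P C \<and> 0 \<in> C \<and> C \<subseteq> U"
   using C D AB(5) by (intro exI[of _ "C \<times> D"]) (auto simp: zero_prod_def)
 qed
qed

section \<open>Linear, bilinear and componentwise smooth maps\<close>

definition cont_linear ::
 "('k::real_normed_field, 'e::ab_group_add) tvs \<Rightarrow> ('k, 'f::ab_group_add) tvs \<Rightarrow> ('e \<Rightarrow> 'f) \<Rightarrow> bool" where
 "cont_linear E F L \<longleftrightarrow> cont E F L \<and>
   (\<forall>x\<in>pts E. \<forall>y\<in>pts E. L (x + y) = L x + L y) \<and> (\<forall>c. \<forall>x\<in>pts E. L (smul E c x) = smul F c (L x))"

definition cont_bilinear ::
 "('k::real_normed_field, 'e::ab_group_add) tvs \<Rightarrow> ('k, 'f::ab_group_add) tvs \<Rightarrow> ('k, 'g::ab_group_add) tvs \<Rightarrow>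
  ('e \<Rightarrow> 'f \<Rightarrow> 'g) \<Rightarrow> bool" where
 "cont_bilinear E F G b \<longleftrightarrow> continuous_map (prod_topology (topol E) (topol F)) (topol G) (\<lambda>(x, y). b x y) \<and>
   (\<forall>x\<in>pts E. \<forall>x'\<in>pts E. \<forall>y\<in>pts F. b (x + x') y = b x y + b x' y) \<and>
   (\<forall>x\<in>pts E. \<forall>y\<in>pts F. \<forall>y'\<in>pts F. b x (y + y') = b x y + b x y') \<and>
   (\<forall>c. \<forall>x\<in>pts E. \<forall>y\<in>pts F. b (smul E c x) y = smul G c (b x y) \<and> b x (smul F c y) = smul G c (b x y))"

lemma cont_linear_lim:
 "cont_linear E F L \<Longrightarrow> tlim E f l G \<Longrightarrow> tlim F (\<lambda>s. L (f s)) (L l) G"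
 unfolding cont_linear_def by (elim conjE) (rule limitin_continuous)

lemma cont_linear_pts: "cont_linear E F L \<Longrightarrow> x \<in> pts E \<Longrightarrow> L x \<in> pts F"
 by (auto simp: cont_linear_def continuous_map_def Pi_iff)

lemma cont_linearI:
 assumes "\<And>x. x \<in> pts E \<Longrightarrow> tlim F L (L x) (atin (topol E) x)"
  and "\<And>x y. x \<in> pts E \<Longrightarrow> y \<in> pts E \<Longrightarrow> L (x + y) = L x + L y"
  and "\<And>c x. x \<in> pts E \<Longrightarrow> L (smul E c x) = smul F c (L x)"
 shows "cont_linear E F L"
 using assms unfolding cont_linear_def continuous_map_atin by blast

lemma cont_bilinear_lim:
 assumes "cont_bilinear E F G b" "tlim E f x H" "tlim F g y H"
 shows "tlim G (\<lambda>s. b (f s) (g s)) (b x y) H"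
proof -
 have "continuous_map (prod_topology (topol E) (topol F)) (topol G) (\<lambda>(x, y). b x y)"
  using assms(1) by (simp add: cont_bilinear_def)
 from limitin_continuous[OF this limitin_Pair[OF assms(2,3)]] show ?thesis by simp
qed

lemma cont_bilinear_pts: "cont_bilinear E F G b \<Longrightarrow> x \<in> pts E \<Longrightarrow> y \<in> pts F \<Longrightarrow> b x y \<in> pts G"
 using cont_bilinear_lim[of E F G b "\<lambda>_::unit. x" x bot "\<lambda>_. y" y] by (auto dest: limitin_topspace)

lemma cont_bilinearI:
 assumes "\<And>p. fst p \<in> pts E \<Longrightarrow> snd p \<in> pts F \<Longrightarrow>
    tlim G (\<lambda>q. b (fst q) (snd q)) (b (fst p) (snd p)) (atin (prod_topology (topol E) (topol F)) p)"
  and "\<And>x x' y. x \<in> pts E \<Longrightarrow> x' \<in> pts E \<Longrightarrow> y \<in> pts F \<Longrightarrow> b (x + x') y = b x y + b x' y"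
  and "\<And>x y y'. x \<in> pts E \<Longrightarrow> y \<in> pts F \<Longrightarrow> y' \<in> pts F \<Longrightarrow> b x (y + y') = b x y + b x y'"
  and "\<And>c x y. x \<in> pts E \<Longrightarrow> y \<in> pts F \<Longrightarrow> b (smul E c x) y = smul G c (b x y)"
  and "\<And>c x y. x \<in> pts E \<Longrightarrow> y \<in> pts F \<Longrightarrow> b x (smul F c y) = smul G c (b x y)"
 shows "cont_bilinear E F G b"
 using assms unfolding cont_bilinear_def by (auto simp: continuous_map_atin case_prod_beta')

lemma eventually_at_neq: "eventually (\<lambda>t::'a::t1_space. t \<noteq> a) (at a)"
 by (simp add: eventually_at_filter)

context lcs2
begin

lemma smooth_on_const:
 assumes "topen E U" "c \<in> pts F" shows "smooth_on E F U (\<lambda>x. c)"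
proof (rule smooth_on_family[OF assms(1)])
 show "deriv_family E F U {\<lambda>x v. c, \<lambda>x v. 0}"
  using assms(2) by (auto simp: deriv_family_def has_dir_deriv_const case_prod_beta')
qed auto

lemma has_dir_deriv_linear:
 assumes L: "cont_linear E F L" and x: "x \<in> pts E" and v: "v \<in> pts E"
 shows "has_dir_deriv E F L x v (L v)"
 unfolding has_dir_deriv_def
proof (rule limitin_transform_eventually)
 show "tlim F (\<lambda>t. L v) (L v) (at 0)" using cont_linear_pts[OF L v] by simp
 show "\<forall>\<^sub>F t in at 0. L v = smul F (inverse t) (L (x + smul E t v) - L x)"
  using eventually_at_neq[of 0]
  by eventually_elim (use L x v in "auto simp: cont_linear_def")
qed

lemma smooth_on_linear:
 assumes L: "cont_linear E F L" shows "smooth_on E F (pts E) L"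
proof (rule smooth_on_family)
 let ?H = "{\<lambda>x v. L x, \<lambda>x v. 0} \<union> {\<lambda>x v. L (v k) | k. True} :: ('e \<Rightarrow> (nat \<Rightarrow> 'e) \<Rightarrow> 'f) set"
 show "deriv_family E F (pts E) ?H"
  unfolding deriv_family_def
 proof (intro conjI ballI allI)
  fix h assume "h \<in> ?H"
  then consider "h = (\<lambda>x v. L x)" | "h = (\<lambda>x v. 0)" | k where "h = (\<lambda>x v. L (v k))" by blast
  note cases = this
  show "continuous_map (prod_topology (subtopology (topol E) (pts E)) (product_topology (\<lambda>_. topol E) UNIV))
    (topol F) (\<lambda>(x, v). h x v)"
  proof (rule continuous_map_dirs)
   fix p assume p: "p \<in> topspace (prod_topology (subtopology (topol E) (pts E)) (product_topology (\<lambda>_. topol E) (UNIV::nat set)))"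
   note D = limitin_atin_dom[OF p]
   show "tlim F (\<lambda>q. h (fst q) (snd q)) (h (fst p) (snd p))
     (atin (prod_topology (subtopology (topol E) (pts E)) (product_topology (\<lambda>_. topol E) UNIV)) p)"
    using cases by cases (use D(1,4) in "auto intro: cont_linear_lim[OF L]")
  qed
  fix k
  show "\<exists>h'\<in>?H. \<forall>x\<in>pts E. \<forall>v. range v \<subseteq> pts E \<longrightarrow> has_dir_deriv E F (\<lambda>z. h z v) x (v k) (h' x v)"
   using cases
  proof cases
   case 1
   show ?thesis
    by (rule bexI[of _ "\<lambda>x v. L (v k)"]) (auto simp: 1 intro!: has_dir_deriv_linear[OF L])
  qed (rule bexI[of _ "\<lambda>x v. 0"], auto intro!: has_dir_deriv_const)+
 qed
qed auto

end

lemma cont_bilinear_zero: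
 assumes "lcs E" "lcs F" "lcs G" "cont_bilinear E F G b" "x \<in> pts E" "y \<in> pts F"
 shows "b 0 y = 0" "b x 0 = 0"
proof -
 interpret E: lcs E by fact
 interpret F: lcs F by fact
 interpret G: lcs G by fact
 have "b (smul E 0 x) y = smul G 0 (b x y)" "b x (smul F 0 y) = smul G 0 (b x y)"
  using assms(4-) unfolding cont_bilinear_def by blast+
 then show "b 0 y = 0" "b x 0 = 0" by simp_all
qed

text \<open>On the product the map is quadratic and \<open>p\<close> is its polarisation: the first
  derivative is \<open>p x v\<close>, the second \<open>p v w\<close>, the third 0. These terms form
  a closed family.\<close>

lemma smooth_on_bilinear:
 fixes E :: "('k::real_normed_field, 'e::ab_group_add) tvs" and F :: "('k, 'f::ab_group_add) tvs"
  and G :: "('k, 'g::ab_group_add) tvs"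
 assumes "lcs E" "lcs F" "lcs G" and b: "cont_bilinear E F G b"
 shows "smooth_on (prod_tvs E F) G (pts (prod_tvs E F)) (\<lambda>x. b (fst x) (snd x))"
proof -
 interpret E: lcs E by fact
 interpret F: lcs F by fact
 let ?P = "prod_tvs E F"
 interpret P: lcs ?P by (rule lcs_prod) fact+
 interpret PG: lcs2 ?P G using assms by (simp add: lcs2_def P.lcs_axioms)
 define q where "q x = b (fst x) (snd x)" for x
 define p where "p x y = b (fst x) (snd y) + b (fst y) (snd x)" for x y
 have qlim: "tlim G (\<lambda>s. q (x s)) (q x0) H" if "tlim ?P x x0 H" for x x0 and H :: "('k) filter"
  using that unfolding q_def by (intro cont_bilinear_lim[OF b]) (auto simp: limitin_prod_iff)
 have expand: "q (x + smul ?P t v) = q x + smul G t (p x v) + smul G (t * t) (q v)" if "x \<in> pts ?P" "v \<in> pts ?P" for x v t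
  using that b unfolding q_def p_def cont_bilinear_def
  by (cases x; cases v) (simp add: PG.F.vs.scale_right_distrib algebra_simps)
 have pexp: "p (x + smul ?P t v) w = p x w + smul G t (p v w)" if "x \<in> pts ?P" "v \<in> pts ?P" "w \<in> pts ?P" for x v w t
  using that b unfolding p_def cont_bilinear_def
  by (cases x; cases v; cases w) (simp add: PG.F.vs.scale_right_distrib algebra_simps)
 have ppts: "p x v \<in> pts G" "q x \<in> pts G" if "x \<in> pts ?P" "v \<in> pts ?P" for x v
  using that unfolding p_def q_def by (auto intro!: PG.F.add_pts cont_bilinear_pts[OF b])
 have dq: "has_dir_deriv ?P G q x v (p x v)" if x: "x \<in> pts ?P" and v: "v \<in> pts ?P" for x v
  unfolding has_dir_deriv_def
 proof (rule limitin_transform_eventually)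
  show "tlim G (\<lambda>t. p x v + smul G t (q v)) (p x v) (at 0)"
   using PG.F.lim_add[OF _ PG.F.lim_smul[OF tendsto_ident_at], of "\<lambda>_. p x v" "p x v" 0 UNIV "\<lambda>_. q v" "q v"] ppts[OF x v] ppts[OF v x] by simp
  show "\<forall>\<^sub>F t in at 0. p x v + smul G t (q v) = smul G (inverse t) (q (x + smul ?P t v) - q x)"
   using eventually_at_neq[of 0]
   by eventually_elim (simp add: expand[OF x v] PG.F.vs.scale_right_distrib del: tvs_simps)
 qed
 have dp: "has_dir_deriv ?P G (\<lambda>z. p z w) x v (p v w)" if x: "x \<in> pts ?P" and v: "v \<in> pts ?P" and w: "w \<in> pts ?P" for x v w
  unfolding has_dir_deriv_def
 proof (rule limitin_transform_eventually)
  show "tlim G (\<lambda>t. p v w) (p v w) (at 0)" using ppts[OF v w] by simp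
  show "\<forall>\<^sub>F t in at 0. p v w = smul G (inverse t) (p (x + smul ?P t v) w - p x w)"
   using eventually_at_neq[of 0]
   by eventually_elim (simp add: pexp[OF x v w] PG.F.vs.scale_right_distrib del: tvs_simps)
 qed
 let ?H = "{\<lambda>x v. q x, \<lambda>x v. 0} \<union> {\<lambda>x v. p x (v k) | k. True} \<union> {\<lambda>x v. p (v j) (v k) | j k. True}
   :: ('e \<times> 'f \<Rightarrow> (nat \<Rightarrow> 'e \<times> 'f) \<Rightarrow> 'g) set"
 have "smooth_on ?P G (pts ?P) q"
 proof (rule PG.smooth_on_family)
  show "deriv_family ?P G (pts ?P) ?H"
   unfolding deriv_family_def
  proof (intro conjI ballI allI)
   fix h assume "h \<in> ?H"
   then consider "h = (\<lambda>x v. q x)" | "h = (\<lambda>x v. 0)" | k where "h = (\<lambda>x v. p x (v k))" | j k where "h = (\<lambda>x v. p (v j) (v k))" by blast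
   note cases = this
   show "continuous_map (prod_topology (subtopology (topol ?P) (pts ?P)) (product_topology (\<lambda>_. topol ?P) UNIV))
     (topol G) (\<lambda>(x, v). h x v)"
   proof (rule PG.continuous_map_dirs)
    fix z assume z: "z \<in> topspace (prod_topology (subtopology (topol ?P) (pts ?P)) (product_topology (\<lambda>_. topol ?P) (UNIV::nat set)))"
    let ?G = "atin (prod_topology (subtopology (topol ?P) (pts ?P)) (product_topology (\<lambda>_. topol ?P) UNIV)) z"
    note D = limitin_atin_dom[OF z]
    have "tlim G (\<lambda>q. h (fst q) (snd q)) (h (fst z) (snd z)) W"
     if "tlim ?P fst (fst z) W" "\<And>i. tlim ?P (\<lambda>q. snd q i) (snd z i) W" for W
    proof -
     have 1: "tlim E (\<lambda>q. fst (fst q)) (fst (fst z)) W" "tlim F (\<lambda>q. snd (fst q)) (snd (fst z)) W"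
      "tlim E (\<lambda>q. fst (snd q k)) (fst (snd z k)) W" "tlim F (\<lambda>q. snd (snd q k)) (snd (snd z k)) W" for k
      using that(1) that(2)[of k] by (auto simp: limitin_prod_iff)
     show ?thesis
      using cases by cases (auto simp: q_def p_def intro!: cont_bilinear_lim[OF b] PG.F.lim_add 1)
    qed
    then show "tlim G (\<lambda>q. h (fst q) (snd q)) (h (fst z) (snd z)) ?G"
     using D(1,4) by blast
   qed
   fix k
   show "\<exists>h'\<in>?H. \<forall>x\<in>pts ?P. \<forall>v. range v \<subseteq> pts ?P \<longrightarrow> has_dir_deriv ?P G (\<lambda>z. h z v) x (v k) (h' x v)"
    using cases
   proof cases
    case 1
    show ?thesis unfolding 1
     by (rule bexI[of _ "\<lambda>x v. p x (v k)"]) (blast intro!: dq | blast)+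
   next
    case 2 show ?thesis unfolding 2
     by (rule bexI[of _ "\<lambda>x v. 0"]) (blast intro!: PG.has_dir_deriv_const | blast)+
   next
    case (3 j)
    show ?thesis unfolding 3
     by (rule bexI[of _ "\<lambda>x v. p (v k) (v j)"]) (blast intro!: dp | blast)+
   next
    case 4 show ?thesis unfolding 4
     by (rule bexI[of _ "\<lambda>x v. 0"]) (blast intro!: PG.has_dir_deriv_const | blast)+
   qed
  qed
  show "topen ?P (pts ?P)" by (rule openin_topspace)
 qed auto
 then show ?thesis unfolding q_def .
qed

text \<open>Derivatives are taken componentwise; the premise on limits keeps those of difference
  quotients, and with them all derivatives, inside \<open>V\<close>. The intended subspaces consist
  of linear maps, which are closed under pointwise limits.\<close>

lemma smooth_on_pow_subspace:
 fixes X :: "('k::real_normed_field, 'x::ab_group_add) tvs" and Y :: "('k, 'y::ab_group_add) tvs"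
  and f :: "'x \<Rightarrow> 'i \<Rightarrow> 'y"
 assumes "lcs X" "lcs Y" and V: "module.subspace (smul (pow_tvs Y)) V"
  and closed: "\<And>(q :: 'k \<Rightarrow> 'i \<Rightarrow> 'y) y. eventually (\<lambda>t. q t \<in> V) (at 0) \<Longrightarrow>
    (\<And>i. tlim Y (\<lambda>t. q t i) (y i) (at 0)) \<Longrightarrow> y \<in> V"
  and U: "topen X U"
  and f: "\<And>x. x \<in> U \<Longrightarrow> f x \<in> V" and fi: "\<And>i. smooth_on X Y U (\<lambda>x. f x i)"
 shows "smooth_on X (subspace_tvs (pow_tvs Y) V) U f"
proof -
 let ?S = "subspace_tvs (pow_tvs Y) V"
 interpret XY: lcs2 X Y using assms by (simp add: lcs2_def)
 interpret P: lcs "pow_tvs Y :: ('k, 'i \<Rightarrow> 'y) tvs" by (rule lcs_pow) fact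
 interpret S: lcs ?S by (rule lcs_subspace[OF P.lcs_axioms V])
 interpret XS: lcs2 X ?S using assms by (simp add: lcs2_def S.lcs_axioms)
 note sub = P.vs.subspace_0[OF V] P.vs.subspace_diff[OF V] P.vs.subspace_scale[OF V]
 define D where "D m x v = (\<lambda>i. iterD X Y (\<lambda>x. f x i) m x v)" for m x v
 have Dpts: "D m x v i \<in> pts Y" if "x \<in> U" "\<And>j. v j \<in> pts X" for m x v i
  unfolding D_def by (rule XY.iter_pts[OF fi that(1)]) (rule that(2))
 have DV: "D m x v \<in> V" if "x \<in> U" "\<And>j. v j \<in> pts X" for m x v
  using that
 proof (induction m arbitrary: x)
  case 0 then show ?case using f by (simp add: D_def)
 next
  case (Suc m)
  let ?q = "\<lambda>t. smul (pow_tvs Y) (inverse t) (D m (x + smul X t (v m)) v - D m x v)"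
  have "eventually (\<lambda>t. ?q t \<in> V) (at 0)"
   using XY.E.eventually_line[OF U Suc.prems(1) Suc.prems(2)[of m]]
   by eventually_elim (intro sub Suc.IH Suc.prems)
  moreover have "tlim Y (\<lambda>t. ?q t i) (D (Suc m) x v i) (at 0)" for i
  proof -
   have "has_dir_deriv X Y (\<lambda>z. iterD X Y (\<lambda>x. f x i) m z v) x (v m) (D (Suc m) x v i)"
    unfolding D_def by (rule XY.smooth_on_deriv[OF fi Suc.prems(1)]) (rule Suc.prems(2))
   then show ?thesis unfolding D_def has_dir_deriv_def by simp
  qed
  ultimately show ?case by (rule closed)
 qed
 let ?H = "{\<lambda>x v. D m x (\<lambda>j. v (\<sigma> j)) | m \<sigma>. True} :: ('x \<Rightarrow> (nat \<Rightarrow> 'x) \<Rightarrow> ('i \<Rightarrow> 'y)) set"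
 show ?thesis
 proof (rule XS.smooth_on_family[OF U])
  show "(\<lambda>x v. f x) \<in> ?H" by (auto simp: D_def intro!: exI[of _ 0])
  show "deriv_family X ?S U ?H"
   unfolding deriv_family_def
  proof (intro conjI ballI allI)
   fix h assume "h \<in> ?H"
   then obtain m \<sigma> where h: "h = (\<lambda>x v. D m x (\<lambda>j. v (\<sigma> j)))" by blast
   show "continuous_map (prod_topology (subtopology (topol X) U) (product_topology (\<lambda>_. topol X) UNIV))
     (topol ?S) (\<lambda>(x, v). h x v)"
   proof (rule XS.continuous_map_dirs)
    fix z assume z: "z \<in> topspace (prod_topology (subtopology (topol X) U) (product_topology (\<lambda>_. topol X) (UNIV::nat set)))"
    let ?G = "atin (prod_topology (subtopology (topol X) U) (product_topology (\<lambda>_. topol X) UNIV)) z"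
    note L = limitin_atin_dom[OF z]
    have ev: "eventually (\<lambda>q. fst q \<in> U \<and> (\<forall>j. snd q j \<in> pts X)) ?G"
     using limitin_in_topspace[OF limitin_atin_id[OF z]]
     by eventually_elim (simp add: mem_Times_iff PiE_iff)
    have "tlim Y (\<lambda>q. h (fst q) (snd q) i) (h (fst z) (snd z) i) ?G" for i
     unfolding h D_def by (rule XY.iter_lim[OF fi L(1,2)]) (rule L(4), simp)
    moreover have "eventually (\<lambda>q. h (fst q) (snd q) \<in> V \<and> (\<forall>i. h (fst q) (snd q) i \<in> pts Y)) ?G"
     using ev unfolding h by eventually_elim (simp add: DV Dpts)
    moreover have "h (fst z) (snd z) \<in> V" unfolding h using L(2,7) by (simp add: DV)
    ultimately show "tlim ?S (\<lambda>q. h (fst q) (snd q)) (h (fst z) (snd z)) ?G"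
     by (simp add: limitin_subtopology limitin_componentwise PiE_iff eventually_conj_iff)
   qed
   fix k
   let ?s = "\<sigma>(m := k)"
   show "\<exists>h'\<in>?H. \<forall>x\<in>U. \<forall>v. range v \<subseteq> pts X \<longrightarrow> has_dir_deriv X ?S (\<lambda>z. h z v) x (v k) (h' x v)"
   proof (rule bexI[of _ "\<lambda>x v. D (Suc m) x (\<lambda>j. v (?s j))"], intro ballI allI impI)
    fix x and v :: "nat \<Rightarrow> 'x" assume x: "x \<in> U" and v: "range v \<subseteq> pts X"
    have e: "D m z (\<lambda>j. v (?s j)) = D m z (\<lambda>j. v (\<sigma> j))" for z
     unfolding D_def by (rule ext, rule iter_dir_deriv_cong_dirs) simp
    have vk: "v j \<in> pts X" for j using v by auto
    let ?q = "\<lambda>t. smul ?S (inverse t) (h (x + smul X t (v k)) v - h x v)"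
    have "tlim Y (\<lambda>t. ?q t i) (D (Suc m) x (\<lambda>j. v (?s j)) i) (at 0)" for i
    proof -
     have "has_dir_deriv X Y (\<lambda>z. iterD X Y (\<lambda>x. f x i) m z (\<lambda>j. v (?s j))) x (v (?s m)) (D (Suc m) x (\<lambda>j. v (?s j)) i)"
      unfolding D_def by (rule XY.smooth_on_deriv[OF fi x]) (rule vk)
     then have "has_dir_deriv X Y (\<lambda>z. D m z (\<lambda>j. v (?s j)) i) x (v k) (D (Suc m) x (\<lambda>j. v (?s j)) i)"
      unfolding D_def by simp
     then show ?thesis unfolding h e has_dir_deriv_def by simp
    qed
    moreover have "eventually (\<lambda>t. ?q t \<in> V \<and> (\<forall>i. ?q t i \<in> pts Y)) (at 0)"
     using XY.E.eventually_line[OF U x vk[of k]]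
    proof eventually_elim
     case (elim t)
     then have "h (x + smul X t (v k)) v \<in> V" "h x v \<in> V" "\<And>i. h (x + smul X t (v k)) v i \<in> pts Y" "\<And>i. h x v i \<in> pts Y"
      unfolding h using x vk by (auto intro: DV Dpts)
     moreover from this have "smul (pow_tvs Y) (inverse t) (h (x + smul X t (v k)) v - h x v) \<in> V"
      by (intro sub)
     ultimately show ?case by simp
    qed
    moreover have "D (Suc m) x (\<lambda>j. v (?s j)) \<in> V" using x vk by (intro DV) auto
    ultimately show "has_dir_deriv X ?S (\<lambda>z. h z v) x (v k) (D (Suc m) x (\<lambda>j. v (?s j)))"
     unfolding has_dir_deriv_def
     by (simp add: limitin_subtopology limitin_componentwise PiE_iff eventually_conj_iff)
   qed blast
  qed
 qed auto
qed

section \<open>Analytic maps\<close>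

lemma smooth_on_continuous:
 assumes "lcs E" "lcs F" and f: "smooth_on E F U f"
 shows "continuous_map (subtopology (topol E) U) (topol F) f"
proof -
 interpret lcs2 E F using assms by (simp add: lcs2_def)
 show ?thesis
  unfolding continuous_map_atin
 proof
  fix x assume "x \<in> topspace (subtopology (topol E) U)"
  from limitin_atin_id[OF this] have "tlim E (\<lambda>y. y) x (atin (subtopology (topol E) U) x)" "x \<in> U"
   by (auto simp: limitin_subtopology)
  then show "tlim F f (f x) (atin (subtopology (topol E) U) x)" by (rule smooth_on_lim[OF f])
 qed
qed

lemma smooth_on_preimage_open:
 assumes "lcs E" "lcs F" and f: "smooth_on E F U f" and V: "topen F V"
 shows "topen E {x \<in> U. f x \<in> V}"
proof -
 have U: "topen E U" using f by (simp add: Cr_on_def)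
 have "openin (subtopology (topol E) U) {x \<in> topspace (subtopology (topol E) U). f x \<in> V}"
  by (rule openin_continuous_map_preimage[OF smooth_on_continuous V]) fact+
 moreover have "{x \<in> topspace (subtopology (topol E) U). f x \<in> V} = {x \<in> U. f x \<in> V}"
  using openin_subset[OF U] by auto
 ultimately show ?thesis using openin_trans_full U by metis
qed

lemma smooth_on_pair:
 fixes X :: "('k::real_normed_field, 'x::ab_group_add) tvs" and Y :: "('k, 'y::ab_group_add) tvs"
  and Z :: "('k, 'z::ab_group_add) tvs"
 assumes "lcs X" "lcs Y" "lcs Z" and f: "smooth_on X Y U f" and g: "smooth_on X Z U g"
 shows "smooth_on X (prod_tvs Y Z) U (\<lambda>x. (f x, g x))"
proof -
 interpret XY: lcs2 X Y using assms by (simp add: lcs2_def)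
 interpret XZ: lcs2 X Z using assms by (simp add: lcs2_def)
 let ?P = "prod_tvs Y Z"
 have P: "lcs ?P" by (rule lcs_prod) fact+
 interpret XP: lcs2 X ?P using assms P by (simp add: lcs2_def)
 interpret YP: lcs2 Y ?P using assms P by (simp add: lcs2_def)
 interpret ZP: lcs2 Z ?P using assms P by (simp add: lcs2_def)
 have 1: "cont_linear Y ?P (\<lambda>y. (y, 0))"
  by (rule cont_linearI) (auto intro!: limitin_Pair limitin_atin_id)
 have 2: "cont_linear Z ?P (\<lambda>z. (0, z))"
  by (rule cont_linearI) (auto intro!: limitin_Pair limitin_atin_id)
 have "smooth_on X ?P U (\<lambda>x. (f x, 0))"
  by (rule smooth_on_compose[OF assms(1,2) P f YP.smooth_on_linear[OF 1]]) (use XY.smooth_on_image[OF f] in auto)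
 moreover have "smooth_on X ?P U (\<lambda>x. (0, g x))"
  by (rule smooth_on_compose[OF assms(1,3) P g ZP.smooth_on_linear[OF 2]]) (use XZ.smooth_on_image[OF g] in auto)
 ultimately show ?thesis using XP.smooth_on_add by fastforce
qed

text \<open>The complexification of a product is the product of the complexifications only up to
  interchanging the middle entries; this interchange is continuous and complex linear.\<close>

lemma smooth_on_cx_pair:
 fixes X :: "(complex, 'x::ab_group_add) tvs" and Y :: "('k::real_normed_field, 'y::ab_group_add) tvs"
  and Z :: "('k, 'z::ab_group_add) tvs"
 assumes "lcs X" "lcs Y" "lcs Z" and f: "smooth_on X (cx Y) U f" and g: "smooth_on X (cx Z) U g"
 shows "smooth_on X (cx (prod_tvs Y Z)) U (\<lambda>x. ((fst (f x), fst (g x)), (snd (f x), snd (g x))))"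
proof -
 interpret Y: lcs Y by fact
 interpret Z: lcs Z by fact
 let ?P = "prod_tvs (cx Y) (cx Z)" and ?Q = "cx (prod_tvs Y Z)"
 have P: "lcs ?P" "lcs ?Q" by (intro lcs_prod lcs_cx assms)+
 interpret PQ: lcs2 ?P ?Q using P by (simp add: lcs2_def)
 interpret XP: lcs2 X ?P using P assms by (simp add: lcs2_def)
 let ?r = "\<lambda>p. ((fst (fst p), fst (snd p)), (snd (fst p), snd (snd p)))"
 have "cont_linear ?P ?Q ?r"
 proof (rule cont_linearI)
  fix x assume "x \<in> pts ?P"
  from limitin_atin_id[OF this] show "tlim ?Q ?r (?r x) (atin (topol ?P) x)"
   by (simp add: limitin_prod_iff)
 qed (auto simp: smul_cx)
 from PQ.smooth_on_linear[OF this] have r: "smooth_on ?P ?Q (pts ?P) ?r" .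
 have fg: "smooth_on X ?P U (\<lambda>x. (f x, g x))"
  by (intro smooth_on_pair assms lcs_cx)
 have "smooth_on X ?Q U (\<lambda>x. ?r (f x, g x))"
  by (rule smooth_on_compose[OF assms(1) P fg r]) (use XP.smooth_on_image[OF fg] in blast)
 then show ?thesis by simp
qed

lemma cont_linear_cx:
 assumes "lcs E" "lcs F" and L: "cont_linear E F L"
 shows "cont_linear (cx E) (cx F) (\<lambda>p. (L (fst p), L (snd p)))"
proof -
 interpret lcs2 E F using assms by (simp add: lcs2_def)
 have diff: "L (x - y) = L x - L y" if "x \<in> pts E" "y \<in> pts E" for x y
 proof -
  have "L ((x - y) + y) = L (x - y) + L y"
   using L E.diff_pts[OF that] that(2) unfolding cont_linear_def by blast
  then show ?thesis by simp
 qed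
 show ?thesis
 proof (rule cont_linearI)
  fix x assume "x \<in> pts (cx E)"
  from limitin_atin_id[OF this] have
   "tlim E fst (fst x) (atin (topol (cx E)) x)" "tlim E snd (snd x) (atin (topol (cx E)) x)"
   by (auto simp: limitin_prod_iff)
  from this[THEN cont_linear_lim[OF L]]
  show "tlim (cx F) (\<lambda>p. (L (fst p), L (snd p))) (L (fst x), L (snd x)) (atin (topol (cx E)) x)"
   by (simp add: limitin_prod_iff)
 next
  fix x y assume "x \<in> pts (cx E)" "y \<in> pts (cx E)"
  then show "(L (fst (x + y)), L (snd (x + y))) = (L (fst x), L (snd x)) + (L (fst y), L (snd y))"
   using L unfolding cont_linear_def by auto
 next
  fix c x assume "x \<in> pts (cx E)"
  then have x: "fst x \<in> pts E" "snd x \<in> pts E" by auto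
  have "L (smul E a (fst x)) = smul F a (L (fst x))" "L (smul E a (snd x)) = smul F a (L (snd x))" for a
   using L x unfolding cont_linear_def by auto
  moreover have "L (smul E a (fst x) + smul E b (snd x)) = L (smul E a (fst x)) + L (smul E b (snd x))"
   "L (smul E a (snd x) + smul E b (fst x)) = L (smul E a (snd x)) + L (smul E b (fst x))" for a b
   using L x E.smul_pts unfolding cont_linear_def by blast+
  ultimately show "(L (fst (smul (cx E) c x)), L (snd (smul (cx E) c x))) = smul (cx F) c (L (fst x), L (snd x))"
   using x by (simp add: smul_cx case_prod_beta' diff)
 qed
qed

text \<open>The complex bilinear extension, modelled on
  \<open>(x + iy)(u + iv) = (xu - yv) + i(xv + yu)\<close>.\<close>

lemma cont_bilinear_cx:
 assumes "lcs E" "lcs F" "lcs G" and b: "cont_bilinear E F G b"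
 shows "cont_bilinear (cx E) (cx F) (cx G)
   (\<lambda>p q. (b (fst p) (fst q) - b (snd p) (snd q), b (fst p) (snd q) + b (snd p) (fst q)))"
proof -
 interpret E: lcs E by fact
 interpret F: lcs F by fact
 interpret G: lcs G by fact
 have add1: "b (x + x') y = b x y + b x' y" if "x \<in> pts E" "x' \<in> pts E" "y \<in> pts F" for x x' y
  using b that unfolding cont_bilinear_def by blast
 have add2: "b x (y + y') = b x y + b x y'" if "x \<in> pts E" "y' \<in> pts F" "y \<in> pts F" for x y y'
  using b that unfolding cont_bilinear_def by blast
 have sc1: "b (smul E c x) y = smul G c (b x y)" if "x \<in> pts E" "y \<in> pts F" for x y c
  using b that unfolding cont_bilinear_def by blast
 have sc2: "b x (smul F c y) = smul G c (b x y)" if "x \<in> pts E" "y \<in> pts F" for x y c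
  using b that unfolding cont_bilinear_def by blast
 have d1: "b (x - x') y = b x y - b x' y" if "x \<in> pts E" "x' \<in> pts E" "y \<in> pts F" for x x' y
  using add1[of "x - x'" x' y] that by simp
 have d2: "b x (y - y') = b x y - b x y'" if "x \<in> pts E" "y' \<in> pts F" "y \<in> pts F" for x y y'
  using add2[of x y' "y - y'"] that by simp
 show ?thesis
 proof (rule cont_bilinearI)
  fix p :: "('b \<times> 'b) \<times> ('c \<times> 'c)"
  let ?H = "atin (prod_topology (topol (cx E)) (topol (cx F))) p"
  assume "fst p \<in> pts (cx E)" "snd p \<in> pts (cx F)"
  from atin_prod_limits[OF this] have
   "tlim E (\<lambda>q. fst (fst q)) (fst (fst p)) ?H" "tlim E (\<lambda>q. snd (fst q)) (snd (fst p)) ?H"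
   "tlim F (\<lambda>q. fst (snd q)) (fst (snd p)) ?H" "tlim F (\<lambda>q. snd (snd q)) (snd (snd p)) ?H"
   by (auto simp: limitin_prod_iff)
  then show "tlim (cx G)
     (\<lambda>q. (b (fst (fst q)) (fst (snd q)) - b (snd (fst q)) (snd (snd q)), b (fst (fst q)) (snd (snd q)) + b (snd (fst q)) (fst (snd q))))
     (b (fst (fst p)) (fst (snd p)) - b (snd (fst p)) (snd (snd p)), b (fst (fst p)) (snd (snd p)) + b (snd (fst p)) (fst (snd p))) ?H"
   unfolding tvs_simps(7)
   by (intro limitin_Pair G.lim_diff G.lim_add cont_bilinear_lim[OF b]) auto
 qed (auto simp: smul_cx add1 add2 sc1 sc2 d1 d2 algebra_simps G.vs.scale_right_distrib G.vs.scale_right_diff_distrib)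
qed

text \<open>The global form of \<open>K_analytic_on\<close>: in the real case the extension lives on
  the whole complexification. Extensions of infinitely many components then share one domain,
  whereas an infinite intersection of open domains need not be open.\<close>

definition K_entire ::
 "('k::real_or_complex_field, 'e::ab_group_add) tvs \<Rightarrow> ('k, 'f::ab_group_add) tvs \<Rightarrow> ('e \<Rightarrow> 'f) \<Rightarrow> bool" where
 "K_entire E F f \<longleftrightarrow>
   (if \<exists>i::'k. i * i = - 1 then smooth_on E F (pts E) f
   else \<exists>g. (\<forall>x\<in>pts E. g (x, 0) = (f x, 0)) \<and> smooth_on (cx E) (cx F) (pts (cx E)) g)"

lemma K_entire_imp_analytic:
 assumes "lcs E" "K_entire E F f" shows "K_analytic_on E F (pts E) f"
proof -
 interpret lcs E by fact
 show ?thesis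
  using assms(2) unfolding K_entire_def K_analytic_on_def
  by (auto split: if_splits intro!: exI[of _ "pts E \<times> pts E"])
qed

lemma K_analytic_on_open: "K_analytic_on E F U f \<Longrightarrow> topen E U"
 unfolding K_analytic_on_def Cr_on_def by (auto split: if_splits)

lemma K_analytic_on_subset:
 assumes "K_analytic_on E F U f" "topen E V" "V \<subseteq> U" shows "K_analytic_on E F V f"
 using assms unfolding K_analytic_on_def
 by (auto split: if_splits intro: smooth_on_subset) blast

lemma K_analytic_on_cong:
 assumes "lcs E" "lcs F" "K_analytic_on E F U f" "\<And>x. x \<in> U \<Longrightarrow> f x = g x"
 shows "K_analytic_on E F U g"
proof -
 interpret lcs2 E F using assms by (simp add: lcs2_def)
 show ?thesis
  using assms(3,4) smooth_on_cong unfolding K_analytic_on_def by (auto split: if_splits)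
qed

lemma K_analytic_on_compose:
 fixes E :: "('k::real_or_complex_field, 'e::ab_group_add) tvs" and F :: "('k, 'f::ab_group_add) tvs"
  and G :: "('k, 'g::ab_group_add) tvs"
 assumes "lcs E" "lcs F" "lcs G"
  and f: "K_analytic_on E F U f" and g: "K_analytic_on F G V g" and fU: "f ` U \<subseteq> V"
 shows "K_analytic_on E G U (\<lambda>x. g (f x))"
proof (cases "\<exists>i::'k. i * i = - 1")
 case True
 then show ?thesis using assms smooth_on_compose[OF assms(1-3)] by (simp add: K_analytic_on_def)
next
 case False
 obtain A f' where A: "\<forall>x\<in>U. (x, 0) \<in> A \<and> f' (x, 0) = (f x, 0)" "smooth_on (cx E) (cx F) A f'"
  using f False unfolding K_analytic_on_def by auto
 obtain B g' where B: "\<forall>x\<in>V. (x, 0) \<in> B \<and> g' (x, 0) = (g x, 0)" "smooth_on (cx F) (cx G) B g'"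
  using g False unfolding K_analytic_on_def by auto
 have cxs: "lcs (cx E)" "lcs (cx F)" "lcs (cx G)" using assms lcs_cx by blast+
 have "topen (cx F) B" using B(2) by (simp add: Cr_on_def)
 \<comment> \<open>The extension of \<open>f\<close> may leave the domain of the extension of
   \<open>g\<close>; the preimage of that domain is open and contains the real points in
   question.\<close>
 then have op: "topen (cx E) {x \<in> A. f' x \<in> B}" by (rule smooth_on_preimage_open[OF cxs(1,2) A(2)])
 have "smooth_on (cx E) (cx G) {x \<in> A. f' x \<in> B} (\<lambda>x. g' (f' x))"
  by (rule smooth_on_compose[OF cxs smooth_on_subset[OF A(2) op] B(2)]) auto
 then show ?thesis
  unfolding K_analytic_on_def using False A(1) B(1) fU K_analytic_on_open[OF f]
  by (auto intro!: exI[of _ "{x \<in> A. f' x \<in> B}"] exI[of _ "\<lambda>x. g' (f' x)"])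
qed

lemma K_analytic_on_pair:
 fixes X :: "('k::real_or_complex_field, 'x::ab_group_add) tvs" and Y :: "('k, 'y::ab_group_add) tvs"
  and Z :: "('k, 'z::ab_group_add) tvs"
 assumes "lcs X" "lcs Y" "lcs Z" and f: "K_analytic_on X Y U f" and g: "K_analytic_on X Z U g"
 shows "K_analytic_on X (prod_tvs Y Z) U (\<lambda>x. (f x, g x))"
proof (cases "\<exists>i::'k. i * i = - 1")
 case True
 then show ?thesis using assms smooth_on_pair[OF assms(1-3)] by (simp add: K_analytic_on_def)
next
 case False
 obtain A f' where A: "\<forall>x\<in>U. (x, 0) \<in> A \<and> f' (x, 0) = (f x, 0)" "smooth_on (cx X) (cx Y) A f'"
  using f False unfolding K_analytic_on_def by auto
 obtain B g' where B: "\<forall>x\<in>U. (x, 0) \<in> B \<and> g' (x, 0) = (g x, 0)" "smooth_on (cx X) (cx Z) B g'"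
  using g False unfolding K_analytic_on_def by auto
 have "topen (cx X) A" "topen (cx X) B" using A(2) B(2) by (simp_all add: Cr_on_def)
 then have op: "topen (cx X) (A \<inter> B)" by blast
 have "smooth_on (cx X) (cx (prod_tvs Y Z)) (A \<inter> B) (\<lambda>x. ((fst (f' x), fst (g' x)), (snd (f' x), snd (g' x))))"
  by (intro smooth_on_cx_pair lcs_cx assms smooth_on_subset[OF A(2) op] smooth_on_subset[OF B(2) op]) auto
 then show ?thesis
  unfolding K_analytic_on_def using False A(1) B(1) K_analytic_on_open[OF f]
  by (auto intro!: exI[of _ "A \<inter> B"] exI[of _ "(\<lambda>x. ((fst (f' x), fst (g' x)), (snd (f' x), snd (g' x))))"] simp: zero_prod_def)
qed

lemma K_entire_compose:
 fixes E :: "('k::real_or_complex_field, 'e::ab_group_add) tvs" and F :: "('k, 'f::ab_group_add) tvs"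
  and G :: "('k, 'g::ab_group_add) tvs"
 assumes "lcs E" "lcs F" "lcs G" and f: "K_entire E F f" and g: "K_entire F G g"
 shows "K_entire E G (\<lambda>x. g (f x))"
proof (cases "\<exists>i::'k. i * i = - 1")
 case True
 interpret lcs2 E F using assms by (simp add: lcs2_def)
 have f: "smooth_on E F (pts E) f" using f True by (simp add: K_entire_def)
 have "f ` pts E \<subseteq> pts F" using smooth_on_image[OF f] by blast
 then show ?thesis using g f True smooth_on_compose[OF assms(1-3) f] by (simp add: K_entire_def)
next
 case False
 obtain f' where A: "\<forall>x\<in>pts E. f' (x, 0) = (f x, 0)" "smooth_on (cx E) (cx F) (pts (cx E)) f'"
  using f False unfolding K_entire_def by auto
 obtain g' where B: "\<forall>x\<in>pts F. g' (x, 0) = (g x, 0)" "smooth_on (cx F) (cx G) (pts (cx F)) g'"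
  using g False unfolding K_entire_def by auto
 have cxs: "lcs (cx E)" "lcs (cx F)" "lcs (cx G)" using assms lcs_cx by blast+
 interpret cE: lcs2 "cx E" "cx F" using cxs by (simp add: lcs2_def)
 interpret E: lcs E by fact
 note im = cE.smooth_on_image[OF A(2)]
 have fp: "f x \<in> pts F" if "x \<in> pts E" for x using im[of "(x, 0)"] A(1) that by auto
 have "smooth_on (cx E) (cx G) (pts (cx E)) (\<lambda>x. g' (f' x))"
  by (rule smooth_on_compose[OF cxs A(2) B(2)]) (use im in blast)
 then show ?thesis
  unfolding K_entire_def using False A(1) B(1) fp by (auto intro!: exI[of _ "\<lambda>x. g' (f' x)"])
qed

lemma K_entire_linear:
 fixes E :: "('k::real_or_complex_field, 'e::ab_group_add) tvs" and F :: "('k, 'f::ab_group_add) tvs"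
 assumes "lcs E" "lcs F" and L: "cont_linear E F L"
 shows "K_entire E F L"
proof -
 interpret lcs2 E F using assms by (simp add: lcs2_def)
 interpret c: lcs2 "cx E" "cx F" using assms by (simp add: lcs2_def lcs_cx)
 have "L (0 + 0) = L 0 + L 0" using L E.zero_pts unfolding cont_linear_def by blast
 then have "L 0 = 0" by simp
 then show ?thesis
  unfolding K_entire_def using smooth_on_linear[OF L] c.smooth_on_linear[OF cont_linear_cx[OF assms]]
  by (auto intro!: exI[of _ "\<lambda>p. (L (fst p), L (snd p))"])
qed

lemma K_entire_pair:
 fixes X :: "('k::real_or_complex_field, 'x::ab_group_add) tvs" and Y :: "('k, 'y::ab_group_add) tvs"
  and Z :: "('k, 'z::ab_group_add) tvs"
 assumes "lcs X" "lcs Y" "lcs Z" and f: "K_entire X Y f" and g: "K_entire X Z g"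
 shows "K_entire X (prod_tvs Y Z) (\<lambda>x. (f x, g x))"
proof (cases "\<exists>i::'k. i * i = - 1")
 case True
 then show ?thesis using assms smooth_on_pair[OF assms(1-3)] by (simp add: K_entire_def)
next
 case False
 obtain f' where A: "\<forall>x\<in>pts X. f' (x, 0) = (f x, 0)" "smooth_on (cx X) (cx Y) (pts (cx X)) f'"
  using f False unfolding K_entire_def by auto
 obtain g' where B: "\<forall>x\<in>pts X. g' (x, 0) = (g x, 0)" "smooth_on (cx X) (cx Z) (pts (cx X)) g'"
  using g False unfolding K_entire_def by auto
 have "smooth_on (cx X) (cx (prod_tvs Y Z)) (pts (cx X)) (\<lambda>x. ((fst (f' x), fst (g' x)), (snd (f' x), snd (g' x))))"
  by (intro smooth_on_cx_pair lcs_cx assms A(2) B(2))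
 then show ?thesis
  unfolding K_entire_def using False A(1) B(1)
  by (auto intro!: exI[of _ "(\<lambda>x. ((fst (f' x), fst (g' x)), (snd (f' x), snd (g' x))))"] simp: zero_prod_def)
qed

lemma K_entire_bilinear:
 fixes E :: "('k::real_or_complex_field, 'e::ab_group_add) tvs" and F :: "('k, 'f::ab_group_add) tvs"
  and G :: "('k, 'g::ab_group_add) tvs"
 assumes "lcs E" "lcs F" "lcs G" and b: "cont_bilinear E F G b"
 shows "K_entire (prod_tvs E F) G (\<lambda>p. b (fst p) (snd p))"
proof (cases "\<exists>i::'k. i * i = - 1")
 case True
 then show ?thesis using smooth_on_bilinear[OF assms] by (simp add: K_entire_def)
next
 case False
 interpret E: lcs E by fact
 interpret F: lcs F by fact
 interpret G: lcs G by fact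
 let ?P = "prod_tvs (cx E) (cx F)" and ?Q = "cx (prod_tvs E F)"
 have P: "lcs ?Q" "lcs ?P" "lcs (cx G)" by (intro lcs_prod lcs_cx assms)+
 interpret QP: lcs2 ?Q ?P using P by (simp add: lcs2_def)
 let ?r = "\<lambda>p. ((fst (fst p), fst (snd p)), (snd (fst p), snd (snd p)))"
 let ?b = "\<lambda>p q. (b (fst p) (fst q) - b (snd p) (snd q), b (fst p) (snd q) + b (snd p) (fst q))"
 have "cont_linear ?Q ?P ?r"
 proof (rule cont_linearI)
  fix x assume "x \<in> pts ?Q"
  from limitin_atin_id[OF this] show "tlim ?P ?r (?r x) (atin (topol ?Q) x)"
   by (simp add: limitin_prod_iff)
 qed (auto simp: smul_cx)
 from QP.smooth_on_linear[OF this] have r: "smooth_on ?Q ?P (pts ?Q) ?r" .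
 have "smooth_on ?P (cx G) (pts ?P) (\<lambda>x. ?b (fst x) (snd x))"
  by (rule smooth_on_bilinear[OF _ _ _ cont_bilinear_cx[OF assms]]) (intro lcs_cx assms)+
 from smooth_on_compose[OF P r this]
 have s: "smooth_on ?Q (cx G) (pts ?Q) (\<lambda>x. ?b (fst (?r x)) (snd (?r x)))"
  using QP.smooth_on_image[OF r] by blast
 have z: "b 0 y = 0" "b x 0 = 0" if "x \<in> pts E" "y \<in> pts F" for x y
  using cont_bilinear_zero[OF assms that] by auto
 then show ?thesis
  unfolding K_entire_def using False s
  by (auto intro!: exI[of _ "\<lambda>x. ?b (fst (?r x)) (snd (?r x))"] simp: zero_prod_def)
qed

lemma K_entire_const:
 fixes E :: "('k::real_or_complex_field, 'e::ab_group_add) tvs" and F :: "('k, 'f::ab_group_add) tvs"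
 assumes "lcs E" "lcs F" "c \<in> pts F"
 shows "K_entire E F (\<lambda>x. c)"
proof -
 interpret lcs2 E F using assms by (simp add: lcs2_def)
 interpret c: lcs2 "cx E" "cx F" using assms by (simp add: lcs2_def lcs_cx)
 have "smooth_on E F (pts E) (\<lambda>x. c)" using assms(3) by (intro smooth_on_const openin_topspace)
 moreover have "smooth_on (cx E) (cx F) (pts (cx E)) (\<lambda>x. (c, 0))"
  using assms(3) by (intro c.smooth_on_const openin_topspace) auto
 ultimately show ?thesis
  unfolding K_entire_def by (auto intro!: exI[of _ "\<lambda>x. (c, 0)"])
qed

lemma K_entire_add:
 fixes E :: "('k::real_or_complex_field, 'e::ab_group_add) tvs" and F :: "('k, 'f::ab_group_add) tvs"
 assumes "lcs E" "lcs F" "K_entire E F f" "K_entire E F g"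
 shows "K_entire E F (\<lambda>x. f x + g x)"
proof (cases "\<exists>i::'k. i * i = - 1")
 case True
 interpret lcs2 E F using assms by (simp add: lcs2_def)
 show ?thesis using assms(3,4) True smooth_on_add by (simp add: K_entire_def)
next
 case False
 interpret c: lcs2 "cx E" "cx F" using assms by (simp add: lcs2_def lcs_cx)
 obtain f' where A: "\<forall>x\<in>pts E. f' (x, 0) = (f x, 0)" "smooth_on (cx E) (cx F) (pts (cx E)) f'"
  using assms(3) False unfolding K_entire_def by auto
 obtain g' where B: "\<forall>x\<in>pts E. g' (x, 0) = (g x, 0)" "smooth_on (cx E) (cx F) (pts (cx E)) g'"
  using assms(4) False unfolding K_entire_def by auto
 show ?thesis
  unfolding K_entire_def using False A(1) B(1) c.smooth_on_add[OF A(2) B(2)]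
  by (auto intro!: exI[of _ "\<lambda>x. f' x + g' x"])
qed

lemma K_entire_sum:
 assumes "lcs E" "lcs F" "\<And>i. i \<in> I \<Longrightarrow> K_entire E F (f i)"
 shows "K_entire E F (\<lambda>x. \<Sum>i\<in>I. f i x)"
proof -
 interpret F: lcs F by fact
 show ?thesis
  using assms(3)
  by (induction I rule: infinite_finite_induct)
   (auto intro!: K_entire_add K_entire_const assms(1,2))
qed

lemma K_entire_bilinear_compose:
 assumes "lcs X" "lcs E" "lcs F" "lcs G" "cont_bilinear E F G b" "K_entire X E f" "K_entire X F g"
 shows "K_entire X G (\<lambda>x. b (f x) (g x))"
 using K_entire_compose[OF assms(1) lcs_prod[OF assms(2,3)] assms(4)
   K_entire_pair[OF assms(1-3,6,7)] K_entire_bilinear[OF assms(2-5)]] by simp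

lemma K_entire_linear_compose:
 assumes "lcs X" "lcs E" "lcs F" "cont_linear E F L" "K_entire X E f"
 shows "K_entire X F (\<lambda>x. L (f x))"
 by (rule K_entire_compose[OF assms(1-3,5) K_entire_linear[OF assms(2-4)]])

lemma not_imaginary_imp_real:
 assumes "\<nexists>i::'k::real_or_complex_field. i * i = - 1"
 shows "\<exists>a. (x::'k) = of_real a"
 using assms real_or_complex[where 'a = 'k] by (auto simp: of_real_def)

text \<open>In the real case the derivatives of the complex extension at real points and in real
  directions, reduced to their first components, form a closed family that starts with
  \<open>f\<close>.\<close>

lemma K_analytic_on_imp_smooth:
 fixes E :: "('k::real_or_complex_field, 'e::ab_group_add) tvs" and F :: "('k, 'f::ab_group_add) tvs"
 assumes "lcs E" "lcs F" and f: "K_analytic_on E F U f"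
 shows "smooth_on E F U f"
proof (cases "\<exists>i::'k. i * i = - 1")
 case True
 then show ?thesis using f by (simp add: K_analytic_on_def)
next
 case False
 interpret lcs2 E F using assms by (simp add: lcs2_def)
 interpret c: lcs2 "cx E" "cx F" using assms by (simp add: lcs2_def lcs_cx)
 obtain A g where A: "\<And>x. x \<in> U \<Longrightarrow> (x, 0) \<in> A" "\<And>x. x \<in> U \<Longrightarrow> g (x, 0) = (f x, 0)"
  and g: "smooth_on (cx E) (cx F) A g"
  using f False unfolding K_analytic_on_def by auto
 \<comment> \<open>Without an imaginary unit every scalar is a real multiple of 1;
   \<open>\<rho>\<close> reads off the real number.\<close>
 obtain \<rho> :: "'k \<Rightarrow> real" where \<rho>: "\<And>x. x = of_real (\<rho> x)" using not_imaginary_imp_real[OF False] by metis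
 have \<rho>0: "\<rho> t = 0 \<longleftrightarrow> t = 0" for t using \<rho>[of t] by (metis of_real_eq_0_iff)
 have \<rho>inv: "of_real (inverse (\<rho> t)) = inverse t" for t using \<rho>[of t] by (metis of_real_inverse)
 have "norm (\<rho> t) = norm t" for t using \<rho>[of t] by (metis norm_of_real real_norm_def)
 then have "(\<lambda>t. norm (\<rho> t)) = norm" by (rule ext)
 then have "(\<rho> \<longlongrightarrow> 0) (at 0)"
  using tendsto_norm_zero_iff[of \<rho> "at 0"] tendsto_norm_zero[OF tendsto_ident_at[of "0::'k" UNIV]] by (metis (no_types, lifting))
 \<comment> \<open>This restricts the complex difference quotients to parameters from the ground
   field.\<close>
 then have lim\<rho>: "filterlim (\<lambda>t. complex_of_real (\<rho> t)) (at 0) (at 0)"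
  unfolding filterlim_at using eventually_at_neq[of "0::'k"]
  by (auto intro!: tendsto_eq_intros simp: \<rho>0 elim: eventually_mono)
 let ?D = "\<lambda>m \<sigma> x v. fst (iterD (cx E) (cx F) g m (x, 0) (\<lambda>j. (v (\<sigma> j), 0)))"
 let ?H = "{?D m \<sigma> | m \<sigma>. True} :: ('e \<Rightarrow> (nat \<Rightarrow> 'e) \<Rightarrow> 'f) set"
 have U: "topen E U" using K_analytic_on_open[OF f] .
 show ?thesis
 proof (rule smooth_on_family[OF U])
  show "?D 0 id \<in> ?H" by blast
  show "?D 0 id x v = f x" if "x \<in> U" for x and v using A(2)[OF that] by simp
  show "deriv_family E F U ?H"
   unfolding deriv_family_def
  proof (intro conjI ballI allI)
   fix h assume "h \<in> ?H"
   then obtain m \<sigma> where h: "h = ?D m \<sigma>" by blast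
   show "continuous_map (prod_topology (subtopology (topol E) U) (product_topology (\<lambda>_. topol E) UNIV))
     (topol F) (\<lambda>(x, v). h x v)"
   proof (rule continuous_map_dirs)
    fix z assume z: "z \<in> topspace (prod_topology (subtopology (topol E) U) (product_topology (\<lambda>_. topol E) (UNIV::nat set)))"
    let ?G = "atin (prod_topology (subtopology (topol E) U) (product_topology (\<lambda>_. topol E) UNIV)) z"
    note L = limitin_atin_dom[OF z]
    have "tlim (cx F) (\<lambda>q. iterD (cx E) (cx F) g m (fst q, 0) (\<lambda>j. (snd q (\<sigma> j), 0)))
     (iterD (cx E) (cx F) g m (fst z, 0) (\<lambda>j. (snd z (\<sigma> j), 0))) ?G"
     by (rule c.iter_lim[OF g]) (use L(1,4) A(1)[OF L(2)] in "auto intro!: limitin_Pair")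
    then show "tlim F (\<lambda>q. h (fst q) (snd q)) (h (fst z) (snd z)) ?G"
     unfolding h by (simp add: limitin_prod_iff)
   qed
   fix k
   let ?s = "\<sigma>(m := k)"
   show "\<exists>h'\<in>?H. \<forall>x\<in>U. \<forall>v. range v \<subseteq> pts E \<longrightarrow> has_dir_deriv E F (\<lambda>z. h z v) x (v k) (h' x v)"
   proof (rule bexI[of _ "?D (Suc m) ?s"], intro ballI allI impI)
    fix x and v :: "nat \<Rightarrow> 'e" assume x: "x \<in> U" and v: "range v \<subseteq> pts E"
    let ?w = "\<lambda>j. (v (?s j), 0)"
    have "has_dir_deriv (cx E) (cx F) (\<lambda>z. iterD (cx E) (cx F) g m z ?w) (x, 0) (?w m)
      (iterD (cx E) (cx F) g (Suc m) (x, 0) ?w)"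
     by (rule c.smooth_on_deriv[OF g A(1)[OF x]]) (use v in auto)
    moreover have "iterD (cx E) (cx F) g m z ?w = iterD (cx E) (cx F) g m z (\<lambda>j. (v (\<sigma> j), 0))" for z
     by (rule iter_dir_deriv_cong_dirs) simp
    ultimately have "tlim (cx F) (\<lambda>t. smul (cx F) (inverse t) (iterD (cx E) (cx F) g m ((x, 0) + smul (cx E) t (v k, 0)) (\<lambda>j. (v (\<sigma> j), 0))
      - iterD (cx E) (cx F) g m (x, 0) (\<lambda>j. (v (\<sigma> j), 0)))) (iterD (cx E) (cx F) g (Suc m) (x, 0) ?w) (at 0)"
     unfolding has_dir_deriv_def by simp
    from limitin_filterlim_compose[OF this lim\<rho>]
    have "tlim F (\<lambda>t. fst (smul (cx F) (inverse (complex_of_real (\<rho> t))) (iterD (cx E) (cx F) g m ((x, 0) + smul (cx E) (complex_of_real (\<rho> t)) (v k, 0)) (\<lambda>j. (v (\<sigma> j), 0))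
      - iterD (cx E) (cx F) g m (x, 0) (\<lambda>j. (v (\<sigma> j), 0))))) (?D (Suc m) ?s x v) (at 0)"
     unfolding tvs_simps(7) by (rule limitin_fst)
    moreover have "(x, 0) + smul (cx E) (complex_of_real (\<rho> t)) (v k, 0) = (x + smul E t (v k), 0)" for t
     by (simp add: smul_cx flip: \<rho>)
    moreover have "fst (smul (cx F) (inverse (complex_of_real (\<rho> t))) y) = smul F (inverse t) (fst y)" for t y
     by (simp add: smul_cx case_prod_beta' \<rho>inv flip: of_real_inverse)
    ultimately show "has_dir_deriv E F (\<lambda>z. h z v) x (v k) (?D (Suc m) ?s x v)"
     unfolding has_dir_deriv_def h by simp
   qed blast
  qed
 qed
qed

section \<open>Convolution on graded connected Hopf algebras\<close>

text \<open>The bare equations of \<open>Vector_Spaces.linear\<close>, without its vector space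
  premises.\<close>

definition lin :: "('k::field \<Rightarrow> 'a::ab_group_add \<Rightarrow> 'a) \<Rightarrow> ('k \<Rightarrow> 'v::ab_group_add \<Rightarrow> 'v) \<Rightarrow> ('a \<Rightarrow> 'v) \<Rightarrow> bool" where
 "lin s V f \<longleftrightarrow> (\<forall>x y. f (x + y) = f x + f y) \<and> (\<forall>c x. f (s c x) = V c (f x))"

definition bilin :: "('k::field \<Rightarrow> 'a::ab_group_add \<Rightarrow> 'a) \<Rightarrow> ('k \<Rightarrow> 'v::ab_group_add \<Rightarrow> 'v) \<Rightarrow> ('a \<Rightarrow> 'a \<Rightarrow> 'v) \<Rightarrow> bool" where
 "bilin s V f \<longleftrightarrow> (\<forall>b. lin s V (\<lambda>a. f a b)) \<and> (\<forall>a. lin s V (f a))"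

lemma linear_eq_lin: "vector_space s \<Longrightarrow> vector_space V \<Longrightarrow> Vector_Spaces.linear s V f \<longleftrightarrow> lin s V f"
 by (auto simp: Vector_Spaces.linear_iff lin_def)

lemma lin_zero: "lin s V f \<Longrightarrow> f 0 = 0"
 unfolding lin_def by (metis add_cancel_right_right)

lemma lin_minus: "lin s V f \<Longrightarrow> f (- x) = - f x"
 using lin_zero[of s V f] unfolding lin_def by (metis add.right_inverse add_eq_0_iff)

lemma lin_diff: "lin s V f \<Longrightarrow> f (x - y) = f x - f y"
 using lin_minus[of s V f y] unfolding lin_def by (metis add_uminus_conv_diff)

lemma lin_sum: "lin s V f \<Longrightarrow> f (\<Sum>i\<in>I. g i) = (\<Sum>i\<in>I. f (g i))"
 by (induction I rule: infinite_finite_induct) (auto simp: lin_zero, auto simp: lin_def)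

lemma bilinI: "(\<And>b. lin s V (\<lambda>a. f a b)) \<Longrightarrow> (\<And>a. lin s V (\<lambda>b. f a b)) \<Longrightarrow> bilin s V f"
 by (simp add: bilin_def)

lemma lookup_free_smul: "Poly_Mapping.lookup (free_smul c u) x = c * Poly_Mapping.lookup u x"
 unfolding free_smul_def by (simp add: Poly_Mapping.map.rep_eq when_def)

lemma vector_space_free: "vector_space free_smul"
 by unfold_locales (auto intro!: poly_mapping_eqI simp: lookup_free_smul lookup_add algebra_simps)

interpretation fvs: vector_space free_smul by (rule vector_space_free)

section \<open>Linear extension from free vector spaces and the tensor relations\<close>

context vector_space
begin

lemma lin_ext_superset:
 assumes "finite K" "Poly_Mapping.keys u \<subseteq> K"
 shows "lin_ext scale f u = (\<Sum>x\<in>K. scale (Poly_Mapping.lookup u x) (f x))"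
 unfolding lin_ext_def by (rule sum.mono_neutral_left) (use assms in "auto simp: in_keys_iff")

lemma lin_lin_ext:
 fixes f :: "'x \<Rightarrow> 'b"
 shows "lin free_smul scale (lin_ext scale f)"
 unfolding lin_def
proof (intro conjI allI)
 fix u v :: "'x \<Rightarrow>\<^sub>0 'a" and c
 let ?K = "Poly_Mapping.keys u \<union> Poly_Mapping.keys v"
 have "lin_ext scale f (u + v) = (\<Sum>x\<in>?K. scale (Poly_Mapping.lookup (u + v) x) (f x))"
  by (rule lin_ext_superset) (use keys_add[of u v] in auto)
 also have "\<dots> = lin_ext scale f u + lin_ext scale f v"
  by (simp add: lin_ext_superset[of ?K] lookup_add scale_left_distrib sum.distrib)
 finally show "lin_ext scale f (u + v) = lin_ext scale f u + lin_ext scale f v" .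
 have "lin_ext scale f (free_smul c u) = (\<Sum>x\<in>Poly_Mapping.keys u. scale (Poly_Mapping.lookup (free_smul c u) x) (f x))"
  by (rule lin_ext_superset) (auto simp: in_keys_iff lookup_free_smul)
 then show "lin_ext scale f (free_smul c u) = scale c (lin_ext scale f u)"
  by (simp add: lookup_free_smul lin_ext_def scale_sum_right)
qed

lemma lin_ext_gen: "lin_ext scale f (gen x) = f x"
 unfolding lin_ext_def by simp

lemma lin_ext_commute:
 assumes "lin s scale g" shows "g (lin_ext s f u) = lin_ext scale (\<lambda>x. g (f x)) u"
 unfolding lin_ext_def lin_sum[OF assms] using assms by (simp add: lin_def)

lemma lin_ext_span_zero:
 assumes "u \<in> fvs.span R" "\<And>r. r \<in> R \<Longrightarrow> lin_ext scale f r = 0"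
 shows "lin_ext scale f u = 0"
 using assms(1)
proof (induction rule: fvs.span_induct_alt)
 case base then show ?case using lin_zero[OF lin_lin_ext] .
next
 case (step c x y)
 have "lin_ext scale f (free_smul c x + y) = scale c (lin_ext scale f x) + lin_ext scale f y"
  using lin_lin_ext unfolding lin_def by metis
 then show ?case using step assms(2) by simp
qed

text \<open>The universal property of the tensor product: the linear extension of a bilinear map
  kills the spanning relations, so its values on representatives depend only on the tensor.\<close>

lemma lin_ext_tensor2:
 assumes f: "bilin s scale f" and uv: "tensor2_eq s u v"
 shows "lin_ext scale (\<lambda>(a, b). f a b) u = lin_ext scale (\<lambda>(a, b). f a b) v"
proof -
 have "lin_ext scale (\<lambda>(a, b). f a b) (u - v) = 0"
  by (rule lin_ext_span_zero[OF uv[unfolded tensor2_eq_def]])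
   (use f in "auto simp: lin_diff[OF lin_lin_ext] lin_ext_gen bilin_def lin_def lin_lin_ext[unfolded lin_def]")
 then show ?thesis by (simp add: lin_diff[OF lin_lin_ext])
qed

lemma lin_ext_tensor3:
 assumes f: "\<And>b d. lin s scale (\<lambda>a. f a b d)" "\<And>a d. lin s scale (\<lambda>b. f a b d)" "\<And>a b. lin s scale (\<lambda>d. f a b d)"
  and uv: "tensor3_eq s u v"
 shows "lin_ext scale (\<lambda>(a, b, d). f a b d) u = lin_ext scale (\<lambda>(a, b, d). f a b d) v"
proof -
 have "lin_ext scale (\<lambda>(a, b, d). f a b d) (u - v) = 0"
  by (rule lin_ext_span_zero[OF uv[unfolded tensor3_eq_def]])
   (use f in "auto simp: lin_diff[OF lin_lin_ext] lin_ext_gen lin_def lin_lin_ext[unfolded lin_def]")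
 then show ?thesis by (simp add: lin_diff[OF lin_lin_ext])
qed

lemma lin_add_fun: "lin s scale f \<Longrightarrow> lin s scale g \<Longrightarrow> lin s scale (\<lambda>x. f x + g x)"
 by (auto simp: lin_def scale_right_distrib)

lemma lin_diff_fun: "lin s scale f \<Longrightarrow> lin s scale g \<Longrightarrow> lin s scale (\<lambda>x. f x - g x)"
 by (auto simp: lin_def scale_right_diff_distrib)

lemma lin_zero_fun: "lin s scale (\<lambda>x. 0)"
 by (auto simp: lin_def)

lemma lin_scale_fun: "lin s scale f \<Longrightarrow> lin s scale (\<lambda>x. scale c (f x))"
 by (auto simp: lin_def scale_right_distrib mult.commute)

end

lemma lin_compose: "lin s t f \<Longrightarrow> lin t V g \<Longrightarrow> lin s V (\<lambda>x. g (f x))"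
 by (simp add: lin_def)

section \<open>Sweedler sums\<close>

context hopf_algebra
begin

sublocale vs: vector_space s using algebra by (simp add: unital_algebra_def)

text \<open>Sweedler notation: the sum of \<open>f\<close> over the two legs of the coproduct of
  \<open>x\<close>. For bilinear \<open>f\<close> it does not depend on the representative chosen by
  \<open>\<Delta>\<close>.\<close>

definition sw :: "('k \<Rightarrow> 'v::ab_group_add \<Rightarrow> 'v) \<Rightarrow> 'h \<Rightarrow> ('h \<Rightarrow> 'h \<Rightarrow> 'v) \<Rightarrow> 'v" where
 "sw V x f = lin_ext V (\<lambda>(a, b). f a b) (\<Delta> x)"

lemma lin_mult_H: "lin s s (\<lambda>x. x * y)" "lin s s (\<lambda>x. y * x)"
 using algebra by (auto simp: lin_def unital_algebra_def algebra_simps)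

lemma lin_counit: "lin s (*) \<epsilon>"
 using counit_linear by (auto simp: lin_def Vector_Spaces.linear_iff)

lemma lin_antipode: "lin s s S"
 using antipode_linear by (auto simp: lin_def Vector_Spaces.linear_iff)

lemma sw_lin_arg:
 assumes "vector_space V" "bilin s V f" shows "lin s V (\<lambda>x. sw V x f)"
proof -
 interpret V: vector_space V by fact
 show ?thesis
  unfolding lin_def sw_def
  using V.lin_ext_tensor2[OF assms(2) comult_add] V.lin_ext_tensor2[OF assms(2) comult_scale]
   V.lin_lin_ext[of "\<lambda>(a, b). f a b"]
  by (simp add: lin_def)
qed

lemma sw_commute:
 assumes "vector_space V" "lin W V g" shows "g (sw W x f) = sw V x (\<lambda>a b. g (f a b))"
proof -
 interpret V: vector_space V by fact
 show ?thesis unfolding sw_def V.lin_ext_commute[OF assms(2)] by (simp add: case_prod_beta')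
qed

lemma sw_add: "vector_space V \<Longrightarrow> sw V x (\<lambda>a b. f a b + g a b) = sw V x f + sw V x g"
 unfolding sw_def lin_ext_def
 by (simp add: case_prod_beta' sum.distrib vector_space.vector_space_assms(1))

lemma sw_zero: "vector_space V \<Longrightarrow> sw V x (\<lambda>a b. 0) = 0"
 using sw_add[of V x "\<lambda>a b. 0" "\<lambda>a b. 0"] by simp

lemma sw_scale: "vector_space V \<Longrightarrow> sw V x (\<lambda>a b. V c (f a b)) = V c (sw V x f)"
 using sw_commute[of V V "V c" x f] vector_space.lin_scale_fun[of V V "\<lambda>x. x" c] by (simp add: lin_def)

lemma sw_diff:
 assumes "vector_space V" shows "sw V x (\<lambda>a b. f a b - g a b) = sw V x f - sw V x g"
 using sw_add[OF assms, of x "\<lambda>a b. f a b - g a b" g] by simp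

lemma sw_lin_param:
 assumes "vector_space V" "\<And>a b. lin t V (\<lambda>z. f z a b)" shows "lin t V (\<lambda>z. sw V x (f z))"
proof -
 have "f (u + v) = (\<lambda>a b. f u a b + f v a b)" "f (t c u) = (\<lambda>a b. V c (f u a b))" for u v c
  using assms(2) by (auto simp: lin_def fun_eq_iff)
 then show ?thesis unfolding lin_def by (simp add: sw_add[OF assms(1)] sw_scale[OF assms(1)])
qed

lemma sw_swap:
 assumes "vector_space V"
 shows "sw V x (\<lambda>a b. sw V y (\<lambda>c d. f a b c d)) = sw V y (\<lambda>c d. sw V x (\<lambda>a b. f a b c d))"
proof -
 interpret V: vector_space V by fact
 show ?thesis
  unfolding sw_def lin_ext_def
  by (simp add: case_prod_beta' V.scale_sum_right mult.commute sum.swap[of _ "Poly_Mapping.keys (\<Delta> y)"])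
qed

lemma sw_counit_left:
 assumes "vector_space V" "lin s V g" shows "sw V x (\<lambda>a b. V (\<epsilon> a) (g b)) = g x"
proof -
 have "g (sw s x (\<lambda>a b. s (\<epsilon> a) b)) = sw V x (\<lambda>a b. g (s (\<epsilon> a) b))" by (rule sw_commute[OF assms])
 then show ?thesis using counit_left[of x] assms(2) by (simp add: sw_def lin_def)
qed

lemma sw_counit_right:
 assumes "vector_space V" "lin s V g" shows "sw V x (\<lambda>a b. V (\<epsilon> b) (g a)) = g x"
proof -
 have "g (sw s x (\<lambda>a b. s (\<epsilon> b) a)) = sw V x (\<lambda>a b. g (s (\<epsilon> b) a))" by (rule sw_commute[OF assms])
 then show ?thesis using counit_right[of x] assms(2) by (simp add: sw_def lin_def)
qed

lemma sw_coassoc: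
 assumes V: "vector_space V"
  and f: "\<And>b d. lin s V (\<lambda>a. f a b d)" "\<And>a d. lin s V (\<lambda>b. f a b d)" "\<And>a b. lin s V (\<lambda>d. f a b d)"
 shows "sw V x (\<lambda>a b. sw V a (\<lambda>p q. f p q b)) = sw V x (\<lambda>a b. sw V b (\<lambda>p q. f a p q))"
proof -
 interpret V: vector_space V by fact
 have "lin_ext V (\<lambda>(a, b, d). f a b d) (lin_ext free_smul (\<lambda>(a, b). lin_ext free_smul (\<lambda>(p, q). gen (p, q, b)) (\<Delta> a)) (\<Delta> x))
  = sw V x (\<lambda>a b. sw V a (\<lambda>p q. f p q b))"
  unfolding sw_def V.lin_ext_commute[OF V.lin_lin_ext]
  by (simp add: case_prod_beta' V.lin_ext_commute[OF V.lin_lin_ext] V.lin_ext_gen)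
 moreover have "lin_ext V (\<lambda>(a, b, d). f a b d) (lin_ext free_smul (\<lambda>(a, b). lin_ext free_smul (\<lambda>(p, q). gen (a, p, q)) (\<Delta> b)) (\<Delta> x))
  = sw V x (\<lambda>a b. sw V b (\<lambda>p q. f a p q))"
  unfolding sw_def V.lin_ext_commute[OF V.lin_lin_ext]
  by (simp add: case_prod_beta' V.lin_ext_commute[OF V.lin_lin_ext] V.lin_ext_gen)
 ultimately show ?thesis using V.lin_ext_tensor3[OF f coassoc[of x]] by simp
qed

lemma sw_mult:
 assumes V: "vector_space V" and f: "bilin s V f"
 shows "sw V (x * y) f = sw V x (\<lambda>a b. sw V y (\<lambda>c d. f (a * c) (b * d)))"
proof -
 interpret V: vector_space V by fact
 have "lin_ext V (\<lambda>(a, b). f a b) (lin_ext free_smul (\<lambda>(a, b). lin_ext free_smul (\<lambda>(c, d). gen (a * c, b * d)) (\<Delta> y)) (\<Delta> x))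
  = sw V x (\<lambda>a b. sw V y (\<lambda>c d. f (a * c) (b * d)))"
  unfolding sw_def V.lin_ext_commute[OF V.lin_lin_ext]
  by (simp add: case_prod_beta' V.lin_ext_commute[OF V.lin_lin_ext] V.lin_ext_gen)
 then show ?thesis using V.lin_ext_tensor2[OF f comult_mult[of x y]] by (simp add: sw_def)
qed

lemma sw_one:
 assumes V: "vector_space V" and f: "bilin s V f" shows "sw V 1 f = f 1 1"
proof -
 interpret V: vector_space V by fact
 show ?thesis using V.lin_ext_tensor2[OF f comult_one] by (simp add: sw_def V.lin_ext_gen)
qed

end

text \<open>Commutativity of the target is part of the sort. The locale serves twice, for the target
  algebra and for the algebra of curves in it.\<close>

locale hopf_target = hopf_algebra s \<Delta> \<epsilon> S
 for s :: "'k::field \<Rightarrow> 'h::{ring, monoid_mult} \<Rightarrow> 'h" and \<Delta> \<epsilon> S +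
 fixes V :: "'k \<Rightarrow> 'v::{comm_ring, comm_monoid_mult} \<Rightarrow> 'v"
 assumes V: "unital_algebra V"
begin

sublocale V: vector_space V using V by (simp add: unital_algebra_def)
lemmas Vv = V.vector_space_axioms

lemma V_mult: "V c x * y = V c (x * y)" "x * V c y = V c (x * y)"
 using V by (auto simp: unital_algebra_def)

lemma lin_mult: "lin t V \<phi> \<Longrightarrow> lin t V (\<lambda>x. \<phi> x * c)" "lin t V \<phi> \<Longrightarrow> lin t V (\<lambda>x. c * \<phi> x)"
 by (auto simp: lin_def V_mult algebra_simps)

lemma lin_mult_arg: "lin s V \<phi> \<Longrightarrow> lin s V (\<lambda>x. \<phi> (x * c))" "lin s V \<phi> \<Longrightarrow> lin s V (\<lambda>x. \<phi> (c * x))"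
 using lin_compose[OF lin_mult_H(1)] lin_compose[OF lin_mult_H(2)] by blast+

definition conv :: "('h \<Rightarrow> 'v) \<Rightarrow> ('h \<Rightarrow> 'v) \<Rightarrow> 'h \<Rightarrow> 'v" where
 "conv \<phi> \<psi> x = sw V x (\<lambda>a b. \<phi> a * \<psi> b)"

definition unit :: "'h \<Rightarrow> 'v" where "unit x = V (\<epsilon> x) 1"

lemma bilin_mult: "lin s V \<phi> \<Longrightarrow> lin s V \<psi> \<Longrightarrow> bilin s V (\<lambda>a b. \<phi> a * \<psi> b)"
 by (intro bilinI lin_mult)

lemma lin_conv: "lin s V \<phi> \<Longrightarrow> lin s V \<psi> \<Longrightarrow> lin s V (conv \<phi> \<psi>)"
 unfolding conv_def[abs_def] by (intro sw_lin_arg Vv bilin_mult)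

lemma lin_unit: "lin s V unit"
 using lin_counit by (auto simp: lin_def unit_def V.scale_left_distrib)

lemma conv_unit_left: "lin s V \<phi> \<Longrightarrow> conv unit \<phi> = \<phi>"
 unfolding conv_def[abs_def] unit_def using sw_counit_left[OF Vv] by (auto simp: V_mult)

lemma conv_unit_right: "lin s V \<phi> \<Longrightarrow> conv \<phi> unit = \<phi>"
 unfolding conv_def[abs_def] unit_def using sw_counit_right[OF Vv] by (auto simp: V_mult)

lemma sw_mult_left: "c * sw V x f = sw V x (\<lambda>a b. c * f a b)"
 by (rule sw_commute[OF Vv]) (auto simp: lin_def V_mult algebra_simps)

lemma sw_mult_right: "sw V x f * c = sw V x (\<lambda>a b. f a b * c)"
 by (rule sw_commute[OF Vv]) (auto simp: lin_def V_mult algebra_simps)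

lemma sw_mult_sw: "sw V x f * sw V y g = sw V x (\<lambda>a b. sw V y (\<lambda>c d. f a b * g c d))"
 by (simp only: sw_mult_right) (simp only: sw_mult_left)

lemma conv_assoc:
 assumes "lin s V \<phi>" "lin s V \<psi>" "lin s V \<xi>"
 shows "conv (conv \<phi> \<psi>) \<xi> = conv \<phi> (conv \<psi> \<xi>)"
proof
 fix x
 have "conv (conv \<phi> \<psi>) \<xi> x = sw V x (\<lambda>a b. sw V a (\<lambda>p q. \<phi> p * \<psi> q * \<xi> b))"
  unfolding conv_def by (simp only: sw_mult_right)
 also have "\<dots> = sw V x (\<lambda>a b. sw V b (\<lambda>p q. \<phi> a * \<psi> p * \<xi> q))"
  by (rule sw_coassoc[OF Vv]) (intro lin_mult assms)+
 also have "\<dots> = conv \<phi> (conv \<psi> \<xi>) x"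
  unfolding conv_def by (simp only: sw_mult_left mult.assoc)
 finally show "conv (conv \<phi> \<psi>) \<xi> x = conv \<phi> (conv \<psi> \<xi>) x" .
qed

lemma conv_add_left: "conv (\<lambda>a. \<phi> a + \<phi>' a) \<psi> x = conv \<phi> \<psi> x + conv \<phi>' \<psi> x"
 unfolding conv_def using sw_add[OF Vv] by (simp add: distrib_right)

lemma conv_diff_left: "conv (\<lambda>a. \<phi> a - \<phi>' a) \<psi> x = conv \<phi> \<psi> x - conv \<phi>' \<psi> x"
 unfolding conv_def using sw_diff[OF Vv] by (simp add: left_diff_distrib)

lemma conv_diff_right: "conv \<psi> (\<lambda>a. \<phi> a - \<phi>' a) x = conv \<psi> \<phi> x - conv \<psi> \<phi>' x"
 unfolding conv_def using sw_diff[OF Vv] by (simp add: right_diff_distrib)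

lemma conv_add_right: "conv \<psi> (\<lambda>a. \<phi> a + \<phi>' a) x = conv \<psi> \<phi> x + conv \<psi> \<phi>' x"
 unfolding conv_def using sw_add[OF Vv] by (simp add: distrib_left)

lemma conv_scale_right: "conv \<psi> (\<lambda>a. V c (\<phi> a)) x = V c (conv \<psi> \<phi> x)"
 unfolding conv_def using sw_scale[OF Vv] by (simp add: V_mult)

lemma conv_mult_const: "conv (\<lambda>a. \<phi> a * k) \<psi> x = conv \<phi> \<psi> x * k" "conv (\<lambda>a. k * \<phi> a) \<psi> x = k * conv \<phi> \<psi> x"
 unfolding conv_def sw_mult_right sw_mult_left by (simp_all add: mult_ac)

lemma conv_one: "lin s V \<phi> \<Longrightarrow> lin s V \<psi> \<Longrightarrow> conv \<phi> \<psi> 1 = \<phi> 1 * \<psi> 1"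
 unfolding conv_def using sw_one[OF Vv bilin_mult] by simp

lemma conv_mult:
 assumes "lin s V \<phi>" "lin s V \<psi>"
 shows "conv \<phi> \<psi> (x * y) = sw V x (\<lambda>a b. sw V y (\<lambda>c d. \<phi> (a * c) * \<psi> (b * d)))"
 unfolding conv_def using sw_mult[OF Vv bilin_mult[OF assms]] by simp

section \<open>Characters and infinitesimal characters\<close>

definition chr :: "('h \<Rightarrow> 'v) \<Rightarrow> bool" where
 "chr \<phi> \<longleftrightarrow> lin s V \<phi> \<and> \<phi> 1 = 1 \<and> (\<forall>a b. \<phi> (a * b) = \<phi> a * \<phi> b)"

definition infchr :: "('h \<Rightarrow> 'v) \<Rightarrow> bool" where
 "infchr \<phi> \<longleftrightarrow> lin s V \<phi> \<and> (\<forall>a b. \<phi> (a * b) = V (\<epsilon> a) (\<phi> b) + V (\<epsilon> b) (\<phi> a))"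

lemma infchr_one: "infchr \<phi> \<Longrightarrow> \<phi> 1 = 0"
proof -
 assume "infchr \<phi>"
 then have "\<phi> (1 * 1) = V (\<epsilon> 1) (\<phi> 1) + V (\<epsilon> 1) (\<phi> 1)" unfolding infchr_def by blast
 then show "\<phi> 1 = 0" by (simp add: counit_one)
qed

lemma chr_unit: "chr unit"
 unfolding chr_def using lin_unit by (auto simp: unit_def counit_one counit_mult V_mult)

lemma chr_conv:
 assumes "chr \<phi>" "chr \<psi>" shows "chr (conv \<phi> \<psi>)"
 unfolding chr_def
proof (intro conjI allI)
 have l: "lin s V \<phi>" "lin s V \<psi>" using assms by (auto simp: chr_def)
 show "lin s V (conv \<phi> \<psi>)" by (rule lin_conv[OF l])
 show "conv \<phi> \<psi> 1 = 1" using conv_one[OF l] assms by (simp add: chr_def)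
 fix x y
 \<comment> \<open>Commutativity of the target algebra makes the convolution of characters
   multiplicative.\<close>
 have "\<phi> (a * c) * \<psi> (b * d) = (\<phi> a * \<psi> b) * (\<phi> c * \<psi> d)" for a b c d
  using assms by (simp add: chr_def mult_ac)
 then show "conv \<phi> \<psi> (x * y) = conv \<phi> \<psi> x * conv \<phi> \<psi> y"
  unfolding conv_mult[OF l] unfolding conv_def sw_mult_sw by simp
qed

lemma antipode_one: "S 1 = 1"
proof -
 have "sw s 1 (\<lambda>a b. S a * b) = S 1 * 1"
  by (rule sw_one[OF vs.vector_space_axioms])
   (intro bilinI lin_mult_H lin_compose[OF lin_antipode lin_mult_H(1)])
 then show ?thesis using antipode_left[of 1] by (simp add: sw_def counit_one)
qed

lemma conv_antipode:
 assumes "chr \<phi>" shows "conv (\<lambda>x. \<phi> (S x)) \<phi> = unit" "conv \<phi> (\<lambda>x. \<phi> (S x)) = unit"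
proof -
 have l: "lin s V \<phi>" and m: "\<And>a b. \<phi> a * \<phi> b = \<phi> (a * b)" and 1: "\<phi> 1 = 1" using assms by (auto simp: chr_def)
 have "conv (\<lambda>x. \<phi> (S x)) \<phi> x = \<phi> (sw s x (\<lambda>a b. S a * b))" for x
  unfolding conv_def m sw_commute[OF Vv l] ..
 then show "conv (\<lambda>x. \<phi> (S x)) \<phi> = unit"
  using antipode_left l 1 by (auto simp: sw_def unit_def lin_def)
 have "conv \<phi> (\<lambda>x. \<phi> (S x)) x = \<phi> (sw s x (\<lambda>a b. a * S b))" for x
  unfolding conv_def m sw_commute[OF Vv l] ..
 then show "conv \<phi> (\<lambda>x. \<phi> (S x)) = unit"
  using antipode_right l 1 by (auto simp: sw_def unit_def lin_def)
qed

lemma lin_antipode_comp: "lin s V \<phi> \<Longrightarrow> lin s V (\<lambda>x. \<phi> (S x))"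
 by (rule lin_compose[OF lin_antipode])

text \<open>Convolving the defect D of multiplicativity of the inverse with the given character in each of
  the two arguments yields zero; as convolution with a character is injective, D vanishes.\<close>

lemma chr_antipode:
 assumes \<phi>: "chr \<phi>" shows "chr (\<lambda>x. \<phi> (S x))"
proof -
 define \<psi> where "\<psi> = (\<lambda>x. \<phi> (S x))"
 have l: "lin s V \<phi>" and m: "\<And>a b. \<phi> (a * b) = \<phi> a * \<phi> b" and "\<phi> 1 = 1" using \<phi> by (auto simp: chr_def)
 have l': "lin s V \<psi>" unfolding \<psi>_def by (rule lin_antipode_comp[OF l])
 have inv: "conv \<psi> \<phi> = unit" "conv \<phi> \<psi> = unit" unfolding \<psi>_def using conv_antipode[OF \<phi>] by auto
 define D where "D x y = \<psi> (x * y) - \<psi> x * \<psi> y" for x y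
 have lD: "lin s V (\<lambda>x. D x y)" "lin s V (D x)" for x y
  unfolding D_def by (intro V.lin_diff_fun lin_mult lin_mult_arg l')+
 have canc: "f = (\<lambda>x. 0)" if "lin s V f" "conv f \<phi> = (\<lambda>x. 0)" for f
 proof -
  have "f = conv (conv f \<phi>) \<psi>"
   using conv_assoc[OF that(1) l l'] inv(2) conv_unit_right[OF that(1)] by simp
  also have "\<dots> = (\<lambda>x. 0)" unfolding that(2) conv_def using sw_zero[OF Vv] by auto
  finally show ?thesis .
 qed
 have "conv (\<lambda>c. conv (\<lambda>a. D a c) \<phi> x) \<phi> y = 0" for x y
 proof -
  have "conv (\<lambda>c. conv (\<lambda>a. D a c) \<phi> x) \<phi> y =
   conv (\<lambda>c. conv (\<lambda>a. \<psi> (a * c)) \<phi> x) \<phi> y - conv (\<lambda>c. conv (\<lambda>a. \<psi> a * \<psi> c) \<phi> x) \<phi> y"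
   unfolding D_def conv_diff_left ..
  \<comment> \<open>As \<open>\<phi>\<close> is multiplicative, the two successive convolutions
    assemble to a single one at the product.\<close>
  also have "conv (\<lambda>c. conv (\<lambda>a. \<psi> (a * c)) \<phi> x) \<phi> y = conv \<psi> \<phi> (x * y)"
   unfolding conv_mult[OF l' l] unfolding conv_def sw_mult_right m mult.assoc
   by (rule sw_swap[OF Vv])
  also have "conv (\<lambda>c. conv (\<lambda>a. \<psi> a * \<psi> c) \<phi> x) \<phi> y = conv \<psi> \<phi> x * conv \<psi> \<phi> y"
   unfolding conv_mult_const ..
  finally show ?thesis using chr_unit by (simp add: inv chr_def)
 qed
 then have 1: "conv (\<lambda>c. conv (\<lambda>a. D a c) \<phi> x) \<phi> = (\<lambda>c. 0)" for x by (intro ext)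
 have 2: "lin s V (\<lambda>c. conv (\<lambda>a. D a c) \<phi> x)" for x
  unfolding conv_def by (intro sw_lin_param[OF Vv] lin_mult lD)
 have "conv (\<lambda>a. D a c) \<phi> x = 0" for c x
  using fun_cong[OF canc[OF 2 1]] .
 then have "conv (\<lambda>a. D a c) \<phi> = (\<lambda>x. 0)" for c by (intro ext)
 then have "(\<lambda>a. D a c) = (\<lambda>x. 0)" for c by (rule canc[OF lD(1)])
 from fun_cong[OF this] have "D a c = 0" for a c .
 then have "\<psi> (x * y) = \<psi> x * \<psi> y" for x y by (simp add: D_def)
 moreover have "\<psi> 1 = 1" unfolding \<psi>_def by (simp add: antipode_one \<open>\<phi> 1 = 1\<close>)
 ultimately show ?thesis using l' unfolding chr_def \<psi>_def by auto
qed

text \<open>When \<open>\<xi>\<close> is expanded on a product, each summand contains a counit,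
  which collapses one of the two Sweedler sums.\<close>

lemma conv_derivation:
 assumes \<phi>: "lin s V \<phi>" and \<xi>: "infchr \<xi>"
 shows "conv \<phi> \<xi> (x * y) = conv (\<lambda>c. \<phi> (x * c)) \<xi> y + conv (\<lambda>a. \<phi> (a * y)) \<xi> x"
proof -
 have l: "lin s V \<xi>" and d: "\<And>a b. \<xi> (a * b) = V (\<epsilon> a) (\<xi> b) + V (\<epsilon> b) (\<xi> a)" using \<xi> by (auto simp: infchr_def)
 have "conv \<phi> \<xi> (x * y) = sw V x (\<lambda>a b. sw V y (\<lambda>c e. V (\<epsilon> b) (\<phi> (a * c) * \<xi> e)))
   + sw V x (\<lambda>a b. sw V y (\<lambda>c e. V (\<epsilon> e) (\<phi> (a * c) * \<xi> b)))"
  unfolding conv_mult[OF \<phi> l] d distrib_left V_mult by (simp only: sw_add[OF Vv])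
 also have "sw V x (\<lambda>a b. sw V y (\<lambda>c e. V (\<epsilon> b) (\<phi> (a * c) * \<xi> e))) = conv (\<lambda>c. \<phi> (x * c)) \<xi> y"
  unfolding sw_swap[OF Vv, of x] conv_def
  by (subst sw_counit_right[OF Vv]) (intro lin_mult lin_mult_arg \<phi>, rule refl)
 also have "sw V x (\<lambda>a b. sw V y (\<lambda>c e. V (\<epsilon> e) (\<phi> (a * c) * \<xi> b))) = conv (\<lambda>a. \<phi> (a * y)) \<xi> x"
  unfolding conv_def
  by (subst sw_counit_right[OF Vv]) (intro lin_mult lin_mult_arg \<phi>, rule refl)
 finally show ?thesis .
qed

text \<open>How far \<open>conv \<phi> \<xi>\<close> is from a derivation along
  \<open>\<phi>\<close> is governed by the multiplicativity defect of \<open>\<phi>\<close>, again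
  convolved with \<open>\<xi>\<close>. Since \<open>\<xi>\<close> vanishes at 1, that defect will
  enter only in lower total degree.\<close>

lemma conv_defect:
 assumes \<phi>: "lin s V \<phi>" and \<xi>: "infchr \<xi>"
 shows "conv \<phi> \<xi> (x * y) - (conv \<phi> \<xi> x * \<phi> y + \<phi> x * conv \<phi> \<xi> y) =
  conv (\<lambda>c. \<phi> (x * c) - \<phi> x * \<phi> c) \<xi> y + conv (\<lambda>a. \<phi> (a * y) - \<phi> a * \<phi> y) \<xi> x"
 unfolding conv_derivation[OF assms] conv_diff_left conv_mult_const by simp

end

section \<open>Homogeneous components and fixed points by degree\<close>

context graded_connected_hopf_algebra
begin

definition dec :: "'h \<Rightarrow> nat \<Rightarrow> 'h" where
 "dec x = (THE f. (\<forall>n. f n \<in> gr n) \<and> finite {n. f n \<noteq> 0} \<and> x = (\<Sum>n | f n \<noteq> 0. f n))"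

lemma dec: "dec x n \<in> gr n" "finite {n. dec x n \<noteq> 0}" "x = (\<Sum>n | dec x n \<noteq> 0. dec x n)"
 using theI'[OF gr_direct_sum[of x]] unfolding dec_def by blast+

lemma dec_eqI:
 assumes "\<And>n. f n \<in> gr n" "finite K" "\<And>n. n \<notin> K \<Longrightarrow> f n = 0" "x = (\<Sum>n\<in>K. f n)"
 shows "dec x = f"
proof -
 have K: "{n. f n \<noteq> 0} \<subseteq> K" using assms(3) by blast
 have "x = (\<Sum>n | f n \<noteq> 0. f n)"
  unfolding assms(4) by (rule sum.mono_neutral_right) (use assms(2) K in auto)
 moreover have "finite {n. f n \<noteq> 0}" using K assms(2) finite_subset by blast
 ultimately show ?thesis
  unfolding dec_def using assms(1) by (intro the1_equality[OF gr_direct_sum]) auto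
qed

lemma dec_sum: "finite K \<Longrightarrow> {n. dec x n \<noteq> 0} \<subseteq> K \<Longrightarrow> (\<Sum>n\<in>K. dec x n) = x"
 by (subst (2) dec(3), rule sum.mono_neutral_right) auto

lemma gr_zero: "0 \<in> gr n" and gr_add: "x \<in> gr n \<Longrightarrow> y \<in> gr n \<Longrightarrow> x + y \<in> gr n"
 and gr_scale: "x \<in> gr n \<Longrightarrow> s c x \<in> gr n"
 using gr_subspace[of n] by (auto simp: vs.subspace_def)

lemma dec_gr: "x \<in> gr n \<Longrightarrow> dec x = (\<lambda>m. if m = n then x else 0)"
 by (rule dec_eqI[of _ "{n}"]) (auto simp: gr_zero)

lemma dec_add: "dec (x + y) = (\<lambda>n. dec x n + dec y n)"
proof (rule dec_eqI)
 let ?K = "{n. dec x n \<noteq> 0} \<union> {n. dec y n \<noteq> 0}"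
 show "finite ?K" using dec(2) by blast
 show "x + y = (\<Sum>n\<in>?K. dec x n + dec y n)"
  using dec_sum[of ?K x] dec_sum[of ?K y] dec(2) by (simp add: sum.distrib)
qed (auto intro: gr_add dec)

lemma dec_scale: "dec (s c x) = (\<lambda>n. s c (dec x n))"
proof (rule dec_eqI)
 show "finite {n. dec x n \<noteq> 0}" using dec(2) by blast
 show "s c x = (\<Sum>n | dec x n \<noteq> 0. s c (dec x n))"
  using dec(3)[of x] by (simp flip: vs.scale_sum_right)
qed (auto intro: gr_scale dec)

lemma lin_eq_gr:
 assumes "lin s V f" "lin s V g" "\<And>n x. x \<in> gr n \<Longrightarrow> f x = g x"
 shows "f x = g x"
proof -
 have "f (\<Sum>n | dec x n \<noteq> 0. dec x n) = g (\<Sum>n | dec x n \<noteq> 0. dec x n)"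
  unfolding lin_sum[OF assms(1)] lin_sum[OF assms(2)] using assms(3)[OF dec(1)] by simp
 then show ?thesis by (simp flip: dec(3))
qed

lemma bilin_eq_gr:
 assumes "bilin s V f" "bilin s V g" "\<And>n m x y. x \<in> gr n \<Longrightarrow> y \<in> gr m \<Longrightarrow> f x y = g x y"
 shows "f x y = g x y"
proof (rule lin_eq_gr[of V "\<lambda>x. f x y"])
 fix n x assume x: "x \<in> gr n"
 show "f x y = g x y"
  by (rule lin_eq_gr[of V "f x"]) (use assms x in "auto simp: bilin_def")
qed (use assms in "auto simp: bilin_def")

definition dil :: "(nat \<Rightarrow> 'k) \<Rightarrow> 'h \<Rightarrow> 'h" where
 "dil c x = (\<Sum>n | dec x n \<noteq> 0. s (c n) (dec x n))"

lemma dil_superset: "finite K \<Longrightarrow> {n. dec x n \<noteq> 0} \<subseteq> K \<Longrightarrow> dil c x = (\<Sum>n\<in>K. s (c n) (dec x n))"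
 unfolding dil_def by (rule sum.mono_neutral_left) auto

lemma lin_dil: "lin s s (dil c)"
 unfolding lin_def
proof (intro conjI allI)
 fix x y a
 let ?K = "{n. dec x n \<noteq> 0} \<union> {n. dec y n \<noteq> 0}"
 have f: "finite ?K" using dec(2) by blast
 have "dil c (x + y) = (\<Sum>n\<in>?K. s (c n) (dec (x + y) n))"
  by (rule dil_superset[OF f]) (auto simp: dec_add)
 then show "dil c (x + y) = dil c x + dil c y"
  using dil_superset[OF f, of x] dil_superset[OF f, of y] by (simp add: dec_add vs.scale_right_distrib sum.distrib)
 have "dil c (s a x) = (\<Sum>n\<in>?K. s (c n) (dec (s a x) n))"
  by (rule dil_superset[OF f]) (auto simp: dec_scale)
 then show "dil c (s a x) = s a (dil c x)"
  using dil_superset[OF f, of x] by (simp add: dec_scale vs.scale_sum_right mult.commute)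
qed

lemma dil_gr: "x \<in> gr n \<Longrightarrow> dil c x = s (c n) x"
 by (cases "x = 0") (auto simp: dil_def dec_gr vs.scale_sum_right)

lemma dil_in_gr: "x \<in> gr n \<Longrightarrow> dil c x \<in> gr n"
 by (simp add: dil_gr gr_scale)

text \<open>A one-dimensional space containing 1 is spanned by 1, and the counit reads off the
  coefficient.\<close>

lemma gr_0:
 assumes "x \<in> gr 0" shows "x = s (\<epsilon> x) 1"
proof -
 obtain B where B: "B \<subseteq> gr 0" "vs.independent B" "gr 0 \<subseteq> vs.span B" "card B = 1"
  using vs.basis_exists[of "gr 0"] gr_connected by metis
 then obtain b where "B = {b}" using card_1_singletonE by blast
 then have "1 \<in> vs.span {b}" "x \<in> vs.span {b}" using B gr_one assms by auto
 then have "1 \<in> range (\<lambda>k. s k b)" "x \<in> range (\<lambda>k. s k b)" by (simp_all add: vs.span_singleton)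
 then obtain k l where k: "1 = s k b" and l: "x = s l b" by (elim rangeE)
 have \<epsilon>s: "\<epsilon> (s c y) = c * \<epsilon> y" for c y using lin_counit by (simp add: lin_def)
 have "k * \<epsilon> b = 1" using k \<epsilon>s counit_one by metis
 then have k0: "k \<noteq> 0" "\<epsilon> b = inverse k" by (auto simp: inverse_unique)
 have "s (inverse k) (s k b) = b" using k0 by simp
 then have "b = s (inverse k) 1" using k by metis
 then have "x = s (l * inverse k) 1" using l by simp
 then show ?thesis using \<epsilon>s[of "l * inverse k" 1] counit_one by simp
qed

text \<open>A bilinear map may be evaluated on any representative of the coproduct; the homogeneous
  one from \<open>gr_comult\<close> involves only pairs of complementary degrees.\<close>

lemma sw_graded_zero:
 assumes V: "vector_space V" and f: "bilin s V f" and x: "x \<in> gr n"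
  and z: "\<And>i j a b. i + j = n \<Longrightarrow> a \<in> gr i \<Longrightarrow> b \<in> gr j \<Longrightarrow> f a b = 0"
 shows "sw V x f = 0"
proof -
 interpret V: vector_space V by fact
 obtain u where u: "tensor2_eq s (\<Delta> x) u" "Poly_Mapping.keys u \<subseteq> (\<Union>(i, j)\<in>{(i, j). i + j = n}. gr i \<times> gr j)"
  using gr_comult[OF x] by blast
 have "sw V x f = lin_ext V (\<lambda>(a, b). f a b) u"
  unfolding sw_def by (rule V.lin_ext_tensor2[OF f u(1)])
 also have "\<dots> = 0"
  unfolding lin_ext_def by (rule sum.neutral) (use u(2) z in fastforce)
 finally show ?thesis .
qed

definition vanish :: "('h \<Rightarrow> 'v::zero) \<Rightarrow> nat \<Rightarrow> bool" where
 "vanish \<phi> n \<longleftrightarrow> (\<forall>m<n. \<forall>x\<in>gr m. \<phi> x = 0)"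

text \<open>One more than the top degree of \<open>x\<close>, and 0 for \<open>x = 0\<close>: the
  number of iterations after which a fixed point is determined at \<open>x\<close>.\<close>

definition bound :: "'h \<Rightarrow> nat" where
 "bound x = (LEAST N. \<forall>m\<ge>N. dec x m = 0)"

lemma bound: "bound x \<le> m \<Longrightarrow> dec x m = 0"
proof -
 obtain k where k: "{n. dec x n \<noteq> 0} \<subseteq> {..k}" using finite_nat_iff_bounded_le dec(2) by blast
 have "\<forall>m\<ge>Suc k. dec x m = 0" using k by fastforce
 from LeastI[of "\<lambda>N. \<forall>m\<ge>N. dec x m = 0", OF this] show "bound x \<le> m \<Longrightarrow> dec x m = 0"
  unfolding bound_def by blast
qed

lemma bound_gr: "x \<in> gr n \<Longrightarrow> bound x \<le> Suc n"
 unfolding bound_def by (rule Least_le) (auto simp: dec_gr)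

lemma vanish_eval:
 assumes "lin s V \<phi>" "vanish \<phi> n" "bound x \<le> n" shows "\<phi> x = 0"
proof -
 have "\<phi> (dec x m) = 0" if "dec x m \<noteq> 0" for m
  using assms(2,3) bound[of x m] that dec(1)[of x m] unfolding vanish_def by (meson leI order_trans)
 then have "\<phi> (\<Sum>m | dec x m \<noteq> 0. dec x m) = 0"
  unfolding lin_sum[OF assms(1)] by (intro sum.neutral) auto
 then show ?thesis by (simp flip: dec(3))
qed

text \<open>Operators that gain one degree have unique fixed points, obtained by iteration from zero.\<close>

definition trifix :: "(('h \<Rightarrow> 'v::zero) \<Rightarrow> 'h \<Rightarrow> 'v) \<Rightarrow> 'h \<Rightarrow> 'v" where
 "trifix T x = (T ^^ bound x) (\<lambda>_. 0) x"

text \<open>The subspace \<open>A\<close> restricts the values. For curve-valued maps it is the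
  space of curves that are known to have primitives.\<close>

context
 fixes V :: "'k \<Rightarrow> 'v::ab_group_add \<Rightarrow> 'v" and A :: "'v set" and T
 assumes V: "vector_space V" and A: "module.subspace V A"
  and T: "\<And>\<phi>. lin s V \<phi> \<Longrightarrow> range \<phi> \<subseteq> A \<Longrightarrow> lin s V (T \<phi>) \<and> range (T \<phi>) \<subseteq> A"
  and contr: "\<And>\<phi> \<psi> n. lin s V \<phi> \<Longrightarrow> range \<phi> \<subseteq> A \<Longrightarrow> lin s V \<psi> \<Longrightarrow> range \<psi> \<subseteq> A \<Longrightarrow>
   vanish (\<lambda>x. \<phi> x - \<psi> x) n \<Longrightarrow> vanish (\<lambda>x. T \<phi> x - T \<psi> x) (Suc n)"
begin

interpretation V: vector_space V by (rule V)

lemma trifix_iter: "lin s V ((T ^^ j) (\<lambda>_. 0))" "range ((T ^^ j) (\<lambda>_. 0)) \<subseteq> A"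
proof (induction j)
 case 0
 show "lin s V ((T ^^ 0) (\<lambda>_. 0))" "range ((T ^^ 0) (\<lambda>_. 0)) \<subseteq> A"
  using V.subspace_0[OF A] V.lin_zero_fun[of s] by auto
next
 case (Suc j)
 then show "lin s V ((T ^^ Suc j) (\<lambda>_. 0))" "range ((T ^^ Suc j) (\<lambda>_. 0)) \<subseteq> A" using T by auto
qed

text \<open>Every application of \<open>T\<close> gains a degree, so after \<open>j\<close> steps
  the degrees below \<open>j\<close> are final.\<close>

lemma trifix_iter_diff: "vanish (\<lambda>x. (T ^^ (j + k)) (\<lambda>_. 0) x - (T ^^ j) (\<lambda>_. 0) x) j"
proof (induction j)
 case (Suc j)
 from contr[OF trifix_iter trifix_iter Suc] show ?case by simp
qed (simp add: vanish_def)

lemma trifix_eq_iter: "bound x \<le> j \<Longrightarrow> (T ^^ j) (\<lambda>_. 0) x = trifix T x"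
proof -
 assume "bound x \<le> j"
 then obtain k where j: "j = bound x + k" using le_Suc_ex by blast
 show ?thesis
  using vanish_eval[OF V.lin_diff_fun[OF trifix_iter(1) trifix_iter(1)] trifix_iter_diff order_refl, of x k]
  by (simp add: j trifix_def)
qed

lemma lin_trifix: "lin s V (trifix T)"
 unfolding lin_def
proof (intro conjI allI)
 fix x y c
 define N where "N = max (max (bound x) (bound y)) (max (bound (x + y)) (bound (s c x)))"
 have N: "bound x \<le> N" "bound y \<le> N" "bound (x + y) \<le> N" "bound (s c x) \<le> N" by (auto simp: N_def)
 show "trifix T (x + y) = trifix T x + trifix T y" "trifix T (s c x) = V c (trifix T x)"
  using trifix_iter(1)[of N] N[THEN trifix_eq_iter, symmetric] by (simp_all add: lin_def)
qed

lemma trifix_range: "range (trifix T) \<subseteq> A"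
 using trifix_iter(2) by (auto simp: trifix_def)

lemma trifix_fixed: "T (trifix T) = trifix T"
proof
 fix x
 \<comment> \<open>In the degrees that matter at \<open>x\<close>, the fixed point coincides with
   the iterate of the one length \<open>bound x\<close>, to which \<open>contr\<close>
   applies.\<close>
 have "vanish (\<lambda>z. trifix T z - (T ^^ bound x) (\<lambda>_. 0) z) (bound x)"
  unfolding vanish_def
 proof (intro allI ballI impI)
  fix m z assume "m < bound x" "z \<in> gr m"
  then have "bound z \<le> bound x" using bound_gr[of z m] by simp
  then show "trifix T z - (T ^^ bound x) (\<lambda>_. 0) z = 0" using trifix_eq_iter by simp
 qed
 from contr[OF lin_trifix trifix_range trifix_iter this]
 have v: "vanish (\<lambda>z. T (trifix T) z - (T ^^ Suc (bound x)) (\<lambda>_. 0) z) (Suc (bound x))" by simp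
 have l: "lin s V (T (trifix T))" using T[OF lin_trifix trifix_range] by blast
 have "T (trifix T) x - (T ^^ Suc (bound x)) (\<lambda>_. 0) x = 0"
  by (rule vanish_eval[OF V.lin_diff_fun[OF l trifix_iter(1)] v]) simp
 then show "T (trifix T) x = trifix T x" using trifix_eq_iter[of x "Suc (bound x)"] by simp
qed

lemma trifix_unique:
 assumes "lin s V \<phi>" "range \<phi> \<subseteq> A" "T \<phi> = \<phi>" shows "\<phi> = trifix T"
proof
 fix x
 have "vanish (\<lambda>x. \<phi> x - trifix T x) n" for n
 proof (induction n)
  case (Suc n)
  from contr[OF assms(1,2) lin_trifix trifix_range this] show ?case by (simp add: assms(3) trifix_fixed)
 qed (simp add: vanish_def)
 from vanish_eval[OF V.lin_diff_fun[OF assms(1) lin_trifix] this order_refl] show "\<phi> x = trifix T x" by simp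
qed

end

end

section \<open>The grading derivation and infinitesimal characters\<close>

locale graded_target = graded_connected_hopf_algebra s \<Delta> \<epsilon> S gr + hopf_target s \<Delta> \<epsilon> S V
 for s :: "'k::real_or_complex_field \<Rightarrow> 'h::{ring, monoid_mult} \<Rightarrow> 'h" and \<Delta> \<epsilon> S gr
  and V :: "'k \<Rightarrow> 'v::{comm_ring, comm_monoid_mult} \<Rightarrow> 'v"
begin

definition Y :: "'h \<Rightarrow> 'h" where "Y = dil of_nat"
text \<open>The convention \<open>inverse 0 = 0\<close> makes it vanish in degree 0, so that it
  inverts \<open>Y\<close> up to the counit part.\<close>

definition Yi :: "'h \<Rightarrow> 'h" where "Yi = dil (\<lambda>n. inverse (of_nat n))"

lemma lin_Y: "lin s s Y" "lin s s Yi"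
 by (simp_all add: Y_def Yi_def lin_dil)

lemma Y_gr: "x \<in> gr n \<Longrightarrow> Y x = s (of_nat n) x" "x \<in> gr n \<Longrightarrow> Yi x = s (inverse (of_nat n)) x"
 by (simp_all add: Y_def Yi_def dil_gr)

lemma counit_gr: "x \<in> gr n \<Longrightarrow> \<epsilon> x = 0 \<or> n = 0"
 using gr_counit[of n x] by (cases n) auto

lemma lin_counit_one: "lin s s (\<lambda>x. s (\<epsilon> x) 1)"
 using lin_counit by (simp add: lin_def vs.scale_left_distrib)

lemma Yi_Y: "Yi (Y x) = x - s (\<epsilon> x) 1" "Y (Yi x) = x - s (\<epsilon> x) 1"
proof -
 have l: "lin s s (\<lambda>x. x - s (\<epsilon> x) 1)"
  by (intro vs.lin_diff_fun lin_counit_one) (simp add: lin_def)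
 have sc: "Y (s c z) = s c (Y z)" "Yi (s c z) = s c (Yi z)" "Y 0 = 0" "Yi 0 = 0" for c z
  using lin_Y lin_zero by (auto simp: lin_def)
 have gr: "Yi (Y z) = z - s (\<epsilon> z) 1 \<and> Y (Yi z) = z - s (\<epsilon> z) 1" if z: "z \<in> gr n" for n z
 proof (cases "n = 0")
  case True
  have "z - s (\<epsilon> z) 1 = 0" using gr_0[of z] z True by simp
  then show ?thesis using Y_gr[OF z] True sc by simp
 next
  case False
  then have "\<epsilon> z = 0" using counit_gr[OF z] by blast
  then show ?thesis using Y_gr[OF z] False sc by simp
 qed
 show "Yi (Y x) = x - s (\<epsilon> x) 1"
  by (rule lin_eq_gr[OF lin_compose[OF lin_Y(1,2)] l]) (use gr in blast)
 show "Y (Yi x) = x - s (\<epsilon> x) 1"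
  by (rule lin_eq_gr[OF lin_compose[OF lin_Y(2,1)] l]) (use gr in blast)
qed

lemma Y_one: "Y 1 = 0" "Yi 1 = 0"
 using Y_gr[OF gr_one] by simp_all

lemma counit_Y: "\<epsilon> (Y x) = 0" "\<epsilon> (Yi x) = 0"
proof -
 have z: "lin s (*) (\<lambda>x. 0)" by (simp add: lin_def)
 have \<epsilon>s: "\<epsilon> (s c x) = c * \<epsilon> x" for c x using lin_counit by (simp add: lin_def)
 have gr: "\<epsilon> (Y z) = 0 \<and> \<epsilon> (Yi z) = 0" if z: "z \<in> gr n" for n z
  using counit_gr[OF z] Y_gr[OF z] by (auto simp: \<epsilon>s)
 show "\<epsilon> (Y x) = 0"
  by (rule lin_eq_gr[OF lin_compose[OF lin_Y(1) lin_counit] z]) (use gr in blast)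
 show "\<epsilon> (Yi x) = 0"
  by (rule lin_eq_gr[OF lin_compose[OF lin_Y(2) lin_counit] z]) (use gr in blast)
qed

lemma lin_gr_0: "lin s V \<phi> \<Longrightarrow> \<phi> 1 = 0 \<Longrightarrow> x \<in> gr 0 \<Longrightarrow> \<phi> x = 0"
 using gr_0[of x] unfolding lin_def by (metis V.scale_zero_right)

text \<open>A factor that vanishes at 1 vanishes in degree 0; the other factor is then evaluated
  only in degrees strictly below the total one.\<close>

lemma conv_vanish:
 assumes "lin s V \<phi>" "lin s V \<xi>"
 shows "vanish \<phi> n \<Longrightarrow> \<xi> 1 = 0 \<Longrightarrow> vanish (conv \<phi> \<xi>) (Suc n)"
  "\<phi> 1 = 0 \<Longrightarrow> vanish \<xi> n \<Longrightarrow> vanish (conv \<phi> \<xi>) (Suc n)"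
proof -
 show "vanish (conv \<phi> \<xi>) (Suc n)" if v: "vanish \<phi> n" and 1: "\<xi> 1 = 0"
  unfolding vanish_def conv_def
 proof (intro allI ballI impI)
  fix m x assume m: "m < Suc n" and x: "x \<in> gr m"
  show "sw V x (\<lambda>a b. \<phi> a * \<xi> b) = 0"
  proof (rule sw_graded_zero[OF Vv bilin_mult[OF assms] x])
   fix i j a b assume ij: "i + j = m" "a \<in> gr i" "b \<in> gr j"
   show "\<phi> a * \<xi> b = 0"
   proof (cases "j = 0")
    case True then show ?thesis using lin_gr_0[OF assms(2) 1] ij by simp
   next
    case False
    then have "i < n" using ij m by linarith
    then have "\<phi> a = 0" using v ij unfolding vanish_def by blast
    then show ?thesis by simp
   qed
  qed
 qed
 show "vanish (conv \<phi> \<xi>) (Suc n)" if 1: "\<phi> 1 = 0" and v: "vanish \<xi> n"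
  unfolding vanish_def conv_def
 proof (intro allI ballI impI)
  fix m x assume m: "m < Suc n" and x: "x \<in> gr m"
  show "sw V x (\<lambda>a b. \<phi> a * \<xi> b) = 0"
  proof (rule sw_graded_zero[OF Vv bilin_mult[OF assms] x])
   fix i j a b assume ij: "i + j = m" "a \<in> gr i" "b \<in> gr j"
   show "\<phi> a * \<xi> b = 0"
   proof (cases "i = 0")
    case True then show ?thesis using lin_gr_0[OF assms(1) 1] ij by simp
   next
    case False
    then have "j < n" using ij m by linarith
    then have "\<xi> b = 0" using v ij unfolding vanish_def by blast
    then show ?thesis by simp
   qed
  qed
 qed
qed

text \<open>The counit vanishes in positive degrees, and degree 0 consists of multiples of 1, where
  the derivation rule follows from the value 0 at 1. This form makes stability under degreewise
  scaling visible and exhibits infinitesimal characters as an annihilator.\<close>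

lemma infchr_gr:
 "infchr \<phi> \<longleftrightarrow> lin s V \<phi> \<and> \<phi> 1 = 0 \<and> (\<forall>n m x y. 0 < n \<longrightarrow> 0 < m \<longrightarrow> x \<in> gr n \<longrightarrow> y \<in> gr m \<longrightarrow> \<phi> (x * y) = 0)"
proof
 assume \<phi>: "infchr \<phi>"
 have "\<phi> (x * y) = 0" if "0 < n" "0 < m" "x \<in> gr n" "y \<in> gr m" for n m x y
  using \<phi> gr_counit[of n x] gr_counit[of m y] that by (simp add: infchr_def)
 then show "lin s V \<phi> \<and> \<phi> 1 = 0 \<and> (\<forall>n m x y. 0 < n \<longrightarrow> 0 < m \<longrightarrow> x \<in> gr n \<longrightarrow> y \<in> gr m \<longrightarrow> \<phi> (x * y) = 0)"
  using \<phi> infchr_one by (auto simp: infchr_def)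
next
 assume R: "lin s V \<phi> \<and> \<phi> 1 = 0 \<and> (\<forall>n m x y. 0 < n \<longrightarrow> 0 < m \<longrightarrow> x \<in> gr n \<longrightarrow> y \<in> gr m \<longrightarrow> \<phi> (x * y) = 0)"
 then have l: "lin s V \<phi>" and 1: "\<phi> 1 = 0" by auto
 have "\<phi> (a * b) = V (\<epsilon> a) (\<phi> b) + V (\<epsilon> b) (\<phi> a)" for a b
 proof (rule bilin_eq_gr[of V "\<lambda>a b. \<phi> (a * b)" "\<lambda>a b. V (\<epsilon> a) (\<phi> b) + V (\<epsilon> b) (\<phi> a)"])
  show "bilin s V (\<lambda>a b. \<phi> (a * b))" by (intro bilinI lin_mult_arg l)
  show "bilin s V (\<lambda>a b. V (\<epsilon> a) (\<phi> b) + V (\<epsilon> b) (\<phi> a))"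
   using l lin_counit
   by (intro bilinI) (auto simp: lin_def V.scale_left_distrib V.scale_right_distrib algebra_simps)
  fix n m a b assume a: "a \<in> gr n" and b: "b \<in> gr m"
  have s1: "\<phi> (s c 1 * y) = V c (\<phi> y)" "\<phi> (y * s c 1) = V c (\<phi> y)" for c y
   using algebra l by (simp_all add: unital_algebra_def lin_def)
  have s0: "\<phi> (s c 1) = 0" for c using l 1 by (simp add: lin_def)
  consider "n = 0" | "m = 0" | "0 < n" "0 < m" by auto
  then show "\<phi> (a * b) = V (\<epsilon> a) (\<phi> b) + V (\<epsilon> b) (\<phi> a)"
  proof cases
   case 1
   then have a0: "a = s (\<epsilon> a) 1" using gr_0 a by simp
   then have "\<phi> a = 0" using s0 by metis
   then show ?thesis using s1(1)[of "\<epsilon> a" b] a0 by simp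
  next
   case 2
   then have b0: "b = s (\<epsilon> b) 1" using gr_0 b by simp
   then have "\<phi> b = 0" using s0 by metis
   then show ?thesis using s1(2)[of a "\<epsilon> b"] b0 by simp
  next
   case 3
   then show ?thesis using R a b gr_counit[of n a] gr_counit[of m b] by simp
  qed
 qed
 with l show "infchr \<phi>" by (simp add: infchr_def)
qed

lemma infchr_dil: "infchr \<phi> \<Longrightarrow> infchr (\<lambda>x. \<phi> (dil c x))"
 unfolding infchr_gr
proof (intro conjI allI impI; elim conjE)
 assume l: "lin s V \<phi>" and 1: "\<phi> 1 = 0"
 show "lin s V (\<lambda>x. \<phi> (dil c x))" by (rule lin_compose[OF lin_dil l])
 show "\<phi> (dil c 1) = 0" using dil_gr[OF gr_one] l 1 by (simp add: lin_def)
 fix n m :: nat and x y assume *: "\<forall>n m x y. 0 < n \<longrightarrow> 0 < m \<longrightarrow> x \<in> gr n \<longrightarrow> y \<in> gr m \<longrightarrow> \<phi> (x * y) = 0"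
  and nm: "0 < n" "0 < m" "x \<in> gr n" "y \<in> gr m"
 have "\<phi> (x * y) = 0" using * nm by blast
 then show "\<phi> (dil c (x * y)) = 0"
  using dil_gr[OF gr_mult[OF nm(3,4)]] l by (simp add: lin_def)
qed

lemma infchr_Y: "infchr \<phi> \<Longrightarrow> infchr (\<lambda>x. \<phi> (Y x))" "infchr \<phi> \<Longrightarrow> infchr (\<lambda>x. \<phi> (Yi x))"
 unfolding Y_def Yi_def by (simp_all add: infchr_dil)

text \<open>\<open>\<xi>\<close> kills degree 0, so \<open>conv_defect\<close> evaluates the
  multiplicativity defect of \<open>\<phi>\<close> only in total degree below \<open>n + m\<close>,
  where it is 0.\<close>

lemma conv_infchr_mult:
 assumes \<phi>: "lin s V \<phi>" and \<xi>: "infchr \<xi>" and x: "x \<in> gr n" and y: "y \<in> gr m"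
  and IH: "\<And>i j a b. i + j < n + m \<Longrightarrow> a \<in> gr i \<Longrightarrow> b \<in> gr j \<Longrightarrow> \<phi> (a * b) = \<phi> a * \<phi> b"
 shows "conv \<phi> \<xi> (x * y) = conv \<phi> \<xi> x * \<phi> y + \<phi> x * conv \<phi> \<xi> y"
proof -
 have l: "lin s V \<xi>" and 1: "\<xi> 1 = 0" using \<xi> infchr_one by (auto simp: infchr_def)
 have "conv (\<lambda>c. \<phi> (x * c) - \<phi> x * \<phi> c) \<xi> y = 0"
  unfolding conv_def
 proof (rule sw_graded_zero[OF Vv _ y])
  show "bilin s V (\<lambda>c b. (\<phi> (x * c) - \<phi> x * \<phi> c) * \<xi> b)"
   by (intro bilin_mult l V.lin_diff_fun lin_mult lin_mult_arg \<phi>)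
  fix i j a b assume ij: "i + j = m" "a \<in> gr i" "b \<in> gr j"
  show "(\<phi> (x * a) - \<phi> x * \<phi> a) * \<xi> b = 0"
  proof (cases "j = 0")
   case True then show ?thesis using lin_gr_0[OF l 1] ij by simp
  next
   case False then show ?thesis using IH[of n i x a] ij x by simp
  qed
 qed
 moreover have "conv (\<lambda>a. \<phi> (a * y) - \<phi> a * \<phi> y) \<xi> x = 0"
  unfolding conv_def
 proof (rule sw_graded_zero[OF Vv _ x])
  show "bilin s V (\<lambda>c b. (\<phi> (c * y) - \<phi> c * \<phi> y) * \<xi> b)"
   by (intro bilin_mult l V.lin_diff_fun lin_mult lin_mult_arg \<phi>)
  fix i j a b assume ij: "i + j = n" "a \<in> gr i" "b \<in> gr j"
  show "(\<phi> (a * y) - \<phi> a * \<phi> y) * \<xi> b = 0"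
  proof (cases "j = 0")
   case True then show ?thesis using lin_gr_0[OF l 1] ij by simp
  next
   case False then show ?thesis using IH[of i m a y] ij y by simp
  qed
 qed
 ultimately show ?thesis using conv_defect[OF \<phi> \<xi>, of x y] by simp
qed

text \<open>A factor of degree 0 is a multiple of 1, so \<open>step\<close> has to deal only with
  positive degrees and may use multiplicativity in lower total degree.\<close>

lemma chr_by_degree:
 assumes \<phi>: "lin s V \<phi>" "\<phi> 1 = 1"
  and step: "\<And>n m x y. 0 < n \<Longrightarrow> 0 < m \<Longrightarrow> x \<in> gr n \<Longrightarrow> y \<in> gr m \<Longrightarrow>
   (\<And>i j a b. i + j < n + m \<Longrightarrow> a \<in> gr i \<Longrightarrow> b \<in> gr j \<Longrightarrow> \<phi> (a * b) = \<phi> a * \<phi> b) \<Longrightarrow> \<phi> (x * y) = \<phi> x * \<phi> y"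
 shows "chr \<phi>"
proof -
 have "\<forall>n m x y. n + m = N \<longrightarrow> x \<in> gr n \<longrightarrow> y \<in> gr m \<longrightarrow> \<phi> (x * y) = \<phi> x * \<phi> y" for N
 proof (induction N rule: less_induct)
  case (less N)
  show ?case
  proof (intro allI impI)
   fix n m x y assume nm: "n + m = N" "x \<in> gr n" "y \<in> gr m"
   have s1: "\<phi> (s c 1 * y) = \<phi> (s c 1) * \<phi> y" "\<phi> (y * s c 1) = \<phi> y * \<phi> (s c 1)" for c y
    using algebra \<phi> by (simp_all add: unital_algebra_def lin_def V_mult)
   consider "n = 0" | "m = 0" | "0 < n" "0 < m" by auto
   then show "\<phi> (x * y) = \<phi> x * \<phi> y"
   proof cases
    case 1 then show ?thesis using gr_0[of x] nm s1(1)[of "\<epsilon> x" y] by simp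
   next
    case 2 then show ?thesis using gr_0[of y] nm s1(2)[of x "\<epsilon> y"] by simp
   next
    case 3
    show ?thesis by (rule step[OF 3 nm(2,3)]) (use less.IH nm in blast)
   qed
  qed
 qed
 then have m: "\<phi> (x * y) = \<phi> x * \<phi> y" if "x \<in> gr n" "y \<in> gr m" for n m x y
  using that by metis
 have b: "bilin s V (\<lambda>x y. \<phi> (x * y))" "bilin s V (\<lambda>x y. \<phi> x * \<phi> y)"
  by (intro bilinI lin_mult_arg lin_mult \<phi>)+
 have "\<phi> (x * y) = \<phi> x * \<phi> y" for x y
  by (rule bilin_eq_gr[OF b]) (rule m)
 with \<phi> show ?thesis by (simp add: chr_def)
qed

section \<open>A global chart of the space of linear maps\<close>

text \<open>For a character \<open>\<phi>\<close> the chart is essentially the logarithmic derivative \<open>\<phi>\<^sup>-\<^sup>1 \<star> (\<phi> \<circ> Y)\<close>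
 along the grading derivation \<open>Y\<close>. It is polynomial in each degree, and so is its inverse.\<close>

definition T_log :: "('h \<Rightarrow> 'v) \<Rightarrow> ('h \<Rightarrow> 'v) \<Rightarrow> 'h \<Rightarrow> 'v" where
 "T_log \<phi> \<xi> x = \<phi> (Y x) - conv (\<lambda>x. \<phi> x - V (\<epsilon> x) (\<phi> 1)) \<xi> x"

text \<open>The equation \<open>\<phi> \<circ> Y = \<phi> \<star> (\<psi> \<circ> Y)\<close> solved
  for \<open>\<phi>\<close>: \<open>Yi\<close> recovers the positive degrees, and
  \<open>unit\<close> prescribes the value at 1.\<close>

definition T_exp :: "('h \<Rightarrow> 'v) \<Rightarrow> ('h \<Rightarrow> 'v) \<Rightarrow> 'h \<Rightarrow> 'v" where
 "T_exp \<psi> \<eta> x = unit x + conv \<eta> (\<lambda>x. \<psi> (Y x)) (Yi x)"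

text \<open>The second summand records \<open>\<phi> 1\<close>. It vanishes on unital maps and makes
  the chart a bijection of all linear maps, as \<open>submanifold\<close> starts from charts of the
  ambient space. The composition with \<open>Yi\<close> normalises the differential of the inverse
  chart at 0 to the identity.\<close>

definition log_chart :: "('h \<Rightarrow> 'v) \<Rightarrow> 'h \<Rightarrow> 'v" where
 "log_chart \<phi> x = trifix (T_log \<phi>) (Yi x) + V (\<epsilon> x) (\<phi> 1 - 1)"

definition exp_chart :: "('h \<Rightarrow> 'v) \<Rightarrow> 'h \<Rightarrow> 'v" where
 "exp_chart \<psi> x = trifix (T_exp \<psi>) x + V (\<epsilon> x) (\<psi> 1)"

lemma lin_counit_V: "lin s V (\<lambda>x. V (\<epsilon> x) c)"
 using lin_counit by (auto simp: lin_def V.scale_left_distrib)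

lemma vanish_compose_dil:
 "lin s V \<phi> \<Longrightarrow> vanish \<phi> n \<Longrightarrow> vanish (\<lambda>x. \<phi> (dil c x)) n"
 unfolding vanish_def using dil_in_gr by blast

lemma vanish_minus: "vanish \<phi> n \<Longrightarrow> vanish (\<lambda>x. - \<phi> x :: 'v) n"
 unfolding vanish_def by simp

lemma T_log:
 assumes \<phi>: "lin s V \<phi>"
 shows "lin s V \<xi> \<Longrightarrow> lin s V (T_log \<phi> \<xi>)"
  "lin s V \<xi> \<Longrightarrow> lin s V \<xi>' \<Longrightarrow> vanish (\<lambda>x. \<xi> x - \<xi>' x) n \<Longrightarrow> vanish (\<lambda>x. T_log \<phi> \<xi> x - T_log \<phi> \<xi>' x) (Suc n)"
proof -
 have l0: "lin s V (\<lambda>x. \<phi> x - V (\<epsilon> x) (\<phi> 1))" by (intro V.lin_diff_fun \<phi> lin_counit_V)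
 show "lin s V \<xi> \<Longrightarrow> lin s V (T_log \<phi> \<xi>)"
  unfolding T_log_def[abs_def] by (intro V.lin_diff_fun lin_conv l0 lin_compose[OF lin_Y(1) \<phi>])
 assume "lin s V \<xi>" "lin s V \<xi>'" "vanish (\<lambda>x. \<xi> x - \<xi>' x) n"
 then have "vanish (conv (\<lambda>x. \<phi> x - V (\<epsilon> x) (\<phi> 1)) (\<lambda>x. \<xi> x - \<xi>' x)) (Suc n)"
  by (intro conv_vanish(2) l0 V.lin_diff_fun) (simp_all add: counit_one)
 from vanish_minus[OF this] show "vanish (\<lambda>x. T_log \<phi> \<xi> x - T_log \<phi> \<xi>' x) (Suc n)"
  by (simp add: T_log_def conv_diff_right)
qed

lemma T_exp:
 assumes \<psi>: "lin s V \<psi>"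
 shows "lin s V \<eta> \<Longrightarrow> lin s V (T_exp \<psi> \<eta>)"
  "lin s V \<eta> \<Longrightarrow> lin s V \<eta>' \<Longrightarrow> vanish (\<lambda>x. \<eta> x - \<eta>' x) n \<Longrightarrow> vanish (\<lambda>x. T_exp \<psi> \<eta> x - T_exp \<psi> \<eta>' x) (Suc n)"
proof -
 have l0: "lin s V (\<lambda>x. \<psi> (Y x))" by (rule lin_compose[OF lin_Y(1) \<psi>])
 show "lin s V \<eta> \<Longrightarrow> lin s V (T_exp \<psi> \<eta>)"
  unfolding T_exp_def[abs_def] by (intro V.lin_add_fun lin_unit lin_compose[OF lin_Y(2) lin_conv] l0)
 assume l: "lin s V \<eta>" "lin s V \<eta>'" and v: "vanish (\<lambda>x. \<eta> x - \<eta>' x) n"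
 then have "vanish (conv (\<lambda>x. \<eta> x - \<eta>' x) (\<lambda>x. \<psi> (Y x))) (Suc n)"
  by (intro conv_vanish(1) l0 V.lin_diff_fun) (simp_all add: Y_one lin_zero[OF \<psi>])
 from vanish_compose_dil[OF lin_conv[OF V.lin_diff_fun[OF l] l0] this]
 show "vanish (\<lambda>x. T_exp \<psi> \<eta> x - T_exp \<psi> \<eta>' x) (Suc n)"
  by (simp add: T_exp_def conv_diff_left Yi_def)
qed

lemma V_UNIV: "V.subspace UNIV" by (rule V.subspace_UNIV)

lemma fix_log:
 assumes \<phi>: "lin s V \<phi>"
 shows "lin s V (trifix (T_log \<phi>))" "T_log \<phi> (trifix (T_log \<phi>)) = trifix (T_log \<phi>)"
  "lin s V \<xi> \<Longrightarrow> T_log \<phi> \<xi> = \<xi> \<Longrightarrow> \<xi> = trifix (T_log \<phi>)"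
proof -
 have T: "lin s V (T_log \<phi> \<phi>') \<and> range (T_log \<phi> \<phi>') \<subseteq> UNIV" if "lin s V \<phi>'" for \<phi>'
  using T_log(1)[OF \<phi> that] by simp
 have C: "vanish (\<lambda>x. T_log \<phi> \<phi>' x - T_log \<phi> \<psi>' x) (Suc n)"
  if "lin s V \<phi>'" "lin s V \<psi>'" "vanish (\<lambda>x. \<phi>' x - \<psi>' x) n" for \<phi>' \<psi>' n
  by (rule T_log(2)[OF \<phi> that])
 show "lin s V (trifix (T_log \<phi>))" by (rule lin_trifix[OF Vv V_UNIV T C])
 show "T_log \<phi> (trifix (T_log \<phi>)) = trifix (T_log \<phi>)" by (rule trifix_fixed[OF Vv V_UNIV T C])
 show "lin s V \<xi> \<Longrightarrow> T_log \<phi> \<xi> = \<xi> \<Longrightarrow> \<xi> = trifix (T_log \<phi>)"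
  by (rule trifix_unique[OF Vv V_UNIV T C]) simp_all
qed

lemma fix_exp:
 assumes \<psi>: "lin s V \<psi>"
 shows "lin s V (trifix (T_exp \<psi>))" "T_exp \<psi> (trifix (T_exp \<psi>)) = trifix (T_exp \<psi>)"
  "lin s V \<xi> \<Longrightarrow> T_exp \<psi> \<xi> = \<xi> \<Longrightarrow> \<xi> = trifix (T_exp \<psi>)"
proof -
 have T: "lin s V (T_exp \<psi> \<phi>') \<and> range (T_exp \<psi> \<phi>') \<subseteq> UNIV" if "lin s V \<phi>'" for \<phi>'
  using T_exp(1)[OF \<psi> that] by simp
 have C: "vanish (\<lambda>x. T_exp \<psi> \<phi>' x - T_exp \<psi> \<psi>' x) (Suc n)"
  if "lin s V \<phi>'" "lin s V \<psi>'" "vanish (\<lambda>x. \<phi>' x - \<psi>' x) n" for \<phi>' \<psi>' n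
  by (rule T_exp(2)[OF \<psi> that])
 show "lin s V (trifix (T_exp \<psi>))" by (rule lin_trifix[OF Vv V_UNIV T C])
 show "T_exp \<psi> (trifix (T_exp \<psi>)) = trifix (T_exp \<psi>)" by (rule trifix_fixed[OF Vv V_UNIV T C])
 show "lin s V \<xi> \<Longrightarrow> T_exp \<psi> \<xi> = \<xi> \<Longrightarrow> \<xi> = trifix (T_exp \<psi>)"
  by (rule trifix_unique[OF Vv V_UNIV T C]) simp_all
qed

lemma lin_log_chart: "lin s V \<phi> \<Longrightarrow> lin s V (log_chart \<phi>)"
 unfolding log_chart_def[abs_def] by (intro V.lin_add_fun lin_compose[OF lin_Y(2)] fix_log lin_counit_V)

lemma lin_exp_chart: "lin s V \<psi> \<Longrightarrow> lin s V (exp_chart \<psi>)"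
 unfolding exp_chart_def[abs_def] by (intro V.lin_add_fun fix_exp lin_counit_V)

lemma lin_proj: "lin s V \<phi> \<Longrightarrow> \<phi> (x - s (\<epsilon> x) 1) = \<phi> x - V (\<epsilon> x) (\<phi> 1)"
 using lin_diff[of s V \<phi>] by (simp add: lin_def)

lemma fix_log_one: "lin s V \<phi> \<Longrightarrow> trifix (T_log \<phi>) 1 = 0"
proof -
 assume \<phi>: "lin s V \<phi>"
 have "trifix (T_log \<phi>) 1 = T_log \<phi> (trifix (T_log \<phi>)) 1" using fix_log(2)[OF \<phi>] by simp
 also have "\<dots> = 0"
  unfolding T_log_def conv_one[OF V.lin_diff_fun[OF \<phi> lin_counit_V] fix_log(1)[OF \<phi>]]
  by (simp add: Y_one lin_zero[OF \<phi>] counit_one)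
 finally show ?thesis .
qed

lemma fix_exp_one: "lin s V \<psi> \<Longrightarrow> trifix (T_exp \<psi>) 1 = 1"
proof -
 assume \<psi>: "lin s V \<psi>"
 have "trifix (T_exp \<psi>) 1 = T_exp \<psi> (trifix (T_exp \<psi>)) 1" using fix_exp(2)[OF \<psi>] by simp
 also have "\<dots> = 1"
  unfolding T_exp_def Y_one lin_zero[OF lin_conv[OF fix_exp(1)[OF \<psi>] lin_compose[OF lin_Y(1) \<psi>]]]
  by (simp add: unit_def counit_one)
 finally show ?thesis .
qed

text \<open>Subtracting a multiple of the counit makes \<open>\<phi>\<close> unital; for this unital
  map the fixed point is the logarithmic derivative, with the inverse multiplied out.\<close>

lemma fix_log_conv:
 assumes \<phi>: "lin s V \<phi>"
 shows "conv (\<lambda>x. \<phi> x - V (\<epsilon> x) (\<phi> 1 - 1)) (trifix (T_log \<phi>)) x = \<phi> (Y x)"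
proof -
 let ?\<xi> = "trifix (T_log \<phi>)"
 \<comment> \<open>Splitting off \<open>unit\<close> isolates the part that vanishes at 1, which is
   what \<open>T_log\<close> convolves with.\<close>
 have "(\<lambda>x. \<phi> x - V (\<epsilon> x) (\<phi> 1 - 1)) = (\<lambda>x. (\<phi> x - V (\<epsilon> x) (\<phi> 1)) + unit x)"
  by (simp add: unit_def V.scale_right_diff_distrib fun_eq_iff)
 then have "conv (\<lambda>x. \<phi> x - V (\<epsilon> x) (\<phi> 1 - 1)) ?\<xi> x = conv (\<lambda>x. \<phi> x - V (\<epsilon> x) (\<phi> 1)) ?\<xi> x + ?\<xi> x"
  using conv_unit_left[OF fix_log(1)[OF \<phi>]] by (simp only: conv_add_left)
 also have "?\<xi> x = T_log \<phi> ?\<xi> x" using fix_log(2)[OF \<phi>] by simp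
 also have "\<dots> = \<phi> (Y x) - conv (\<lambda>x. \<phi> x - V (\<epsilon> x) (\<phi> 1)) ?\<xi> x" by (rule T_log_def)
 finally show ?thesis by simp
qed

lemma fix_exp_conv:
 assumes \<psi>: "lin s V \<psi>"
 shows "trifix (T_exp \<psi>) (Y x) = conv (trifix (T_exp \<psi>)) (\<lambda>x. \<psi> (Y x)) x"
proof -
 let ?\<eta> = "trifix (T_exp \<psi>)"
 have l: "lin s V (\<lambda>x. \<psi> (Y x))" by (rule lin_compose[OF lin_Y(1) \<psi>])
 have "?\<eta> (Y x) = T_exp \<psi> ?\<eta> (Y x)" using fix_exp(2)[OF \<psi>] by simp
 also have "\<dots> = conv ?\<eta> (\<lambda>x. \<psi> (Y x)) (x - s (\<epsilon> x) 1)"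
  by (simp add: T_exp_def unit_def counit_Y Yi_Y)
 also have "\<dots> = conv ?\<eta> (\<lambda>x. \<psi> (Y x)) x"
  unfolding lin_proj[OF lin_conv[OF fix_exp(1)[OF \<psi>] l]] conv_one[OF fix_exp(1)[OF \<psi>] l]
  by (simp add: Y_one lin_zero[OF \<psi>])
 finally show ?thesis .
qed

text \<open>Composing the chart value with \<open>Y\<close> recovers the logarithmic derivative, so
  the unital map \<open>?t\<close> satisfies the fixed point equation of \<open>T_exp\<close>;
  uniqueness concludes.\<close>

lemma exp_log_chart:
 assumes \<phi>: "lin s V \<phi>" shows "exp_chart (log_chart \<phi>) = \<phi>"
proof -
 define \<psi> where "\<psi> = log_chart \<phi>"
 define \<xi> where "\<xi> = trifix (T_log \<phi>)"
 have \<xi>: "lin s V \<xi>" "\<xi> 1 = 0" unfolding \<xi>_def using fix_log(1) fix_log_one \<phi> by auto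
 have \<psi>1: "\<psi> 1 = \<phi> 1 - 1" unfolding \<psi>_def log_chart_def using lin_zero[OF \<xi>(1)] by (simp add: Y_one counit_one \<xi>_def)
 have \<psi>Y: "\<psi> (Y x) = \<xi> x" for x
  unfolding \<psi>_def log_chart_def counit_Y Yi_Y using lin_proj[OF \<xi>(1)] \<xi>(2) by (simp add: \<xi>_def)
 let ?t = "\<lambda>x. \<phi> x - V (\<epsilon> x) (\<phi> 1 - 1)"
 have lt: "lin s V ?t" by (intro V.lin_diff_fun \<phi> lin_counit_V)
 have "?t = trifix (T_exp \<psi>)"
 proof (rule fix_exp(3)[OF _ lt])
  show "lin s V \<psi>" unfolding \<psi>_def by (rule lin_log_chart[OF \<phi>])
  show "T_exp \<psi> ?t = ?t"
  proof
   fix x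
   have "T_exp \<psi> ?t x = unit x + \<phi> (Y (Yi x))"
    unfolding T_exp_def \<psi>Y using fix_log_conv[OF \<phi>] by (simp add: \<xi>_def)
   also have "\<dots> = ?t x"
    unfolding Yi_Y lin_proj[OF \<phi>] by (simp add: unit_def V.scale_right_diff_distrib)
   finally show "T_exp \<psi> ?t x = ?t x" .
  qed
 qed
 from fun_cong[OF this] have "trifix (T_exp \<psi>) x = \<phi> x - V (\<epsilon> x) (\<phi> 1 - 1)" for x by metis
 then show ?thesis by (simp add: exp_chart_def[abs_def] \<psi>1 flip: \<psi>_def)
qed

lemma exp_chart_one: "lin s V \<psi> \<Longrightarrow> exp_chart \<psi> 1 = 1 + \<psi> 1"
 by (simp add: exp_chart_def fix_exp_one counit_one)

text \<open>Here uniqueness for \<open>T_log\<close> decides: \<open>\<psi> \<circ> Y\<close> solves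
  its equation because \<open>fix_exp_conv\<close> is that equation with \<open>unit\<close> split
  off.\<close>

lemma log_exp_chart:
 assumes \<psi>: "lin s V \<psi>" shows "log_chart (exp_chart \<psi>) = \<psi>"
proof -
 define \<phi> where "\<phi> = exp_chart \<psi>"
 define \<eta> where "\<eta> = trifix (T_exp \<psi>)"
 have \<eta>: "lin s V \<eta>" "\<eta> 1 = 1" unfolding \<eta>_def using fix_exp(1) fix_exp_one \<psi> by auto
 have \<phi>1: "\<phi> 1 = 1 + \<psi> 1" unfolding \<phi>_def by (rule exp_chart_one[OF \<psi>])
 have l\<phi>: "lin s V \<phi>" unfolding \<phi>_def by (rule lin_exp_chart[OF \<psi>])
 let ?\<xi> = "\<lambda>x. \<psi> (Y x)"
 have l: "lin s V ?\<xi>" by (rule lin_compose[OF lin_Y(1) \<psi>])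
 have "?\<xi> = trifix (T_log \<phi>)"
 proof (rule fix_log(3)[OF l\<phi> l])
  show "T_log \<phi> ?\<xi> = ?\<xi>"
  proof
   fix x
   have e: "(\<lambda>x. \<phi> x - V (\<epsilon> x) (\<phi> 1)) = (\<lambda>x. \<eta> x - unit x)"
    by (simp add: \<phi>1 unit_def fun_eq_iff V.scale_right_distrib) (simp add: \<phi>_def \<eta>_def exp_chart_def)
   have "\<phi> (Y x) = \<eta> (Y x)" by (simp add: \<phi>_def \<eta>_def exp_chart_def counit_Y)
   then show "T_log \<phi> ?\<xi> x = ?\<xi> x"
    unfolding T_log_def e conv_diff_left conv_unit_left[OF l] using fix_exp_conv[OF \<psi>, of x] by (simp add: \<eta>_def)
  qed
 qed
 from fun_cong[OF this] have "trifix (T_log \<phi>) x = \<psi> (Y x)" for x by metis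
 then show ?thesis
  by (simp add: log_chart_def[abs_def] Yi_Y lin_proj[OF \<psi>] \<phi>1 flip: \<phi>_def)
qed

text \<open>In degree \<open>n + m\<close> the operator \<open>Y\<close> multiplies by
  \<open>n + m\<close>. By \<open>conv_infchr_mult\<close> the other side gives the same multiple of
  \<open>\<phi> x * \<phi> y\<close>, and the factor can be cancelled in characteristic 0.\<close>

lemma conv_mult_of_derivation:
 assumes l: "lin s V \<phi>" and eq: "\<And>x. \<phi> (Y x) = conv \<phi> \<xi> x" and \<xi>: "infchr \<xi>" and 1: "\<phi> 1 = 1"
 shows "chr \<phi>"
proof (rule chr_by_degree[OF l 1])
 fix n m :: nat and x y assume nm: "0 < n" "0 < m" and x: "x \<in> gr n" and y: "y \<in> gr m"
  and IH: "\<And>i j a b. i + j < n + m \<Longrightarrow> a \<in> gr i \<Longrightarrow> b \<in> gr j \<Longrightarrow> \<phi> (a * b) = \<phi> a * \<phi> b"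
 have Yp: "\<phi> (Y z) = V (of_nat k) (\<phi> z)" if "z \<in> gr k" for z k
  using Y_gr(1)[OF that] l by (simp add: lin_def)
 have "V (of_nat (n + m)) (\<phi> (x * y)) = conv \<phi> \<xi> x * \<phi> y + \<phi> x * conv \<phi> \<xi> y"
  unfolding Yp[OF gr_mult[OF x y], symmetric] eq by (rule conv_infchr_mult[OF l \<xi> x y]) (rule IH)
 also have "\<dots> = V (of_nat (n + m)) (\<phi> x * \<phi> y)"
  unfolding eq[symmetric] Yp[OF x] Yp[OF y] by (simp add: V_mult V.scale_left_distrib)
 finally have "V (of_nat (n + m)) (\<phi> (x * y)) = V (of_nat (n + m)) (\<phi> x * \<phi> y)" .
 moreover have "(of_nat (n + m) :: 'k) \<noteq> 0" using nm by (simp del: of_nat_add)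
 ultimately show "\<phi> (x * y) = \<phi> x * \<phi> y" using V.scale_left_imp_eq by blast
qed

lemma chr_exp_chart:
 assumes "infchr \<psi>" shows "chr (exp_chart \<psi>)"
proof -
 have l: "lin s V \<psi>" and "\<psi> 1 = 0" using assms infchr_one by (auto simp: infchr_def)
 then have "exp_chart \<psi> = trifix (T_exp \<psi>)" by (simp add: exp_chart_def[abs_def])
 then show ?thesis
  using conv_mult_of_derivation[OF fix_exp(1)[OF l] fix_exp_conv[OF l] infchr_Y(1)[OF assms] fix_exp_one[OF l]] by simp
qed

lemma Y_mult: "Y (x * y) = Y x * y + x * Y y"
proof (rule bilin_eq_gr[of s "\<lambda>x y. Y (x * y)" "\<lambda>x y. Y x * y + x * Y y"])
 show "bilin s s (\<lambda>x y. Y (x * y))"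
  by (intro bilinI lin_compose[OF lin_mult_H(1) lin_Y(1)] lin_compose[OF lin_mult_H(2) lin_Y(1)])
 show "bilin s s (\<lambda>x y. Y x * y + x * Y y)"
  by (intro bilinI vs.lin_add_fun lin_mult_H lin_compose[OF lin_Y(1) lin_mult_H(1)] lin_compose[OF lin_Y(1) lin_mult_H(2)])
 fix n m x y assume "x \<in> gr n" "y \<in> gr m"
 then show "Y (x * y) = Y x * y + x * Y y"
  using Y_gr(1) gr_mult[of x n y m] algebra by (simp add: unital_algebra_def vs.scale_left_distrib)
qed

text \<open>\<open>\<xi>\<close> is the convolution of the inverse character \<open>\<psi>\<close>
  with \<open>\<phi> \<circ> Y\<close>. As \<open>\<psi>\<close> is multiplicative and
  \<open>Y\<close> is a derivation, the Sweedler sums on a product factor into two terms, each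
  containing \<open>conv \<psi> \<phi>\<close>, that is, the counit.\<close>

lemma infchr_log_chart:
 assumes \<phi>: "chr \<phi>" shows "infchr (log_chart \<phi>)"
proof -
 have l: "lin s V \<phi>" and m: "\<And>a b. \<phi> (a * b) = \<phi> a * \<phi> b" and 1: "\<phi> 1 = 1" using \<phi> by (auto simp: chr_def)
 define \<xi> where "\<xi> = trifix (T_log \<phi>)"
 have l\<xi>: "lin s V \<xi>" unfolding \<xi>_def by (rule fix_log(1)[OF l])
 define \<psi> where "\<psi> = (\<lambda>x. \<phi> (S x))"
 have \<psi>: "chr \<psi>" "conv \<psi> \<phi> = unit" unfolding \<psi>_def using chr_antipode[OF \<phi>] conv_antipode[OF \<phi>] by auto
 have lY: "lin s V (\<lambda>x. \<phi> (Y x))" by (rule lin_compose[OF lin_Y(1) l])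
 have l\<psi>: "lin s V \<psi>" and m\<psi>: "\<And>a b. \<psi> (a * b) = \<psi> a * \<psi> b" using \<psi>(1) by (auto simp: chr_def)
 have "conv \<phi> \<xi> = (\<lambda>x. \<phi> (Y x))" using fix_log_conv[OF l] by (auto simp: 1 \<xi>_def)
 then have \<xi>: "\<xi> = conv \<psi> (\<lambda>x. \<phi> (Y x))"
  using conv_assoc[OF l\<psi> l l\<xi>] \<psi>(2) conv_unit_left[OF l\<xi>] by simp
 have "\<xi> (x * y) = V (\<epsilon> x) (\<xi> y) + V (\<epsilon> y) (\<xi> x)" for x y
 proof -
  have "\<phi> (Y (b * d)) = \<phi> (Y b) * \<phi> d + \<phi> b * \<phi> (Y d)" for b d
   using Y_mult l by (simp add: lin_def m)
  then have "\<xi> (x * y) = sw V x (\<lambda>a b. sw V y (\<lambda>c d. (\<psi> a * \<phi> (Y b)) * (\<psi> c * \<phi> d)))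
    + sw V x (\<lambda>a b. sw V y (\<lambda>c d. (\<psi> a * \<phi> b) * (\<psi> c * \<phi> (Y d))))"
   unfolding \<xi> conv_mult[OF l\<psi> lY] m\<psi> by (simp add: distrib_left mult_ac sw_add[OF Vv])
  also have "\<dots> = conv \<psi> (\<lambda>x. \<phi> (Y x)) x * conv \<psi> \<phi> y + conv \<psi> \<phi> x * conv \<psi> (\<lambda>x. \<phi> (Y x)) y"
   unfolding conv_def sw_mult_sw ..
  also have "\<dots> = V (\<epsilon> x) (\<xi> y) + V (\<epsilon> y) (\<xi> x)"
   unfolding \<psi>(2) by (simp add: unit_def V_mult flip: \<xi>)
  finally show ?thesis .
 qed
 then have "infchr \<xi>" using l\<xi> by (simp add: infchr_def)
 then have "infchr (\<lambda>x. \<xi> (Yi x))" by (rule infchr_Y(2))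
 then show ?thesis by (simp add: log_chart_def[abs_def] 1 \<xi>_def)
qed

text \<open>By \<open>infchr_gr\<close> infinitesimal characters are the linear maps vanishing on
  \<open>R\<close>. A basis of the span of \<open>R\<close> is extended to the whole space and
  \<open>\<pi>\<close> kills its part, so \<open>x - \<pi> x\<close> lies in that span.
  Precomposition with \<open>\<pi>\<close> thus projects all linear maps onto infinitesimal
  characters, continuously for pointwise convergence.\<close>

lemma infchr_projection:
 obtains \<pi> where "lin s s \<pi>" "\<And>\<phi>. lin s V \<phi> \<Longrightarrow> infchr (\<lambda>x. \<phi> (\<pi> x))" "\<And>\<phi> x. infchr \<phi> \<Longrightarrow> \<phi> (\<pi> x) = \<phi> x"
proof -
 define R where "R = insert 1 {x * y | x y n m. 0 < n \<and> 0 < m \<and> x \<in> gr n \<and> y \<in> gr m}"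
 obtain B0 where B0: "B0 \<subseteq> R" "vs.independent B0" "vs.span R = vs.span B0"
  using vs.maximal_independent_subset[of R] vs.span_mono vs.span_minimal vs.subspace_span
  by (metis subset_antisym)
 define B where "B = vs.extend_basis B0"
 have B: "B0 \<subseteq> B" "vs.independent B" "vs.span B = UNIV"
  unfolding B_def using vs.extend_basis_superset vs.independent_extend_basis vs.span_extend_basis B0(2) by auto
 interpret vp: vector_space_pair s s by unfold_locales
 obtain \<pi> where lin\<pi>: "Vector_Spaces.linear s s \<pi>" and \<pi>B: "\<forall>x\<in>B. \<pi> x = (if x \<in> B0 then 0 else x)"
  using vp.linear_independent_extend[OF B(2), of "\<lambda>x. if x \<in> B0 then 0 else x"] by blast
 have l: "lin s s \<pi>" using lin\<pi> by (simp add: linear_eq_lin vs.vector_space_axioms)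
 have z: "\<pi> x = 0" if "x \<in> vs.span R" for x
  using that unfolding B0(3)
 proof (induction rule: vs.span_induct_alt)
  case (step c x y) then show ?case using l \<pi>B B(1) by (auto simp: lin_def)
 qed (rule lin_zero[OF l])
 have c: "x - \<pi> x \<in> vs.span R" for x
 proof -
  have "x \<in> vs.span B" by (simp add: B)
  then show ?thesis
  proof (induction rule: vs.span_induct_alt)
   case base show ?case using lin_zero[OF l] vs.span_zero by simp
  next
   case (step c x y)
   have "x - \<pi> x \<in> vs.span R"
    using \<pi>B step(1) B0(1) vs.span_base[of x R] vs.span_zero by auto
   then have "s c (x - \<pi> x) + (y - \<pi> y) \<in> vs.span R" using step(2) vs.span_add vs.span_scale by blast
   moreover have "s c (x - \<pi> x) + (y - \<pi> y) = s c x + y - \<pi> (s c x + y)"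
    using l by (simp add: lin_def vs.scale_right_diff_distrib)
   ultimately show ?case by simp
  qed
 qed
 show thesis
 proof
  show "lin s s \<pi>" by (rule l)
  fix \<phi> assume "lin s V \<phi>"
  moreover have "\<pi> 1 = 0" by (intro z vs.span_base) (simp add: R_def)
  moreover have "\<pi> (x * y) = 0" if "0 < n" "0 < m" "x \<in> gr n" "y \<in> gr m" for n m x y
   by (intro z vs.span_base) (use that in "auto simp: R_def")
  ultimately show "infchr (\<lambda>x. \<phi> (\<pi> x))"
   unfolding infchr_gr using lin_compose[OF l] lin_zero[of s V \<phi>] by auto
 next
  fix \<phi> x assume \<phi>: "infchr \<phi>"
  then have l\<phi>: "lin s V \<phi>" by (simp add: infchr_def)
  have "\<phi> r = 0" if "r \<in> vs.span R" for r
   using that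
  proof (induction rule: vs.span_induct_alt)
   case (step c x y)
   have "\<phi> x = 0" using \<phi> step(1) unfolding infchr_gr R_def by auto
   then show ?case using step(2) l\<phi> by (simp add: lin_def)
  qed (rule lin_zero[OF l\<phi>])
  from this[OF c[of x]] show "\<phi> (\<pi> x) = \<phi> x" using lin_diff[OF l\<phi>] by simp
 qed
qed

end

section \<open>Curves\<close>

text \<open>No point is isolated, which makes derivatives of curves unique.\<close>

definition curve_domain :: "real set \<Rightarrow> bool" where
 "curve_domain J \<longleftrightarrow> (\<forall>t\<in>J. at t within J \<noteq> bot)"

lemma curve_domain_Icc: "curve_domain {0..1}"
 unfolding curve_domain_def by (auto simp: at_within_Icc_at_left at_within_Icc_at_right trivial_limit_within islimpt_Icc)

lemma at_within_relopen:
 assumes "openin (top_of_set I) J" "t \<in> J" shows "at t within J = at t within I"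
proof -
 obtain T where T: "open T" "J = I \<inter> T" using assms(1) by (auto simp: openin_open)
 show ?thesis by (rule at_within_nhd[of _ T]) (use T assms(2) in auto)
qed

lemma curve_domain_relopen: "openin (top_of_set {0..1}) J \<Longrightarrow> curve_domain J"
 unfolding curve_domain_def
proof
 fix t assume J: "openin (top_of_set {0..1}) J" and t: "t \<in> J"
 have "t \<in> {0..1}" using openin_imp_subset[OF J] t by blast
 then show "at t within J \<noteq> bot" using curve_domain_Icc at_within_relopen[OF J t] unfolding curve_domain_def by simp
qed

lemma continuous_map_top_of_set_iff:
 "continuous_map (top_of_set J) X c \<longleftrightarrow> (\<forall>t\<in>J. limitin X c (c t) (at t within J))"
proof -
 have "limitin X c (c t) (atin (top_of_set J) t) \<longleftrightarrow> limitin X c (c t) (at t within J)" if "t \<in> J" for t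
 proof -
  have "eventually P (atin (top_of_set J) t) \<longleftrightarrow> eventually P (at t within J)" for P
   using that by (simp add: atin_subtopology_within eventually_atin_within eventually_at_topological) blast
  then show ?thesis by (simp add: limitin_def)
 qed
 then show ?thesis by (simp add: continuous_map_atin)
qed

lemma has_curve_deriv_cong:
 assumes "\<And>s. s \<in> J \<Longrightarrow> c s = d s" "t \<in> J"
 shows "has_curve_deriv E J c t y \<longleftrightarrow> has_curve_deriv E J d t y"
proof -
 have "eventually (\<lambda>s. s \<in> J) (at t within J)" by (simp add: eventually_at_filter)
 then have ev: "eventually (\<lambda>s. smul E (of_real (inverse (s - t))) (c s - c t) = smul E (of_real (inverse (s - t))) (d s - d t)) (at t within J)"
  by eventually_elim (simp add: assms)
 then have ev': "eventually (\<lambda>s. smul E (of_real (inverse (s - t))) (d s - d t) = smul E (of_real (inverse (s - t))) (c s - c t)) (at t within J)"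
  by eventually_elim simp
 show ?thesis
  unfolding has_curve_deriv_def
  using limitin_transform_eventually[OF ev] limitin_transform_eventually[OF ev'] by blast
qed

lemma curve_time:
 "((\<lambda>s. of_real (s - t) :: 'k::real_normed_field) \<longlongrightarrow> 0) (at t within J)"
 "eventually (\<lambda>s. (of_real (s - t) :: 'k) \<noteq> 0) (at t within J)"
proof -
 show "((\<lambda>s. of_real (s - t) :: 'k) \<longlongrightarrow> 0) (at t within J)" by (auto intro!: tendsto_eq_intros)
 have "eventually (\<lambda>s. s \<noteq> t) (at t within J)" by (simp add: eventually_at_filter)
 then show "eventually (\<lambda>s. (of_real (s - t) :: 'k) \<noteq> 0) (at t within J)" by eventually_elim simp
qed

context lcs
begin

lemma curve_deriv_eq: "curve_domain J \<Longrightarrow> t \<in> J \<Longrightarrow> has_curve_deriv E J c t y \<Longrightarrow> curve_deriv E J c t = y"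
 unfolding curve_deriv_def
 by (rule the_equality) (auto simp: has_curve_deriv_def curve_domain_def intro: lim_unique)

lemma has_curve_deriv_add:
 "has_curve_deriv E J c t y \<Longrightarrow> has_curve_deriv E J d t z \<Longrightarrow> has_curve_deriv E J (\<lambda>s. c s + d s) t (y + z)"
 unfolding has_curve_deriv_def
 by (drule (1) lim_add) (simp add: algebra_simps vs.scale_right_diff_distrib vs.scale_right_distrib)

lemma has_curve_deriv_smul:
 "has_curve_deriv E J c t y \<Longrightarrow> has_curve_deriv E J (\<lambda>s. smul E a (c s)) t (smul E a y)"
 unfolding has_curve_deriv_def
 by (drule lim_smul[OF tendsto_const, of _ _ _ a]) (simp add: vs.scale_right_diff_distrib mult.commute)

lemma has_curve_deriv_diff:
 "has_curve_deriv E J c t y \<Longrightarrow> has_curve_deriv E J d t z \<Longrightarrow> has_curve_deriv E J (\<lambda>s. c s - d s) t (y - z)"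
 using has_curve_deriv_add[of J c t y "\<lambda>s. smul E (- 1) (d s)" "smul E (- 1) z"] has_curve_deriv_smul[of J d t z "- 1"] by simp

lemma has_curve_deriv_const: "has_curve_deriv E J (\<lambda>s. a) t 0"
 unfolding has_curve_deriv_def by simp

lemma has_curve_deriv_lim:
 assumes "has_curve_deriv E J c t y" "c t \<in> pts E"
 shows "tlim E c (c t) (at t within J)"
proof -
 interpret EE: lcs2 E E by (simp add: lcs2_def lcs_axioms)
 show ?thesis
  by (rule EE.lim_of_quotient[of "\<lambda>s. of_real (s - t)" c "c t" y])
   (use assms curve_time[where 'k = 'k] in "auto simp: has_curve_deriv_def")
qed

lemma iter_curve_deriv_Suc: "iter_curve_deriv E J (Suc k) c = curve_deriv E J (iter_curve_deriv E J k c)"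
 by (simp add: iter_curve_deriv_def)

lemma iter_curve_deriv_0: "iter_curve_deriv E J 0 c = c"
 by (simp add: iter_curve_deriv_def)

lemma Cr_curveD:
 assumes "Cr_curve E r J c" "curve_domain J" "enat k < r" "t \<in> J"
 shows "has_curve_deriv E J (iter_curve_deriv E J k c) t (iter_curve_deriv E J (Suc k) c t)"
proof -
 obtain y where y: "has_curve_deriv E J (iter_curve_deriv E J k c) t y"
  using assms unfolding Cr_curve_def by meson
 with curve_deriv_eq[OF assms(2,4) y] show ?thesis by (simp add: iter_curve_deriv_Suc)
qed

text \<open>The counterpart of \<open>smooth_on_family\<close> for curves: explicit candidates for
  the derivatives show differentiability and compute \<open>iter_curve_deriv\<close> at the same
  time.\<close>

lemma Cr_curve_family:
 assumes J: "curve_domain J" and C0: "\<And>t. t \<in> J \<Longrightarrow> C 0 t = c t"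
  and d: "\<And>k t. enat k < r \<Longrightarrow> t \<in> J \<Longrightarrow> has_curve_deriv E J (C k) t (C (Suc k) t)"
  and cont: "\<And>k. enat k \<le> r \<Longrightarrow> continuous_map (top_of_set J) (topol E) (C k)"
 shows "Cr_curve E r J c" "enat k \<le> r \<Longrightarrow> t \<in> J \<Longrightarrow> iter_curve_deriv E J k c t = C k t"
proof -
 have *: "\<forall>t\<in>J. iter_curve_deriv E J k c t = C k t" if "enat k \<le> r" for k
  using that
 proof (induction k)
  case 0 show ?case using C0 by (simp add: iter_curve_deriv_0)
 next
  case (Suc k)
  then have k: "enat k < r" using Suc_ile_eq by blast
  then have IH: "\<forall>t\<in>J. iter_curve_deriv E J k c t = C k t" using Suc.IH by simp
  show ?case
  proof
   fix t assume t: "t \<in> J"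
   have "has_curve_deriv E J (iter_curve_deriv E J k c) t (C (Suc k) t)"
    using d[OF k t] has_curve_deriv_cong[of J "iter_curve_deriv E J k c" "C k" t] IH t by blast
   then show "iter_curve_deriv E J (Suc k) c t = C (Suc k) t"
    unfolding iter_curve_deriv_Suc by (rule curve_deriv_eq[OF J t])
  qed
 qed
 then show "enat k \<le> r \<Longrightarrow> t \<in> J \<Longrightarrow> iter_curve_deriv E J k c t = C k t" by blast
 show "Cr_curve E r J c"
  unfolding Cr_curve_def
 proof (intro conjI allI impI ballI)
  fix k t assume k: "enat k < r" and t: "t \<in> J"
  have "has_curve_deriv E J (iter_curve_deriv E J k c) t (C (Suc k) t)"
   using d[OF k t] has_curve_deriv_cong[of J "iter_curve_deriv E J k c" "C k" t] *[OF less_imp_le[OF k]] t by blast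
  then show "\<exists>y. has_curve_deriv E J (iter_curve_deriv E J k c) t y" by blast
 next
  fix k assume "enat k \<le> r"
  from cont[OF this] show "continuous_map (top_of_set J) (topol E) (iter_curve_deriv E J k c)"
   by (rule continuous_map_eq) (use *[OF \<open>enat k \<le> r\<close>] in simp)
 qed
qed

text \<open>\<open>x + y\<close> is the midpoint of \<open>2x\<close> and \<open>2y\<close>, and
  \<open>x - y\<close> that of \<open>2x\<close> and \<open>-2y\<close>; this is why preimages of a
  convex set under the factors 2 and -2 are taken.\<close>

lemma half_nbhd:
 assumes "topen E U" "0 \<in> U"
 obtains C where "convex_nbhd E C" "0 \<in> C" "\<And>x y. x \<in> C \<Longrightarrow> y \<in> C \<Longrightarrow> x + y \<in> U"
  "\<And>x y. x \<in> C \<Longrightarrow> y \<in> C \<Longrightarrow> x - y \<in> U" "C \<subseteq> U"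
proof -
 obtain D where D: "convex_nbhd E D" "0 \<in> D" "D \<subseteq> U" using convex_nbhd_base[OF assms] .
 define C where "C = {x \<in> pts E. smul E 2 x \<in> D} \<inter> {x \<in> pts E. smul E (- 2) x \<in> D} \<inter> D"
 have half: "smul E (of_real (1/2)) (smul E 2 x) = x" "smul E (of_real (1 - 1/2)) (smul E 2 x) = x"
  "smul E (of_real (1 - 1/2)) (smul E (- 2) x) = - x" for x by simp_all
 show thesis
 proof
  show "convex_nbhd E C"
   unfolding C_def by (intro convex_nbhd_Int convex_nbhd_scale D(1))
  show "0 \<in> C" using D(2) by (simp add: C_def)
  show "x + y \<in> U" if "x \<in> C" "y \<in> C" for x y
  proof -
   have "smul E (of_real (1/2)) (smul E 2 x) + smul E (of_real (1 - 1/2)) (smul E 2 y) \<in> D"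
    by (rule convex_nbhdD[OF D(1)]) (use that in "simp_all add: C_def")
   then show ?thesis unfolding half using D(3) by blast
  qed
  show "x - y \<in> U" if "x \<in> C" "y \<in> C" for x y
  proof -
   have "smul E (of_real (1/2)) (smul E 2 x) + smul E (of_real (1 - 1/2)) (smul E (- 2) y) \<in> D"
    by (rule convex_nbhdD[OF D(1)]) (use that in "simp_all add: C_def")
   then show ?thesis unfolding half using D(3) by auto
  qed
  show "C \<subseteq> U" using D(3) by (auto simp: C_def)
 qed
qed

end

text \<open>With the scalars as a space of their own, scalar multiplication is a continuous bilinear
  map.\<close>

lemma lcs_scalars: "lcs \<lparr>smul = (*), topol = (euclidean :: 'k::real_normed_field topology)\<rparr>" (is "lcs ?K")
proof (rule lcs_of_limits)
 show "vector_space (smul ?K)" by unfold_locales (simp_all add: algebra_simps)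
 then interpret vector_space "smul ?K" .
 show "module.subspace (smul ?K) (pts ?K)" by (rule subspaceI) auto
 show "Hausdorff_space (topol ?K)" by (simp add: Hausdorff_space_euclidean)
next
 fix p :: "'k \<times> 'k"
 assume "fst p \<in> pts ?K" "snd p \<in> pts ?K"
 from atin_prod_limits[OF this] show "tlim ?K (\<lambda>q. fst q + snd q) (fst p + snd p) (atin (prod_topology (topol ?K) (topol ?K)) p)"
  by (auto intro: tendsto_add)
next
 fix p :: "'k \<times> 'k"
 assume "snd p \<in> pts ?K"
 from atin_prod_limits[OF _ this, of euclidean]
 show "tlim ?K (\<lambda>q. smul ?K (fst q) (snd q)) (smul ?K (fst p) (snd p)) (atin (prod_topology euclidean (topol ?K)) p)"
  by (auto intro: tendsto_mult)
next
 fix U :: "'k set" assume "topen ?K U" "0 \<in> U"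
 then obtain e where e: "e > 0" "ball 0 e \<subseteq> U" by (auto simp: open_contains_ball)
 have "convex_nbhd ?K (ball 0 e)"
  unfolding convex_nbhd_def
 proof (intro conjI ballI)
  fix x y :: 'k and t :: real assume *: "x \<in> ball 0 e" "y \<in> ball 0 e" "t \<in> {0..1}"
  have "norm (of_real t * x + of_real (1 - t) * y) \<le> t * norm x + (1 - t) * norm y"
   using * by (intro norm_triangle_le) (simp add: norm_mult del: of_real_diff)
  also have "\<dots> < e"
   using * by (intro convex_bound_lt) auto
  finally show "smul ?K (of_real t) x + smul ?K (of_real (1 - t)) y \<in> ball 0 e" by simp
 qed simp
 then show "\<exists>C. convex_nbhd ?K C \<and> 0 \<in> C \<and> C \<subseteq> U" using e by (intro exI[of _ "ball 0 e"]) auto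
qed

text \<open>Compactness of \<open>[0,1]\<close>, used through bisection: the neighbourhood that
  witnesses continuity of \<open>m\<close> at \<open>e t\<close> can be chosen independent of
  \<open>t\<close>.\<close>

lemma uniform_along_curve:
 assumes "lcs E" "lcs F" and m: "cont E F m"
  and e: "cont01 E e"
  and U: "topen F U" "0 \<in> U"
 obtains V where "topen E V" "0 \<in> V" "\<And>t v. t \<in> {0..1::real} \<Longrightarrow> v \<in> V \<Longrightarrow> m (e t + v) - m (e t) \<in> U"
proof -
 interpret E: lcs E by fact
 interpret F: lcs F by fact
 have ep: "e t \<in> pts E" if "t \<in> {0..1}" for t
  using e that by (auto simp: continuous_map_def Pi_iff)
 define P where "P a b \<longleftrightarrow> (\<exists>V. topen E V \<and> 0 \<in> V \<and> (\<forall>t\<in>{a..b} \<inter> {0..1}. \<forall>v\<in>V. m (e t + v) - m (e t) \<in> U))" for a b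
 have "P 0 1"
 proof (rule Bolzano)
  fix a b c :: real assume "P a b" "P b c" "a \<le> b" "b \<le> c"
  then obtain V W where "topen E V" "0 \<in> V" "\<forall>t\<in>{a..b} \<inter> {0..1}. \<forall>v\<in>V. m (e t + v) - m (e t) \<in> U"
   "topen E W" "0 \<in> W" "\<forall>t\<in>{b..c} \<inter> {0..1}. \<forall>v\<in>W. m (e t + v) - m (e t) \<in> U" unfolding P_def by blast
  note VW = this
  have "m (e t + v) - m (e t) \<in> U" if "t \<in> {a..c} \<inter> {0..1}" "v \<in> V \<inter> W" for t v
   using VW(3,6) that by (cases "t \<le> b") auto
  then show "P a c" unfolding P_def using VW by (intro exI[of _ "V \<inter> W"]) blast
 next
  fix x :: real assume "0 \<le> x" "x \<le> 1"
  then have x: "x \<in> {0..1}" by simp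
  obtain U' where U': "convex_nbhd F U'" "0 \<in> U'" "\<And>x y. x \<in> U' \<Longrightarrow> y \<in> U' \<Longrightarrow> x - y \<in> U"
   using F.half_nbhd[OF U] by metis
  have mx: "m (e x) \<in> pts F" using m ep[OF x] by (auto simp: continuous_map_def Pi_iff)
  define N where "N = {y \<in> pts E. m y \<in> {z \<in> pts F. z - m (e x) \<in> U'}}"
  have "topen E N"
   unfolding N_def by (rule openin_continuous_map_preimage[OF m F.openin_translate[OF F.convex_nbhd_open[OF U'(1)] mx]])
  then have N': "topen E {v \<in> pts E. v - (- e x) \<in> N}" using ep[OF x] by (intro E.openin_translate) auto
  have "0 \<in> {v \<in> pts E. v - (- e x) \<in> N}" using ep[OF x] mx U'(2) by (simp add: N_def)
  from E.half_nbhd[OF N' this] obtain V where V: "convex_nbhd E V" "0 \<in> V"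
   "\<And>u v. u \<in> V \<Longrightarrow> v \<in> V \<Longrightarrow> u + v \<in> {v \<in> pts E. v - (- e x) \<in> N}" by metis
  have "tlim E e (e x) (at x within {0..1})" using e x by (simp add: continuous_map_top_of_set_iff)
  then have "eventually (\<lambda>t. e t - e x \<in> V) (at x within {0..1})" unfolding E.lim_iff using V(1,2) by blast
  then obtain d where d: "d > 0" "\<And>t. t \<in> {0..1} \<Longrightarrow> t \<noteq> x \<Longrightarrow> dist t x < d \<Longrightarrow> e t - e x \<in> V"
   unfolding eventually_at by blast
  have dd: "e t - e x \<in> V" if "t \<in> {0..1}" "dist t x < d" for t
   using d(2)[OF that(1) _ that(2)] V(2) by (cases "t = x") auto
  have "P a b" if "a \<le> x \<and> x \<le> b \<and> b - a < d" for a b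
   unfolding P_def
  proof (intro exI[of _ V] conjI ballI)
   show "topen E V" by (rule E.convex_nbhd_open[OF V(1)])
   show "0 \<in> V" by (rule V(2))
   fix t v assume t: "t \<in> {a..b} \<inter> {0..1}" and v: "v \<in> V"
   have tV: "e t - e x \<in> V" using t that by (intro dd) (auto simp: dist_real_def)
   have "m (e t + v) - m (e x) \<in> U'" using V(3)[OF tV v] by (simp add: N_def algebra_simps)
   moreover have "m (e t) - m (e x) \<in> U'" using V(3)[OF tV V(2)] by (simp add: N_def)
   \<comment> \<open>Both values are compared with the one at the base point \<open>x\<close> of the
     short interval.\<close>
   ultimately have "(m (e t + v) - m (e x)) - (m (e t) - m (e x)) \<in> U" by (rule U'(3))
   then show "m (e t + v) - m (e t) \<in> U" by simp
  qed
  with d(1) show "\<exists>d>0. \<forall>a b. a \<le> x \<and> x \<le> b \<and> b - a < d \<longrightarrow> P a b" by blast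
 qed simp
 with that show thesis unfolding P_def by auto
qed

lemma cont_bilinear_smul:
 "lcs E \<Longrightarrow> cont_bilinear \<lparr>smul = (*), topol = euclidean\<rparr> E E (smul E)"
proof -
 assume "lcs E"
 then interpret E: lcs E .
 show ?thesis
 proof (rule cont_bilinearI)
  fix p assume "fst p \<in> pts \<lparr>smul = (*), topol = (euclidean::'a topology)\<rparr>" "snd p \<in> pts E"
  from atin_prod_limits[OF this]
  show "tlim E (\<lambda>q. smul E (fst q) (snd q)) (smul E (fst p) (snd p))
   (atin (prod_topology (topol \<lparr>smul = (*), topol = euclidean\<rparr>) (topol E)) p)"
   by (auto intro: E.lim_smul)
 qed (auto simp: E.vs.scale_left_distrib E.vs.scale_right_distrib mult.commute)
qed

text \<open>The limit curves have compact images, along which a continuous bilinear map is uniformly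
  continuous in the sense of \<open>uniform_along_curve\<close>.\<close>

lemma bilinear_uniform_lim:
 assumes "lcs E" "lcs F" "lcs G" and b: "cont_bilinear E F G b"
  and c: "cont01 E c" and d: "cont01 F d"
  and U: "topen G U" "0 \<in> U"
  and f: "\<And>V. topen E V \<Longrightarrow> 0 \<in> V \<Longrightarrow> eventually (\<lambda>s. \<forall>t\<in>{0..1}. f s t - c t \<in> V) H"
  and g: "\<And>V. topen F V \<Longrightarrow> 0 \<in> V \<Longrightarrow> eventually (\<lambda>s. \<forall>t\<in>{0..1::real}. g s t - d t \<in> V) H"
 shows "eventually (\<lambda>s. \<forall>t\<in>{0..1}. b (f s t) (g s t) - b (c t) (d t) \<in> U) H"
proof -
 have m: "continuous_map (topol (prod_tvs E F)) (topol G) (\<lambda>p. b (fst p) (snd p))"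
  using b by (simp add: cont_bilinear_def case_prod_beta')
 have e: "cont01 (prod_tvs E F) (\<lambda>t. (c t, d t))"
  using c d by (simp add: continuous_map_top_of_set_iff limitin_prod_iff)
 obtain V where V: "topen (prod_tvs E F) V" "0 \<in> V"
  "\<And>t v. t \<in> {0..1} \<Longrightarrow> v \<in> V \<Longrightarrow> b (fst ((c t, d t) + v)) (snd ((c t, d t) + v)) - b (fst (c t, d t)) (snd (c t, d t)) \<in> U"
  using uniform_along_curve[OF lcs_prod[OF assms(1,2)] assms(3) m e U] by metis
 obtain A B where AB: "topen E A" "topen F B" "0 \<in> A" "0 \<in> B" "A \<times> B \<subseteq> V"
  using openin_prod_zeroE V(1,2) unfolding tvs_simps by metis
 show ?thesis
  using f[OF AB(1,3)] g[OF AB(2,4)]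
 proof eventually_elim
  case (elim s)
  show ?case
  proof
   fix t :: real assume t: "t \<in> {0..1}"
   then have "(f s t - c t, g s t - d t) \<in> V" using elim AB(5) by auto
   from V(3)[OF t this] show "b (f s t) (g s t) - b (c t) (d t) \<in> U" by simp
  qed
 qed
qed

section \<open>Spaces of curves\<close>

abbreviation idc where "idc E k \<equiv> iter_curve_deriv E {0..1} k"

context lcs
begin

lemma Cr_curves_deriv:
 "c \<in> Cr_curves E r \<Longrightarrow> enat k < r \<Longrightarrow> t \<in> {0..1} \<Longrightarrow> deriv01 E (idc E k c) t (idc E (Suc k) c t)"
 unfolding Cr_curves_def using Cr_curveD[OF _ curve_domain_Icc] by blast

lemma Cr_curves_cont:
 "c \<in> Cr_curves E r \<Longrightarrow> enat k \<le> r \<Longrightarrow> cont01 E (idc E k c)"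
 unfolding Cr_curves_def Cr_curve_def by blast

lemma Cr_curves_idc_pts: "c \<in> Cr_curves E r \<Longrightarrow> enat k \<le> r \<Longrightarrow> t \<in> {0..1} \<Longrightarrow> idc E k c t \<in> pts E"
 using Cr_curves_cont[of c r k] by (auto simp: continuous_map_def Pi_iff)

lemma Cr_curves_pts: "c \<in> Cr_curves E r \<Longrightarrow> c t \<in> pts E"
 using Cr_curves_idc_pts[of c r 0 t] by (cases "t \<in> {0..1}") (auto simp: iter_curve_deriv_0 Cr_curves_def simp flip: zero_enat_def)

lemma Cr_curves_family:
 assumes "\<And>t. t \<notin> {0..1} \<Longrightarrow> c t = 0" "\<And>t. t \<in> {0..1} \<Longrightarrow> C 0 t = c t"
  and "\<And>k t. enat k < r \<Longrightarrow> t \<in> {0..1} \<Longrightarrow> deriv01 E (C k) t (C (Suc k) t)"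
  and "\<And>k. enat k \<le> r \<Longrightarrow> cont01 E (C k)"
 shows "c \<in> Cr_curves E r" "enat k \<le> r \<Longrightarrow> t \<in> {0..1} \<Longrightarrow> idc E k c t = C k t"
 using Cr_curve_family[OF curve_domain_Icc, of C c r] assms by (auto simp: Cr_curves_def)

lemma Cr_curves_zero: "0 \<in> Cr_curves E r" "enat k \<le> r \<Longrightarrow> t \<in> {0..1} \<Longrightarrow> idc E k 0 t = 0"
 using Cr_curves_family[of 0 "\<lambda>k t. 0" r] has_curve_deriv_const by auto

lemma Cr_curves_add:
 assumes "c \<in> Cr_curves E r" "d \<in> Cr_curves E r"
 shows "c + d \<in> Cr_curves E r" "enat k \<le> r \<Longrightarrow> t \<in> {0..1} \<Longrightarrow> idc E k (c + d) t = idc E k c t + idc E k d t"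
proof -
 have cont: "cont01 E (\<lambda>t. idc E k c t + idc E k d t)" if "enat k \<le> r" for k
  using Cr_curves_cont[OF assms(1) that] Cr_curves_cont[OF assms(2) that]
  unfolding continuous_map_top_of_set_iff by (simp add: lim_add)
 note fam = Cr_curves_family[of "c + d" "\<lambda>k t. idc E k c t + idc E k d t" r, OF _ _ has_curve_deriv_add[OF Cr_curves_deriv[OF assms(1)] Cr_curves_deriv[OF assms(2)]] cont]
 show "c + d \<in> Cr_curves E r" by (rule fam(1)) (use assms in "auto simp: iter_curve_deriv_0 Cr_curves_def")
 show "enat k \<le> r \<Longrightarrow> t \<in> {0..1} \<Longrightarrow> idc E k (c + d) t = idc E k c t + idc E k d t"
  by (rule fam(2)) (use assms in "auto simp: iter_curve_deriv_0 Cr_curves_def")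
qed

lemma Cr_curves_smul:
 assumes "c \<in> Cr_curves E r"
 shows "(\<lambda>t. smul E a (c t)) \<in> Cr_curves E r" "enat k \<le> r \<Longrightarrow> t \<in> {0..1} \<Longrightarrow> idc E k (\<lambda>t. smul E a (c t)) t = smul E a (idc E k c t)"
proof -
 have cont: "cont01 E (\<lambda>t. smul E a (idc E k c t))" if "enat k \<le> r" for k
  using Cr_curves_cont[OF assms(1) that]
  unfolding continuous_map_top_of_set_iff by (simp add: lim_smul)
 note fam = Cr_curves_family[of "\<lambda>t. smul E a (c t)" "\<lambda>k t. smul E a (idc E k c t)" r, OF _ _ has_curve_deriv_smul[OF Cr_curves_deriv[OF assms(1)]] cont]
 show "(\<lambda>t. smul E a (c t)) \<in> Cr_curves E r" by (rule fam(1)) (use assms in "auto simp: iter_curve_deriv_0 Cr_curves_def")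
 show "enat k \<le> r \<Longrightarrow> t \<in> {0..1} \<Longrightarrow> idc E k (\<lambda>t. smul E a (c t)) t = smul E a (idc E k c t)"
  by (rule fam(2)) (use assms in "auto simp: iter_curve_deriv_0 Cr_curves_def")
qed

lemma Cr_curves_diff:
 assumes "c \<in> Cr_curves E r" "d \<in> Cr_curves E r"
 shows "c - d \<in> Cr_curves E r" "enat k \<le> r \<Longrightarrow> t \<in> {0..1} \<Longrightarrow> idc E k (c - d) t = idc E k c t - idc E k d t"
proof -
 have e: "c - d = c + (\<lambda>t. smul E (- 1) (d t))" by (simp add: fun_eq_iff)
 note s = Cr_curves_smul[OF assms(2), where a = "- 1"]
 show "c - d \<in> Cr_curves E r" unfolding e by (rule Cr_curves_add(1)[OF assms(1) s(1)])
 show "enat k \<le> r \<Longrightarrow> t \<in> {0..1} \<Longrightarrow> idc E k (c - d) t = idc E k c t - idc E k d t"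
  unfolding e using Cr_curves_add(2)[OF assms(1) s(1)] s(2) by simp
qed

text \<open>Basic neighbourhoods of a curve need not be open. The curves whose deviations stay in
  \<open>U\<close> with a margin \<open>V\<close> uniform in time form an open set inside
  them.\<close>

definition curve_core :: "enat \<Rightarrow> nat \<Rightarrow> 'e set \<Rightarrow> (real \<Rightarrow> 'e) \<Rightarrow> (real \<Rightarrow> 'e) set" where
 "curve_core r k U c = {d \<in> Cr_curves E r. \<exists>V. topen E V \<and> 0 \<in> V \<and>
   (\<forall>j\<le>k. \<forall>t\<in>{0..1}. \<forall>v\<in>V. (idc E j d t - idc E j c t) + v \<in> U)}"

lemma curve_core:
 assumes k: "enat k \<le> r" and U: "topen E U" "0 \<in> U" and c: "c \<in> Cr_curves E r"
 shows "Cr_curves_open E r (curve_core r k U c)" "c \<in> curve_core r k U c"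
  "curve_core r k U c \<subseteq> Cr_curves_nbhd E r k U c"
proof -
 show "c \<in> curve_core r k U c" using U c by (auto simp: curve_core_def)
 show "curve_core r k U c \<subseteq> Cr_curves_nbhd E r k U c"
 proof
  fix d assume "d \<in> curve_core r k U c"
  then obtain V where V: "d \<in> Cr_curves E r" "0 \<in> V"
   "\<And>j t v. j \<le> k \<Longrightarrow> t \<in> {0..1} \<Longrightarrow> v \<in> V \<Longrightarrow> (idc E j d t - idc E j c t) + v \<in> U"
   unfolding curve_core_def by blast
  from V(3)[OF _ _ V(2)] have "idc E j d t - idc E j c t \<in> U" if "j \<le> k" "t \<in> {0..1}" for j t
   using that by simp
  then show "d \<in> Cr_curves_nbhd E r k U c" using V(1) by (simp add: Cr_curves_nbhd_def)
 qed
 show "Cr_curves_open E r (curve_core r k U c)"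
  unfolding Cr_curves_open_def
 proof (intro conjI ballI)
  show "curve_core r k U c \<subseteq> Cr_curves E r" by (auto simp: curve_core_def)
  fix d assume "d \<in> curve_core r k U c"
  then obtain V where V: "topen E V" "0 \<in> V" "\<And>j t v. j \<le> k \<Longrightarrow> t \<in> {0..1} \<Longrightarrow> v \<in> V \<Longrightarrow> (idc E j d t - idc E j c t) + v \<in> U"
   by (auto simp: curve_core_def)
  obtain W where W: "convex_nbhd E W" "0 \<in> W" "\<And>x y. x \<in> W \<Longrightarrow> y \<in> W \<Longrightarrow> x + y \<in> V"
   using half_nbhd[OF V(1,2)] by metis
  note oW = convex_nbhd_open[OF W(1)]
  have "Cr_curves_nbhd E r k W d \<subseteq> curve_core r k U c"
  proof
   fix e assume e: "e \<in> Cr_curves_nbhd E r k W d"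
   have "(idc E j e t - idc E j c t) + v \<in> U" if "j \<le> k" "t \<in> {0..1}" "v \<in> W" for j t v
   proof -
    have "idc E j e t - idc E j d t \<in> W" using e that by (simp add: Cr_curves_nbhd_def)
    from V(3)[OF that(1,2) W(3)[OF this that(3)]] show ?thesis by (simp add: algebra_simps)
   qed
   then show "e \<in> curve_core r k U c" using e oW W(2) by (auto simp: curve_core_def Cr_curves_nbhd_def)
  qed
  show "\<exists>k' U'. enat k' \<le> r \<and> topen E U' \<and> 0 \<in> U' \<and> Cr_curves_nbhd E r k' U' d \<subseteq> curve_core r k U c"
   using k oW W(2) \<open>Cr_curves_nbhd E r k W d \<subseteq> curve_core r k U c\<close> by blast
 qed
qed

lemma pts_curve_space: "pts (Cr_curve_space E r) = Cr_curves E r"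
 by (rule pts_Cr_curve_space[OF lcs])

text \<open>A basic neighbourhood involves finitely many orders of derivatives, so uniform
  convergence of each derivative separately is enough.\<close>

lemma lim_curve_iff:
 "tlim (Cr_curve_space E r) f l G \<longleftrightarrow>
   l \<in> Cr_curves E r \<and> eventually (\<lambda>s. f s \<in> Cr_curves E r) G \<and>
   (\<forall>k U. enat k \<le> r \<longrightarrow> topen E U \<longrightarrow> 0 \<in> U \<longrightarrow>
    eventually (\<lambda>s. \<forall>t\<in>{0..1}. idc E k (f s) t - idc E k l t \<in> U) G)"
proof
 assume L: "tlim (Cr_curve_space E r) f l G"
 then have l: "l \<in> Cr_curves E r" using limitin_topspace pts_curve_space by metis
 have ev: "eventually (\<lambda>s. f s \<in> Cr_curves E r) G" using limitin_in_topspace[OF L] pts_curve_space by simp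
 have "eventually (\<lambda>s. \<forall>t\<in>{0..1}. idc E k (f s) t - idc E k l t \<in> U) G"
  if k: "enat k \<le> r" and U: "topen E U" "0 \<in> U" for k U
 proof -
  note core = curve_core[OF k U l]
  have "topen (Cr_curve_space E r) (curve_core r k U l)" using core(1) by (simp add: openin_Cr_curve_space)
  from limitinD[OF L this core(2)] show ?thesis
   by eventually_elim (use core(3) in "auto simp: Cr_curves_nbhd_def")
 qed
 with l ev show "l \<in> Cr_curves E r \<and> eventually (\<lambda>s. f s \<in> Cr_curves E r) G \<and>
   (\<forall>k U. enat k \<le> r \<longrightarrow> topen E U \<longrightarrow> 0 \<in> U \<longrightarrow>
    eventually (\<lambda>s. \<forall>t\<in>{0..1}. idc E k (f s) t - idc E k l t \<in> U) G)" by blast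
next
 assume R: "l \<in> Cr_curves E r \<and> eventually (\<lambda>s. f s \<in> Cr_curves E r) G \<and>
   (\<forall>k U. enat k \<le> r \<longrightarrow> topen E U \<longrightarrow> 0 \<in> U \<longrightarrow>
    eventually (\<lambda>s. \<forall>t\<in>{0..1}. idc E k (f s) t - idc E k l t \<in> U) G)"
 show "tlim (Cr_curve_space E r) f l G"
  unfolding limitin_def pts_curve_space
 proof (intro conjI allI impI)
  fix W assume "topen (Cr_curve_space E r) W \<and> l \<in> W"
  then have "Cr_curves_open E r W" "l \<in> W" by (simp_all add: openin_Cr_curve_space)
  then obtain k U where kU: "enat k \<le> r" "topen E U" "0 \<in> U" "Cr_curves_nbhd E r k U l \<subseteq> W"
   unfolding Cr_curves_open_def by meson
  have "enat j \<le> r" if "j \<in> {..k}" for j using that kU(1) by (meson atMost_iff enat_ord_simps(1) order_trans)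
  then have "\<forall>j\<in>{..k}. eventually (\<lambda>s. \<forall>t\<in>{0..1}. idc E j (f s) t - idc E j l t \<in> U) G" using R kU(2,3) by blast
  then have "eventually (\<lambda>s. \<forall>j\<in>{..k}. \<forall>t\<in>{0..1}. idc E j (f s) t - idc E j l t \<in> U) G"
   by (simp add: eventually_ball_finite)
  moreover have "eventually (\<lambda>s. f s \<in> Cr_curves E r) G" using R by blast
  ultimately show "eventually (\<lambda>s. f s \<in> W) G"
   by eventually_elim (use kU(4) in "auto simp: Cr_curves_nbhd_def")
 qed (use R in blast)
qed

lemma smul_curve_space: "smul (Cr_curve_space E r) = (\<lambda>a c t. smul E a (c t))"
 by (simp add: Cr_curve_space_def)

lemma eval_lim:
 assumes L: "tlim (Cr_curve_space E r) f l G" shows "tlim E (\<lambda>s. f s t) (l t) G"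
proof (cases "t \<in> {0..1}")
 case True
 have l: "l t \<in> pts E" using L Cr_curves_pts unfolding lim_curve_iff by blast
 show ?thesis
  unfolding lim_iff
 proof (intro conjI allI impI l)
  fix C assume C: "convex_nbhd E C \<and> 0 \<in> C"
  have "eventually (\<lambda>s. \<forall>t\<in>{0..1}. idc E 0 (f s) t - idc E 0 l t \<in> C) G"
   using L C convex_nbhd_open unfolding lim_curve_iff by (simp flip: zero_enat_def)
  then show "eventually (\<lambda>s. f s t - l t \<in> C) G"
   by eventually_elim (use True in "simp add: iter_curve_deriv_0")
 qed
next
 case False
 have "l t = 0" using L False unfolding lim_curve_iff Cr_curves_def by blast
 moreover have "eventually (\<lambda>s. f s t = 0) G"
  using L False unfolding lim_curve_iff Cr_curves_def by (auto elim: eventually_mono)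
 ultimately show ?thesis by (simp add: limitin_eventually)
qed

end

lemma lcs_curve_space:
 assumes "lcs E" shows "lcs (Cr_curve_space E r)"
proof -
 interpret E: lcs E by fact
 let ?X = "Cr_curve_space E r"
 note [simp] = E.pts_curve_space E.smul_curve_space
 have vsX: "vector_space (smul ?X)" by (simp add: vector_space_pow[OF E.vs.vector_space_axioms])
 interpret X: vector_space "smul ?X" by (rule vsX)
 have sub: "X.subspace (pts ?X)"
  by (rule X.subspaceI) (auto simp: E.Cr_curves_zero E.Cr_curves_add E.Cr_curves_smul)
 show ?thesis
 proof (rule lcs_of_limits[OF vsX sub])
  show "Hausdorff_space (topol ?X)"
   unfolding Hausdorff_space_def
  proof (intro allI impI)
   fix c d assume cd: "c \<in> pts ?X \<and> d \<in> pts ?X \<and> c \<noteq> d"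
   then obtain t where t: "c t \<noteq> d t" by (auto simp: fun_eq_iff)
   have cont: "continuous_map (topol ?X) (topol E) (\<lambda>c. c t)"
    unfolding continuous_map_atin using E.eval_lim[OF limitin_atin_id] by blast
   have "c t \<in> pts E" "d t \<in> pts E" using cd E.Cr_curves_pts by auto
   then obtain U V where UV: "topen E U" "topen E V" "c t \<in> U" "d t \<in> V" "disjnt U V"
    using E.hausdorff t unfolding Hausdorff_space_def by meson
   show "\<exists>U V. topen ?X U \<and> topen ?X V \<and> c \<in> U \<and> d \<in> V \<and> disjnt U V"
    by (intro exI[of _ "{c \<in> pts ?X. c t \<in> U}"] exI[of _ "{c \<in> pts ?X. c t \<in> V}"] conjI
      openin_continuous_map_preimage[OF cont] UV) (use cd UV in "auto simp: disjnt_def")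
  qed
 next
  fix p :: "(real \<Rightarrow> 'b) \<times> (real \<Rightarrow> 'b)"
  let ?H = "atin (prod_topology (topol ?X) (topol ?X)) p"
  assume p: "fst p \<in> pts ?X" "snd p \<in> pts ?X"
  from atin_prod_limits[OF p] have L: "tlim ?X fst (fst p) ?H" "tlim ?X snd (snd p) ?H" by auto
  note L' = L[unfolded E.lim_curve_iff]
  have ev: "eventually (\<lambda>q. fst q \<in> Cr_curves E r) ?H" "eventually (\<lambda>q. snd q \<in> Cr_curves E r) ?H" using L' by blast+
  show "tlim ?X (\<lambda>q. fst q + snd q) (fst p + snd p) ?H"
   unfolding E.lim_curve_iff
  proof (intro conjI allI impI)
   show "fst p + snd p \<in> Cr_curves E r" using p E.Cr_curves_add by simp
   show "eventually (\<lambda>q. fst q + snd q \<in> Cr_curves E r) ?H" using ev by eventually_elim (rule E.Cr_curves_add)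
   fix k U assume k: "enat k \<le> r" and U: "topen E U" "0 \<in> U"
   obtain V where V: "convex_nbhd E V" "0 \<in> V" "\<And>x y. x \<in> V \<Longrightarrow> y \<in> V \<Longrightarrow> x + y \<in> U"
    using E.half_nbhd[OF U] by metis
   have "eventually (\<lambda>q. \<forall>t\<in>{0..1}. idc E k (fst q) t - idc E k (fst p) t \<in> V) ?H"
    "eventually (\<lambda>q. \<forall>t\<in>{0..1}. idc E k (snd q) t - idc E k (snd p) t \<in> V) ?H"
    using L' k V(2) E.convex_nbhd_open[OF V(1)] by blast+
   then show "eventually (\<lambda>q. \<forall>t\<in>{0..1}. idc E k (fst q + snd q) t - idc E k (fst p + snd p) t \<in> U) ?H"
    using ev
   proof eventually_elim
    case (elim q)
    show ?case
    proof
     fix t :: real assume t: "t \<in> {0..1}"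
     have "(idc E k (fst q) t - idc E k (fst p) t) + (idc E k (snd q) t - idc E k (snd p) t) \<in> U"
      using elim t V(3) by blast
     then show "idc E k (fst q + snd q) t - idc E k (fst p + snd p) t \<in> U"
      using E.Cr_curves_add(2)[OF elim(3,4) k t] E.Cr_curves_add(2)[OF _ _ k t, of "fst p" "snd p"] p
      by (simp add: algebra_simps)
    qed
   qed
  qed
 next
  fix p :: "'a \<times> (real \<Rightarrow> 'b)"
  let ?H = "atin (prod_topology euclidean (topol ?X)) p"
  let ?K = "\<lparr>smul = (*), topol = (euclidean :: 'a topology)\<rparr>"
  assume p: "snd p \<in> pts ?X"
  from atin_prod_limits[OF _ p, of euclidean] have L: "(fst \<longlongrightarrow> fst p) ?H" "tlim ?X snd (snd p) ?H" by auto
  note L' = L(2)[unfolded E.lim_curve_iff]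
  have ev: "eventually (\<lambda>q. snd q \<in> Cr_curves E r) ?H" using L' by blast
  show "tlim ?X (\<lambda>q. smul ?X (fst q) (snd q)) (smul ?X (fst p) (snd p)) ?H"
   unfolding E.lim_curve_iff
  proof (intro conjI allI impI)
   show "smul ?X (fst p) (snd p) \<in> Cr_curves E r" using p E.Cr_curves_smul by simp
   show "eventually (\<lambda>q. smul ?X (fst q) (snd q) \<in> Cr_curves E r) ?H" using ev by eventually_elim (simp add: E.Cr_curves_smul)
   fix k U assume k: "enat k \<le> r" and U: "topen E U" "0 \<in> U"
   \<comment> \<open>Scalar multiplication is applied to a constant curve of scalars; uniformity in
     \<open>t\<close> comes from the compact image of the derivative of
     \<open>snd p\<close>.\<close>
   have "eventually (\<lambda>q. \<forall>t\<in>{0..1}. smul E (fst q) (idc E k (snd q) t) - smul E (fst p) (idc E k (snd p) t) \<in> U) ?H"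
   proof (rule bilinear_uniform_lim[OF lcs_scalars assms assms cont_bilinear_smul[OF assms] _ _ U, where c = "\<lambda>t. fst p" and f = "\<lambda>q t. fst q"])
    show "cont01 E (idc E k (snd p))" using E.Cr_curves_cont p k by simp
    show "cont01 ?K (\<lambda>t. fst p)" by simp
    fix V assume V: "topen E V" "0 \<in> V"
    show "eventually (\<lambda>q. \<forall>t\<in>{0..1}. idc E k (snd q) t - idc E k (snd p) t \<in> V) ?H" using L' k V by blast
   next
    fix V assume V: "topen ?K V" "0 \<in> V"
    have "((\<lambda>q. fst q - fst p) \<longlongrightarrow> 0) ?H" using L(1) by (simp add: LIM_zero_iff)
    then have "eventually (\<lambda>q. fst q - fst p \<in> V) ?H" using V by (simp add: tendsto_def)
    then show "eventually (\<lambda>q. \<forall>t\<in>{0..1}. fst q - fst p \<in> V) ?H" by eventually_elim simp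
   qed
   then show "eventually (\<lambda>q. \<forall>t\<in>{0..1}. idc E k (smul ?X (fst q) (snd q)) t - idc E k (smul ?X (fst p) (snd p)) t \<in> U) ?H"
    using ev
   proof eventually_elim
    case (elim q)
    then show ?case using E.Cr_curves_smul(2)[OF elim(2) k] E.Cr_curves_smul(2)[OF _ k, of "snd p"] p by simp
   qed
  qed
 next
  fix U assume "topen ?X U" "0 \<in> U"
  then obtain k V where kV: "enat k \<le> r" "topen E V" "0 \<in> V" "Cr_curves_nbhd E r k V 0 \<subseteq> U"
   unfolding openin_Cr_curve_space Cr_curves_open_def by meson
  obtain C where C: "convex_nbhd E C" "0 \<in> C" "C \<subseteq> V" using E.convex_nbhd_base[OF kV(2,3)] .
  note core = E.curve_core[OF kV(1) E.convex_nbhd_open[OF C(1)] C(2) E.Cr_curves_zero(1)]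
  have jr: "enat j \<le> r" if "j \<le> k" for j using that kV(1) by (meson enat_ord_simps(1) order_trans)
  have "convex_nbhd ?X (E.curve_core r k C 0)"
   unfolding convex_nbhd_def
  proof (intro conjI ballI)
   show "topen ?X (E.curve_core r k C 0)" using core(1) by (simp add: openin_Cr_curve_space)
   fix x y and t :: real assume x: "x \<in> E.curve_core r k C 0" and y: "y \<in> E.curve_core r k C 0" and t: "t \<in> {0..1}"
   obtain A where A: "topen E A" "0 \<in> A" "\<And>j u v. j \<le> k \<Longrightarrow> u \<in> {0..1} \<Longrightarrow> v \<in> A \<Longrightarrow> idc E j x u + v \<in> C"
    using x E.Cr_curves_zero(2) jr unfolding E.curve_core_def by fastforce
   obtain B where B: "topen E B" "0 \<in> B" "\<And>j u v. j \<le> k \<Longrightarrow> u \<in> {0..1} \<Longrightarrow> v \<in> B \<Longrightarrow> idc E j y u + v \<in> C"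
    using y E.Cr_curves_zero(2) jr unfolding E.curve_core_def by fastforce
   have xy: "x \<in> Cr_curves E r" "y \<in> Cr_curves E r" using x y by (auto simp: E.curve_core_def)
   let ?z = "smul ?X (of_real t) x + smul ?X (of_real (1 - t)) y"
   have z: "?z \<in> Cr_curves E r" using xy E.Cr_curves_add E.Cr_curves_smul by simp
   \<comment> \<open>The margins of the two curves are intersected, and \<open>v\<close> is written
     as the convex combination of itself with itself.\<close>
   have "(idc E j ?z u - idc E j 0 u) + v \<in> C" if j: "j \<le> k" and u: "u \<in> {0..1}" and v: "v \<in> A \<inter> B" for j u v
   proof -
    have "smul E (of_real t) (idc E j x u + v) + smul E (of_real (1 - t)) (idc E j y u + v) \<in> C"
     using A(3)[OF j u, of v] B(3)[OF j u, of v] v t by (intro E.convex_nbhdD[OF C(1)]) auto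
    moreover have vv: "smul E (of_real t) v + smul E (of_real (1 - t)) v = v"
     by (simp flip: E.vs.scale_left_distrib of_real_add)
    have "smul E (of_real t) (idc E j x u) + smul E (of_real t) v + (smul E (of_real (1 - t)) (idc E j y u) + smul E (of_real (1 - t)) v)
     = (smul E (of_real t) (idc E j x u) + smul E (of_real (1 - t)) (idc E j y u)) + (smul E (of_real t) v + smul E (of_real (1 - t)) v)"
     by (simp only: add_ac)
    then have "smul E (of_real t) (idc E j x u + v) + smul E (of_real (1 - t)) (idc E j y u + v)
     = (smul E (of_real t) (idc E j x u) + smul E (of_real (1 - t)) (idc E j y u)) + v"
     unfolding E.vs.scale_right_distrib vv .
    moreover have "idc E j ?z u = smul E (of_real t) (idc E j x u) + smul E (of_real (1 - t)) (idc E j y u)"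
     using E.Cr_curves_add(2)[OF E.Cr_curves_smul(1)[OF xy(1)] E.Cr_curves_smul(1)[OF xy(2)] jr[OF j] u]
      E.Cr_curves_smul(2)[OF xy(1) jr[OF j] u] E.Cr_curves_smul(2)[OF xy(2) jr[OF j] u] by simp
    ultimately show ?thesis
     using E.Cr_curves_zero(2)[OF jr[OF j] u] by (simp only: diff_zero)
   qed
   moreover have "topen E (A \<inter> B)" "0 \<in> A \<inter> B" using A B by auto
   ultimately show "?z \<in> E.curve_core r k C 0" unfolding E.curve_core_def using z by blast
  qed
  moreover have "E.curve_core r k C 0 \<subseteq> U" using core(3) kV(4) C(3) unfolding Cr_curves_nbhd_def by blast
  ultimately show "\<exists>C. convex_nbhd ?X C \<and> 0 \<in> C \<and> C \<subseteq> U" using core(2) by blast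
 qed
qed

lemma enat_le_01: "enat k \<le> 0 \<longleftrightarrow> k = 0" "enat k \<le> 1 \<longleftrightarrow> k \<le> 1" "\<not> enat k < 0" "enat k < 1 \<longleftrightarrow> k = 0" "enat k = 0 \<longleftrightarrow> k = 0"
 by (auto simp: zero_enat_def one_enat_def)

lemma cont_linear_curves:
 assumes "lcs E" "lcs F" and L: "cont_linear E F L"
 shows "cont_linear (Cr_curve_space E r) (Cr_curve_space F r) (\<lambda>c t. L (c t))"
proof -
 interpret E: lcs E by fact
 interpret F: lcs F by fact
 have add: "L (x + y) = L x + L y" if "x \<in> pts E" "y \<in> pts E" for x y using L that unfolding cont_linear_def by blast
 have sc: "L (smul E a x) = smul F a (L x)" if "x \<in> pts E" for x a using L that unfolding cont_linear_def by blast
 have diff: "L (x - y) = L x - L y" if "x \<in> pts E" "y \<in> pts E" for x y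
  using add[of "x - y" y] that by simp
 have L0: "L 0 = 0" using add[of 0 0] by simp
 have d: "deriv01 F (\<lambda>t. L (c t)) t (L y)"
  if "deriv01 E c t y" "\<And>t. t \<in> {0..1} \<Longrightarrow> c t \<in> pts E" "t \<in> {0..1}" for c t y
  unfolding has_curve_deriv_def
 proof (rule limitin_transform_eventually)
  show "tlim F (\<lambda>s. L (smul E (of_real (inverse (s - t))) (c s - c t))) (L y) (at t within {0..1})"
   by (rule cont_linear_lim[OF L]) (use that in "simp add: has_curve_deriv_def")
  have "eventually (\<lambda>s. s \<in> {0..1}) (at t within {0..1})" by (simp add: eventually_at_filter)
  then show "\<forall>\<^sub>F s in at t within {0..1}. L (smul E (of_real (inverse (s - t))) (c s - c t)) = smul F (of_real (inverse (s - t))) (L (c s) - L (c t))"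
   by eventually_elim (use that(2,3) in "simp add: sc diff")
 qed
 have mem: "(\<lambda>t. L (c t)) \<in> Cr_curves F r" "\<And>k t. enat k \<le> r \<Longrightarrow> t \<in> {0..1} \<Longrightarrow> idc F k (\<lambda>t. L (c t)) t = L (idc E k c t)"
  if c: "c \<in> Cr_curves E r" for c
 proof -
  have 1: "L (c t) = 0" if "t \<notin> {0..1}" for t using c that L0 by (simp add: Cr_curves_def)
  have 2: "L (idc E 0 c t) = L (c t)" for t by (simp add: E.iter_curve_deriv_0)
  have 3: "deriv01 F (\<lambda>t. L (idc E k c t)) t (L (idc E (Suc k) c t))" if "enat k < r" "t \<in> {0..1}" for k t
   by (rule d[OF E.Cr_curves_deriv[OF c that] E.Cr_curves_idc_pts[OF c less_imp_le[OF that(1)]] that(2)])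
  have 4: "cont01 F (\<lambda>t. L (idc E k c t))" if "enat k \<le> r" for k
   using E.Cr_curves_cont[OF c that] unfolding continuous_map_top_of_set_iff using cont_linear_lim[OF L] by blast
  show "(\<lambda>t. L (c t)) \<in> Cr_curves F r" by (rule F.Cr_curves_family(1)[of _ "\<lambda>k t. L (idc E k c t)", OF 1 2 3 4])
  show "idc F k (\<lambda>t. L (c t)) t = L (idc E k c t)" if "enat k \<le> r" "t \<in> {0..1}" for k t
   by (rule F.Cr_curves_family(2)[of _ "\<lambda>k t. L (idc E k c t)", OF 1 2 3 4 that])
 qed
 show ?thesis
 proof (rule cont_linearI)
  fix c assume "c \<in> pts (Cr_curve_space E r)"
  then have c: "c \<in> Cr_curves E r" by (simp add: E.pts_curve_space)
  let ?G = "atin (topol (Cr_curve_space E r)) c"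
  have "tlim (Cr_curve_space E r) (\<lambda>d. d) c ?G" by (rule limitin_atin_id) (simp add: E.pts_curve_space c)
  note lim = this[unfolded E.lim_curve_iff]
  have ev: "eventually (\<lambda>d. d \<in> Cr_curves E r) ?G" using lim by blast
  show "tlim (Cr_curve_space F r) (\<lambda>c t. L (c t)) (\<lambda>t. L (c t)) ?G"
   unfolding F.lim_curve_iff
  proof (intro conjI allI impI mem(1)[OF c])
   show "eventually (\<lambda>d. (\<lambda>t. L (d t)) \<in> Cr_curves F r) ?G" using ev by eventually_elim (rule mem(1))
   fix k U assume k: "enat k \<le> r" and U: "topen F U" "0 \<in> U"
   define V where "V = {x \<in> pts E. L x \<in> U}"
   have "topen E V" unfolding V_def
    by (rule openin_continuous_map_preimage[OF _ U(1)]) (use L in "simp add: cont_linear_def")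
   moreover have "0 \<in> V" using U(2) L0 by (simp add: V_def)
   ultimately have "eventually (\<lambda>d. \<forall>t\<in>{0..1}. idc E k d t - idc E k c t \<in> V) ?G" using lim k by blast
   then show "eventually (\<lambda>d. \<forall>t\<in>{0..1}. idc F k (\<lambda>t. L (d t)) t - idc F k (\<lambda>t. L (c t)) t \<in> U) ?G"
    using ev
   proof eventually_elim
    case (elim d)
    then show ?case
     using mem(2)[OF elim(2) k] mem(2)[OF c k] E.Cr_curves_idc_pts[OF elim(2) k] E.Cr_curves_idc_pts[OF c k]
     by (simp add: V_def diff)
   qed
  qed
 next
  fix c d assume "c \<in> pts (Cr_curve_space E r)" "d \<in> pts (Cr_curve_space E r)"
  then have "c t \<in> pts E" "d t \<in> pts E" for t using E.Cr_curves_pts by (auto simp: E.pts_curve_space)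
  then show "(\<lambda>t. L ((c + d) t)) = (\<lambda>t. L (c t)) + (\<lambda>t. L (d t))" by (simp add: fun_eq_iff add)
 next
  fix a c assume "c \<in> pts (Cr_curve_space E r)"
  then have "c t \<in> pts E" for t using E.Cr_curves_pts by (auto simp: E.pts_curve_space)
  then show "(\<lambda>t. L (smul (Cr_curve_space E r) a c t)) = smul (Cr_curve_space F r) a (\<lambda>t. L (c t))"
   by (simp add: E.smul_curve_space F.smul_curve_space sc)
 qed
qed

lemma (in lcs) cont_linear_eval: "cont_linear (Cr_curve_space E r) E (\<lambda>c. c t)"
proof (rule cont_linearI)
 fix c assume "c \<in> pts (Cr_curve_space E r)"
 then show "tlim E (\<lambda>c. c t) (c t) (atin (topol (Cr_curve_space E r)) c)"
  by (rule eval_lim[OF limitin_atin_id])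
qed (auto simp: smul_curve_space)

lemma has_curve_deriv_bilinear:
 assumes "lcs E" "lcs F" "lcs G" and b: "cont_bilinear E F G b"
  and c: "has_curve_deriv E J c t c'" "\<And>t. t \<in> J \<Longrightarrow> c t \<in> pts E"
  and d: "has_curve_deriv F J d t d'" "\<And>t. t \<in> J \<Longrightarrow> d t \<in> pts F" and t: "t \<in> J"
 shows "has_curve_deriv G J (\<lambda>t. b (c t) (d t)) t (b c' (d t) + b (c t) d')"
proof -
 interpret E: lcs E by fact
 interpret F: lcs F by fact
 interpret G: lcs G by fact
 have add1: "b (x + x') y = b x y + b x' y" if "x \<in> pts E" "x' \<in> pts E" "y \<in> pts F" for x x' y
  using b that unfolding cont_bilinear_def by blast
 have add2: "b x (y + y') = b x y + b x y'" if "x \<in> pts E" "y' \<in> pts F" "y \<in> pts F" for x y y'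
  using b that unfolding cont_bilinear_def by blast
 have sc1: "b (smul E a x) y = smul G a (b x y)" if "x \<in> pts E" "y \<in> pts F" for x y a
  using b that unfolding cont_bilinear_def by blast
 have sc2: "b x (smul F a y) = smul G a (b x y)" if "x \<in> pts E" "y \<in> pts F" for x y a
  using b that unfolding cont_bilinear_def by blast
 have d1: "b (x - x') y = b x y - b x' y" if "x \<in> pts E" "x' \<in> pts E" "y \<in> pts F" for x x' y
  using add1[of "x - x'" x' y] that by simp
 have d2: "b x (y - y') = b x y - b x y'" if "x \<in> pts E" "y' \<in> pts F" "y \<in> pts F" for x y y'
  using add2[of x y' "y - y'"] that by simp
 have lims: "tlim E (\<lambda>s. smul E (of_real (inverse (s - t))) (c s - c t)) c' (at t within J)"
  "tlim F (\<lambda>s. smul F (of_real (inverse (s - t))) (d s - d t)) d' (at t within J)"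
  "tlim F d (d t) (at t within J)"
  using c(1) d(1) F.has_curve_deriv_lim[OF d(1) d(2)[OF t]] by (auto simp: has_curve_deriv_def)
 have L: "tlim G (\<lambda>s. b (smul E (of_real (inverse (s - t))) (c s - c t)) (d s) + b (c t) (smul F (of_real (inverse (s - t))) (d s - d t)))
   (b c' (d t) + b (c t) d') (at t within J)"
  by (intro G.lim_add cont_bilinear_lim[OF b] lims) (use c(2)[OF t] in simp)
 have "eventually (\<lambda>s. s \<in> J) (at t within J)" by (simp add: eventually_at_filter)
 then have "eventually (\<lambda>s. b (smul E (of_real (inverse (s - t))) (c s - c t)) (d s) + b (c t) (smul F (of_real (inverse (s - t))) (d s - d t))
   = smul G (of_real (inverse (s - t))) (b (c s) (d s) - b (c t) (d t))) (at t within J)"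
 proof eventually_elim
  case (elim s)
  have p: "c s \<in> pts E" "d s \<in> pts F" "c t \<in> pts E" "d t \<in> pts F" using elim t c(2) d(2) by auto
  then have "b (smul E (of_real (inverse (s - t))) (c s - c t)) (d s) = smul G (of_real (inverse (s - t))) (b (c s) (d s) - b (c t) (d s))"
   "b (c t) (smul F (of_real (inverse (s - t))) (d s - d t)) = smul G (of_real (inverse (s - t))) (b (c t) (d s) - b (c t) (d t))"
   by (simp_all add: sc1 sc2 d1 d2)
  then show ?case by (simp flip: G.vs.scale_right_distrib)
 qed
 from limitin_transform_eventually[OF this L] show ?thesis unfolding has_curve_deriv_def .
qed

text \<open>In the orders 0 and 1 the derivatives of the product curve are those listed in
  \<open>D\<close>, by the first order product rule.\<close>

lemma cont_bilinear_curves: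
 assumes "lcs E" "lcs F" "lcs G" and b: "cont_bilinear E F G b" and r: "r = 0 \<or> r = 1"
 shows "cont_bilinear (Cr_curve_space E r) (Cr_curve_space F r) (Cr_curve_space G r) (\<lambda>c d t. b (c t) (d t))"
proof -
 interpret E: lcs E by fact
 interpret F: lcs F by fact
 interpret G: lcs G by fact
 have b0: "b 0 y = 0" if "y \<in> pts F" for y using cont_bilinear_zero[OF assms(1-4) E.zero_pts that] by simp
 define D where "D = (\<lambda>c d k t. if k = (0::nat) then b (c t) (d t) else b (idc E 1 c t) (d t) + b (c t) (idc F 1 d t))"
 have mem: "(\<lambda>t. b (c t) (d t)) \<in> Cr_curves G r"
  "\<And>k t. enat k \<le> r \<Longrightarrow> t \<in> {0..1} \<Longrightarrow> idc G k (\<lambda>t. b (c t) (d t)) t = D c d k t"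
  if c: "c \<in> Cr_curves E r" and d: "d \<in> Cr_curves F r" for c d
 proof -
  have 1: "b (c t) (d t) = 0" if "t \<notin> {0..1}" for t using c F.Cr_curves_pts[OF d, of t] that b0 by (simp add: Cr_curves_def)
  have 2: "D c d 0 t = b (c t) (d t)" for t by (simp add: D_def)
  have 3: "deriv01 G (D c d k) t (D c d (Suc k) t)" if k: "enat k < r" and t: "t \<in> {0..1}" for k t
  proof -
   have k0: "k = 0" using r k by (auto simp: enat_le_01)
   have "deriv01 E c t (idc E 1 c t)" "deriv01 F d t (idc F 1 d t)"
    using E.Cr_curves_deriv[OF c k t] F.Cr_curves_deriv[OF d k t] by (simp_all add: k0 E.iter_curve_deriv_0 F.iter_curve_deriv_0)
   from has_curve_deriv_bilinear[OF assms(1-4) this(1) E.Cr_curves_pts[OF c] this(2) F.Cr_curves_pts[OF d] t]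
   show ?thesis by (simp add: k0 D_def)
  qed
  have 4: "cont01 G (D c d k)" if k: "enat k \<le> r" for k
  proof -
   have c0: "cont01 E c" "cont01 F d"
    using E.Cr_curves_cont[OF c, of 0] F.Cr_curves_cont[OF d, of 0]
    by (simp_all add: E.iter_curve_deriv_0 F.iter_curve_deriv_0 flip: zero_enat_def)
   show ?thesis
   proof (cases "k = 0")
    case True
    then show ?thesis using c0 by (simp add: D_def continuous_map_top_of_set_iff cont_bilinear_lim[OF b])
   next
    case False
    then have k1: "k = 1" "enat 1 \<le> r" using r k by (auto simp: enat_le_01)
    then show ?thesis using c0 E.Cr_curves_cont[OF c k1(2)] F.Cr_curves_cont[OF d k1(2)]
     by (simp add: D_def continuous_map_top_of_set_iff cont_bilinear_lim[OF b] G.lim_add)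
   qed
  qed
  show "(\<lambda>t. b (c t) (d t)) \<in> Cr_curves G r"
   by (rule G.Cr_curves_family(1)[where C = "D c d"]) (assumption | rule 1 2 3 4)+
  show "idc G k (\<lambda>t. b (c t) (d t)) t = D c d k t" if "enat k \<le> r" "t \<in> {0..1}" for k t
   by (rule G.Cr_curves_family(2)[where C = "D c d"]) (assumption | rule 1 2 3 4 that)+
 qed
 show ?thesis
 proof (rule cont_bilinearI)
  fix p assume "fst p \<in> pts (Cr_curve_space E r)" "snd p \<in> pts (Cr_curve_space F r)"
  note p = this this[unfolded E.pts_curve_space F.pts_curve_space]
  let ?H = "atin (prod_topology (topol (Cr_curve_space E r)) (topol (Cr_curve_space F r))) p"
  note L = atin_prod_limits[OF p(1,2)]
  note LE = L(1)[unfolded E.lim_curve_iff] and LF = L(2)[unfolded F.lim_curve_iff]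
  have ev: "eventually (\<lambda>q. fst q \<in> Cr_curves E r) ?H" "eventually (\<lambda>q. snd q \<in> Cr_curves F r) ?H" using LE LF by blast+
  have uni: "eventually (\<lambda>q. \<forall>t\<in>{0..1}. b (idc E i (fst q) t) (idc F j (snd q) t) - b (idc E i (fst p) t) (idc F j (snd p) t) \<in> U) ?H"
   if "enat i \<le> r" "enat j \<le> r" and U: "topen G U" "0 \<in> U" for i j U
  proof (rule bilinear_uniform_lim[OF assms(1-4) _ _ U])
   show "cont01 E (idc E i (fst p))" using E.Cr_curves_cont p that by blast
   show "cont01 F (idc F j (snd p))" using F.Cr_curves_cont p that by blast
   show "eventually (\<lambda>q. \<forall>t\<in>{0..1}. idc E i (fst q) t - idc E i (fst p) t \<in> V) ?H" if "topen E V" "0 \<in> V" for V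
    using LE that \<open>enat i \<le> r\<close> by blast
   show "eventually (\<lambda>q. \<forall>t\<in>{0..1}. idc F j (snd q) t - idc F j (snd p) t \<in> V) ?H" if "topen F V" "0 \<in> V" for V
    using LF that \<open>enat j \<le> r\<close> by blast
  qed
  show "tlim (Cr_curve_space G r) (\<lambda>q t. b (fst q t) (snd q t)) (\<lambda>t. b (fst p t) (snd p t)) ?H"
   unfolding G.lim_curve_iff
  proof (intro conjI allI impI)
   show "(\<lambda>t. b (fst p t) (snd p t)) \<in> Cr_curves G r" using mem(1) p by blast
   show "eventually (\<lambda>q. (\<lambda>t. b (fst q t) (snd q t)) \<in> Cr_curves G r) ?H" using ev by eventually_elim (rule mem(1))
   fix k U assume k: "enat k \<le> r" and U: "topen G U" "0 \<in> U"
   have r0: "enat 0 \<le> r" by (simp flip: zero_enat_def)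
   have "eventually (\<lambda>q. \<forall>t\<in>{0..1}. D (fst q) (snd q) k t - D (fst p) (snd p) k t \<in> U) ?H"
   proof (cases "k = 0")
    case True
    then show ?thesis using uni[OF r0 r0 U] by (simp add: D_def E.iter_curve_deriv_0 F.iter_curve_deriv_0)
   next
    case False
    then have k1: "k = 1" "enat 1 \<le> r" using r k False by (auto simp: enat_le_01)
    obtain V where V: "convex_nbhd G V" "0 \<in> V" "\<And>x y. x \<in> V \<Longrightarrow> y \<in> V \<Longrightarrow> x + y \<in> U"
     using G.half_nbhd[OF U] by metis
    show ?thesis
     using uni[OF k1(2) r0 G.convex_nbhd_open[OF V(1)] V(2)] uni[OF r0 k1(2) G.convex_nbhd_open[OF V(1)] V(2)]
    proof eventually_elim
     case (elim q)
     show ?case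
     proof
      fix t :: real assume t: "t \<in> {0..1}"
      have "(b (idc E 1 (fst q) t) (idc F 0 (snd q) t) - b (idc E 1 (fst p) t) (idc F 0 (snd p) t)) +
       (b (idc E 0 (fst q) t) (idc F 1 (snd q) t) - b (idc E 0 (fst p) t) (idc F 1 (snd p) t)) \<in> U"
       using elim t V(3) by blast
      then show "D (fst q) (snd q) k t - D (fst p) (snd p) k t \<in> U"
       using k1 by (simp add: D_def E.iter_curve_deriv_0 F.iter_curve_deriv_0 algebra_simps)
     qed
    qed
   qed
   then show "eventually (\<lambda>q. \<forall>t\<in>{0..1}. idc G k (\<lambda>t. b (fst q t) (snd q t)) t - idc G k (\<lambda>t. b (fst p t) (snd p t)) t \<in> U) ?H"
    using ev
   proof eventually_elim
    case (elim q)
    then show ?case using mem(2)[OF elim(2,3) k] mem(2)[OF p(3,4) k] by simp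
   qed
  qed
 next
  fix c c' d assume *: "c \<in> pts (Cr_curve_space E r)" "c' \<in> pts (Cr_curve_space E r)" "d \<in> pts (Cr_curve_space F r)"
  then have "c t \<in> pts E" "c' t \<in> pts E" "d t \<in> pts F" for t using E.Cr_curves_pts F.Cr_curves_pts by (auto simp: E.pts_curve_space F.pts_curve_space)
  then show "(\<lambda>t. b ((c + c') t) (d t)) = (\<lambda>t. b (c t) (d t)) + (\<lambda>t. b (c' t) (d t))"
   using b unfolding cont_bilinear_def by (simp add: fun_eq_iff)
 next
  fix c d d' assume *: "c \<in> pts (Cr_curve_space E r)" "d \<in> pts (Cr_curve_space F r)" "d' \<in> pts (Cr_curve_space F r)"
  then have "c t \<in> pts E" "d' t \<in> pts F" "d t \<in> pts F" for t using E.Cr_curves_pts F.Cr_curves_pts by (auto simp: E.pts_curve_space F.pts_curve_space)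
  then show "(\<lambda>t. b (c t) ((d + d') t)) = (\<lambda>t. b (c t) (d t)) + (\<lambda>t. b (c t) (d' t))"
   using b unfolding cont_bilinear_def by (simp add: fun_eq_iff)
 next
  fix a c d assume *: "c \<in> pts (Cr_curve_space E r)" "d \<in> pts (Cr_curve_space F r)"
  then have "c t \<in> pts E" "d t \<in> pts F" for t using E.Cr_curves_pts F.Cr_curves_pts by (auto simp: E.pts_curve_space F.pts_curve_space)
  then show "(\<lambda>t. b (smul (Cr_curve_space E r) a c t) (d t)) = smul (Cr_curve_space G r) a (\<lambda>t. b (c t) (d t))"
   "(\<lambda>t. b (c t) (smul (Cr_curve_space F r) a d t)) = smul (Cr_curve_space G r) a (\<lambda>t. b (c t) (d t))"
   using b unfolding cont_bilinear_def by (simp_all add: fun_eq_iff E.smul_curve_space F.smul_curve_space G.smul_curve_space)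
 qed
qed

section \<open>Primitives of curves\<close>

text \<open>Normalised hat functions centred at \<open>i / n\<close> with radius
  \<open>1 / n\<close>. Because they are continuous, averages of sample values with these weights
  have differentiable primitives.\<close>

lemma partition_weights:
 assumes n: "n > 0"
 obtains w :: "nat \<Rightarrow> real \<Rightarrow> real" where "\<And>i. continuous_on {0..1} (w i)" "\<And>i t. t \<in> {0..1} \<Longrightarrow> 0 \<le> w i t"
  "\<And>t. t \<in> {0..1} \<Longrightarrow> (\<Sum>i\<le>n. w i t) = 1" "\<And>i t. w i t \<noteq> 0 \<Longrightarrow> \<bar>real i / n - t\<bar> < 1 / n"
proof -
 define h where "h i t = max 0 (1 - \<bar>real n * t - real i\<bar>)" for i t
 define S where "S t = (\<Sum>i\<le>n. h i t)" for t
 have pos: "S t > 0" if t: "t \<in> {0..1}" for t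
 proof -
  define i where "i = nat \<lfloor>real n * t\<rfloor>"
  have nt: "0 \<le> real n * t" "real n * t \<le> real n" using t by (auto intro: mult_left_le)
  then have i: "real i \<le> real n * t" "real n * t < real i + 1" unfolding i_def by linarith+
  then have "i \<le> n" using nt by linarith
  moreover have "h i t > 0" using i by (simp add: h_def)
  ultimately show ?thesis unfolding S_def by (intro sum_pos2[of _ i]) (auto simp: h_def)
 qed
 have S0: "S t \<noteq> 0" if "t \<in> {0..1}" for t using pos[OF that] by simp
 show thesis
 proof
  fix i
  show "continuous_on {0..1} (\<lambda>t. h i t / S t)"
   using S0 unfolding S_def h_def by (intro continuous_intros) auto
  fix t :: real
  show "0 \<le> h i t / S t" if "t \<in> {0..1}" using pos[OF that] by (simp add: h_def)
  show "\<bar>real i / n - t\<bar> < 1 / n" if "h i t / S t \<noteq> 0"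
  proof -
   have "h i t \<noteq> 0" using that by auto
   then have "\<bar>real i - real n * t\<bar> < 1" by (auto simp: h_def max_def abs_minus_commute split: if_splits)
   moreover have "real i / n - t = (real i - real n * t) / n" using n by (simp add: field_simps)
   ultimately show ?thesis using n by (simp add: divide_strict_right_mono)
  qed
 next
  fix t :: real assume "t \<in> {0..1}"
  then show "(\<Sum>i\<le>n. h i t / S t) = 1" using S0 by (simp add: S_def flip: sum_divide_distrib)
 qed
qed

context lcs
begin

text \<open>Points of weight 0 are left unconstrained, since sample points far from the time under
  consideration are not controlled.\<close>

lemma convex_sum:
 assumes C: "convex_nbhd E C" and "finite I" "\<And>i. i \<in> I \<Longrightarrow> 0 \<le> w i" "(\<Sum>i\<in>I. w i) = 1"
  and "\<And>i. i \<in> I \<Longrightarrow> w i \<noteq> 0 \<Longrightarrow> x i \<in> C"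
 shows "(\<Sum>i\<in>I. smul E (of_real (w i)) (x i)) \<in> C"
 using assms(2-)
proof (induction I arbitrary: w rule: finite_induct)
 case (insert i I)
 define v where "v = (\<Sum>j\<in>I. w j)"
 have v: "v = 1 - w i" "0 \<le> v" using insert.hyps insert.prems(1,2) by (auto simp: v_def intro: sum_nonneg)
 have wi: "0 \<le> w i" using insert.prems(1) by simp
 consider "v = 0" | "w i = 0" | "v \<noteq> 0" "w i \<noteq> 0" by blast
 then show ?case
 proof cases
  case 1
  then have "\<forall>j\<in>I. w j = 0" using insert.hyps insert.prems(1) sum_nonneg_eq_0_iff[of I w] by (simp add: v_def)
  then show ?thesis using insert.hyps insert.prems(3)[of i] v 1 by simp
 next
  case 2
  then have "(\<Sum>j\<in>I. smul E (of_real (w j)) (x j)) \<in> C"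
   using insert.prems v by (intro insert.IH) (auto simp: v_def)
  then show ?thesis using 2 insert.hyps by simp
 next
  case 3
  have "(\<Sum>j\<in>I. smul E (of_real (w j / v)) (x j)) \<in> C"
  proof (rule insert.IH)
   show "(\<Sum>j\<in>I. w j / v) = 1" using 3 by (simp add: v_def flip: sum_divide_distrib)
  qed (use insert.prems v 3 in auto)
  then have "smul E (of_real (w i)) (x i) + smul E (of_real (1 - w i)) (\<Sum>j\<in>I. smul E (of_real (w j / v)) (x j)) \<in> C"
   using insert.prems(3)[of i] 3 v wi by (intro convex_nbhdD[OF C]) auto
  moreover have "smul E (of_real (1 - w i)) (\<Sum>j\<in>I. smul E (of_real (w j / v)) (x j)) = (\<Sum>j\<in>I. smul E (of_real (w j)) (x j))"
   unfolding v(1)[symmetric] vs.scale_sum_right vs.scale_scale of_real_mult[symmetric] using 3 by simp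
  ultimately show ?thesis using insert.hyps by simp
 qed
qed simp

text \<open>The constant sequence \<open>x\<close> has the limits \<open>x\<close> and 0, and the
  space is Hausdorff.\<close>

lemma eq_zero_if_in_all:
 assumes "\<And>C. convex_nbhd E C \<Longrightarrow> 0 \<in> C \<Longrightarrow> x \<in> C" shows "x = 0"
proof (rule lim_unique)
 have "x \<in> pts E" by (rule assms) (auto simp: convex_nbhd_def)
 then show "tlim E (\<lambda>_::nat. x) x sequentially" by simp
 show "tlim E (\<lambda>_::nat. x) 0 sequentially" unfolding lim_iff using assms by simp
qed simp

text \<open>The slope between 0 and \<open>t\<close> lies in \<open>C\<close>; multiplying it by
  \<open>t \<le> 1\<close> keeps it in \<open>C\<close>, which is convex and contains 0.\<close>

lemma curve_in_convex:
 assumes C: "convex_nbhd E C" "0 \<in> C" and t: "t \<in> {0..1}" and P0: "P 0 = 0"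
  and d: "\<And>u. u \<in> {0..1} \<Longrightarrow> deriv01 E P u (c u)" "\<And>u. u \<in> {0..1} \<Longrightarrow> c u \<in> C"
 shows "P t \<in> C"
proof (cases "t = 0")
 case False
 have "smul E (of_real (inverse (t - 0))) (P t - P 0) \<in> C"
  by (rule slope_in_convex[OF C(1) _ _ d]) (use t False in auto)
 then have "smul E (of_real t) (smul E (of_real (inverse t)) (P t)) + smul E (of_real (1 - t)) 0 \<in> C"
  using t P0 by (intro convex_nbhdD[OF C(1)] C(2)) auto
 then show ?thesis using False by (simp flip: of_real_inverse of_real_mult)
qed (use P0 C in simp)

lemma zero_deriv_const:
 assumes "\<And>u. u \<in> {0..1} \<Longrightarrow> deriv01 E P u 0" "t \<in> {0..1}"
 shows "P t = P 0"
proof -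
 have "P t - P 0 = 0"
 proof (rule eq_zero_if_in_all)
  fix C assume C: "convex_nbhd E C" "0 \<in> C"
  have "deriv01 E (\<lambda>u. P u - P 0) u 0" if "u \<in> {0..1}" for u
   using has_curve_deriv_diff[OF assms(1)[OF that] has_curve_deriv_const] by simp
  from curve_in_convex[OF C assms(2) _ this] C show "P t - P 0 \<in> C" by simp
 qed
 then show ?thesis by simp
qed

lemma has_curve_deriv_real:
 assumes g: "(g has_real_derivative g') (at t within J)" and v: "v \<in> pts E"
 shows "has_curve_deriv E J (\<lambda>t. smul E (of_real (g t)) v) t (smul E (of_real g') v)"
proof -
 have "((\<lambda>s. (g s - g t) / (s - t)) \<longlongrightarrow> g') (at t within J)" using g by (simp add: has_field_derivative_iff)
 then have "tlim E (\<lambda>s. smul E (of_real ((g s - g t) / (s - t))) v) (smul E (of_real g') v) (at t within J)"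
  by (intro lim_smul tendsto_of_real) (use v in auto)
 moreover have "smul E (of_real ((g s - g t) / (s - t))) v = smul E (of_real (inverse (s - t))) (smul E (of_real (g s)) v - smul E (of_real (g t)) v)" for s
  by (simp add: divide_inverse mult.commute flip: vs.scale_left_diff_distrib)
 ultimately show ?thesis unfolding has_curve_deriv_def by simp
qed

lemma has_curve_deriv_sum:
 "(\<And>i. i \<in> I \<Longrightarrow> has_curve_deriv E J (f i) t (y i)) \<Longrightarrow> has_curve_deriv E J (\<lambda>s. \<Sum>i\<in>I. f i s) t (\<Sum>i\<in>I. y i)"
 by (induction I rule: infinite_finite_induct) (auto intro: has_curve_deriv_const has_curve_deriv_add)

text \<open>Sample values of \<open>c\<close> are averaged with scalar weights, so only scalar
  integrals occur in \<open>p\<close>. The deviation \<open>q t - c t\<close> is a convex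
  combination of increments of \<open>c\<close> over distances below \<open>1 / n\<close>.\<close>

lemma approximate_primitive:
 assumes n: "n > 0" and cp: "\<And>t. t \<in> {0..1} \<Longrightarrow> c t \<in> pts E"
 obtains p q where "p 0 = 0" "\<And>t. t \<in> {0..1} \<Longrightarrow> deriv01 E p t (q t)" "\<And>t. p t \<in> pts E"
  "\<And>D t. convex_nbhd E D \<Longrightarrow> t \<in> {0..1} \<Longrightarrow> (\<And>s. s \<in> {0..1} \<Longrightarrow> \<bar>s - t\<bar> < 1 / real n \<Longrightarrow> c s - c t \<in> D) \<Longrightarrow> q t - c t \<in> D"
proof -
 obtain w :: "nat \<Rightarrow> real \<Rightarrow> real" where w: "\<And>i. continuous_on {0..1} (w i)" "\<And>i t. t \<in> {0..1} \<Longrightarrow> 0 \<le> w i t"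
  "\<And>t. t \<in> {0..1} \<Longrightarrow> (\<Sum>i\<le>n. w i t) = 1" "\<And>i t. w i t \<noteq> 0 \<Longrightarrow> \<bar>real i / n - t\<bar> < 1 / n"
  using partition_weights[OF n] by metis
 have ip: "real i / real n \<in> {0..1}" if "i \<in> {..n}" for i using that n by (simp add: field_simps)
 define p where "p t = (\<Sum>i\<le>n. smul E (of_real (integral {0..t} (w i))) (c (real i / n)))" for t
 define q where "q t = (\<Sum>i\<le>n. smul E (of_real (w i t)) (c (real i / n)))" for t
 show thesis
 proof
  show "p 0 = 0" by (simp add: p_def)
  show "p t \<in> pts E" for t unfolding p_def by (intro sum_pts smul_pts cp ip)
  show "deriv01 E p t (q t)" if t: "t \<in> {0..1}" for t
   unfolding p_def q_def
  proof (intro has_curve_deriv_sum has_curve_deriv_real cp ip)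
   fix i
   show "((\<lambda>t. integral {0..t} (w i)) has_real_derivative w i t) (at t within {0..1})"
    using integral_has_vector_derivative[OF w(1) t, of i] by (simp add: has_real_derivative_iff_has_vector_derivative)
  qed
  fix D t assume D: "convex_nbhd E D" and t: "t \<in> {0..1}" and cD: "\<And>s. s \<in> {0..1} \<Longrightarrow> \<bar>s - t\<bar> < 1 / real n \<Longrightarrow> c s - c t \<in> D"
  have "(\<Sum>i\<le>n. smul E (of_real (w i t)) (c (real i / n) - c t)) \<in> D"
   by (rule convex_sum[OF D]) (use w t cD ip in auto)
  moreover have "(\<Sum>i\<le>n. smul E (of_real (w i t)) (c t)) = c t"
   using w(3)[OF t] by (simp flip: vs.scale_sum_left of_real_sum)
  ultimately show "q t - c t \<in> D" by (simp add: q_def vs.scale_right_diff_distrib sum_subtractf)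
 qed
qed

lemma uniformly_continuous_curve:
 assumes c: "cont01 E c" and U: "topen E U" "0 \<in> U"
 obtains d where "d > 0" "\<And>s t. s \<in> {0..1} \<Longrightarrow> t \<in> {0..1::real} \<Longrightarrow> \<bar>s - t\<bar> < d \<Longrightarrow> c s - c t \<in> U"
proof -
 define P where "P a b \<longleftrightarrow> (\<exists>d>0. \<forall>t\<in>{a..b} \<inter> {0..1}. \<forall>s\<in>{0..1}. \<bar>s - t\<bar> < d \<longrightarrow> c s - c t \<in> U)" for a b :: real
 have "P 0 1"
 proof (rule Bolzano)
  fix a b e :: real assume "P a b" "P b e" "a \<le> b" "b \<le> e"
  then obtain d d' where d: "d > 0" "\<forall>t\<in>{a..b} \<inter> {0..1}. \<forall>s\<in>{0..1}. \<bar>s - t\<bar> < d \<longrightarrow> c s - c t \<in> U"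
   and d': "d' > 0" "\<forall>t\<in>{b..e} \<inter> {0..1}. \<forall>s\<in>{0..1}. \<bar>s - t\<bar> < d' \<longrightarrow> c s - c t \<in> U" unfolding P_def by blast
  have "c s - c t \<in> U" if "t \<in> {a..e} \<inter> {0..1}" "s \<in> {0..1}" "\<bar>s - t\<bar> < min d d'" for s t
   using d(2) d'(2) that by (cases "t \<le> b") auto
  then show "P a e" unfolding P_def using d(1) d'(1) by (intro exI[of _ "min d d'"]) auto
 next
  fix x :: real assume "0 \<le> x" "x \<le> 1"
  then have x: "x \<in> {0..1}" by simp
  obtain V where V: "convex_nbhd E V" "0 \<in> V" "\<And>x y. x \<in> V \<Longrightarrow> y \<in> V \<Longrightarrow> x - y \<in> U"
   using half_nbhd[OF U] by metis
  have "tlim E c (c x) (at x within {0..1})" using c x by (simp add: continuous_map_top_of_set_iff)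
  then have "eventually (\<lambda>t. c t - c x \<in> V) (at x within {0..1})" unfolding lim_iff using V(1,2) by blast
  then obtain d where d: "d > 0" "\<And>t. t \<in> {0..1} \<Longrightarrow> t \<noteq> x \<Longrightarrow> dist t x < d \<Longrightarrow> c t - c x \<in> V"
   unfolding eventually_at by blast
  have dd: "c t - c x \<in> V" if "t \<in> {0..1}" "\<bar>t - x\<bar> < d" for t
   using d(2)[OF that(1)] that(2) V(2) by (cases "t = x") (auto simp: dist_real_def)
  have "P a b" if "a \<le> x \<and> x \<le> b \<and> b - a < d / 2" for a b
   unfolding P_def
  proof (intro exI[of _ "d / 2"] conjI ballI impI)
   fix t s assume *: "t \<in> {a..b} \<inter> {0..1}" "s \<in> {0..1}" "\<bar>s - t\<bar> < d / 2"
   have "\<bar>t - x\<bar> < d / 2" using *(1) that by (auto simp: abs_real_def)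
   then have "\<bar>t - x\<bar> < d" "\<bar>s - x\<bar> < d" using *(3) by linarith+
   then have "(c s - c x) - (c t - c x) \<in> U" using * by (intro V(3) dd) auto
   then show "c s - c t \<in> U" by simp
  qed (use d in simp)
  then show "\<exists>d>0. \<forall>a b. a \<le> x \<and> x \<le> b \<and> b - a < d \<longrightarrow> P a b" using d(1) by (intro exI[of _ "d / 2"]) auto
 qed simp
 with that show thesis unfolding P_def by auto
qed

text \<open>Near \<open>t\<close> and for large \<open>n\<close> the derivatives \<open>q n\<close>
  lie in a fixed convex set around \<open>c t\<close>, hence so do the slopes of \<open>p n\<close>,
  whose limits are the slopes of \<open>P\<close>. The radius \<open>d\<close> and the index
  \<open>N\<close> are chosen before the slope; only the final \<open>n\<close> depends on
  it.\<close>

lemma primitive_of_uniform_limit: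
 assumes c: "cont01 E c"
  and p: "\<And>n u. u \<in> {0..1} \<Longrightarrow> deriv01 E (p n) u (q n u)"
  and q: "\<And>C. convex_nbhd E C \<Longrightarrow> 0 \<in> C \<Longrightarrow> \<exists>N. \<forall>n\<ge>N. \<forall>u\<in>{0..1}. q n u - c u \<in> C"
  and P: "\<And>u. u \<in> {0..1} \<Longrightarrow> tlim E (\<lambda>n. p n u) (P u) sequentially"
  and t: "t \<in> {0..1}"
 shows "deriv01 E P t (c t)"
 unfolding has_curve_deriv_def lim_iff
proof (intro conjI allI impI)
 show ct: "c t \<in> pts E" using c t by (auto simp: continuous_map_def Pi_iff)
 fix C assume "convex_nbhd E C \<and> 0 \<in> C"
 then have C: "convex_nbhd E C" "0 \<in> C" by auto
 \<comment> \<open>\<open>C1\<close> and \<open>C2\<close> are \<open>C\<close> shrunk to one third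
   and to two thirds: sums of two elements of \<open>C1\<close> lie in \<open>C2\<close>, and adding
   an element of \<open>C1\<close> to one of \<open>C2\<close> leads to \<open>C\<close>.\<close>
 define C1 where "C1 = {x \<in> pts E. smul E 3 x \<in> C}"
 define C2 where "C2 = {x \<in> pts E. smul E (of_real (3/2)) x \<in> C}"
 have C1: "convex_nbhd E C1" "0 \<in> C1" unfolding C1_def using convex_nbhd_scale[OF C(1)] C(2) by auto
 have C2: "convex_nbhd E C2" unfolding C2_def using convex_nbhd_scale[OF C(1)] by auto
 have C12: "x + y \<in> C2" if "x \<in> C1" "y \<in> C1" for x y
 proof -
  have "smul E (of_real (1/2)) (smul E 3 x) + smul E (of_real (1 - 1/2)) (smul E 3 y) \<in> C"
   using that by (intro convex_nbhdD[OF C(1)]) (auto simp: C1_def)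
  then show ?thesis using that by (simp add: C2_def C1_def vs.scale_right_distrib)
 qed
 have C3: "x + y \<in> C" if "x \<in> C1" "y \<in> C2" for x y
 proof -
  have "smul E (of_real (1/3)) (smul E 3 x) + smul E (of_real (1 - 1/3)) (smul E (of_real (3/2)) y) \<in> C"
   using that by (intro convex_nbhdD[OF C(1)]) (auto simp: C1_def C2_def)
  moreover have "smul E (of_real (1/3)) (smul E 3 x) = x" by simp
  moreover have "smul E (of_real (1 - 1/3)) (smul E (of_real (3/2)) y) = y"
   by (simp only: vs.scale_scale of_real_mult[symmetric]) simp
  ultimately show ?thesis by simp
 qed
 obtain d where d: "d > 0" "\<And>s t. s \<in> {0..1} \<Longrightarrow> t \<in> {0..1::real} \<Longrightarrow> \<bar>s - t\<bar> < d \<Longrightarrow> c s - c t \<in> C1"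
  using uniformly_continuous_curve[OF c convex_nbhd_open[OF C1(1)] C1(2)] by metis
 obtain N where N: "\<And>n u. n \<ge> N \<Longrightarrow> u \<in> {0..1} \<Longrightarrow> q n u - c u \<in> C1" using q[OF C1] by blast
 have "smul E (of_real (inverse (s - t))) (P s - P t) - c t \<in> C" if s: "s \<in> {0..1}" "s \<noteq> t" "\<bar>s - t\<bar> < d" for s
 proof -
  let ?sl = "\<lambda>f. smul E (of_real (inverse (s - t))) (f s - f t)"
  have "tlim E (\<lambda>n. ?sl (p n)) (?sl P) sequentially"
   by (intro lim_smul lim_diff P s t tendsto_const)
  then have "tlim E (\<lambda>n. ?sl P - ?sl (p n)) (?sl P - ?sl P) sequentially"
   by (intro lim_diff) (auto dest: limitin_topspace)
  then have "eventually (\<lambda>n. ?sl P - ?sl (p n) \<in> C1) sequentially"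
   using limitinD[OF _ convex_nbhd_open[OF C1(1)]] C1(2) by fastforce
  then obtain M where M: "\<And>n. n \<ge> M \<Longrightarrow> ?sl P - ?sl (p n) \<in> C1" by (auto simp: eventually_sequentially)
  define n where "n = max M N"
  define D where "D = {x \<in> pts E. x - c t \<in> C2}"
  have D: "convex_nbhd E D" unfolding D_def by (rule convex_nbhd_translate[OF C2 ct])
  have qD: "q n u \<in> D" if u: "u \<in> {0..1}" "\<bar>u - t\<bar> < d" for u
  proof -
   have "(q n u - c u) + (c u - c t) \<in> C2" using N[of n u] d(2)[OF u(1) t u(2)] u by (intro C12) (auto simp: n_def)
   moreover have "q n u - c u \<in> pts E" "c u \<in> pts E"
    using N[of n u] u c by (auto simp: n_def C1_def continuous_map_def Pi_iff)
   then have "(q n u - c u) + c u \<in> pts E" by (rule add_pts)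
   ultimately show ?thesis by (simp add: D_def)
  qed
  have "?sl (p n) \<in> D"
  proof (cases "t < s")
   case True
   show ?thesis by (rule slope_in_convex[OF D True, of "{0..1}" "p n" "q n"]) (use s t p qD in auto)
  next
   case False
   then have st: "s < t" using s by simp
   have "smul E (of_real (inverse (t - s))) (p n t - p n s) \<in> D"
    by (rule slope_in_convex[OF D st, of "{0..1}" "p n" "q n"]) (use s t p qD in auto)
   moreover have "inverse (t - s) = - inverse (s - t)" by (metis inverse_minus_eq minus_diff_eq)
   ultimately show ?thesis by (simp add: vs.scale_right_diff_distrib)
  qed
  then have "?sl (p n) - c t \<in> C2" by (simp add: D_def)
  with M[of n] have "(?sl P - ?sl (p n)) + (?sl (p n) - c t) \<in> C" by (intro C3) (auto simp: n_def)
  then show ?thesis by simp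
 qed
 then show "\<forall>\<^sub>F s in at t within {0..1}. smul E (of_real (inverse (s - t))) (P s - P t) - c t \<in> C"
  unfolding eventually_at using d(1) by (auto simp: dist_real_def)
qed

end

context lcs
begin

lemma approximate_primitives:
 assumes c: "cont01 E c"
 obtains p q where "\<And>n. p n 0 = 0" "\<And>n t. t \<in> {0..1} \<Longrightarrow> deriv01 E (p n) t (q n t)" "\<And>n t. p n t \<in> pts E"
  "\<And>n D t. convex_nbhd E D \<Longrightarrow> t \<in> {0..1} \<Longrightarrow>
   (\<And>s. s \<in> {0..1} \<Longrightarrow> \<bar>s - t\<bar> < 1 / real (Suc n) \<Longrightarrow> c s - c t \<in> D) \<Longrightarrow> q n t - c t \<in> D"
proof -
 have cp: "c t \<in> pts E" if "t \<in> {0..1}" for t using c that by (auto simp: continuous_map_def Pi_iff)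
 have "\<exists>p q. p 0 = 0 \<and> (\<forall>t\<in>{0..1}. deriv01 E p t (q t)) \<and> (\<forall>t. p t \<in> pts E) \<and>
   (\<forall>D t. convex_nbhd E D \<longrightarrow> t \<in> {0..1} \<longrightarrow>
   (\<forall>s. s \<in> {0..1} \<longrightarrow> \<bar>s - t\<bar> < 1 / real (Suc n) \<longrightarrow> c s - c t \<in> D) \<longrightarrow> q t - c t \<in> D)" for n
 proof -
  obtain p q where "p 0 = 0" "\<And>t. t \<in> {0..1} \<Longrightarrow> deriv01 E p t (q t)" "\<And>t. p t \<in> pts E"
  "\<And>D t. convex_nbhd E D \<Longrightarrow> t \<in> {0..1} \<Longrightarrow> (\<And>s. s \<in> {0..1} \<Longrightarrow> \<bar>s - t\<bar> < 1 / real (Suc n) \<Longrightarrow> c s - c t \<in> D) \<Longrightarrow> q t - c t \<in> D"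
   using approximate_primitive[of "Suc n" c] cp by (metis zero_less_Suc)
  then show ?thesis by (intro exI[of _ p] exI[of _ q]) simp
 qed
 then obtain p q where "\<forall>n. p n 0 = 0 \<and> (\<forall>t\<in>{0..1}. deriv01 E (p n) t (q n t)) \<and> (\<forall>t. p n t \<in> pts E) \<and>
   (\<forall>D t. convex_nbhd E D \<longrightarrow> t \<in> {0..1} \<longrightarrow>
   (\<forall>s. s \<in> {0..1} \<longrightarrow> \<bar>s - t\<bar> < 1 / real (Suc n) \<longrightarrow> c s - c t \<in> D) \<longrightarrow> q n t - c t \<in> D)" by metis
 then show thesis by (intro that[of p q]) simp_all
qed

lemma primitive_if_convergent:
 assumes c: "cont01 E c"
  and p: "\<And>n t. t \<in> {0..1} \<Longrightarrow> deriv01 E (p n) t (q n t)"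
  and q: "\<And>C. convex_nbhd E C \<Longrightarrow> 0 \<in> C \<Longrightarrow> \<exists>N. \<forall>n\<ge>N. \<forall>u\<in>{0..1}. q n u - c u \<in> C"
  and l: "\<And>t. t \<in> {0..1} \<Longrightarrow> \<exists>l. tlim E (\<lambda>n. p n t) l sequentially"
 shows "\<exists>P. \<forall>t\<in>{0..1}. deriv01 E P t (c t) \<and> P t \<in> pts E"
proof -
 obtain P where P: "\<And>t. t \<in> {0..1} \<Longrightarrow> tlim E (\<lambda>n. p n t) (P t) sequentially" using l by metis
 show ?thesis
  by (intro exI[of _ P] ballI conjI primitive_of_uniform_limit[OF c p q P])
   (use P in "auto dest: limitin_topspace")
qed

lemma approximation_uniform:
 assumes c: "cont01 E c"
  and q: "\<And>n D t. convex_nbhd E D \<Longrightarrow> t \<in> {0..1} \<Longrightarrow>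
   (\<And>s. s \<in> {0..1} \<Longrightarrow> \<bar>s - t\<bar> < 1 / real (Suc n) \<Longrightarrow> c s - c t \<in> D) \<Longrightarrow> q n t - c t \<in> D"
  and C: "convex_nbhd E C" "0 \<in> C"
 shows "\<exists>N. \<forall>n\<ge>N. \<forall>u\<in>{0..1}. q n u - c u \<in> C"
proof -
 obtain d where d: "d > 0" "\<And>s t. s \<in> {0..1} \<Longrightarrow> t \<in> {0..1::real} \<Longrightarrow> \<bar>s - t\<bar> < d \<Longrightarrow> c s - c t \<in> C"
  using uniformly_continuous_curve[OF c convex_nbhd_open[OF C(1)] C(2)] by metis
 obtain N where N: "inverse (real (Suc N)) < d" using reals_Archimedean[OF d(1)] by blast
 have "q n u - c u \<in> C" if "n \<ge> N" "u \<in> {0..1}" for n u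
 proof (rule q[OF C(1) that(2)])
  fix s :: real assume s: "s \<in> {0..1}" "\<bar>s - u\<bar> < 1 / real (Suc n)"
  have "1 / real (Suc n) \<le> inverse (real (Suc N))" using that(1) by (simp add: field_simps)
  then show "c s - c u \<in> C" using s N that(2) by (intro d(2)) auto
 qed
 then show ?thesis by blast
qed

text \<open>The differences \<open>p m - p n\<close> start at 0 and have the uniformly small
  derivatives \<open>q m - q n\<close>, so they are small themselves and the approximate primitives
  are Cauchy.\<close>

lemma primitive_sequentially_complete:
 assumes sc: "sequentially_complete E" and c: "cont01 E c"
 shows "\<exists>P. \<forall>t\<in>{0..1}. deriv01 E P t (c t) \<and> P t \<in> pts E"
proof -
 obtain p q where p: "\<And>n. p n 0 = 0" "\<And>n t. t \<in> {0..1} \<Longrightarrow> deriv01 E (p n) t (q n t)" "\<And>n t. p n t \<in> pts E"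
  and q: "\<And>n D t. convex_nbhd E D \<Longrightarrow> t \<in> {0..1} \<Longrightarrow>
   (\<And>s. s \<in> {0..1} \<Longrightarrow> \<bar>s - t\<bar> < 1 / real (Suc n) \<Longrightarrow> c s - c t \<in> D) \<Longrightarrow> q n t - c t \<in> D"
  using approximate_primitives[OF c] by metis
 have uni: "\<exists>N. \<forall>n\<ge>N. \<forall>u\<in>{0..1}. q n u - c u \<in> C" if "convex_nbhd E C" "0 \<in> C" for C
  by (rule approximation_uniform[OF c _ that]) (fact q)
 show ?thesis
 proof (rule primitive_if_convergent[OF c p(2) uni])
  fix t :: real assume t: "t \<in> {0..1}"
  have "cauchy_seq E (\<lambda>n. p n t)"
   unfolding cauchy_seq_def
  proof (intro conjI allI impI)
   show "range (\<lambda>n. p n t) \<subseteq> pts E" using p(3) by auto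
   fix U assume "topen E U \<and> 0 \<in> U"
   then obtain C0 where C0: "convex_nbhd E C0" "0 \<in> C0" "C0 \<subseteq> U" using convex_nbhd_base by metis
   obtain C where C: "convex_nbhd E C" "0 \<in> C" "\<And>x y. x \<in> C \<Longrightarrow> y \<in> C \<Longrightarrow> x - y \<in> C0"
    using half_nbhd[OF convex_nbhd_open[OF C0(1)] C0(2)] by metis
   obtain N where N: "\<forall>n\<ge>N. \<forall>u\<in>{0..1}. q n u - c u \<in> C" using uni[OF C(1,2)] by blast
   have "p m t - p n t \<in> C0" if "m \<ge> N" "n \<ge> N" for m n
   proof (rule curve_in_convex[OF C0(1,2) t, of "\<lambda>t. p m t - p n t" "\<lambda>t. q m t - q n t"])
    fix u :: real assume u: "u \<in> {0..1}"
    show "deriv01 E (\<lambda>t. p m t - p n t) u (q m u - q n u)" by (intro has_curve_deriv_diff p u)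
    have "(q m u - c u) - (q n u - c u) \<in> C0" using N that u by (intro C(3)) auto
    then show "q m u - q n u \<in> C0" by simp
   qed (simp add: p)
   then show "\<exists>N. \<forall>m\<ge>N. \<forall>n\<ge>N. p m t - p n t \<in> U" using C0(3) by blast
  qed
  then show "\<exists>l. tlim E (\<lambda>n. p n t) l sequentially" using sc unfolding sequentially_complete_def by blast
 qed
qed

section \<open>Primitives under Mackey completeness\<close>

lemma convex_scale_down:
 assumes C: "convex_nbhd E C" "0 \<in> C" and x: "smul E (of_real b) x \<in> C" and ab: "0 \<le> a" "a \<le> b"
 shows "smul E (of_real a) x \<in> C"
proof (cases "b = 0")
 case False
 then have b: "b > 0" using ab by simp
 have "smul E (of_real (a / b)) (smul E (of_real b) x) + smul E (of_real (1 - a / b)) 0 \<in> C"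
  using ab b by (intro convex_nbhdD[OF C(1) x C(2)]) auto
 then show ?thesis using b by (simp flip: of_real_mult of_real_divide)
qed (use x ab in simp)

text \<open>\<open>S\<close> is a hull of the curve described from outside, by the symmetric convex
  neighbourhoods that contain it. It inherits boundedness from the compact image of
  \<open>c\<close>: every neighbourhood of 0 contains a symmetric convex one, a multiple of which
  contains this image.\<close>

lemma bounded_hull:
 fixes c :: "real \<Rightarrow> 'e"
 assumes c: "cont01 E c"
 defines "S \<equiv> {y \<in> pts E. \<forall>C. convex_nbhd E C \<longrightarrow> (\<forall>x\<in>C. - x \<in> C) \<longrightarrow> (\<forall>t\<in>{0..1}. c t \<in> C) \<longrightarrow> y \<in> C}"
 shows "bounded_in E S"
 unfolding bounded_in_def
proof (intro conjI allI impI)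
 show "S \<subseteq> pts E" by (auto simp: S_def)
 fix U assume U: "topen E U \<and> 0 \<in> U"
 let ?K = "\<lparr>smul = (*), topol = (euclidean :: 'k topology)\<rparr>"
 have m: "continuous_map (topol (prod_tvs ?K E)) (topol E) (\<lambda>p. smul E (fst p) (snd p))"
  using cont_bilinear_smul[OF lcs_axioms] by (simp add: cont_bilinear_def case_prod_beta')
 \<comment> \<open>Scalar multiplication is continuous at the pairs \<open>(0, d t)\<close>,
   uniformly in \<open>t\<close>: small scalars move a whole neighbourhood of the curve into
   \<open>W\<close>.\<close>
 have nb: "\<exists>e>0. \<exists>V. topen E V \<and> 0 \<in> V \<and> (\<forall>a. norm a < e \<longrightarrow> (\<forall>t\<in>{0..1}. \<forall>v\<in>V. smul E a (d t + v) \<in> W))"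
  if d: "cont01 E d" and W: "topen E W" "0 \<in> W" for d :: "real \<Rightarrow> 'e" and W
 proof -
  have e: "cont01 (prod_tvs ?K E) (\<lambda>t. (0, d t))"
   using d by (simp add: continuous_map_top_of_set_iff limitin_prod_iff)
  obtain V where V: "topen (prod_tvs ?K E) V" "0 \<in> V"
   "\<And>t v. t \<in> {0..1} \<Longrightarrow> v \<in> V \<Longrightarrow> smul E (fst ((0, d t) + v)) (snd ((0, d t) + v)) - smul E (fst (0::'k, d t)) (snd (0::'k, d t)) \<in> W"
   using uniform_along_curve[OF lcs_prod[OF lcs_scalars lcs_axioms] lcs_axioms m e W] by metis
  obtain A B where AB: "openin (euclidean :: 'k topology) A" "topen E B" "0 \<in> A" "0 \<in> B" "A \<times> B \<subseteq> V"
   using openin_prod_zeroE[of euclidean "topol E" V] V(1,2) by auto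
  obtain e where e: "e > 0" "ball 0 e \<subseteq> A" using AB(1,3) by (auto simp: open_contains_ball)
  have "smul E a (d t + v) \<in> W" if "norm a < e" "t \<in> {0..1}" "v \<in> B" for a t v
  proof -
   have "(a, v) \<in> V" using that e(2) AB(5) by auto
   from V(3)[OF that(2) this] show ?thesis by simp
  qed
  with e(1) AB(2,4) show ?thesis by blast
 qed
 have z: "continuous_map (top_of_set {0..1::real}) (topol E) (\<lambda>t. 0)" by simp
 \<comment> \<open>All scalars of small norm, of any phase, map \<open>V\<close> into
   \<open>U\<close>; this makes up for the fact that the sets defining \<open>S\<close> are
   symmetric only under change of sign.\<close>
 obtain e V where e: "e > 0" and V: "topen E V" "0 \<in> V"
  and eV: "\<And>a v. norm a < e \<Longrightarrow> v \<in> V \<Longrightarrow> smul E a v \<in> U"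
  using nb[OF z, of U] U by (metis add_0 atLeastAtMost_iff zero_le_one order_refl)
 obtain C where C: "convex_nbhd E C" "0 \<in> C" "\<And>x y. x \<in> C \<Longrightarrow> y \<in> C \<Longrightarrow> x - y \<in> V" "C \<subseteq> V"
  using half_nbhd[OF V] by metis
 \<comment> \<open>\<open>C\<close> is made symmetric so that a multiple of \<open>D\<close> is
   among the sets that define \<open>S\<close>.\<close>
 define D where "D = C \<inter> {x \<in> pts E. smul E (- 1) x \<in> C}"
 have "convex_nbhd E D" unfolding D_def by (intro convex_nbhd_Int convex_nbhd_scale C(1))
 moreover have "0 \<in> D" "\<And>x. x \<in> D \<Longrightarrow> - x \<in> D"
  unfolding D_def using C(2) convex_nbhd_pts[OF C(1)] by auto
 ultimately have D: "convex_nbhd E D" "0 \<in> D" "\<And>x. x \<in> D \<Longrightarrow> - x \<in> D" by auto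
 obtain e' V' where e': "e' > 0" and V': "0 \<in> V'"
  and eV': "\<And>a t v. norm a < e' \<Longrightarrow> t \<in> {0..1} \<Longrightarrow> v \<in> V' \<Longrightarrow> smul E a (c t + v) \<in> D"
  using nb[OF c convex_nbhd_open[OF D(1)] D(2)] by metis
 define \<delta> where "\<delta> = e' / 2"
 have \<delta>: "\<delta> > 0" "norm (of_real \<delta> :: 'k) < e'" using e' by (auto simp: \<delta>_def)
 have SD: "smul E (of_real \<delta>) y \<in> D" if y: "y \<in> S" for y
 proof -
  define C' where "C' = {x \<in> pts E. smul E (of_real \<delta>) x \<in> D}"
  have cp: "c t \<in> pts E" if "t \<in> {0..1}" for t using c that by (auto simp: continuous_map_def Pi_iff)
  have "convex_nbhd E C'" unfolding C'_def by (rule convex_nbhd_scale[OF D(1)])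
  moreover have "\<forall>x\<in>C'. - x \<in> C'" using D(3) by (auto simp: C'_def)
  moreover have "\<forall>t\<in>{0..1}. c t \<in> C'" using eV'[OF \<delta>(2) _ V'] cp by (auto simp: C'_def)
  ultimately have "y \<in> C'" using y unfolding S_def by blast
  then show ?thesis by (simp add: C'_def)
 qed
 show "\<exists>r>0. \<forall>a. r \<le> norm a \<longrightarrow> S \<subseteq> smul E a ` U"
 \<comment> \<open>For \<open>norm a\<close> at least this large, the inverse of \<open>a\<close>
   times \<open>\<delta>\<close> has norm at most \<open>e / 2\<close>, hence below
   \<open>e\<close>.\<close>
 proof (intro exI[of _ "2 / (\<delta> * e)"] conjI allI impI subsetI)
  show "2 / (\<delta> * e) > 0" using \<delta> e by simp
  fix a :: 'k and y assume a: "2 / (\<delta> * e) \<le> norm a" and y: "y \<in> S"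
  have "0 < 2 / (\<delta> * e)" using \<delta> e by simp
  then have a0: "norm a > 0" "a \<noteq> 0" using a by auto
  have "norm (inverse a * inverse (of_real \<delta>)) = 1 / (norm a * \<delta>)"
   using \<delta>(1) by (simp add: norm_mult norm_inverse divide_inverse)
  also have "\<dots> < e"
   using a \<delta> e a0 by (simp add: field_simps)
  finally have "smul E (inverse a * inverse (of_real \<delta>)) (smul E (of_real \<delta>) y) \<in> U"
   using SD[OF y] C(4) by (intro eV) (auto simp: D_def)
  then have "smul E (inverse a) y \<in> U" using \<delta>(1) by (simp add: mult.assoc)
  moreover have "y = smul E a (smul E (inverse a) y)" using a0 by simp
  ultimately show "y \<in> smul E a ` U" by blast
 qed
qed

text \<open>By the mean value theorem increments of \<open>c\<close>, divided by their length, lie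
  in every symmetric convex neighbourhood containing the values of \<open>c1\<close>. This makes the
  approximate primitives Mackey-Cauchy with respect to the hull of \<open>c1\<close>.\<close>

lemma primitive_mackey_complete:
 assumes mc: "mackey_complete E" and c: "cont01 E c"
  and c1: "cont01 E c1"
  and cd: "\<And>t. t \<in> {0..1} \<Longrightarrow> deriv01 E c t (c1 t)"
 shows "\<exists>P. \<forall>t\<in>{0..1}. deriv01 E P t (c t) \<and> P t \<in> pts E"
proof -
 obtain p q where p: "\<And>n. p n 0 = 0" "\<And>n t. t \<in> {0..1} \<Longrightarrow> deriv01 E (p n) t (q n t)" "\<And>n t. p n t \<in> pts E"
  and q: "\<And>n D t. convex_nbhd E D \<Longrightarrow> t \<in> {0..1} \<Longrightarrow>
   (\<And>s. s \<in> {0..1} \<Longrightarrow> \<bar>s - t\<bar> < 1 / real (Suc n) \<Longrightarrow> c s - c t \<in> D) \<Longrightarrow> q n t - c t \<in> D"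
  using approximate_primitives[OF c] by metis
 have uni: "\<exists>N. \<forall>n\<ge>N. \<forall>u\<in>{0..1}. q n u - c u \<in> C" if "convex_nbhd E C" "0 \<in> C" for C
  by (rule approximation_uniform[OF c _ that]) (fact q)
 define S where "S = {y \<in> pts E. \<forall>C. convex_nbhd E C \<longrightarrow> (\<forall>x\<in>C. - x \<in> C) \<longrightarrow> (\<forall>t\<in>{0..1}. c1 t \<in> C) \<longrightarrow> y \<in> C}"
 have cp: "c t \<in> pts E" if "t \<in> {0..1}" for t using c that by (auto simp: continuous_map_def Pi_iff)
 \<comment> \<open>Measured in the hull of \<open>c1\<close>, the curve \<open>q n\<close> deviates
   from \<open>c\<close> by at most \<open>1 / Suc n\<close>; in a difference the two deviations add
   up.\<close>
 define \<mu> where "\<mu> m n = 1 / real (Suc m) + 1 / real (Suc n)" for m n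
 have \<mu>0: "\<mu> m n > 0" for m n by (simp add: \<mu>_def add_pos_pos)
 show ?thesis
 proof (rule primitive_if_convergent[OF c p(2) uni])
  fix t :: real assume t: "t \<in> {0..1}"
  have key: "smul E (of_real (1 / \<mu> m n)) (p m t - p n t) \<in> C"
   if C: "convex_nbhd E C" "\<forall>x\<in>C. - x \<in> C" "\<forall>t\<in>{0..1}. c1 t \<in> C" for C m n
  proof -
   have "c1 0 \<in> C" "- c1 0 \<in> C" using C by auto
   from convex_nbhdD[OF C(1) this, of "1/2"] have C0: "0 \<in> C" by simp
   have incr: "smul E (of_real a) (c s - c u) \<in> C"
    if su: "s \<in> {0..1}" "u \<in> {0..1}" "\<bar>s - u\<bar> < 1 / a" "a > 0" for s u a
   proof (cases "s = u")
    case False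
    have pos: "smul E (of_real a) (c s - c u) \<in> C"
     if su: "s \<in> {0..1}" "u \<in> {0..1}" "\<bar>s - u\<bar> < 1 / a" "a > 0" "u < s" for s u
    proof (rule convex_scale_down[OF C(1) C0, of "inverse (s - u)"])
     show "smul E (of_real (inverse (s - u))) (c s - c u) \<in> C"
      by (rule slope_in_convex[OF C(1) su(5), of "{0..1}" c c1]) (use su cd C(3) in auto)
     show "a \<le> inverse (s - u)" using su by (simp add: field_simps)
    qed (use su in simp)
    show ?thesis
    proof (cases "u < s")
     case True then show ?thesis using pos su by blast
    next
     case F: False
     then have "smul E (of_real a) (c u - c s) \<in> C" using pos[of u s] su False by (simp add: abs_minus_commute)
     then have "- smul E (of_real a) (c u - c s) \<in> C" using C(2) by blast
     then show ?thesis by (simp add: vs.scale_right_diff_distrib)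
    qed
   qed (use C0 in simp)
   have qn: "smul E (of_real (real (Suc n))) (q n u - c u) \<in> C" if u: "u \<in> {0..1}" for u n
   proof -
    have "q n u - c u \<in> {x \<in> pts E. smul E (of_real (real (Suc n))) x \<in> C}"
    proof (rule q[OF convex_nbhd_scale[OF C(1)] u])
     fix s :: real assume s: "s \<in> {0..1}" "\<bar>s - u\<bar> < 1 / real (Suc n)"
     have "smul E (of_real (real (Suc n))) (c s - c u) \<in> C" by (rule incr[OF s(1) u s(2)]) simp
     then show "c s - c u \<in> {x \<in> pts E. smul E (of_real (real (Suc n))) x \<in> C}" using cp[OF s(1)] cp[OF u] by simp
    qed
    then show ?thesis by simp
   qed
   define D where "D = {x \<in> pts E. smul E (of_real (1 / \<mu> m n)) x \<in> C}"
   have D: "convex_nbhd E D" "0 \<in> D" unfolding D_def using convex_nbhd_scale[OF C(1)] C0 by auto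
   have "p m t - p n t \<in> D"
   proof (rule curve_in_convex[OF D t, of "\<lambda>t. p m t - p n t" "\<lambda>t. q m t - q n t"])
    fix u :: real assume u: "u \<in> {0..1}"
    show "deriv01 E (\<lambda>t. p m t - p n t) u (q m u - q n u)" by (intro has_curve_deriv_diff p u)
    \<comment> \<open>The weight \<open>l\<close> is the share of index \<open>m\<close> in
      \<open>\<mu> m n\<close>. It writes the scaled difference as a convex combination of
      \<open>Suc m\<close> times one deviation and minus \<open>Suc n\<close> times the
      other.\<close>
    define l where "l = (1 / real (Suc m)) / \<mu> m n"
    have l: "0 \<le> l" "l \<le> 1" using \<mu>0[of m n] by (auto simp: l_def \<mu>_def divide_simps)
    have l1: "l * real (Suc m) = 1 / \<mu> m n" by (simp add: l_def)
    have "\<mu> m n - 1 / real (Suc m) = 1 / real (Suc n)" by (simp add: \<mu>_def)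
    moreover have "1 - l = (\<mu> m n - 1 / real (Suc m)) / \<mu> m n"
     using \<mu>0[of m n] unfolding l_def diff_divide_distrib by simp
    ultimately have "1 - l = (1 / real (Suc n)) / \<mu> m n" by (simp only:)
    then have l2: "(1 - l) * real (Suc n) = 1 / \<mu> m n" by simp
    have "- smul E (of_real (real (Suc n))) (q n u - c u) \<in> C" using qn[OF u] C(2) by blast
    from convex_nbhdD[OF C(1) qn[OF u, of m] this l]
    have "smul E (of_real (l * real (Suc m))) (q m u - c u) - smul E (of_real ((1 - l) * real (Suc n))) (q n u - c u) \<in> C"
     by (simp only: of_real_mult vs.scale_scale vs.scale_minus_right diff_conv_add_uminus)
    then have "smul E (of_real (1 / \<mu> m n)) ((q m u - c u) - (q n u - c u)) \<in> C"
     unfolding l1 l2 by (simp only: vs.scale_right_diff_distrib)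
    moreover have qp: "q n u - c u \<in> pts E" for n
     using q[of "pts E" u n] u cp by (auto simp: convex_nbhd_def)
    have "(q m u - c u) - (q n u - c u) \<in> pts E" by (rule diff_pts[OF qp qp])
    ultimately show "q m u - q n u \<in> D" by (simp add: D_def)
   qed (simp add: p)
   then show ?thesis by (simp add: D_def)
  qed
  have "mackey_cauchy E (\<lambda>n. p n t)"
   unfolding mackey_cauchy_def
  proof (intro conjI exI[of _ S] exI[of _ \<mu>] allI impI)
   show "range (\<lambda>n. p n t) \<subseteq> pts E" using p(3) by auto
   show "bounded_in E S" unfolding S_def by (rule bounded_hull[OF c1])
   show "\<exists>N. \<forall>m\<ge>N. \<forall>n\<ge>N. \<bar>\<mu> m n\<bar> < e" if e: "0 < e" for e
   proof -
    obtain N where N: "inverse (real (Suc N)) < e / 2" using reals_Archimedean[of "e / 2"] e by auto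
    have "\<bar>\<mu> m n\<bar> < e" if "m \<ge> N" "n \<ge> N" for m n
    proof -
     have "1 / real (Suc m) \<le> inverse (real (Suc N))" "1 / real (Suc n) \<le> inverse (real (Suc N))"
      using that by (simp_all add: field_simps)
     then show ?thesis using N \<mu>0[of m n] by (simp add: \<mu>_def)
    qed
    then show ?thesis by blast
   qed
   show "p m t - p n t \<in> smul E (of_real (\<mu> m n)) ` S" for m n
   proof
    show "smul E (of_real (1 / \<mu> m n)) (p m t - p n t) \<in> S" using key p(3) by (simp add: S_def)
    show "p m t - p n t = smul E (of_real (\<mu> m n)) (smul E (of_real (1 / \<mu> m n)) (p m t - p n t))"
     using \<mu>0[of m n] by (simp only: vs.scale_scale of_real_mult[symmetric]) simp
   qed
  qed
  then show "\<exists>l. tlim E (\<lambda>n. p n t) l sequentially" using mc unfolding mackey_complete_def by blast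
 qed
qed

end

text \<open>What is kept of the completeness hypotheses is the existence of primitives: for
  \<open>r = 0\<close> it comes from sequential completeness, for \<open>r = 1\<close> from Mackey
  completeness.\<close>

locale int_space = lcs E for E :: "('k::real_normed_field, 'e::ab_group_add) tvs" +
 fixes r :: enat
 assumes r: "r = 0 \<or> r = 1"
  and prim: "c \<in> Cr_curves E r \<Longrightarrow> \<exists>P. \<forall>t\<in>{0..1}. deriv01 E P t (c t) \<and> P t \<in> pts E"
begin

definition integ :: "(real \<Rightarrow> 'e) \<Rightarrow> real \<Rightarrow> 'e" where
 "integ c = (let P = SOME P. \<forall>t\<in>{0..1}. deriv01 E P t (c t) \<and> P t \<in> pts E
   in (\<lambda>t. if t \<in> {0..1} then P t - P 0 else 0))"

lemma integ:
 assumes c: "c \<in> Cr_curves E r"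
 shows "integ c 0 = 0" "t \<notin> {0..1} \<Longrightarrow> integ c t = 0"
  "t \<in> {0..1} \<Longrightarrow> deriv01 E (integ c) t (c t)" "integ c t \<in> pts E"
proof -
 define P where "P = (SOME P. \<forall>t\<in>{0..1}. deriv01 E P t (c t) \<and> P t \<in> pts E)"
 have P: "\<forall>t\<in>{0..1}. deriv01 E P t (c t) \<and> P t \<in> pts E"
  unfolding P_def by (rule someI_ex[OF prim[OF c]])
 have i: "integ c = (\<lambda>t. if t \<in> {0..1} then P t - P 0 else 0)" unfolding integ_def P_def Let_def ..
 show "integ c 0 = 0" "t \<notin> {0..1} \<Longrightarrow> integ c t = 0" "integ c t \<in> pts E" using P by (auto simp: i)
 assume t: "t \<in> {0..1}"
 have "deriv01 E (\<lambda>t. P t - P 0) t (c t)"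
  using has_curve_deriv_diff[OF _ has_curve_deriv_const, of "{0..1}" P t "c t" "P 0"] P t by simp
 then show "deriv01 E (integ c) t (c t)"
  using has_curve_deriv_cong[of "{0..1}" "integ c" "\<lambda>t. P t - P 0" t E "c t"] t by (simp add: i)
qed

lemma integ_unique:
 assumes c: "c \<in> Cr_curves E r" and P: "\<And>u. u \<in> {0..1} \<Longrightarrow> deriv01 E P u (c u)" and t: "t \<in> {0..1}"
 shows "P t = P 0 + integ c t"
proof -
 have "deriv01 E (\<lambda>u. P u - integ c u) u 0" if "u \<in> {0..1}" for u
  using has_curve_deriv_diff[OF P[OF that] integ(3)[OF c that]] by simp
 from zero_deriv_const[OF this t] show ?thesis using integ(1)[OF c] by (simp add: algebra_simps)
qed

text \<open>The primitive is recorded in the same space as \<open>c\<close>, although it has one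
  derivative more; the Picard iteration thus stays in one algebra of curves.\<close>

lemma integ_curve:
 assumes c: "c \<in> Cr_curves E r"
 shows "integ c \<in> Cr_curves E r" "enat 1 \<le> r \<Longrightarrow> t \<in> {0..1} \<Longrightarrow> idc E 1 (integ c) t = c t"
proof -
 define C where "C = (\<lambda>k. if k = (0::nat) then integ c else c)"
 have 1: "t \<notin> {0..1} \<Longrightarrow> integ c t = 0" for t by (rule integ(2)[OF c])
 have 2: "C 0 t = integ c t" for t by (simp add: C_def)
 have 3: "deriv01 E (C k) t (C (Suc k) t)" if "enat k < r" "t \<in> {0..1}" for k t
 proof -
  have "k = 0" using that r by (auto simp: enat_le_01)
  then show ?thesis using integ(3)[OF c that(2)] by (simp add: C_def)
 qed
 have 4: "cont01 E (C k)" if "enat k \<le> r" for k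
 proof (cases "k = 0")
  case True
  then show ?thesis using has_curve_deriv_lim[OF integ(3)[OF c] integ(4)[OF c]]
   by (simp add: continuous_map_top_of_set_iff C_def)
 next
  case False
  then show ?thesis using Cr_curves_cont[OF c, of 0] by (simp add: C_def iter_curve_deriv_0 flip: zero_enat_def)
 qed
 show "integ c \<in> Cr_curves E r"
  by (rule Cr_curves_family(1)[where C = C]) (assumption | rule 1 2 3 4)+
 assume t: "enat 1 \<le> r" "t \<in> {0..1}"
 have "idc E 1 (integ c) t = C 1 t"
  by (rule Cr_curves_family(2)[where C = C and r = r]) (assumption | rule 1 2 3 4 t)+
 then show "idc E 1 (integ c) t = c t" by (simp add: C_def)
qed

lemma integ_add:
 assumes "c \<in> Cr_curves E r" "d \<in> Cr_curves E r" shows "integ (c + d) = integ c + integ d"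
proof
 fix t
 have cd: "c + d \<in> Cr_curves E r" by (rule Cr_curves_add(1)[OF assms])
 show "integ (c + d) t = (integ c + integ d) t"
 proof (cases "t \<in> {0..1}")
  case True
  have "deriv01 E (\<lambda>u. integ c u + integ d u) u ((c + d) u)" if "u \<in> {0..1}" for u
   using has_curve_deriv_add[OF integ(3)[OF assms(1) that] integ(3)[OF assms(2) that]] by simp
  from integ_unique[OF cd this True] show ?thesis using assms by (simp add: integ plus_fun_def)
 qed (use assms cd in "simp add: integ")
qed

lemma integ_smul:
 assumes "c \<in> Cr_curves E r" shows "integ (\<lambda>t. smul E a (c t)) = (\<lambda>t. smul E a (integ c t))"
proof
 fix t
 have cd: "(\<lambda>t. smul E a (c t)) \<in> Cr_curves E r" by (rule Cr_curves_smul(1)[OF assms])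
 show "integ (\<lambda>t. smul E a (c t)) t = smul E a (integ c t)"
 proof (cases "t \<in> {0..1}")
  case True
  from integ_unique[OF cd has_curve_deriv_smul[OF integ(3)[OF assms]] True] show ?thesis using assms by (simp add: integ)
 qed (use assms cd in "simp add: integ")
qed

lemma integ_diff:
 assumes "c \<in> Cr_curves E r" "d \<in> Cr_curves E r" shows "integ (c - d) = integ c - integ d"
 using integ_add[OF Cr_curves_diff(1)[OF assms] assms(2)] by simp

lemma cont_linear_integ: "cont_linear (Cr_curve_space E r) (Cr_curve_space E r) integ"
proof (rule cont_linearI)
 fix c assume "c \<in> pts (Cr_curve_space E r)"
 then have c: "c \<in> Cr_curves E r" by (simp add: pts_curve_space)
 let ?G = "atin (topol (Cr_curve_space E r)) c"
 have "tlim (Cr_curve_space E r) (\<lambda>d. d) c ?G" by (rule limitin_atin_id) (simp add: pts_curve_space c)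
 note lim = this[unfolded lim_curve_iff]
 have ev: "eventually (\<lambda>d. d \<in> Cr_curves E r) ?G" using lim by blast
 show "tlim (Cr_curve_space E r) integ (integ c) ?G"
  unfolding lim_curve_iff
 proof (intro conjI allI impI integ_curve(1)[OF c])
  show "eventually (\<lambda>d. integ d \<in> Cr_curves E r) ?G" using ev by eventually_elim (rule integ_curve(1))
  fix k U assume k: "enat k \<le> r" and U: "topen E U" "0 \<in> U"
  obtain C where C: "convex_nbhd E C" "0 \<in> C" "C \<subseteq> U" using convex_nbhd_base[OF U] .
  have "enat 0 \<le> r" by (simp flip: zero_enat_def)
  then have "eventually (\<lambda>d. \<forall>t\<in>{0..1}. idc E 0 d t - idc E 0 c t \<in> C) ?G"
   using lim convex_nbhd_open[OF C(1)] C(2) by blast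
  then show "eventually (\<lambda>d. \<forall>t\<in>{0..1}. idc E k (integ d) t - idc E k (integ c) t \<in> U) ?G"
   using ev
  proof eventually_elim
   case (elim d)
   have dc: "d u - c u \<in> C" if "u \<in> {0..1}" for u using elim(1) that by (simp add: iter_curve_deriv_0)
   show ?case
   proof
    fix t :: real assume t: "t \<in> {0..1}"
    show "idc E k (integ d) t - idc E k (integ c) t \<in> U"
    proof (cases "k = 0")
     case True
     have "integ d t - integ c t \<in> C"
      by (rule curve_in_convex[OF C(1,2) t, of "\<lambda>t. integ d t - integ c t" "\<lambda>u. d u - c u"])
       (use dc has_curve_deriv_diff[OF integ(3)[OF elim(2)] integ(3)[OF c]] in "auto simp: integ(1)[OF c] integ(1)[OF elim(2)]")
     then show ?thesis using True C(3) by (auto simp: iter_curve_deriv_0)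
    next
     case False
     then have k1: "k = 1" "enat 1 \<le> r" using r k by (auto simp: enat_le_01)
     show ?thesis unfolding k1(1) integ_curve(2)[OF elim(2) k1(2) t] integ_curve(2)[OF c k1(2) t]
      using dc[OF t] C(3) by blast
    qed
   qed
  qed
 qed
qed (simp_all add: pts_curve_space smul_curve_space integ_add integ_smul)

end

lemma K_entire_lin_ext:
 assumes "lcs X" "lcs Z" "\<And>a b. K_entire X Z (\<lambda>p. f p a b)"
 shows "K_entire X Z (\<lambda>p. lin_ext (smul Z) (\<lambda>(a, b). f p a b) u)"
proof -
 interpret Z: lcs Z by fact
 have "cont_linear Z Z (smul Z c)" for c
  by (rule cont_linearI) (auto simp: Z.vs.scale_right_distrib mult.commute intro!: Z.lim_smul limitin_atin_id)
 from K_entire_linear_compose[OF assms(1,2,2) this assms(3)]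
 have "K_entire X Z (\<lambda>p. \<Sum>x\<in>Poly_Mapping.keys u. smul Z (Poly_Mapping.lookup u x) (f p (fst x) (snd x)))"
  by (intro K_entire_sum assms(1,2))
 then show ?thesis by (simp add: lin_ext_def case_prod_beta')
qed

lemma K_entire_diff:
 assumes "lcs X" "lcs Z" "K_entire X Z f" "K_entire X Z g"
 shows "K_entire X Z (\<lambda>p. f p - g p)"
proof -
 interpret Z: lcs Z by fact
 have "cont_linear Z Z (\<lambda>x. - x)"
  by (rule cont_linearI) (auto intro!: Z.lim_minus limitin_atin_id)
 from K_entire_add[OF assms(1,2,3) K_entire_linear_compose[OF assms(1,2,2) this assms(4)]] show ?thesis by simp
qed

section \<open>The space of linear maps into the algebra\<close>

locale char_setting = graded_connected_hopf_algebra s \<Delta> \<epsilon> S gr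
 for s :: "'k::real_or_complex_field \<Rightarrow> 'h::{ring, monoid_mult} \<Rightarrow> 'h" and \<Delta> \<epsilon> S gr +
 fixes B :: "('k, 'b::{comm_ring, comm_monoid_mult}) tvs"
 assumes B: "locally_convex_algebra B"
begin

sublocale Bl: lcs B using B by (simp add: lcs_def locally_convex_algebra_def)

lemma pts_B[simp]: "pts B = UNIV" and alg_B: "unital_algebra (smul B)"
 using B by (simp_all add: locally_convex_algebra_def)

sublocale V: graded_target s \<Delta> \<epsilon> S gr "smul B"
 by unfold_locales (rule alg_B)

lemma alg_curves: "unital_algebra (\<lambda>a (c :: real \<Rightarrow> 'b) t. smul B a (c t))"
 unfolding unital_algebra_def using alg_B vector_space_pow[OF Bl.vs.vector_space_axioms]
 by (simp add: unital_algebra_def fun_eq_iff)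

text \<open>The convolution calculus a second time, for maps with values in curves under pointwise
  operations; the integral equation lives there.\<close>

sublocale W: graded_target s \<Delta> \<epsilon> S gr "\<lambda>a (c :: real \<Rightarrow> 'b) t. smul B a (c t)"
 by unfold_locales (rule alg_curves)

lemma mult_B: "cont_bilinear B B B (*)"
proof (rule cont_bilinearI)
 fix p assume p: "fst p \<in> pts B" "snd p \<in> pts B"
 have "continuous_map (prod_topology (topol B) (topol B)) (topol B) (\<lambda>(x, y). x * y)"
  using B by (simp add: locally_convex_algebra_def)
 from limitin_continuous[OF this limitin_atin_id, of p] p
 show "tlim B (\<lambda>q. fst q * snd q) (fst p * snd p) (atin (prod_topology (topol B) (topol B)) p)"
  by (simp add: case_prod_beta' mem_Times_iff)
qed (use alg_B in "auto simp: algebra_simps unital_algebra_def")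

abbreviation "E \<equiv> hom_tvs s B"

lemma hom_eq: "E = subspace_tvs (pow_tvs B) {\<phi>. lin s (smul B) \<phi>}"
 by (simp add: hom_tvs_def subspace_tvs_def pow_tvs_def linear_eq_lin[OF vs.vector_space_axioms Bl.vs.vector_space_axioms])

lemma smul_E: "smul E = (\<lambda>c \<phi> x. smul B c (\<phi> x))" by (simp add: hom_tvs_def)

lemma pts_E: "pts E = {\<phi>. lin s (smul B) \<phi>}"
 by (auto simp: hom_eq PiE_iff)

lemma lim_E: "tlim E f l G \<longleftrightarrow> lin s (smul B) l \<and> eventually (\<lambda>a. lin s (smul B) (f a)) G \<and>
  (\<forall>x. tlim B (\<lambda>a. f a x) (l x) G)"
 by (simp add: hom_eq limitin_subtopology limitin_componentwise PiE_iff)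

lemma lin_subspace: "module.subspace (smul (pow_tvs B)) {\<phi>. lin s (smul B) \<phi>}"
proof -
 interpret P: vector_space "smul (pow_tvs B) :: 'k \<Rightarrow> ('h \<Rightarrow> 'b) \<Rightarrow> _"
  by (simp add: vector_space_pow[OF Bl.vs.vector_space_axioms])
 show ?thesis
  by (rule P.subspaceI)
   (auto simp: lin_def Bl.vs.scale_right_distrib algebra_simps)
qed

lemma lcs_E: "lcs E"
 unfolding hom_eq by (intro lcs_subspace lcs_pow Bl.lcs_axioms lin_subspace)

sublocale El: lcs E by (rule lcs_E)

text \<open>The equations of linearity pass to pointwise limits because limits are unique. This
  supplies the closedness premise of \<open>smooth_on_pow_subspace\<close>.\<close>

lemma lin_closed:
 assumes "eventually (\<lambda>t. lin s (smul B) (q t)) G" "\<And>x. tlim B (\<lambda>t. q t x) (y x) G" "G \<noteq> bot"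
 shows "lin s (smul B) y"
 unfolding lin_def
proof (intro conjI allI)
 fix a b c
 have "eventually (\<lambda>t. q t a + q t b = q t (a + b)) G" using assms(1) by eventually_elim (simp add: lin_def)
 from limitin_transform_eventually[OF this Bl.lim_add[OF assms(2) assms(2)]]
 show "y (a + b) = y a + y b" using Bl.lim_unique[OF assms(2) _ assms(3)] by blast
 have "eventually (\<lambda>t. smul B c (q t a) = q t (s c a)) G" using assms(1) by eventually_elim (simp add: lin_def)
 from limitin_transform_eventually[OF this Bl.lim_smul[OF tendsto_const assms(2)]]
 show "y (s c a) = smul B c (y a)" using Bl.lim_unique[OF assms(2) _ assms(3)] by blast
qed

lemma eval_linear: "cont_linear E B (\<lambda>\<phi>. \<phi> x)"
proof (rule cont_linearI)
 fix \<phi> assume "\<phi> \<in> pts E"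
 from limitin_atin_id[OF this] show "tlim B (\<lambda>\<phi>. \<phi> x) (\<phi> x) (atin (topol E) \<phi>)" by (simp add: lim_E)
qed (auto simp: smul_E)

lemma cont_linear_homI:
 assumes "\<And>p. p \<in> pts X \<Longrightarrow> lin s (smul B) (L p)" "\<And>x. cont_linear X B (\<lambda>p. L p x)"
 shows "cont_linear X E L"
proof (rule cont_linearI)
 fix p assume p: "p \<in> pts X"
 have "eventually (\<lambda>q. q \<in> pts X) (atin (topol X) p)" using limitin_in_topspace[OF limitin_atin_id[OF p]] .
 then have "eventually (\<lambda>q. lin s (smul B) (L q)) (atin (topol X) p)" by eventually_elim (rule assms(1))
 moreover have "tlim B (\<lambda>q. L q x) (L p x) (atin (topol X) p)" for x
  by (rule cont_linear_lim[OF assms(2) limitin_atin_id[OF p]])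
 ultimately show "tlim E L (L p) (atin (topol X) p)" using assms(1)[OF p] by (simp add: lim_E)
qed (use assms(2) in "auto simp: cont_linear_def smul_E fun_eq_iff")

lemma smooth_on_hom:
 assumes "lcs X" "topen X U" "\<And>p. p \<in> U \<Longrightarrow> lin s (smul B) (f p)" "\<And>x. smooth_on X B U (\<lambda>p. f p x)"
 shows "smooth_on X E U f"
 unfolding hom_eq
proof (rule smooth_on_pow_subspace[OF assms(1) Bl.lcs_axioms lin_subspace _ assms(2) _ assms(4)])
 fix q :: "'k \<Rightarrow> 'h \<Rightarrow> 'b" and y
 assume "eventually (\<lambda>t. q t \<in> {\<phi>. lin s (smul B) \<phi>}) (at 0)" "\<And>i. tlim B (\<lambda>t. q t i) (y i) (at 0)"
 then show "y \<in> {\<phi>. lin s (smul B) \<phi>}" using lin_closed[of q "at 0" y] by simp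
qed (use assms(3) in simp)

text \<open>In the real case the complex extensions of the components are only chosen on a basis of the
  Hopf algebra and then extended linearly, so that they take values in the space of linear maps.\<close>

lemma K_entire_hom:
 fixes X :: "('k, 'x::ab_group_add) tvs"
 assumes X: "lcs X" and l: "\<And>p. p \<in> pts X \<Longrightarrow> lin s (smul B) (f p)" and f: "\<And>x. K_entire X B (\<lambda>p. f p x)"
 shows "K_entire X E f"
proof (cases "\<exists>i::'k. i * i = - 1")
 case True
 have "smooth_on X E (pts X) f"
  by (rule smooth_on_hom[OF X openin_topspace l]) (use f True in "auto simp: K_entire_def")
 then show ?thesis using True by (simp add: K_entire_def)
next
 case False
 interpret X: lcs X by fact
 have "\<exists>g. (\<forall>p\<in>pts X. g (p, 0) = (f p x, 0)) \<and> smooth_on (cx X) (cx B) (pts (cx X)) g" for x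
  using f[of x] False by (simp add: K_entire_def)
 then obtain g where g: "\<And>x p. p \<in> pts X \<Longrightarrow> g x (p, 0) = (f p x, 0)" "\<And>x. smooth_on (cx X) (cx B) (pts (cx X)) (g x)"
  by metis
 define \<BB> where "\<BB> = vs.extend_basis {}"
 have \<BB>: "vs.independent \<BB>" "vs.span \<BB> = UNIV"
  unfolding \<BB>_def using vs.independent_extend_basis vs.span_extend_basis vs.independent_empty by auto
 interpret vp: vector_space_pair s "smul B" by unfold_locales
 \<comment> \<open>\<open>g x\<close> need not be linear in \<open>x\<close>. Only its values at
   basis elements are kept, and \<open>construct\<close> extends the real and the imaginary part
   linearly.\<close>
 define G where "G p x = (vp.construct \<BB> (\<lambda>b. fst (g b p)) x, vp.construct \<BB> (\<lambda>b. snd (g b p)) x)" for p x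
 have lc: "lin s (smul B) (vp.construct \<BB> h)" for h
  using vp.linear_construct[OF \<BB>(1)] linear_eq_lin[OF vs.vector_space_axioms Bl.vs.vector_space_axioms] by blast
 have cxs: "lcs (cx X)" "lcs (cx B)" "lcs (cx E)" by (intro lcs_cx X Bl.lcs_axioms lcs_E)+
 interpret cXB: lcs2 "cx X" "cx B" using cxs by (simp add: lcs2_def)
 interpret cB: lcs2 "cx B" "cx B" using cxs by (simp add: lcs2_def)
 have Gs: "smooth_on (cx X) (cx B) (pts (cx X)) (\<lambda>p. G p x)" for x
 proof -
  \<comment> \<open>\<open>construct\<close> expands \<open>x\<close> in a basis, so
    \<open>G p x\<close> is a finite combination of the extensions \<open>g b p\<close>.\<close>
  let ?R = "vs.representation (vs.extend_basis \<BB>)"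
  have zero: "smooth_on (cx X) (cx B) (pts (cx X)) (\<lambda>p. 0)"
   by (rule cXB.smooth_on_const[OF openin_topspace]) (simp add: zero_prod_def)
  have sum: "smooth_on (cx X) (cx B) (pts (cx X)) (\<lambda>p. \<Sum>b\<in>I. h b p)"
   if "\<And>b. b \<in> I \<Longrightarrow> smooth_on (cx X) (cx B) (pts (cx X)) (h b)" for I and h :: "'h \<Rightarrow> 'x \<times> 'x \<Rightarrow> 'b \<times> 'b"
   using that
   by (induction I rule: infinite_finite_induct)
    (use zero in "auto intro: cXB.smooth_on_add")
  have lin1: "cont_linear B B (smul B c)" for c
   by (rule cont_linearI) (auto simp: Bl.vs.scale_right_distrib mult.commute intro!: Bl.lim_smul limitin_atin_id)
  have "smooth_on (cx X) (cx B) (pts (cx X)) (\<lambda>p. (smul B c (fst (g b p)), smul B c (snd (g b p))))" for c b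
   by (rule smooth_on_compose[OF cxs(1,2,2) g(2) cB.smooth_on_linear[OF cont_linear_cx[OF Bl.lcs_axioms Bl.lcs_axioms lin1]]])
    auto
  then have "smooth_on (cx X) (cx B) (pts (cx X))
   (\<lambda>p. if b \<in> \<BB> then (smul B (?R x b) (fst (g b p)), smul B (?R x b) (snd (g b p))) else 0)" for b
   using zero by (cases "b \<in> \<BB>") auto
  then have "smooth_on (cx X) (cx B) (pts (cx X)) (\<lambda>p. \<Sum>b | ?R x b \<noteq> 0.
    if b \<in> \<BB> then (smul B (?R x b) (fst (g b p)), smul B (?R x b) (snd (g b p))) else 0)"
   by (rule sum)
  then show ?thesis
  proof (rule cXB.smooth_on_cong)
   fix p
   have "(\<Sum>b | ?R x b \<noteq> 0. if b \<in> \<BB> then (smul B (?R x b) (fst (g b p)), smul B (?R x b) (snd (g b p))) else 0)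
    = (\<Sum>b | ?R x b \<noteq> 0. (smul B (?R x b) (if b \<in> \<BB> then fst (g b p) else 0), smul B (?R x b) (if b \<in> \<BB> then snd (g b p) else 0)))"
    by (rule sum.cong) (auto simp: zero_prod_def)
   then show "(\<Sum>b | ?R x b \<noteq> 0. if b \<in> \<BB> then (smul B (?R x b) (fst (g b p)), smul B (?R x b) (snd (g b p))) else 0) = G p x"
    unfolding G_def vp.construct_def by (simp add: sum_prod)
  qed
 qed
 \<comment> \<open>Families of pairs with two linear components; up to exchanging pairs and
   functions this is the complexification of the space of linear maps.\<close>
 define S' where "S' = {h :: 'h \<Rightarrow> 'b \<times> 'b. lin s (smul B) (\<lambda>x. fst (h x)) \<and> lin s (smul B) (\<lambda>x. snd (h x))}"
 let ?P = "pow_tvs (cx B) :: (complex, 'h \<Rightarrow> 'b \<times> 'b) tvs"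
 let ?T = "subspace_tvs ?P S'"
 have lP: "lcs ?P" by (rule lcs_pow[OF cxs(2)])
 interpret P: lcs ?P by (rule lP)
 have subS: "P.vs.subspace S'"
  by (rule P.vs.subspaceI)
   (auto simp: S'_def lin_def smul_cx case_prod_beta' Bl.vs.scale_right_distrib Bl.vs.scale_right_diff_distrib algebra_simps)
 have lT: "lcs ?T" by (rule lcs_subspace[OF lP subS])
 have GT: "smooth_on (cx X) ?T (pts (cx X)) G"
 proof (rule smooth_on_pow_subspace[OF cxs(1,2) subS _ openin_topspace _ Gs])
  show "G p \<in> S'" for p using lc by (simp add: S'_def G_def)
  fix q :: "complex \<Rightarrow> 'h \<Rightarrow> 'b \<times> 'b" and y
  assume ev: "eventually (\<lambda>t. q t \<in> S') (at 0)" and lim: "\<And>i. tlim (cx B) (\<lambda>t. q t i) (y i) (at 0)"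
  have "eventually (\<lambda>t. lin s (smul B) (\<lambda>x. fst (q t x))) (at 0)" "eventually (\<lambda>t. lin s (smul B) (\<lambda>x. snd (q t x))) (at 0)"
   using ev by (auto simp: S'_def elim: eventually_mono)
  note ev = this
  have "lin s (smul B) (\<lambda>x. fst (y x))"
   by (rule lin_closed[OF ev(1)]) (use lim in "auto simp: limitin_prod_iff")
  moreover have "lin s (smul B) (\<lambda>x. snd (y x))"
   by (rule lin_closed[OF ev(2)]) (use lim in "auto simp: limitin_prod_iff")
  ultimately show "y \<in> S'" by (simp add: S'_def)
 qed
 interpret TE: lcs2 ?T "cx E" using lT cxs by (simp add: lcs2_def)
 have "cont_linear ?T (cx E) (\<lambda>h. (\<lambda>x. fst (h x), \<lambda>x. snd (h x)))"
 proof (rule cont_linearI)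
  fix h assume "h \<in> pts ?T"
  from limitin_atin_id[OF this]
  show "tlim (cx E) (\<lambda>h. (\<lambda>x. fst (h x), \<lambda>x. snd (h x))) (\<lambda>x. fst (h x), \<lambda>x. snd (h x)) (atin (topol ?T) h)"
   unfolding tvs_simps(7) limitin_prod_iff lim_E
   by (auto simp: limitin_subtopology limitin_componentwise limitin_prod_iff S'_def elim: eventually_mono)
 qed (auto simp: smul_cx smul_E case_prod_beta' fun_eq_iff)
 from smooth_on_compose[OF cxs(1) lT cxs(3) GT TE.smooth_on_linear[OF this]]
 have "smooth_on (cx X) (cx E) (pts (cx X)) (\<lambda>p. (\<lambda>x. fst (G p x), \<lambda>x. snd (G p x)))"
  using lc by (auto simp: S'_def G_def image_subset_iff PiE_iff)
 moreover have "(\<lambda>x. fst (G (p, 0) x), \<lambda>x. snd (G (p, 0) x)) = (f p, 0)" if p: "p \<in> pts X" for p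
 proof -
  have "vp.construct \<BB> (\<lambda>b. f p b) = f p"
  proof
   fix x
   have "Vector_Spaces.linear s (smul B) (f p)"
    using l[OF p] linear_eq_lin[OF vs.vector_space_axioms Bl.vs.vector_space_axioms] by blast
   from vp.linear_eq_on[OF vp.linear_construct[OF \<BB>(1)] this, of x \<BB> "\<lambda>b. f p b"]
   show "vp.construct \<BB> (\<lambda>b. f p b) x = f p x" using vp.construct_basis[OF \<BB>(1)] \<BB>(2) by auto
  qed
  moreover have "vp.construct \<BB> (\<lambda>b. 0) x = 0" for x unfolding vp.construct_def by (simp add: if_distrib cong: if_cong)
  ultimately show ?thesis by (simp add: G_def g(1)[OF p] fun_eq_iff)
 qed
 ultimately show ?thesis
  unfolding K_entire_def using False
  by (auto intro!: exI[of _ "\<lambda>p. (\<lambda>x. fst (G p x), \<lambda>x. snd (G p x))"])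
qed

lemma K_entire_eval: "K_entire E B (\<lambda>\<phi>. \<phi> x)"
 by (rule K_entire_linear[OF lcs_E Bl.lcs_axioms eval_linear])

lemma K_entire_conv:
 assumes "lcs X" "\<And>x. K_entire X B (\<lambda>p. f p x)" "\<And>x. K_entire X B (\<lambda>p. g p x)"
 shows "K_entire X B (\<lambda>p. V.conv (f p) (g p) x)"
 unfolding V.conv_def sw_def
 by (rule K_entire_lin_ext[OF assms(1) Bl.lcs_axioms])
  (rule K_entire_bilinear_compose[OF assms(1) Bl.lcs_axioms Bl.lcs_axioms Bl.lcs_axioms mult_B assms(2,3)])

lemma K_entire_smul_const:
 assumes "lcs X" "K_entire X B f" shows "K_entire X B (\<lambda>p. smul B c (f p))"
proof -
 have "cont_linear B B (smul B c)"
  by (rule cont_linearI) (auto simp: Bl.vs.scale_right_distrib mult.commute intro!: Bl.lim_smul limitin_atin_id)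
 from K_entire_linear_compose[OF assms(1) Bl.lcs_axioms Bl.lcs_axioms this assms(2)] show ?thesis .
qed

lemmas K_entire_B = K_entire_add[OF _ Bl.lcs_axioms] K_entire_diff[OF _ Bl.lcs_axioms]
 K_entire_conv K_entire_smul_const K_entire_eval K_entire_const[OF _ Bl.lcs_axioms] lcs_E

text \<open>For fixed \<open>x\<close> the fixed point is read off after \<open>bound\<close> many
  iterations, a number that does not depend on \<open>\<phi>\<close>; each iteration is a finite
  expression in convolutions and evaluations.\<close>

lemma K_entire_log_chart: "K_entire E E V.log_chart"
proof (rule K_entire_hom[OF lcs_E])
 show "p \<in> pts E \<Longrightarrow> lin s (smul B) (V.log_chart p)" for p using V.lin_log_chart by (simp add: pts_E)
 have it: "K_entire E B (\<lambda>\<phi>. (V.T_log \<phi> ^^ j) (\<lambda>_. 0) x)" for j x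
 proof (induction j arbitrary: x)
  case (Suc j)
  have e: "(V.T_log \<phi> ^^ Suc j) (\<lambda>_. 0) x = \<phi> (V.Y x) -
    V.conv (\<lambda>x. \<phi> x - smul B (\<epsilon> x) (\<phi> 1)) ((V.T_log \<phi> ^^ j) (\<lambda>_. 0)) x" for \<phi>
   unfolding funpow.simps o_def by (rule V.T_log_def)
  show ?case unfolding e by (intro K_entire_B Suc | simp)+
 qed (auto intro!: K_entire_B)
 show "K_entire E B (\<lambda>\<phi>. V.log_chart \<phi> x)" for x
  unfolding V.log_chart_def trifix_def by (intro K_entire_B it | simp)+
qed

lemma K_entire_exp_chart: "K_entire E E V.exp_chart"
proof (rule K_entire_hom[OF lcs_E])
 show "p \<in> pts E \<Longrightarrow> lin s (smul B) (V.exp_chart p)" for p using V.lin_exp_chart by (simp add: pts_E)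
 have it: "K_entire E B (\<lambda>\<phi>. (V.T_exp \<phi> ^^ j) (\<lambda>_. 0) x)" for j x
 proof (induction j arbitrary: x)
  case (Suc j)
  have e: "(V.T_exp \<phi> ^^ Suc j) (\<lambda>_. 0) x = V.unit x +
    V.conv ((V.T_exp \<phi> ^^ j) (\<lambda>_. 0)) (\<lambda>x. \<phi> (V.Y x)) (V.Yi x)" for \<phi>
   unfolding funpow.simps o_def by (rule V.T_exp_def)
  show ?case unfolding e by (intro K_entire_B Suc | simp)+
 qed (auto intro!: K_entire_B)
 show "K_entire E B (\<lambda>\<phi>. V.exp_chart \<phi> x)" for x
  unfolding V.exp_chart_def trifix_def by (intro K_entire_B it | simp)+
qed

lemma K_entire_mult: "K_entire (prod_tvs E E) E (\<lambda>p. V.conv (fst p) (snd p))"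
proof (rule K_entire_hom[OF lcs_prod[OF lcs_E lcs_E]])
 let ?X = "prod_tvs E E"
 show "p \<in> pts ?X \<Longrightarrow> lin s (smul B) (V.conv (fst p) (snd p))" for p
  using V.lin_conv by (auto simp: pts_E)
 have X: "lcs ?X" by (intro lcs_prod lcs_E)
 have p: "p \<in> pts ?X \<Longrightarrow> fst p \<in> pts E \<and> snd p \<in> pts E" for p by auto
 have "cont_linear ?X E fst" "cont_linear ?X E snd"
  by (rule cont_linearI; auto simp: smul_E intro!: atin_prod_limits)+
 then have "K_entire ?X B (\<lambda>p. fst p x)" "K_entire ?X B (\<lambda>p. snd p x)" for x
  using K_entire_compose[OF X lcs_E Bl.lcs_axioms K_entire_linear[OF X lcs_E] K_entire_eval] by blast+
 then show "K_entire ?X B (\<lambda>p. V.conv (fst p) (snd p) x)" for x by (intro K_entire_conv X)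
qed

text \<open>The quotient at \<open>t\<close> is \<open>\<eta> t \<star> (v \<circ> Y)\<close>,
  evaluated at \<open>Yi x\<close>, plus a counit term. Continuity of the chart sends
  \<open>\<eta> t\<close> to \<open>unit\<close>, and \<open>Yi_Y\<close> recombines the limit to
  \<open>v\<close>. This identifies tangent vectors at the unit with infinitesimal
  characters.\<close>

lemma exp_chart_deriv:
 assumes v: "v \<in> pts E"
 shows "has_dir_deriv E E V.exp_chart 0 v v"
proof -
 have lv: "lin s (smul B) v" using v by (simp add: pts_E)
 have l0: "lin s (smul B) (\<lambda>x. 0)" by (rule Bl.vs.lin_zero_fun)
 have ltv: "lin s (smul B) (\<lambda>x. smul B t (v x))" for t by (rule Bl.vs.lin_scale_fun[OF lv])
 define \<eta> where "\<eta> t = trifix (V.T_exp (\<lambda>x. smul B t (v x)))" for t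
 have l\<eta>: "lin s (smul B) (\<eta> t)" for t unfolding \<eta>_def by (rule V.fix_exp(1)[OF ltv])
 have \<eta>: "\<eta> t x = V.unit x + smul B t (V.conv (\<eta> t) (\<lambda>x. v (V.Y x)) (V.Yi x))" for t x
 proof -
  have "\<eta> t x = V.T_exp (\<lambda>x. smul B t (v x)) (\<eta> t) x"
   using V.fix_exp(2)[OF ltv, of t] by (simp only: \<eta>_def)
  also have "\<dots> = V.unit x + V.conv (\<eta> t) (\<lambda>x. smul B t (v (V.Y x))) (V.Yi x)" by (rule V.T_exp_def)
  finally show ?thesis by (simp only: V.conv_scale_right)
 qed
 have \<eta>0: "\<eta> 0 = V.unit" using \<eta>[of 0] by (simp add: fun_eq_iff)
 have e: "V.exp_chart (0 + smul E t v) x = \<eta> t x + smul B (\<epsilon> x) (smul B t (v 1))" for t x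
  by (simp add: V.exp_chart_def \<eta>_def smul_E)
 have e0: "V.exp_chart 0 x = V.unit x" for x using e[of 0 x] \<eta>0 by simp
 have q: "smul E (inverse t) (V.exp_chart (0 + smul E t v) - V.exp_chart 0) x =
   V.conv (\<eta> t) (\<lambda>x. v (V.Y x)) (V.Yi x) + smul B (\<epsilon> x) (v 1)" if "t \<noteq> 0" for t x
 proof -
  have "smul E (inverse t) (V.exp_chart (0 + smul E t v) - V.exp_chart 0) x =
    smul B (inverse t) (V.exp_chart (0 + smul E t v) x - V.exp_chart 0 x)"
   by (simp add: smul_E)
  also have "\<dots> = smul B (inverse t) (smul B t (V.conv (\<eta> t) (\<lambda>x. v (V.Y x)) (V.Yi x)) + smul B t (smul B (\<epsilon> x) (v 1)))"
   unfolding e e0 \<eta>[of t x] by (simp add: mult.commute)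
  finally show ?thesis using that by (simp add: Bl.vs.scale_right_distrib)
 qed
 interpret EE: lcs2 E E by (simp add: lcs2_def lcs_E)
 have "smooth_on E E (pts E) V.exp_chart"
  by (intro K_analytic_on_imp_smooth[OF lcs_E lcs_E] K_entire_imp_analytic[OF lcs_E] K_entire_exp_chart)
 from EE.smooth_on_lim[OF this El.lim_line[OF El.zero_pts v]]
 have "tlim E (\<lambda>t. V.exp_chart (0 + smul E t v)) (V.exp_chart 0) (at 0)" by simp
 then have "tlim B (\<lambda>t. V.exp_chart (0 + smul E t v) x) (V.exp_chart 0 x) (at 0)" for x
  by (simp add: lim_E)
 then have "tlim B (\<lambda>t. (\<eta> t x + smul B (\<epsilon> x) (smul B t (v 1))) - smul B (\<epsilon> x) (smul B t (v 1))) (V.unit x - smul B (\<epsilon> x) (smul B 0 (v 1))) (at 0)" for x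
  unfolding e e0 by (intro Bl.lim_diff Bl.lim_smul tendsto_const tendsto_ident_at) auto
 then have \<eta>lim: "tlim B (\<lambda>t. \<eta> t x) (V.unit x) (at 0)" for x by simp
 have conv: "tlim B (\<lambda>t. V.conv (\<eta> t) (\<lambda>x. v (V.Y x)) (V.Yi x) + smul B (\<epsilon> x) (v 1)) (v x) (at 0)" for x
 proof -
  have "tlim B (\<lambda>t. V.conv (\<eta> t) (\<lambda>x. v (V.Y x)) z) (V.conv V.unit (\<lambda>x. v (V.Y x)) z) (at 0)" for z
   unfolding V.conv_def sw_def lin_ext_def case_prod_beta'
   by (intro Bl.lim_sum Bl.lim_smul tendsto_const cont_bilinear_lim[OF mult_B] \<eta>lim) simp
  then have "tlim B (\<lambda>t. V.conv (\<eta> t) (\<lambda>x. v (V.Y x)) (V.Yi x) + smul B (\<epsilon> x) (v 1))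
    (V.conv V.unit (\<lambda>x. v (V.Y x)) (V.Yi x) + smul B (\<epsilon> x) (v 1)) (at 0)"
   by (intro Bl.lim_add) simp_all
  moreover have "V.conv V.unit (\<lambda>x. v (V.Y x)) (V.Yi x) + smul B (\<epsilon> x) (v 1) = v x"
   unfolding V.conv_unit_left[OF lin_compose[OF V.lin_Y(1) lv]] V.Yi_Y V.lin_proj[OF lv] by simp
  ultimately show ?thesis by simp
 qed
 show ?thesis
  unfolding has_dir_deriv_def lim_E
 proof (intro conjI allI lv)
  show "eventually (\<lambda>t. lin s (smul B) (smul E (inverse t) (V.exp_chart (0 + smul E t v) - V.exp_chart 0))) (at 0)"
  proof (intro always_eventually allI)
   fix t
   have "smul E (inverse t) (V.exp_chart (0 + smul E t v) - V.exp_chart 0) \<in> pts E"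
    by (intro El.smul_pts El.diff_pts) (use V.lin_exp_chart v El.smul_pts El.zero_pts in "auto simp: pts_E")
   then show "lin s (smul B) (smul E (inverse t) (V.exp_chart (0 + smul E t v) - V.exp_chart 0))" by (simp add: pts_E)
  qed
  show "tlim B (\<lambda>t. smul E (inverse t) (V.exp_chart (0 + smul E t v) - V.exp_chart 0) x) (v x) (at 0)" for x
   by (rule limitin_transform_eventually[OF _ conv]) (use eventually_at_neq[of 0] q in "auto elim: eventually_mono")
 qed
qed

end

section \<open>The initial value problem\<close>

locale char_int = char_setting s \<Delta> \<epsilon> S gr B
 for s :: "'k::real_or_complex_field \<Rightarrow> 'h::{ring, monoid_mult} \<Rightarrow> 'h" and \<Delta> \<epsilon> S gr
  and B :: "('k, 'b::{comm_ring, comm_monoid_mult}) tvs" +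
 fixes r :: enat
 assumes int: "int_space B r"
begin

sublocale I: int_space B r by (rule int)

abbreviation "CB \<equiv> Cr_curve_space B r"
abbreviation "A \<equiv> Cr_curves B r"
abbreviation "cs \<equiv> \<lambda>a (c :: real \<Rightarrow> 'b) t. smul B a (c t)"

lemma lcs_CB: "lcs CB" by (rule lcs_curve_space[OF Bl.lcs_axioms])

lemma smul_CB: "smul CB = cs" by (rule Bl.smul_curve_space)

lemma pts_CB: "pts CB = A" by (rule Bl.pts_curve_space)

lemma mult_CB: "cont_bilinear CB CB CB (*)"
proof -
 have "(*) = (\<lambda>c d (t::real). c t * d t :: 'b)" by (simp add: times_fun_def fun_eq_iff)
 with cont_bilinear_curves[OF Bl.lcs_axioms Bl.lcs_axioms Bl.lcs_axioms mult_B I.r] show ?thesis by simp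
qed

lemma A_mult: "c \<in> A \<Longrightarrow> d \<in> A \<Longrightarrow> c * d \<in> A"
 using cont_bilinear_pts[OF mult_CB] by (simp add: pts_CB)

lemma A_sub: "W.V.subspace A"
 by (rule W.V.subspaceI) (simp_all add: Bl.Cr_curves_zero(1) Bl.Cr_curves_add(1) Bl.Cr_curves_smul(1))

text \<open>The constant curve at the unit of the group, cut off outside \<open>[0,1]\<close> as
  elements of \<open>Cr_curves\<close> are.\<close>

definition one_c :: "'h \<Rightarrow> real \<Rightarrow> 'b" where
 "one_c x = (\<lambda>t. if t \<in> {0..1} then smul B (\<epsilon> x) 1 else 0)"

lemma one_c_deriv: "t \<in> {0..1} \<Longrightarrow> deriv01 B (one_c x) t 0"
 using has_curve_deriv_cong[of "{0..1}" "one_c x" "\<lambda>_. smul B (\<epsilon> x) 1" t B 0] Bl.has_curve_deriv_const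
 by (simp add: one_c_def)

lemma one_c_A: "one_c x \<in> A"
proof (rule Bl.Cr_curves_family(1)[where C = "\<lambda>k. if k = 0 then one_c x else (\<lambda>_. 0)"])
 fix k :: nat and t :: real assume t: "t \<in> {0..1}"
 show "deriv01 B (if k = 0 then one_c x else (\<lambda>_. 0)) t ((if Suc k = 0 then one_c x else (\<lambda>_. 0)) t)"
  using one_c_deriv[OF t] Bl.has_curve_deriv_const by simp
next
 fix k :: nat
 have "cont01 B (one_c x)"
  unfolding continuous_map_top_of_set_iff using Bl.has_curve_deriv_lim[OF one_c_deriv] by simp
 then show "cont01 B (if k = 0 then one_c x else (\<lambda>_. 0))" by simp
next
 fix t :: real assume "t \<notin> {0..1}"
 then show "one_c x t = 0" by (simp only: one_c_def if_False)
qed (auto simp: one_c_def)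

lemma lin_one_c: "lin s cs one_c"
 using lin_counit by (simp add: lin_def one_c_def fun_eq_iff Bl.vs.scale_left_distrib)

text \<open>A curve of infinitesimal characters in transposed form: one curve in the algebra for
  each element of the Hopf algebra, which is the shape that \<open>trifix\<close> takes.\<close>

definition admissible :: "('h \<Rightarrow> real \<Rightarrow> 'b) \<Rightarrow> bool" where
 "admissible \<gamma> \<longleftrightarrow> lin s cs \<gamma> \<and> range \<gamma> \<subseteq> A \<and> (\<forall>t\<in>{0..1}. V.infchr (\<lambda>x. \<gamma> x t))"

lemma admissible_one: "admissible \<gamma> \<Longrightarrow> \<gamma> 1 = 0"
proof
 fix t assume g: "admissible \<gamma>"
 show "\<gamma> 1 t = 0 t"
 proof (cases "t \<in> {0..1}")
  case True
  then have "V.infchr (\<lambda>x. \<gamma> x t)" using g unfolding admissible_def by blast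
  from V.infchr_one[OF this] show ?thesis by simp
 next
  case False
  have "\<gamma> 1 \<in> A" using g unfolding admissible_def by blast
  then show ?thesis using False by (simp add: Cr_curves_def)
 qed
qed

lemma conv_A: "range \<eta> \<subseteq> A \<Longrightarrow> range \<gamma> \<subseteq> A \<Longrightarrow> W.conv \<eta> \<gamma> x \<in> A"
 unfolding W.conv_def sw_def lin_ext_def case_prod_beta'
 by (intro W.V.subspace_sum[OF A_sub] W.V.subspace_scale[OF A_sub] A_mult) (simp_all add: image_subset_iff)

lemma conv_eval: "W.conv \<eta> \<gamma> x t = V.conv (\<lambda>a. \<eta> a t) (\<lambda>b. \<gamma> b t) x"
proof -
 have "lin cs (smul B) (\<lambda>c. c t)" by (simp add: lin_def)
 from sw_commute[OF Bl.vs.vector_space_axioms this, of x "\<lambda>a b. \<eta> a * \<gamma> b"]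
 show ?thesis by (simp add: W.conv_def V.conv_def)
qed

definition T_ev :: "('h \<Rightarrow> real \<Rightarrow> 'b) \<Rightarrow> ('h \<Rightarrow> real \<Rightarrow> 'b) \<Rightarrow> 'h \<Rightarrow> real \<Rightarrow> 'b" where
 "T_ev \<gamma> \<eta> x = one_c x + I.integ (W.conv \<eta> \<gamma> x)"

definition sol :: "('h \<Rightarrow> real \<Rightarrow> 'b) \<Rightarrow> 'h \<Rightarrow> real \<Rightarrow> 'b" where
 "sol \<gamma> = trifix (T_ev \<gamma>)"

lemma integ_zero: "I.integ 0 = 0"
 using I.integ_add[OF Bl.Cr_curves_zero(1) Bl.Cr_curves_zero(1)] by simp

lemma sol:
 assumes g: "admissible \<gamma>"
 shows "lin s cs (sol \<gamma>)" "range (sol \<gamma>) \<subseteq> A" "sol \<gamma> x = one_c x + I.integ (W.conv (sol \<gamma>) \<gamma> x)"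
proof -
 have l: "lin s cs \<gamma>" and A: "range \<gamma> \<subseteq> A" and 1: "\<gamma> 1 = 0"
  using g admissible_one[OF g] unfolding admissible_def by auto
 have T: "lin s cs (T_ev \<gamma> \<eta>) \<and> range (T_ev \<gamma> \<eta>) \<subseteq> A" if \<eta>: "lin s cs \<eta>" "range \<eta> \<subseteq> A" for \<eta>
 proof
  have c: "W.conv \<eta> \<gamma> x \<in> A" for x by (rule conv_A[OF \<eta>(2) A])
  have lc: "lin s cs (W.conv \<eta> \<gamma>)" by (rule W.lin_conv[OF \<eta>(1) l])
  have "lin s cs (\<lambda>x. I.integ (W.conv \<eta> \<gamma> x))"
   unfolding lin_def
  proof (intro conjI allI)
   fix x y a
   have "W.conv \<eta> \<gamma> (x + y) = W.conv \<eta> \<gamma> x + W.conv \<eta> \<gamma> y" "W.conv \<eta> \<gamma> (s a x) = cs a (W.conv \<eta> \<gamma> x)"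
    using lc unfolding lin_def by blast+
   then show "I.integ (W.conv \<eta> \<gamma> (x + y)) = I.integ (W.conv \<eta> \<gamma> x) + I.integ (W.conv \<eta> \<gamma> y)"
    "I.integ (W.conv \<eta> \<gamma> (s a x)) = cs a (I.integ (W.conv \<eta> \<gamma> x))"
    by (simp_all only: I.integ_add[OF c c] I.integ_smul[OF c])
  qed
  then show "lin s cs (T_ev \<gamma> \<eta>)" unfolding T_ev_def[abs_def] by (rule W.V.lin_add_fun[OF lin_one_c])
  show "range (T_ev \<gamma> \<eta>) \<subseteq> A"
   unfolding T_ev_def[abs_def] using W.V.subspace_add[OF A_sub one_c_A I.integ_curve(1)[OF c]] by blast
 qed
 have C: "vanish (\<lambda>x. T_ev \<gamma> \<eta> x - T_ev \<gamma> \<eta>' x) (Suc n)"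
  if \<eta>: "lin s cs \<eta>" "range \<eta> \<subseteq> A" "lin s cs \<eta>'" "range \<eta>' \<subseteq> A" and v: "vanish (\<lambda>x. \<eta> x - \<eta>' x) n" for \<eta> \<eta>' n
 proof -
  have vc: "vanish (W.conv (\<lambda>x. \<eta> x - \<eta>' x) \<gamma>) (Suc n)"
   by (rule W.conv_vanish(1)[OF W.V.lin_diff_fun[OF \<eta>(1,3)] l v 1])
  have e: "T_ev \<gamma> \<eta> x - T_ev \<gamma> \<eta>' x = I.integ (W.conv (\<lambda>x. \<eta> x - \<eta>' x) \<gamma> x)" for x
   unfolding T_ev_def W.conv_diff_left I.integ_diff[OF conv_A[OF \<eta>(2) A] conv_A[OF \<eta>(4) A]] by simp
  show ?thesis
   unfolding vanish_def e using vc integ_zero unfolding vanish_def by simp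
 qed
 show "lin s cs (sol \<gamma>)" unfolding sol_def by (rule lin_trifix[OF W.V.vector_space_axioms A_sub T C])
 show "range (sol \<gamma>) \<subseteq> A" unfolding sol_def by (rule trifix_range[OF W.V.vector_space_axioms A_sub T C])
 have "T_ev \<gamma> (sol \<gamma>) = sol \<gamma>" unfolding sol_def by (rule trifix_fixed[OF W.V.vector_space_axioms A_sub T C])
 then have "sol \<gamma> x = T_ev \<gamma> (sol \<gamma>) x" by simp
 also have "\<dots> = one_c x + I.integ (W.conv (sol \<gamma>) \<gamma> x)" by (rule T_ev_def)
 finally show "sol \<gamma> x = one_c x + I.integ (W.conv (sol \<gamma>) \<gamma> x)" .
qed

lemma conv_sol_A: "admissible \<gamma> \<Longrightarrow> W.conv (sol \<gamma>) \<gamma> x \<in> A"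
 by (rule conv_A[OF sol(2)]) (simp_all add: admissible_def)

lemma sol_deriv:
 assumes g: "admissible \<gamma>" and t: "t \<in> {0..1}"
 shows "deriv01 B (sol \<gamma> x) t (V.conv (\<lambda>a. sol \<gamma> a t) (\<lambda>b. \<gamma> b t) x)"
proof -
 have "deriv01 B (\<lambda>t. one_c x t + I.integ (W.conv (sol \<gamma>) \<gamma> x) t) t (0 + W.conv (sol \<gamma>) \<gamma> x t)"
  by (intro Bl.has_curve_deriv_add one_c_deriv t I.integ(3) conv_sol_A g)
 moreover have "(\<lambda>t. one_c x t + I.integ (W.conv (sol \<gamma>) \<gamma> x) t) = sol \<gamma> x"
  unfolding fun_eq_iff plus_fun_apply[symmetric] using sol(3)[OF g, of x] by metis
 ultimately show ?thesis by (simp add: conv_eval)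
qed

lemma sol_0:
 assumes g: "admissible \<gamma>" shows "sol \<gamma> x 0 = smul B (\<epsilon> x) 1"
proof -
 have "sol \<gamma> x 0 = (one_c x + I.integ (W.conv (sol \<gamma>) \<gamma> x)) 0" using sol(3)[OF g] by metis
 then show ?thesis using I.integ(1)[OF conv_sol_A[OF g]] by (simp add: one_c_def)
qed

lemma lin_sol: "admissible \<gamma> \<Longrightarrow> lin s (smul B) (\<lambda>x. sol \<gamma> x t)"
 using sol(1)[of \<gamma>] by (simp add: lin_def)

text \<open>Induction on the total degree. Multiplicativity in lower degrees gives, by
  \<open>conv_infchr_mult\<close> and the product rule, that the defect has derivative 0; it
  vanishes at time 0 because the counit is multiplicative.\<close>

lemma sol_chr:
 assumes g: "admissible \<gamma>" and t: "t \<in> {0..1}"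
 shows "V.chr (\<lambda>x. sol \<gamma> x t)"
proof -
 note l = lin_sol[OF g]
 have inf: "V.infchr (\<lambda>x. \<gamma> x t)" if "t \<in> {0..1}" for t using g that unfolding admissible_def by blast
 \<comment> \<open>The time is quantified inside the induction: the derivative of the defect at any
   time \<open>u\<close> uses multiplicativity at \<open>u\<close> in lower total degree.\<close>
 have key: "\<forall>n m x y. n + m = N \<longrightarrow> x \<in> gr n \<longrightarrow> y \<in> gr m \<longrightarrow>
   (\<forall>t\<in>{0..1}. sol \<gamma> (x * y) t = sol \<gamma> x t * sol \<gamma> y t)" for N
 proof (induction N rule: less_induct)
  case (less N)
  show ?case
  proof (intro allI impI ballI)
   fix n m x y and t :: real assume nm: "n + m = N" "x \<in> gr n" "y \<in> gr m" and t: "t \<in> {0..1}"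
   let ?D = "\<lambda>t. sol \<gamma> (x * y) t - sol \<gamma> x t * sol \<gamma> y t"
   have "deriv01 B ?D u 0" if u: "u \<in> {0..1}" for u
   proof -
    let ?c = "\<lambda>z. V.conv (\<lambda>a. sol \<gamma> a u) (\<lambda>b. \<gamma> b u) z"
    have IH: "sol \<gamma> (a * b) u = sol \<gamma> a u * sol \<gamma> b u" if "i + j < n + m" "a \<in> gr i" "b \<in> gr j" for i j a b
     using less.IH[of "i + j"] that nm(1) u by blast
    have "?c (x * y) = ?c x * sol \<gamma> y u + sol \<gamma> x u * ?c y"
     by (rule V.conv_infchr_mult[OF l inf[OF u] nm(2,3)]) (rule IH)
    moreover have "deriv01 B (\<lambda>t. sol \<gamma> x t * sol \<gamma> y t) u (?c x * sol \<gamma> y u + sol \<gamma> x u * ?c y)"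
     by (rule has_curve_deriv_bilinear[OF Bl.lcs_axioms Bl.lcs_axioms Bl.lcs_axioms mult_B sol_deriv[OF g u] _ sol_deriv[OF g u] _ u]) simp_all
    ultimately show ?thesis
     using Bl.has_curve_deriv_diff[OF sol_deriv[OF g u, of "x * y"]] by fastforce
   qed
   from Bl.zero_deriv_const[OF this t] have "?D t = ?D 0" .
   also have "?D 0 = 0" by (simp add: sol_0[OF g] counit_mult V.V_mult)
   finally show "sol \<gamma> (x * y) t = sol \<gamma> x t * sol \<gamma> y t" by simp
  qed
 qed
 have b: "bilin s (smul B) (\<lambda>x y. sol \<gamma> (x * y) t)"
  by (rule bilinI) (rule V.lin_mult_arg[OF l])+
 have b': "bilin s (smul B) (\<lambda>x y. sol \<gamma> x t * sol \<gamma> y t)" by (rule V.bilin_mult[OF l l])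
 have "sol \<gamma> (x * y) t = sol \<gamma> x t * sol \<gamma> y t" for x y
  by (rule bilin_eq_gr[OF b b']) (use key t in simp)
 moreover have "sol \<gamma> 1 t = 1"
 proof -
  have "deriv01 B (sol \<gamma> 1) u 0" if u: "u \<in> {0..1}" for u
  proof -
   have lu: "lin s (smul B) (\<lambda>b. \<gamma> b u)" using inf[OF u] by (simp add: V.infchr_def)
   have "V.conv (\<lambda>a. sol \<gamma> a u) (\<lambda>b. \<gamma> b u) 1 = 0"
    unfolding V.conv_one[OF l lu] using V.infchr_one[OF inf[OF u]] by simp
   then show ?thesis using sol_deriv[OF g u, of 1] by simp
  qed
  from Bl.zero_deriv_const[OF this t] show ?thesis by (simp add: sol_0[OF g] counit_one)
 qed
 ultimately show ?thesis using l by (simp add: V.chr_def)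
qed

text \<open>The competitor is known only through its derivatives pointwise in \<open>x\<close>, so
  the argument runs by degree on derivatives: as \<open>\<gamma>\<close> vanishes at 1, the
  derivative of the difference \<open>\<delta>\<close> in degree \<open>n\<close> involves only
  lower degrees, and \<open>\<delta>\<close> is 0 at time 0.\<close>

lemma sol_unique:
 assumes g: "admissible \<gamma>"
  and l: "\<And>t. t \<in> {0..1} \<Longrightarrow> lin s (smul B) (\<eta> t)" and \<eta>0: "\<And>x. \<eta> 0 x = smul B (\<epsilon> x) 1"
  and d: "\<And>t x. t \<in> {0..1} \<Longrightarrow> deriv01 B (\<lambda>t. \<eta> t x) t (V.conv (\<eta> t) (\<lambda>b. \<gamma> b t) x)"
  and t: "t \<in> {0..1}"
 shows "\<eta> t x = sol \<gamma> x t"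
proof -
 define \<delta> where "\<delta> t = (\<lambda>x. \<eta> t x - sol \<gamma> x t)" for t
 have l\<delta>: "lin s (smul B) (\<delta> t)" if "t \<in> {0..1}" for t
  unfolding \<delta>_def by (rule Bl.vs.lin_diff_fun[OF l[OF that] lin_sol[OF g]])
 have inf: "V.infchr (\<lambda>x. \<gamma> x t)" if "t \<in> {0..1}" for t using g that unfolding admissible_def by blast
 have key: "\<forall>x\<in>gr n. \<forall>t\<in>{0..1}. \<delta> t x = 0" for n
 proof (induction n rule: less_induct)
  case (less n)
  show ?case
  proof (intro ballI)
   fix x and t :: real assume x: "x \<in> gr n" and t: "t \<in> {0..1}"
   have "deriv01 B (\<lambda>t. \<delta> t x) u 0" if u: "u \<in> {0..1}" for u
   proof -
    have lu: "lin s (smul B) (\<lambda>b. \<gamma> b u)" and 1: "\<gamma> 1 u = 0"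
     using inf[OF u] V.infchr_one[OF inf[OF u]] by (simp_all add: V.infchr_def)
    have "V.conv (\<delta> u) (\<lambda>b. \<gamma> b u) x = 0"
     unfolding V.conv_def
    proof (rule sw_graded_zero[OF V.Vv V.bilin_mult[OF l\<delta>[OF u] lu] x])
     fix i j a b assume ij: "i + j = n" "a \<in> gr i" "b \<in> gr j"
     show "\<delta> u a * \<gamma> b u = 0"
     proof (cases "j = 0")
      case True
      then have "\<gamma> b u = 0" using V.lin_gr_0[OF lu 1, of b] ij by simp
      then show ?thesis by simp
     next
      case False
      then have "i < n" using ij by simp
      then have "\<delta> u a = 0" using less.IH ij u by blast
      then show ?thesis by simp
     qed
    qed
    then have "V.conv (\<eta> u) (\<lambda>b. \<gamma> b u) x - V.conv (\<lambda>a. sol \<gamma> a u) (\<lambda>b. \<gamma> b u) x = 0"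
     unfolding \<delta>_def V.conv_diff_left .
    moreover have "deriv01 B (\<lambda>t. \<eta> t x - sol \<gamma> x t) u
      (V.conv (\<eta> u) (\<lambda>b. \<gamma> b u) x - V.conv (\<lambda>a. sol \<gamma> a u) (\<lambda>b. \<gamma> b u) x)"
     by (rule Bl.has_curve_deriv_diff[OF d[OF u] sol_deriv[OF g u]])
    ultimately show ?thesis by (simp add: \<delta>_def)
   qed
   from Bl.zero_deriv_const[OF this t] show "\<delta> t x = 0" by (simp add: \<delta>_def \<eta>0 sol_0[OF g])
  qed
 qed
 have "\<delta> t x = 0"
  by (rule lin_eq_gr[OF l\<delta>[OF t] Bl.vs.lin_zero_fun]) (use key t in blast)
 then show ?thesis by (simp add: \<delta>_def)
qed

text \<open>The value at \<open>x\<close> is reached after \<open>bound x\<close> Picard steps, each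
  built from the pointwise product of curves and from integration. As \<open>\<Gamma> p\<close>
  depends linearly on \<open>p\<close>, every step is entire.\<close>

lemma K_entire_sol:
 fixes X :: "('k, 'x::ab_group_add) tvs"
 assumes X: "lcs X" and \<Gamma>: "\<And>x. cont_linear X CB (\<lambda>p. \<Gamma> p x)" and adm: "\<And>p. p \<in> pts X \<Longrightarrow> admissible (\<Gamma> p)"
 shows "K_entire X E (\<lambda>p x. sol (\<Gamma> p) x 1)"
proof (rule K_entire_hom[OF X])
 show "p \<in> pts X \<Longrightarrow> lin s (smul B) (\<lambda>x. sol (\<Gamma> p) x 1)" for p by (rule lin_sol[OF adm])
 have it: "K_entire X CB (\<lambda>p. (T_ev (\<Gamma> p) ^^ j) (\<lambda>_. 0) x)" for j x
 proof (induction j arbitrary: x)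
  case 0
  have "(0 :: real \<Rightarrow> 'b) \<in> pts CB" unfolding pts_CB by (rule Bl.Cr_curves_zero(1))
  from K_entire_const[OF X lcs_CB this] show ?case by (simp add: zero_fun_def)
 next
  case (Suc j)
  let ?\<eta> = "\<lambda>p. (T_ev (\<Gamma> p) ^^ j) (\<lambda>_. 0)"
  have "K_entire X CB (\<lambda>p. lin_ext (smul CB) (\<lambda>(a, b). ?\<eta> p a * \<Gamma> p b) (\<Delta> x))"
   by (rule K_entire_lin_ext[OF X lcs_CB], rule K_entire_bilinear_compose[OF X lcs_CB lcs_CB lcs_CB mult_CB Suc K_entire_linear[OF X lcs_CB \<Gamma>]])
  then have c: "K_entire X CB (\<lambda>p. W.conv (?\<eta> p) (\<Gamma> p) x)" unfolding W.conv_def sw_def smul_CB .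
  have "K_entire X CB (\<lambda>p. one_c x + I.integ (W.conv (?\<eta> p) (\<Gamma> p) x))"
   by (intro K_entire_add[OF X lcs_CB] K_entire_const[OF X lcs_CB] K_entire_linear_compose[OF X lcs_CB lcs_CB I.cont_linear_integ c])
    (simp add: pts_CB one_c_A)
  moreover have "(T_ev (\<Gamma> p) ^^ Suc j) (\<lambda>_. 0) x = one_c x + I.integ (W.conv (?\<eta> p) (\<Gamma> p) x)" for p
   unfolding funpow.simps o_def by (rule T_ev_def)
  ultimately show ?case by (simp only:)
 qed
 show "K_entire X B (\<lambda>p. sol (\<Gamma> p) x 1)" for x
  unfolding sol_def trifix_def
  by (rule K_entire_linear_compose[OF X lcs_CB Bl.lcs_axioms Bl.cont_linear_eval it])
qed

end

section \<open>Manifolds with a global chart\<close>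

context lcs2
begin

lemma iter_dir_deriv_1: "iterD E F f (Suc 0) x v = dir_deriv E F f x (v 0)"
 by (simp add: iter_dir_deriv.simps(2))

lemma smooth_has_dir_deriv:
 assumes "smooth_on E F U f" "x \<in> U" "v \<in> pts E"
 shows "has_dir_deriv E F f x v (dir_deriv E F f x v)"
 using smooth_on_deriv[OF assms(1,2), of 0 "\<lambda>_. v"] assms(3) by (simp add: iter_dir_deriv_1)

lemma dir_deriv_pts: "smooth_on E F U f \<Longrightarrow> x \<in> U \<Longrightarrow> v \<in> pts E \<Longrightarrow> dir_deriv E F f x v \<in> pts F"
 using iter_pts[of U f x "Suc 0" "\<lambda>_. v"] by (simp add: iter_dir_deriv_1)

lemma dir_deriv_add:
 "smooth_on E F U f \<Longrightarrow> x \<in> U \<Longrightarrow> a \<in> pts E \<Longrightarrow> b \<in> pts E \<Longrightarrow>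
  dir_deriv E F f x (a + b) = dir_deriv E F f x a + dir_deriv E F f x b"
 using iter_add_last[of U f x 0 "\<lambda>_. 0" a b] by (simp add: iter_dir_deriv_1)

lemma dir_deriv_smul:
 "smooth_on E F U f \<Longrightarrow> x \<in> U \<Longrightarrow> a \<in> pts E \<Longrightarrow> dir_deriv E F f x (smul E c a) = smul F c (dir_deriv E F f x a)"
 using iter_smul_last[of U f x 0 "\<lambda>_. 0" a c] by (simp add: iter_dir_deriv_1)

lemma has_dir_deriv_compose:
 assumes g: "smooth_on E F U g" and f: "has_dir_deriv D E f x v y" and x: "f x \<in> U"
 shows "has_dir_deriv D F (\<lambda>z. g (f z)) x v (dir_deriv E F g (f x) y)"
 using iter_quotient_lim[OF g x, of 0 "\<lambda>_. 0" "\<lambda>t. t" "at 0" "\<lambda>t. f (x + smul D t v)" y "\<lambda>_ _. 0" "\<lambda>_. 0"]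
  f eventually_at_neq[of 0] unfolding has_dir_deriv_def by (simp add: iter_dir_deriv_1)

lemma curve_compose_deriv:
 assumes g: "smooth_on E F U g" and c: "has_curve_deriv E J c t y" and t: "c t \<in> U"
 shows "has_curve_deriv F J (\<lambda>s. g (c s)) t (dir_deriv E F g (c t) y)"
 using iter_quotient_lim[OF g t, of 0 "\<lambda>_. 0" "\<lambda>s. of_real (s - t)" "at t within J" c y "\<lambda>_ _. 0" "\<lambda>_. 0"]
  c curve_time[of t J] unfolding has_curve_deriv_def by (simp add: iter_dir_deriv_1 of_real_inverse)

text \<open>The case of one moving direction in \<open>iter_quotient_lim\<close>; for a curve with
  velocity \<open>d\<close> it gives the second derivative of the composite.\<close>

lemma curve_compose_deriv2:
 assumes g: "smooth_on E F U g" and c: "has_curve_deriv E J c t (d t)" and d: "has_curve_deriv E J d t z"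
  and t: "c t \<in> U" "d t \<in> pts E"
 shows "has_curve_deriv F J (\<lambda>s. dir_deriv E F g (c s) (d s)) t
   (iterD E F g 2 (c t) (\<lambda>_. d t) + dir_deriv E F g (c t) z)"
proof -
 have "iterD E F g 2 (c t) ((\<lambda>_. d t)(Suc 0 := d t)) = iterD E F g 2 (c t) (\<lambda>_. d t)"
  by (rule iter_dir_deriv_cong_dirs) simp
 then show ?thesis
  using iter_quotient_lim[OF g t(1), of "Suc 0" "\<lambda>_. d t" "\<lambda>s. of_real (s - t)" "at t within J" c "d t" "\<lambda>s _. d s" "\<lambda>_. z"]
   c d curve_time[of t J] t(2) unfolding has_curve_deriv_def
  by (simp add: iter_dir_deriv_1 of_real_inverse numeral_2_eq_2)
qed

text \<open>Solutions have class \<open>r + 1\<close> with \<open>r\<close> at most 1, which is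
  where the bound 2 comes from. Up to this order the derivatives of the composite are written down
  in \<open>C\<close> and handed to \<open>Cr_curve_family\<close>.\<close>

lemma Cr_curve_compose:
 assumes g: "smooth_on E F U g" and c: "Cr_curve E r J c" and J: "curve_domain J" and cU: "\<And>t. t \<in> J \<Longrightarrow> c t \<in> U"
  and r: "r \<le> enat 2"
 shows "Cr_curve F r J (\<lambda>t. g (c t))"
proof -
 let ?c = "\<lambda>k. iter_curve_deriv E J k c"
 define C where "C k t = (if k = 0 then g (c t) else if k = 1 then dir_deriv E F g (c t) (?c 1 t)
   else iterD E F g 2 (c t) (\<lambda>_. ?c 1 t) + dir_deriv E F g (c t) (?c 2 t))" for k :: nat and t
 show ?thesis
 proof (rule F.Cr_curve_family(1)[OF J, where C = C])
 show "C 0 t = g (c t)" for t by (simp add: C_def)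
 have dc: "has_curve_deriv E J (?c k) t (?c (Suc k) t)" if "enat k < r" "t \<in> J" for k t
  using E.Cr_curveD[OF c J that] .
 have lc: "tlim E (?c k) (?c k t) (at t within J)" if "enat k \<le> r" "t \<in> J" for k t
  using c that unfolding Cr_curve_def continuous_map_top_of_set_iff by blast
 have c0: "?c 0 = c" by (rule E.iter_curve_deriv_0)
 show "has_curve_deriv F J (C k) t (C (Suc k) t)" if k: "enat k < r" and t: "t \<in> J" for k t
 proof -
  have "k < 2" using less_le_trans[OF k r] by simp
  then consider "k = 0" | "k = 1" by linarith
  then show ?thesis
  proof cases
   case 1
   have "has_curve_deriv E J c t (?c 1 t)" using dc[of 0 t] k t 1 c0 by simp
   from curve_compose_deriv[OF g this cU[OF t]] show ?thesis by (simp add: C_def[abs_def] 1)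
  next
   case 2
   have r1: "enat 0 < r" "enat 1 \<le> r" using k 2 by (auto intro: le_less_trans[of _ "enat 1"] simp: order_less_imp_le)
   have a: "has_curve_deriv E J c t (?c 1 t)" using dc[OF r1(1) t] c0 by simp
   have b: "has_curve_deriv E J (?c 1) t (?c 2 t)" using dc[OF k t] 2 by (simp add: numeral_2_eq_2)
   have p: "?c 1 t \<in> pts E" by (rule limitin_topspace[OF lc[OF r1(2) t]])
   from curve_compose_deriv2[of U g J c t "?c 1", OF g a b cU[OF t] p] show ?thesis by (simp add: C_def[abs_def] 2)
  qed
 qed
 show "continuous_map (top_of_set J) (topol F) (C k)" if k: "enat k \<le> r" for k
  unfolding continuous_map_top_of_set_iff
 proof
  fix t assume t: "t \<in> J"
  have le: "enat j \<le> r" if "j \<le> k" for j by (rule order_trans[OF _ k]) (simp add: that)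
  have "k \<le> 2" using order_trans[OF k r] by simp
  then consider "k = 0" | "k = 1" | "k = 2" by linarith
  moreover have l0: "tlim E c (c t) (at t within J)" using lc[OF le[of 0] t] c0 by simp
  have one: "tlim F (\<lambda>s. dir_deriv E F g (c s) (?c j s)) (dir_deriv E F g (c t) (?c j t)) (at t within J)" if "j \<le> k" for j
   using iter_lim[OF g l0 cU[OF t], of "Suc 0" "\<lambda>s _. ?c j s" "\<lambda>_. ?c j t"] lc[OF le[OF that] t]
   by (simp add: iter_dir_deriv_1)
  have two: "tlim F (\<lambda>s. iterD E F g 2 (c s) (\<lambda>_. ?c 1 s)) (iterD E F g 2 (c t) (\<lambda>_. ?c 1 t)) (at t within J)" if "1 \<le> k"
   by (rule iter_lim[OF g l0 cU[OF t]]) (rule lc[OF le[OF that] t])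
  ultimately show "tlim F (C k) (C k t) (at t within J)"
  proof cases
   case 1 then show ?thesis using smooth_on_lim[OF g l0 cU[OF t]] by (simp add: C_def[abs_def])
  next
   case 2 then show ?thesis using one[of 1] by (simp add: C_def[abs_def])
  next
   case 3 then show ?thesis using F.lim_add[OF two one[of 2]] by (simp add: C_def[abs_def])
  qed
 qed
 qed
qed

end

text \<open>A chart domain meets a curve in a relatively open set of times, where limits are the
  same as in \<open>[0,1]\<close>.\<close>

lemma (in lcs) has_curve_deriv_relopen:
 assumes "openin (top_of_set I) J" "t \<in> J"
 shows "has_curve_deriv E J c t y \<longleftrightarrow> has_curve_deriv E I c t y"
 using at_within_relopen[OF assms] by (simp add: has_curve_deriv_def)

lemma (in lcs) Cr_curve_relopen:
 assumes c: "Cr_curve E r {0..1} c" and J: "openin (top_of_set {0..1}) J"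
 shows "Cr_curve E r J c"
proof (rule Cr_curve_family(1)[OF curve_domain_relopen[OF J], where C = "\<lambda>k. iter_curve_deriv E {0..1} k c"])
 have JI: "J \<subseteq> {0..1}" by (rule openin_imp_subset[OF J])
 show "has_curve_deriv E J (iter_curve_deriv E {0..1} k c) t (iter_curve_deriv E {0..1} (Suc k) c t)"
  if "enat k < r" "t \<in> J" for k t
  unfolding has_curve_deriv_relopen[OF J that(2)] using Cr_curveD[OF c curve_domain_Icc that(1)] JI that(2) by blast
 show "continuous_map (top_of_set J) (topol E) (iter_curve_deriv E {0..1} k c)" if "enat k \<le> r" for k
  using c that JI unfolding Cr_curve_def by (blast intro: continuous_map_from_subtopology_mono)
qed (simp add: iter_curve_deriv_0)

lemma (in lcs) Cr_curve_cong:
 assumes J: "curve_domain J" and c: "Cr_curve E r J c" and eq: "\<And>t. t \<in> J \<Longrightarrow> c t = d t"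
 shows "Cr_curve E r J d"
 by (rule Cr_curve_family(1)[OF J, where C = "\<lambda>k. iter_curve_deriv E J k c"])
  (use c Cr_curveD[OF c J] eq in "auto simp: iter_curve_deriv_0 Cr_curve_def")

lemma K_analytic_on_map_prod:
 assumes "lcs E" "lcs F" "lcs E'" "lcs F'" and f: "K_analytic_on E E' U f" and g: "K_analytic_on F F' V g"
 shows "K_analytic_on (prod_tvs E F) (prod_tvs E' F') (U \<times> V) (\<lambda>p. (f (fst p), g (snd p)))"
proof -
 let ?P = "prod_tvs E F"
 have P: "lcs ?P" by (intro lcs_prod assms)
 have c: "cont_linear ?P E fst" "cont_linear ?P F snd"
  by (rule cont_linearI; auto intro!: atin_prod_limits)+
 note a = K_entire_imp_analytic[OF P K_entire_linear[OF P assms(1) c(1)]]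
  K_entire_imp_analytic[OF P K_entire_linear[OF P assms(2) c(2)]]
 have UV: "topen E U" "topen F V"
  using K_analytic_on_imp_smooth[OF assms(1,3) f] K_analytic_on_imp_smooth[OF assms(2,4) g]
  by (simp_all add: Cr_on_def)
 then have o: "topen ?P (U \<times> V)" by (simp add: openin_prod_Times_iff)
 have s: "U \<times> V \<subseteq> pts ?P" by (rule openin_subset[OF o])
 show ?thesis
  by (intro K_analytic_on_pair P assms(3,4)
    K_analytic_on_compose[OF P assms(1,3) K_analytic_on_subset[OF a(1) o s] f]
    K_analytic_on_compose[OF P assms(2,4) K_analytic_on_subset[OF a(2) o s] g]) auto
qed

text \<open>Each chart is compared with \<open>\<theta>\<close> alone; compatibility of two charts
  follows by passing through \<open>\<theta>\<close>.\<close>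

locale global_chart =
 fixes M :: "('k::real_or_complex_field, 'm, 'e::ab_group_add) mfd" and \<theta> :: "'m \<Rightarrow> 'e" and \<theta>i :: "'e \<Rightarrow> 'm"
 assumes lcs_model: "lcs (model M)"
  and homeo: "homeomorphic_maps (mtop M) (topol (model M)) \<theta> \<theta>i"
  and chart_in: "(topspace (mtop M), \<theta>) \<in> atlas M"
  and charts: "(W, \<kappa>) \<in> atlas M \<Longrightarrow> W \<subseteq> topspace (mtop M) \<and> inj_on \<kappa> W \<and>
   K_analytic_on (model M) (model M) (\<theta> ` W) (\<lambda>x. \<kappa> (\<theta>i x)) \<and>
   K_analytic_on (model M) (model M) (\<kappa> ` W) (\<lambda>y. \<theta> (inv_into W \<kappa> y))"
begin

abbreviation "N \<equiv> topspace (mtop M)"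
abbreviation "F \<equiv> model M"

sublocale F: lcs F by (rule lcs_model)
sublocale FF: lcs2 F F by (simp add: lcs2_def lcs_model)

lemma
 shows chart_pts: "z \<in> N \<Longrightarrow> \<theta> z \<in> pts F" and chart_inv_N: "x \<in> pts F \<Longrightarrow> \<theta>i x \<in> N"
  and chart_inv: "z \<in> N \<Longrightarrow> \<theta>i (\<theta> z) = z" and chart_inv': "x \<in> pts F \<Longrightarrow> \<theta> (\<theta>i x) = x"
  and cont_chart: "continuous_map (mtop M) (topol F) \<theta>" and cont_inv: "continuous_map (topol F) (mtop M) \<theta>i"
 using homeo by (auto simp: homeomorphic_maps_def continuous_map_def)

lemma
 assumes "(W, \<kappa>) \<in> atlas M"
 shows chart_sub: "W \<subseteq> N" and chart_inj: "inj_on \<kappa> W"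
  and chart_analytic: "K_analytic_on F F (\<theta> ` W) (\<lambda>x. \<kappa> (\<theta>i x))"
  and inv_analytic: "K_analytic_on F F (\<kappa> ` W) (\<lambda>y. \<theta> (inv_into W \<kappa> y))"
  and chart_smooth: "smooth_on F F (\<theta> ` W) (\<lambda>x. \<kappa> (\<theta>i x))"
  and inv_smooth: "smooth_on F F (\<kappa> ` W) (\<lambda>y. \<theta> (inv_into W \<kappa> y))"
 using charts[OF assms] K_analytic_on_imp_smooth[OF lcs_model lcs_model] by blast+

lemma chart_open:
 assumes "(W, \<kappa>) \<in> atlas M"
 shows "openin (mtop M) W" "topen F (\<theta> ` W)" "topen F (\<kappa> ` W)"
proof -
 show o: "topen F (\<theta> ` W)" "topen F (\<kappa> ` W)"
  using chart_smooth[OF assms] inv_smooth[OF assms] by (simp_all add: Cr_on_def)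
 have "{z \<in> N. \<theta> z \<in> \<theta> ` W} = W" using chart_sub[OF assms] chart_inv by (auto, metis subsetD)
 with openin_continuous_map_preimage[OF cont_chart o(1)] show "openin (mtop M) W" by simp
qed

end

text \<open>All charts differ from the global ones by analytic changes of coordinates, so
  analyticity in the pair of global charts carries over to every pair of charts.\<close>

lemma global_chart_maps:
 assumes "global_chart M \<theta> \<theta>i" "global_chart M' \<mu> \<mu>i"
  and f: "K_analytic_on (model M) (model M') (pts (model M)) (\<lambda>x. \<mu> (f (\<theta>i x)))"
  and fN: "\<And>z. z \<in> topspace (mtop M) \<Longrightarrow> f z \<in> topspace (mtop M')"
 shows "K_analytic_mfd_map M M' f" "Cr_mfd_map M M' \<infinity> f"
proof -
 interpret A: global_chart M \<theta> \<theta>i by fact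
 interpret B: global_chart M' \<mu> \<mu>i by fact
 note l = A.lcs_model B.lcs_model
 have "continuous_map (mtop M) (mtop M') (\<mu>i \<circ> ((\<lambda>x. \<mu> (f (\<theta>i x))) \<circ> \<theta>))"
  using smooth_on_continuous[OF l K_analytic_on_imp_smooth[OF l f]]
  by (intro continuous_map_compose[OF _ B.cont_inv] continuous_map_compose[OF A.cont_chart]) simp
 then have cont: "continuous_map (mtop M) (mtop M') f"
  by (rule continuous_map_eq) (simp add: A.chart_inv B.chart_inv fN)
 have an: "K_analytic_on (model M) (model M') (\<kappa> ` {x \<in> U. f x \<in> V}) (\<nu> \<circ> f \<circ> inv_into U \<kappa>)"
  if U: "(U, \<kappa>) \<in> atlas M" and V: "(V, \<nu>) \<in> atlas M'" for U \<kappa> V \<nu>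
 proof -
  let ?h = "\<lambda>y. \<mu> (f (\<theta>i (\<theta> (inv_into U \<kappa> y))))"
  have inv: "inv_into U \<kappa> (\<kappa> x) = x" if "x \<in> U" for x by (rule inv_into_f_f[OF A.chart_inj[OF U] that])
  have h\<kappa>: "?h (\<kappa> x) = \<mu> (f x)" if "x \<in> U" for x using inv[OF that] A.chart_inv A.chart_sub[OF U] that by auto
  have h: "K_analytic_on (model M) (model M') (\<kappa> ` U) ?h"
   by (rule K_analytic_on_compose[OF l(1,1,2) A.inv_analytic[OF U] f])
    (use A.chart_sub[OF U] inv A.chart_pts in "auto simp: image_subset_iff")
  \<comment> \<open>The domain of the coordinate map is rewritten as a preimage under
    \<open>?h\<close>, which shows that it is open.\<close>
  have eq: "{y \<in> \<kappa> ` U. ?h y \<in> \<mu> ` V} = \<kappa> ` {x \<in> U. f x \<in> V}"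
  proof -
   have "?h (\<kappa> x) \<in> \<mu> ` V \<longleftrightarrow> f x \<in> V" if "x \<in> U" for x
   proof
    assume "?h (\<kappa> x) \<in> \<mu> ` V"
    then have "\<mu> (f x) \<in> \<mu> ` V" unfolding h\<kappa>[OF that] .
    then obtain v where v: "v \<in> V" "\<mu> (f x) = \<mu> v" by blast
    have "f x \<in> topspace (mtop M')" "v \<in> topspace (mtop M')"
     using fN[of x] A.chart_sub[OF U] \<open>x \<in> U\<close> B.chart_sub[OF V] v(1) by blast+
    then have "f x = v" using B.chart_inv v(2) by metis
    then show "f x \<in> V" using v(1) by simp
   qed (simp add: h\<kappa>[OF that])
   then show ?thesis by auto
  qed
  have o: "topen (model M) (\<kappa> ` {x \<in> U. f x \<in> V})"
   using smooth_on_preimage_open[OF l K_analytic_on_imp_smooth[OF l h] B.chart_open(2)[OF V]] unfolding eq .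
  have "K_analytic_on (model M) (model M') (\<kappa> ` {x \<in> U. f x \<in> V}) (\<lambda>y. \<nu> (\<mu>i (?h y)))"
   by (rule K_analytic_on_compose[OF l l(2) K_analytic_on_subset[OF h o] B.chart_analytic[OF V]]) (use eq in auto)
  then show ?thesis
  proof (rule K_analytic_on_cong[OF l])
   fix y assume "y \<in> \<kappa> ` {x \<in> U. f x \<in> V}"
   then obtain x where x: "x \<in> U" "f x \<in> V" "y = \<kappa> x" by blast
   then show "\<nu> (\<mu>i (?h y)) = (\<nu> \<circ> f \<circ> inv_into U \<kappa>) y"
    using h\<kappa>[OF x(1)] inv[OF x(1)] B.chart_inv B.chart_sub[OF V] by auto
  qed
 qed
 show "K_analytic_mfd_map M M' f" unfolding K_analytic_mfd_map_def using cont an by blast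
 show "Cr_mfd_map M M' \<infinity> f" unfolding Cr_mfd_map_def using cont K_analytic_on_imp_smooth[OF l an] by blast
qed

lemma map_prod_image: "map_prod f g ` (U \<times> V) = f ` U \<times> g ` V"
 by (rule map_prod_surj_on) simp_all

lemma inv_into_map_prod:
 assumes "inj_on f U" "inj_on g V" "p \<in> f ` U \<times> g ` V"
 shows "inv_into (U \<times> V) (map_prod f g) p = (inv_into U f (fst p), inv_into V g (snd p))"
 using assms by (intro inv_into_f_eq map_prod_inj_on) (auto simp: inv_into_into f_inv_into_f)

lemma global_chart_prod:
 assumes "global_chart M \<theta> \<theta>i" "global_chart M' \<mu> \<mu>i"
 shows "global_chart (prod_mfd M M') (map_prod \<theta> \<mu>) (map_prod \<theta>i \<mu>i)"
proof -
 interpret A: global_chart M \<theta> \<theta>i by fact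
 interpret B: global_chart M' \<mu> \<mu>i by fact
 note l = A.lcs_model B.lcs_model
 show ?thesis
 proof (rule global_chart.intro)
  show "lcs (model (prod_mfd M M'))" by (simp add: prod_mfd_def lcs_prod l)
  show "homeomorphic_maps (mtop (prod_mfd M M')) (topol (model (prod_mfd M M'))) (map_prod \<theta> \<mu>) (map_prod \<theta>i \<mu>i)"
   using A.homeo B.homeo by (simp add: prod_mfd_def map_prod_def homeomorphic_maps_prod)
  show "(topspace (mtop (prod_mfd M M')), map_prod \<theta> \<mu>) \<in> atlas (prod_mfd M M')"
   using A.chart_in B.chart_in by (auto simp: prod_mfd_def)
  fix W \<kappa> assume "(W, \<kappa>) \<in> atlas (prod_mfd M M')"
  then obtain U \<phi> V \<psi> where W: "W = U \<times> V" "\<kappa> = map_prod \<phi> \<psi>" and U: "(U, \<phi>) \<in> atlas M" and V: "(V, \<psi>) \<in> atlas M'"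
   by (auto simp: prod_mfd_def)
  have "K_analytic_on (prod_tvs (model M) (model M')) (prod_tvs (model M) (model M')) (map_prod \<theta> \<mu> ` (U \<times> V)) (\<lambda>x. \<kappa> (map_prod \<theta>i \<mu>i x))"
   unfolding map_prod_image
   by (rule K_analytic_on_cong[OF lcs_prod[OF l] lcs_prod[OF l] K_analytic_on_map_prod[OF l l A.chart_analytic[OF U] B.chart_analytic[OF V]]])
    (auto simp: W)
  moreover have "K_analytic_on (prod_tvs (model M) (model M')) (prod_tvs (model M) (model M')) (\<kappa> ` (U \<times> V)) (\<lambda>y. map_prod \<theta> \<mu> (inv_into W \<kappa> y))"
   unfolding W map_prod_image
   by (rule K_analytic_on_cong[OF lcs_prod[OF l] lcs_prod[OF l] K_analytic_on_map_prod[OF l l A.inv_analytic[OF U] B.inv_analytic[OF V]]])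
    (simp add: inv_into_map_prod[OF A.chart_inj[OF U] B.chart_inj[OF V]])
  ultimately show "W \<subseteq> topspace (mtop (prod_mfd M M')) \<and> inj_on \<kappa> W \<and>
   K_analytic_on (model (prod_mfd M M')) (model (prod_mfd M M')) (map_prod \<theta> \<mu> ` W) (\<lambda>x. \<kappa> (map_prod \<theta>i \<mu>i x)) \<and>
   K_analytic_on (model (prod_mfd M M')) (model (prod_mfd M M')) (\<kappa> ` W) (\<lambda>y. map_prod \<theta> \<mu> (inv_into W \<kappa> y))"
   using A.chart_sub[OF U] B.chart_sub[OF V] map_prod_inj_on[OF A.chart_inj[OF U] B.chart_inj[OF V]]
   by (auto simp: prod_mfd_def W)
 qed
qed

lemma global_chart_tvs: assumes "lcs X" shows "global_chart (tvs_mfd X) id id"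
proof (rule global_chart.intro)
 have "cont_linear X X (\<lambda>x. x)" by (rule cont_linearI) (auto intro: limitin_atin_id)
 then have "K_analytic_on X X (pts X) (\<lambda>x. x)" by (intro K_entire_imp_analytic K_entire_linear assms)
 moreover from this have "K_analytic_on X X (pts X) (inv_into (pts X) id)"
  by (rule K_analytic_on_cong[OF assms assms]) (use inv_into_f_f[of id "pts X"] in auto)
 ultimately show "W \<subseteq> topspace (mtop (tvs_mfd X)) \<and> inj_on \<kappa> W \<and>
   K_analytic_on (model (tvs_mfd X)) (model (tvs_mfd X)) (id ` W) (\<lambda>x. \<kappa> (id x)) \<and>
   K_analytic_on (model (tvs_mfd X)) (model (tvs_mfd X)) (\<kappa> ` W) (\<lambda>y. id (inv_into W \<kappa> y))"
  if "(W, \<kappa>) \<in> atlas (tvs_mfd X)" for W \<kappa>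
  using that by (auto simp: tvs_mfd_def)
qed (use assms in "auto simp: tvs_mfd_def homeomorphic_maps_id")

context global_chart
begin

text \<open>A chart change is the identity map of the manifold seen in two charts, hence a case of
  \<open>global_chart_maps\<close>.\<close>

lemma transition_analytic:
 assumes "(U, \<kappa>) \<in> atlas M" "(V, \<nu>) \<in> atlas M"
 shows "K_analytic_on F F (\<kappa> ` (U \<inter> V)) (\<nu> \<circ> inv_into U \<kappa>)"
proof -
 have "cont_linear F F (\<lambda>x. x)" by (rule cont_linearI) (auto intro: limitin_atin_id)
 then have "K_analytic_on F F (pts F) (\<lambda>x. x)" by (intro K_entire_imp_analytic K_entire_linear lcs_model)
 then have "K_analytic_on F F (pts F) (\<lambda>x. \<theta> (id (\<theta>i x)))"
  by (rule K_analytic_on_cong[OF lcs_model lcs_model]) (simp add: chart_inv')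
 from global_chart_maps(1)[OF global_chart_axioms global_chart_axioms this] assms
 show ?thesis unfolding K_analytic_mfd_map_def by (force simp: Int_def)
qed

lemma manifold: "K_analytic_manifold M"
 unfolding K_analytic_manifold_def
proof (intro conjI)
 show "locally_convex_space F" using lcs_model by (simp add: lcs_def)
 show "Hausdorff_space (mtop M)"
  using homeomorphic_Hausdorff_space homeomorphic_space_def homeo F.hausdorff by metis
 show "(\<Union>(U, \<kappa>)\<in>atlas M. U) = N" using chart_in chart_sub by auto
 show "\<forall>(U, \<kappa>)\<in>atlas M. \<forall>(V, \<nu>)\<in>atlas M. K_analytic_on F F (\<kappa> ` (U \<inter> V)) (\<nu> \<circ> inv_into U \<kappa>)"
  using transition_analytic by blast
 have "homeomorphic_map (subtopology (mtop M) U) (subtopology (topol F) (\<kappa> ` U)) \<kappa>" if U: "(U, \<kappa>) \<in> atlas M" for U \<kappa>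
 proof -
  have inv: "inv_into U \<kappa> (\<kappa> x) = x" if "x \<in> U" for x by (rule inv_into_f_f[OF chart_inj[OF U] that])
  have "continuous_map (subtopology (mtop M) U) (subtopology (topol F) (\<theta> ` U)) \<theta>"
   using cont_chart by (auto simp: continuous_map_in_subtopology intro: continuous_map_from_subtopology)
  from continuous_map_compose[OF this smooth_on_continuous[OF lcs_model lcs_model chart_smooth[OF U]]]
  have "continuous_map (subtopology (mtop M) U) (topol F) \<kappa>"
   by (rule continuous_map_eq) (simp add: chart_inv)
  moreover have "continuous_map (subtopology (topol F) (\<kappa> ` U)) (mtop M) (inv_into U \<kappa>)"
   by (rule continuous_map_eq[OF continuous_map_compose[OF smooth_on_continuous[OF lcs_model lcs_model inv_smooth[OF U]] cont_inv]])
    (use inv chart_inv chart_sub[OF U] in auto)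
  ultimately have "homeomorphic_maps (subtopology (mtop M) U) (subtopology (topol F) (\<kappa> ` U)) \<kappa> (inv_into U \<kappa>)"
   unfolding homeomorphic_maps_def continuous_map_in_subtopology by (auto simp: inv)
  then show ?thesis by (rule homeomorphic_maps_imp_map)
 qed
 then show "\<forall>(U, \<kappa>)\<in>atlas M. openin (mtop M) U \<and> topen F (\<kappa> ` U) \<and>
   homeomorphic_map (subtopology (mtop M) U) (subtopology (topol F) (\<kappa> ` U)) \<kappa>"
  using chart_open by auto
qed

lemma tangent_space_eq: "tangent_space M z = subspace_tvs (pow_tvs F) (tangent_vectors M z)"
 by (simp add: tangent_space_def subspace_tvs_def pow_tvs_def)

text \<open>Differentials of chart changes are linear, so the coherent families of coordinates form
  a linear subspace of a power of the model space.\<close>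

lemma lcs_tangent: "lcs (tangent_space M z)"
 unfolding tangent_space_eq
proof (rule lcs_subspace[OF lcs_pow[OF lcs_model]])
 interpret P: lcs "pow_tvs F :: ('k, ('m, 'e) chart \<Rightarrow> 'e) tvs" by (rule lcs_pow[OF lcs_model])
 define T where "T c d = dir_deriv F F (snd d \<circ> inv_into (fst c) (snd c)) (snd c z)" for c d :: "('m, 'e) chart"
 have sm: "smooth_on F F (snd c ` (fst c \<inter> fst d)) (snd d \<circ> inv_into (fst c) (snd c)) \<and> snd c z \<in> snd c ` (fst c \<inter> fst d)"
  if "c \<in> charts_at M z" "d \<in> charts_at M z" for c d
  using that transition_analytic[of "fst c" "snd c" "fst d" "snd d"] K_analytic_on_imp_smooth[OF lcs_model lcs_model]
  by (auto simp: charts_at_def)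
 have add: "T c d (a + b) = T c d a + T c d b" and smul: "T c d (smul F k a) = smul F k (T c d a)"
  if "c \<in> charts_at M z" "d \<in> charts_at M z" "a \<in> pts F" "b \<in> pts F" for c d a b k
  unfolding T_def using sm[OF that(1,2)] FF.dir_deriv_add that(3,4) FF.dir_deriv_smul by blast+
 have zero: "T c d 0 = 0" if "c \<in> charts_at M z" "d \<in> charts_at M z" for c d
  using smul[OF that F.zero_pts F.zero_pts, of 0] by (simp only: F.vs.scale_zero_left)
 have mem: "v \<in> tangent_vectors M z \<longleftrightarrow> (\<forall>c\<in>charts_at M z. v c \<in> pts F) \<and> (\<forall>c. c \<notin> charts_at M z \<longrightarrow> v c = 0) \<and>
   (\<forall>c\<in>charts_at M z. \<forall>d\<in>charts_at M z. v d = T c d (v c))" for v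
  unfolding tangent_vectors_def T_def mem_Collect_eq ..
 show "P.vs.subspace (tangent_vectors M z)"
 proof (rule P.vs.subspaceI)
  show "0 \<in> tangent_vectors M z" unfolding mem by (simp add: zero)
  show "v + w \<in> tangent_vectors M z" if v: "v \<in> tangent_vectors M z" and w: "w \<in> tangent_vectors M z" for v w
   unfolding mem
  proof (intro conjI ballI allI impI)
   fix c d assume c: "c \<in> charts_at M z"
   have p: "v c \<in> pts F" "w c \<in> pts F" using v w c unfolding mem by blast+
   show "(v + w) c \<in> pts F" using p by simp
   assume d: "d \<in> charts_at M z"
   have "v d = T c d (v c)" "w d = T c d (w c)" using v w c d unfolding mem by blast+
   then show "(v + w) d = T c d ((v + w) c)" by (simp only: plus_fun_apply add[OF c d p])
  next
   fix c assume "c \<notin> charts_at M z"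
   then have "v c = 0" "w c = 0" using v w unfolding mem by blast+
   then show "(v + w) c = 0" by simp
  qed
  show "smul (pow_tvs F) k v \<in> tangent_vectors M z" if v: "v \<in> tangent_vectors M z" for k v
   unfolding mem tvs_simps
  proof (intro conjI ballI allI impI)
   fix c d assume c: "c \<in> charts_at M z"
   have p: "v c \<in> pts F" using v c unfolding mem by blast
   show "smul F k (v c) \<in> pts F" using p by simp
   assume d: "d \<in> charts_at M z"
   have "v d = T c d (v c)" using v c d unfolding mem by blast
   then show "smul F k (v d) = T c d (smul F k (v c))" by (simp only: smul[OF c d p p])
  next
   fix c assume "c \<notin> charts_at M z"
   then have "v c = 0" using v unfolding mem by blast
   then show "smul F k (v c) = 0" by simp
  qed
 qed
qed

lemma tangent_coord_pts: "v \<in> tangent_vectors M z \<Longrightarrow> v c \<in> pts F"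
proof (cases "c \<in> charts_at M z")
 case False
 assume "v \<in> tangent_vectors M z"
 then have "v c = 0" using False unfolding tangent_vectors_def by blast
 then show ?thesis by simp
qed (unfold tangent_vectors_def, blast)

lemma pts_tangent: "pts (tangent_space M z) = tangent_vectors M z"
 using tangent_coord_pts by (auto simp: tangent_space_eq PiE_iff simp del: split_paired_All)

lemma cont_linear_coord: "cont_linear (tangent_space M z) F (\<lambda>v. v c)"
proof (rule cont_linearI)
 fix v assume "v \<in> pts (tangent_space M z)"
 from limitin_atin_id[OF this] show "tlim F (\<lambda>v. v c) (v c) (atin (topol (tangent_space M z)) v)"
  by (simp add: tangent_space_eq limitin_subtopology limitin_componentwise del: split_paired_All)
qed (auto simp: tangent_space_eq)

abbreviation "c0 \<equiv> (N, \<theta>)"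

lemma curve_velocity:
 assumes \<eta>: "continuous_map (top_of_set {0..1}) (mtop M) \<eta>" and t: "t \<in> {0..1}"
  and d: "deriv01 F (\<lambda>s. \<theta> (\<eta> s)) t y"
 shows "velocity M \<eta> t = (\<lambda>d. if d \<in> charts_at M (\<eta> t) then dir_deriv F F (\<lambda>x. snd d (\<theta>i x)) (\<theta> (\<eta> t)) y else 0)"
proof
 fix d :: "('m, 'e) chart"
 have N: "\<eta> s \<in> N" if "s \<in> {0..1}" for s using \<eta> that by (auto simp: continuous_map_def)
 show "velocity M \<eta> t d = (if d \<in> charts_at M (\<eta> t) then dir_deriv F F (\<lambda>x. snd d (\<theta>i x)) (\<theta> (\<eta> t)) y else 0)"
 proof (cases "d \<in> charts_at M (\<eta> t)")
  case True
  then have W: "(fst d, snd d) \<in> atlas M" "\<eta> t \<in> fst d" by (simp_all add: charts_at_def)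
  let ?J = "{s \<in> {0..1}. \<eta> s \<in> fst d}"
  have J: "openin (top_of_set {0..1}) ?J"
   using openin_continuous_map_preimage[OF \<eta> chart_open(1)[OF W(1)]] by simp
  have tJ: "t \<in> ?J" using t W(2) by simp
  have "has_curve_deriv F ?J (\<lambda>s. \<theta> (\<eta> s)) t y" using d F.has_curve_deriv_relopen[OF J tJ] by simp
  from FF.curve_compose_deriv[OF chart_smooth[OF W(1)] this] W(2)
  have "has_curve_deriv F ?J (\<lambda>s. snd d (\<theta>i (\<theta> (\<eta> s)))) t (dir_deriv F F (\<lambda>x. snd d (\<theta>i x)) (\<theta> (\<eta> t)) y)" by simp
  then have "has_curve_deriv F ?J (snd d \<circ> \<eta>) t (dir_deriv F F (\<lambda>x. snd d (\<theta>i x)) (\<theta> (\<eta> t)) y)"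
   using has_curve_deriv_cong[of ?J "\<lambda>s. snd d (\<theta>i (\<theta> (\<eta> s)))" "snd d \<circ> \<eta>" t F] tJ by (simp add: chart_inv N)
  from F.curve_deriv_eq[OF curve_domain_relopen[OF J] tJ this] True show ?thesis by (simp add: velocity_def)
 qed (simp add: velocity_def)
qed

lemma dir_deriv_id: "x \<in> pts F \<Longrightarrow> y \<in> pts F \<Longrightarrow> dir_deriv F F (\<lambda>x. \<theta> (\<theta>i x)) x y = y"
proof (rule FF.dir_deriv_eq)
 assume x: "x \<in> pts F" and y: "y \<in> pts F"
 have "cont_linear F F (\<lambda>x. x)" by (rule cont_linearI) (auto intro: limitin_atin_id)
 from FF.has_dir_deriv_transform[OF openin_topspace x y _ FF.has_dir_deriv_linear[OF this x y]]
 show "has_dir_deriv F F (\<lambda>x. \<theta> (\<theta>i x)) x y y" by (simp add: chart_inv')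
qed

end

section \<open>Lie groups with a global chart\<close>

locale global_chart_group = global_chart M \<theta> \<theta>i
 for M :: "('k::real_or_complex_field, 'm, 'e::ab_group_add) mfd" and \<theta> :: "'m \<Rightarrow> 'e" and \<theta>i :: "'e \<Rightarrow> 'm" +
 fixes G :: "'m monoid"
 assumes grp: "group G" and carrier: "carrier G = topspace (mtop M)"
  and mult_analytic: "K_analytic_on (prod_tvs (model M) (model M)) (model M) (pts (prod_tvs (model M) (model M)))
   (\<lambda>p. \<theta> (\<theta>i (fst p) \<otimes>\<^bsub>G\<^esub> \<theta>i (snd p)))"
  and inv_analytic_group: "K_analytic_on (model M) (model M) (pts (model M)) (\<lambda>x. \<theta> (inv\<^bsub>G\<^esub> (\<theta>i x)))"
begin

interpretation G: group G by (rule grp)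

lemma one_N: "\<one>\<^bsub>G\<^esub> \<in> N" using G.one_closed carrier by simp

lemma lie_group: "K_analytic_lie_group G M"
 unfolding K_analytic_lie_group_def
proof (intro conjI)
 show "K_analytic_mfd_map (prod_mfd M M) M (\<lambda>(x, y). x \<otimes>\<^bsub>G\<^esub> y)"
  by (rule global_chart_maps(1)[OF global_chart_prod[OF global_chart_axioms global_chart_axioms] global_chart_axioms])
   (use mult_analytic G.m_closed carrier in "auto simp: prod_mfd_def case_prod_beta'")
 show "K_analytic_mfd_map M M (\<lambda>x. inv\<^bsub>G\<^esub> x)"
  by (rule global_chart_maps(1)[OF global_chart_axioms global_chart_axioms inv_analytic_group])
   (use G.inv_closed carrier in auto)
qed (use grp manifold carrier in auto)

lemma left_mult_smooth:
 assumes g: "g \<in> N" shows "smooth_on F F (pts F) (\<lambda>x. \<theta> (g \<otimes>\<^bsub>G\<^esub> \<theta>i x))"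
proof -
 interpret P: lcs "prod_tvs F F" by (intro lcs_prod lcs_model)
 interpret FP: lcs2 F "prod_tvs F F" by (simp add: lcs2_def lcs_model lcs_prod)
 have id: "cont_linear F F (\<lambda>x. x)" by (rule cont_linearI) (auto intro: limitin_atin_id)
 have "smooth_on F (prod_tvs F F) (pts F) (\<lambda>x. (\<theta> g, x))"
  by (intro smooth_on_pair lcs_model FF.smooth_on_const FF.smooth_on_linear id) (auto simp: chart_pts g)
 from smooth_on_compose[OF lcs_model lcs_prod[OF lcs_model lcs_model] lcs_model this
   K_analytic_on_imp_smooth[OF lcs_prod[OF lcs_model lcs_model] lcs_model mult_analytic]]
 show ?thesis using g by (auto simp: chart_inv chart_pts image_subset_iff)
qed

text \<open>The vector \<open>g.v\<close> of the initial value problem in the coordinates of the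
  global chart.\<close>

definition left :: "'m \<Rightarrow> 'e \<Rightarrow> 'e" where
 "left g v = dir_deriv F F (\<lambda>x. \<theta> (g \<otimes>\<^bsub>G\<^esub> \<theta>i x)) (\<theta> \<one>\<^bsub>G\<^esub>) v"

lemma left_pts: "g \<in> N \<Longrightarrow> v \<in> pts F \<Longrightarrow> left g v \<in> pts F"
 unfolding left_def by (rule FF.dir_deriv_pts[OF left_mult_smooth]) (auto simp: chart_pts one_N)

text \<open>\<open>tangent_map\<close> reads \<open>v\<close> in an unspecified chart at the unit.
  The relation that defines tangent vectors leads from there to the coordinate in \<open>c0\<close>,
  and the chain rule gives a formula independent of the choice.\<close>

lemma tangent_left:
 assumes g: "g \<in> N" and v: "v \<in> tangent_vectors M \<one>\<^bsub>G\<^esub>"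
 shows "tangent_map M M (\<lambda>x. g \<otimes>\<^bsub>G\<^esub> x) \<one>\<^bsub>G\<^esub> v =
  (\<lambda>d. if d \<in> charts_at M g then dir_deriv F F (\<lambda>x. snd d (\<theta>i x)) (\<theta> g) (left g (v c0)) else 0)"
proof
 fix d :: "('m, 'e) chart"
 have g1: "g \<otimes>\<^bsub>G\<^esub> \<one>\<^bsub>G\<^esub> = g" using g carrier by simp
 define c where "c = (SOME c. c \<in> charts_at M \<one>\<^bsub>G\<^esub>)"
 have c0: "c0 \<in> charts_at M \<one>\<^bsub>G\<^esub>" using chart_in one_N by (simp add: charts_at_def)
 then have c: "c \<in> charts_at M \<one>\<^bsub>G\<^esub>" unfolding c_def by (rule someI[of "\<lambda>c. c \<in> charts_at M \<one>\<^bsub>G\<^esub>"])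
 then have W: "(fst c, snd c) \<in> atlas M" "\<one>\<^bsub>G\<^esub> \<in> fst c" by (simp_all add: charts_at_def)
 have inv: "inv_into (fst c) (snd c) (snd c z) = z" if "z \<in> fst c" for z
  by (rule inv_into_f_f[OF chart_inj[OF W(1)] that])
 show "tangent_map M M (\<lambda>x. g \<otimes>\<^bsub>G\<^esub> x) \<one>\<^bsub>G\<^esub> v d =
  (if d \<in> charts_at M g then dir_deriv F F (\<lambda>x. snd d (\<theta>i x)) (\<theta> g) (left g (v c0)) else 0)"
 proof (cases "d \<in> charts_at M g")
  case True
  then have d: "(fst d, snd d) \<in> atlas M" "g \<in> fst d" by (simp_all add: charts_at_def)
  let ?k = "\<lambda>y. \<theta> (inv_into (fst c) (snd c) y)"
  let ?x = "snd c \<one>\<^bsub>G\<^esub>"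
  have x: "?x \<in> snd c ` fst c" by (rule imageI[OF W(2)])
  have vc: "v c \<in> pts F" by (rule tangent_coord_pts[OF v])
  have "\<forall>c\<in>charts_at M \<one>\<^bsub>G\<^esub>. \<forall>d\<in>charts_at M \<one>\<^bsub>G\<^esub>.
    v d = dir_deriv F F (snd d \<circ> inv_into (fst c) (snd c)) (snd c \<one>\<^bsub>G\<^esub>) (v c)"
   using v unfolding tangent_vectors_def by blast
  from bspec[OF bspec[OF this c] c0] have v0: "v c0 = dir_deriv F F ?k ?x (v c)"
   by (simp only: snd_conv o_def)
  have kx: "?k ?x = \<theta> \<one>\<^bsub>G\<^esub>" using inv[OF W(2)] by simp
  have 1: "has_dir_deriv F F ?k ?x (v c) (v c0)"
   unfolding v0 by (rule FF.smooth_has_dir_deriv[OF inv_smooth[OF W(1)] x vc])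
  have 2: "has_dir_deriv F F (\<lambda>y. \<theta> (g \<otimes>\<^bsub>G\<^esub> \<theta>i (?k y))) ?x (v c) (left g (v c0))"
   using FF.has_dir_deriv_compose[OF left_mult_smooth[OF g] 1] kx chart_pts[OF one_N] by (simp add: left_def)
  have gx: "\<theta> (g \<otimes>\<^bsub>G\<^esub> \<theta>i (?k ?x)) = \<theta> g" unfolding kx chart_inv[OF one_N] g1 ..
  have "has_dir_deriv F F (\<lambda>y. snd d (\<theta>i (\<theta> (g \<otimes>\<^bsub>G\<^esub> \<theta>i (?k y))))) ?x (v c)
    (dir_deriv F F (\<lambda>x. snd d (\<theta>i x)) (\<theta> g) (left g (v c0)))"
   using FF.has_dir_deriv_compose[OF chart_smooth[OF d(1)] 2] d(2) unfolding gx by simp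
  then have "has_dir_deriv F F (snd d \<circ> (\<lambda>x. g \<otimes>\<^bsub>G\<^esub> x) \<circ> inv_into (fst c) (snd c)) ?x (v c)
    (dir_deriv F F (\<lambda>x. snd d (\<theta>i x)) (\<theta> g) (left g (v c0)))"
  proof (rule FF.has_dir_deriv_transform[OF chart_open(3)[OF W(1)] x vc, rotated])
   fix y assume "y \<in> snd c ` fst c"
   then obtain z where z: "z \<in> fst c" "y = snd c z" by blast
   have "z \<in> N" using z chart_sub[OF W(1)] by blast
   then show "snd d (\<theta>i (\<theta> (g \<otimes>\<^bsub>G\<^esub> \<theta>i (?k y)))) = (snd d \<circ> (\<lambda>x. g \<otimes>\<^bsub>G\<^esub> x) \<circ> inv_into (fst c) (snd c)) y"
    using inv[OF z(1)] z(2) chart_inv G.m_closed g carrier by simp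
  qed
  from FF.dir_deriv_eq[OF this] True show ?thesis
   by (simp add: tangent_map_def g1 Let_def flip: c_def)
 qed (simp add: tangent_map_def g1)
qed

text \<open>Together with \<open>evolution_elim\<close> this reduces the initial value problem on
  the group to an equation for the coordinate curve in the model space. The bound on
  \<open>r\<close> is that of \<open>Cr_curve_compose\<close>.\<close>

lemma evolution_intro:
 assumes ext: "\<eta> \<in> extensional {0..1}" and r: "r + 1 \<le> enat 2" and C: "Cr_curve F (r + 1) {0..1} (\<lambda>t. \<theta> (\<eta> t))"
  and N: "\<And>t. t \<in> {0..1} \<Longrightarrow> \<eta> t \<in> N" and 0: "\<eta> 0 = \<one>\<^bsub>G\<^esub>"
  and \<gamma>: "\<And>t. t \<in> {0..1} \<Longrightarrow> \<gamma> t \<in> tangent_vectors M \<one>\<^bsub>G\<^esub>"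
  and d: "\<And>t. t \<in> {0..1} \<Longrightarrow> deriv01 F (\<lambda>s. \<theta> (\<eta> s)) t (left (\<eta> t) (\<gamma> t c0))"
 shows "is_evolution G M r \<gamma> \<eta>"
proof -
 have "cont01 F (\<lambda>t. \<theta> (\<eta> t))"
  using C unfolding Cr_curve_def by (metis F.iter_curve_deriv_0 zero_enat_def zero_le)
 from continuous_map_eq[OF continuous_map_compose[OF this cont_inv]]
 have cont: "continuous_map (top_of_set {0..1}) (mtop M) \<eta>" by (simp add: chart_inv N)
 have "Cr_curve F (r + 1) {t \<in> {0..1}. \<eta> t \<in> W} (\<kappa> \<circ> \<eta>)" if W: "(W, \<kappa>) \<in> atlas M" for W \<kappa>
 proof -
  let ?J = "{t \<in> {0..1}. \<eta> t \<in> W}"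
  have J: "openin (top_of_set {0..1}) ?J"
   using openin_continuous_map_preimage[OF cont chart_open(1)[OF W]] by simp
  note J' = curve_domain_relopen[OF J]
  have "Cr_curve F (r + 1) ?J (\<lambda>t. \<kappa> (\<theta>i (\<theta> (\<eta> t))))"
   by (rule FF.Cr_curve_compose[OF chart_smooth[OF W] F.Cr_curve_relopen[OF C J] J' _ r]) simp
  then show ?thesis by (rule F.Cr_curve_cong[OF J']) (simp add: chart_inv N)
 qed
 then have "Cr_mfd_curve M (r + 1) \<eta>" unfolding Cr_mfd_curve_def using cont by blast
 then show ?thesis
  unfolding is_evolution_def using ext 0 curve_velocity[OF cont _ d] tangent_left[OF N \<gamma>] by simp
qed

lemma evolution_elim:
 assumes e: "is_evolution G M r \<gamma> \<eta>" and \<gamma>: "\<And>t. t \<in> {0..1} \<Longrightarrow> \<gamma> t \<in> tangent_vectors M \<one>\<^bsub>G\<^esub>" and t: "t \<in> {0..1}"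
 shows "\<eta> t \<in> N" "deriv01 F (\<lambda>s. \<theta> (\<eta> s)) t (left (\<eta> t) (\<gamma> t c0))"
proof -
 have C: "Cr_mfd_curve M (r + 1) \<eta>" and v: "velocity M \<eta> t = tangent_map M M (\<lambda>x. \<eta> t \<otimes>\<^bsub>G\<^esub> x) \<one>\<^bsub>G\<^esub> (\<gamma> t)"
  using e t by (auto simp: is_evolution_def)
 have cont: "continuous_map (top_of_set {0..1}) (mtop M) \<eta>" using C by (simp add: Cr_mfd_curve_def)
 then have N: "\<eta> s \<in> N" if "s \<in> {0..1}" for s using that by (auto simp: continuous_map_def)
 show Nt: "\<eta> t \<in> N" by (rule N[OF t])
 have "Cr_curve F (r + 1) {t \<in> {0..1}. \<eta> t \<in> N} (\<theta> \<circ> \<eta>)" using C chart_in unfolding Cr_mfd_curve_def by blast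
 moreover have "{t \<in> {0..1}. \<eta> t \<in> N} = {0..1}" using N by blast
 ultimately have "Cr_curve F (r + 1) {0..1} (\<theta> \<circ> \<eta>)" by simp
 moreover have "enat 0 < r + 1" by (simp flip: zero_enat_def)
 ultimately have "\<exists>y. deriv01 F (iter_curve_deriv F {0..1} 0 (\<theta> \<circ> \<eta>)) t y"
  unfolding Cr_curve_def using t by blast
 then obtain y where y: "deriv01 F (\<lambda>s. \<theta> (\<eta> s)) t y"
  unfolding F.iter_curve_deriv_0 o_def by blast
 have yp: "y \<in> pts F" using y unfolding has_curve_deriv_def by (rule limitin_topspace)
 have g: "\<gamma> t c0 \<in> pts F" by (rule tangent_coord_pts[OF \<gamma>[OF t]])
 have "c0 \<in> charts_at M (\<eta> t)" using chart_in Nt by (simp add: charts_at_def)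
 \<comment> \<open>The two families of coordinates are compared at \<open>c0\<close>, where the
   differential of the chart change is the identity.\<close>
 then have "y = left (\<eta> t) (\<gamma> t c0)"
  using fun_cong[OF v, of c0] unfolding curve_velocity[OF cont t y] tangent_left[OF Nt \<gamma>[OF t]]
  by (simp add: dir_deriv_id chart_pts[OF Nt] yp left_pts[OF Nt g])
 then show "deriv01 F (\<lambda>s. \<theta> (\<eta> s)) t (left (\<eta> t) (\<gamma> t c0))" using y by simp
qed

end

section \<open>The character group\<close>

context char_setting
begin

abbreviation "IC \<equiv> infinitesimal_characters s \<epsilon> B"
abbreviation "Fs \<equiv> subspace_tvs E IC"
abbreviation "M \<equiv> character_mfd s \<epsilon> B"
abbreviation "G \<equiv> character_group s \<Delta> \<epsilon> B"

lemma IC_eq: "IC = {\<phi>. V.infchr \<phi>}"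
 by (simp add: infinitesimal_characters_def V.infchr_def linear_eq_lin[OF vs.vector_space_axioms Bl.vs.vector_space_axioms])

lemma characters_eq: "characters s B = {\<phi>. V.chr \<phi>}"
 by (simp add: characters_def V.chr_def linear_eq_lin[OF vs.vector_space_axioms Bl.vs.vector_space_axioms])

lemma infchr_lin: "V.infchr \<phi> \<Longrightarrow> lin s (smul B) \<phi>" and chr_lin: "V.chr \<phi> \<Longrightarrow> lin s (smul B) \<phi>"
 by (simp_all add: V.infchr_def V.chr_def)

lemma IC_sub: "IC \<subseteq> pts E" by (auto simp: IC_eq pts_E infchr_lin)

lemma infchr_projection_ex:
 "\<exists>\<pi>. lin s s \<pi> \<and> (\<forall>\<phi>. lin s (smul B) \<phi> \<longrightarrow> V.infchr (\<lambda>x. \<phi> (\<pi> x))) \<and>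
   (\<forall>\<phi>. V.infchr \<phi> \<longrightarrow> (\<forall>x. \<phi> (\<pi> x) = \<phi> x))"
proof (rule V.infchr_projection)
 fix \<pi> assume a: "lin s s \<pi>" and b: "\<And>\<phi>. lin s (smul B) \<phi> \<Longrightarrow> V.infchr (\<lambda>x. \<phi> (\<pi> x))"
  and c: "\<And>\<phi> x. V.infchr \<phi> \<Longrightarrow> \<phi> (\<pi> x) = \<phi> x"
 show ?thesis by (intro exI[of _ \<pi>] conjI allI impI) (rule a, erule b, erule c)
qed

text \<open>Infinitesimal characters are the fixed points of precomposition with
  \<open>\<pi>\<close>, which is a linear operation.\<close>

lemma subspace_IC: "El.vs.subspace IC"
proof (rule El.vs.subspaceI)
 from infchr_projection_ex obtain \<pi> where p: "lin s s \<pi> \<and> (\<forall>\<phi>. lin s (smul B) \<phi> \<longrightarrow> V.infchr (\<lambda>x. \<phi> (\<pi> x))) \<and>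
   (\<forall>\<phi>. V.infchr \<phi> \<longrightarrow> (\<forall>x. \<phi> (\<pi> x) = \<phi> x))" ..
 have \<pi>: "V.infchr (\<lambda>x. \<phi> (\<pi> x))" if "lin s (smul B) \<phi>" for \<phi>
  using p that by simp
 have \<pi>': "\<phi> (\<pi> x) = \<phi> x" if "V.infchr \<phi>" for \<phi> x
  using p that by simp
 have i: "\<phi> \<in> IC" if l: "\<phi> \<in> pts E" and e: "\<And>x. \<phi> (\<pi> x) = \<phi> x" for \<phi>
  using \<pi>[of \<phi>] l unfolding IC_eq pts_E e by simp
 have e: "\<phi> (\<pi> x) = \<phi> x" if "\<phi> \<in> IC" for \<phi> x using \<pi>' that by (simp add: IC_eq)
 show "0 \<in> IC" by (rule i) (use El.zero_pts in auto)
 show "\<phi> + \<psi> \<in> IC" if "\<phi> \<in> IC" "\<psi> \<in> IC" for \<phi> \<psi>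
  by (rule i[OF El.add_pts]) (use that IC_sub e[OF that(1)] e[OF that(2)] in auto)
 show "smul E c \<phi> \<in> IC" if "\<phi> \<in> IC" for c \<phi>
  by (rule i) (use that IC_sub e El.smul_pts[of \<phi> c] in "auto simp: smul_E")
qed

lemma lcs_Fs: "lcs Fs" by (rule lcs_subspace[OF lcs_E subspace_IC])

lemma pts_Fs: "pts Fs = IC" using IC_sub by auto

lemma incl_linear: "cont_linear Fs E (\<lambda>\<phi>. \<phi>)"
proof (rule cont_linearI)
 fix \<phi> assume "\<phi> \<in> pts Fs"
 from limitin_atin_id[OF this] show "tlim E (\<lambda>\<phi>. \<phi>) \<phi> (atin (topol Fs) \<phi>)"
  unfolding tvs_simps limitin_subtopology by blast
qed simp_all

lemma projection:
 obtains P where "cont_linear E Fs P" "\<And>\<phi>. \<phi> \<in> IC \<Longrightarrow> P \<phi> = \<phi>"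
proof -
 from infchr_projection_ex obtain \<pi> where p: "lin s s \<pi> \<and> (\<forall>\<phi>. lin s (smul B) \<phi> \<longrightarrow> V.infchr (\<lambda>x. \<phi> (\<pi> x))) \<and>
   (\<forall>\<phi>. V.infchr \<phi> \<longrightarrow> (\<forall>x. \<phi> (\<pi> x) = \<phi> x))" ..
 have \<pi>: "V.infchr (\<lambda>x. \<phi> (\<pi> x))" if "lin s (smul B) \<phi>" for \<phi>
  using p that by simp
 have \<pi>': "\<phi> (\<pi> x) = \<phi> x" if "V.infchr \<phi>" for \<phi> x
  using p that by simp
 define P where "P \<phi> = (\<lambda>x. \<phi> (\<pi> x))" for \<phi> :: "'h \<Rightarrow> 'b"
 have PI: "P \<phi> \<in> IC" if "\<phi> \<in> pts E" for \<phi> using \<pi> that unfolding IC_eq P_def pts_E by simp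
 have l: "cont_linear E E P"
  unfolding P_def using eval_linear \<pi> by (intro cont_linear_homI) (auto simp: pts_E infchr_lin)
 have "cont_linear E Fs P"
 proof (rule cont_linearI)
  fix \<phi> assume \<phi>: "\<phi> \<in> pts E"
  have "eventually (\<lambda>\<psi>. \<psi> \<in> pts E) (atin (topol E) \<phi>)" by (rule limitin_in_topspace[OF limitin_atin_id[OF \<phi>]])
  then have "eventually (\<lambda>\<psi>. P \<psi> \<in> IC) (atin (topol E) \<phi>)" by eventually_elim (rule PI)
  then show "tlim Fs P (P \<phi>) (atin (topol E) \<phi>)"
   using cont_linear_lim[OF l limitin_atin_id[OF \<phi>]] PI[OF \<phi>] unfolding tvs_simps limitin_subtopology by blast
 qed (use l in "auto simp: cont_linear_def")
 moreover have "P \<phi> = \<phi>" if "\<phi> \<in> IC" for \<phi>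
  unfolding P_def by (rule ext, rule \<pi>') (use that in "simp add: IC_eq")
 ultimately show thesis by (rule that)
qed

text \<open>Composition with a continuous projection onto \<open>IC\<close> restricts the codomain.
  In the real case it also moves the complex extension, whose values may lie elsewhere, into the
  complexified subspace.\<close>

lemma analytic_into_Fs:
 assumes X: "lcs X" and f: "K_analytic_on X E U f" and im: "\<And>x. x \<in> U \<Longrightarrow> f x \<in> IC"
 shows "K_analytic_on X Fs U f"
proof -
 obtain P where P: "cont_linear E Fs P" "\<And>\<phi>. \<phi> \<in> IC \<Longrightarrow> P \<phi> = \<phi>" by (rule projection) blast
 have "K_analytic_on E Fs (pts E) P" by (rule K_entire_imp_analytic[OF lcs_E K_entire_linear[OF lcs_E lcs_Fs P(1)]])
 from K_analytic_on_compose[OF X lcs_E lcs_Fs f this] im IC_sub have "K_analytic_on X Fs U (\<lambda>x. P (f x))" by blast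
 then show ?thesis by (rule K_analytic_on_cong[OF X lcs_Fs]) (rule P(2)[OF im])
qed

lemma analytic_from_Fs:
 assumes Z: "lcs Z" and f: "K_analytic_on E Z U f" shows "K_analytic_on Fs Z (U \<inter> IC) f"
proof -
 have "K_analytic_on Fs E (pts Fs) (\<lambda>\<phi>. \<phi>)" by (rule K_entire_imp_analytic[OF lcs_Fs K_entire_linear[OF lcs_Fs lcs_E incl_linear]])
 moreover have "topen Fs (U \<inter> IC)" using K_analytic_on_open[OF f] by (auto simp: openin_subtopology)
 ultimately have "K_analytic_on Fs E (U \<inter> IC) (\<lambda>\<phi>. \<phi>)"
  by (rule K_analytic_on_subset) (use IC_sub pts_Fs in blast)
 from K_analytic_on_compose[OF lcs_Fs lcs_E Z this f] show ?thesis by simp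
qed

lemma analytic_log: "K_analytic_on E E (pts E) V.log_chart" and analytic_exp: "K_analytic_on E E (pts E) V.exp_chart"
 by (rule K_entire_imp_analytic[OF lcs_E K_entire_log_chart], rule K_entire_imp_analytic[OF lcs_E K_entire_exp_chart])

lemmas smooth_log = K_analytic_on_imp_smooth[OF lcs_E lcs_E analytic_log]
lemmas smooth_exp = K_analytic_on_imp_smooth[OF lcs_E lcs_E analytic_exp]

lemma
 assumes "\<phi> \<in> pts E"
 shows log_pts: "V.log_chart \<phi> \<in> pts E" and exp_pts: "V.exp_chart \<phi> \<in> pts E"
  and log_exp: "V.log_chart (V.exp_chart \<phi>) = \<phi>" and exp_log: "V.exp_chart (V.log_chart \<phi>) = \<phi>"
 using assms V.lin_log_chart V.lin_exp_chart V.log_exp_chart V.exp_log_chart by (auto simp: pts_E)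

lemma mtop_M: "mtop M = subtopology (topol E) (characters s B)" and model_M: "model M = Fs"
 by (simp_all add: character_mfd_def submanifold_def)

lemma characters_sub: "characters s B \<subseteq> pts E" by (auto simp: characters_eq pts_E chr_lin)

lemma topspace_M: "topspace (mtop M) = characters s B"
 using characters_sub by (auto simp: mtop_M)

lemma log_IC: "\<phi> \<in> characters s B \<Longrightarrow> V.log_chart \<phi> \<in> IC" and exp_chr: "\<phi> \<in> IC \<Longrightarrow> V.exp_chart \<phi> \<in> characters s B"
 using V.infchr_log_chart V.chr_exp_chart by (auto simp: IC_eq characters_eq)

lemma log_image: "V.log_chart ` characters s B = IC"
proof
 show "IC \<subseteq> V.log_chart ` characters s B"
 proof
  fix \<phi> assume "\<phi> \<in> IC"
  then show "\<phi> \<in> V.log_chart ` characters s B" using log_exp[of \<phi>] exp_chr IC_sub by (metis image_eqI subsetD)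
 qed
qed (use log_IC in auto)

text \<open>A chart of the inherited atlas restricts an analytic chart \<open>\<kappa>\<close> of
  the ambient space. The change from the global chart to \<open>\<kappa>\<close> is analytic there,
  and \<open>analytic_from_Fs\<close> and \<open>analytic_into_Fs\<close> restrict its domain and
  codomain to infinitesimal characters.\<close>

lemma global: "global_chart M V.log_chart V.exp_chart"
proof (rule global_chart.intro)
 show "lcs (model M)" by (simp add: model_M lcs_Fs)
 have "cont E E V.log_chart" "cont E E V.exp_chart"
  using smooth_on_continuous[OF lcs_E lcs_E smooth_log] smooth_on_continuous[OF lcs_E lcs_E smooth_exp] by (simp_all add: subtopology_topspace)
 then have "continuous_map (subtopology (topol E) (characters s B)) (subtopology (topol E) IC) V.log_chart"
  "continuous_map (subtopology (topol E) IC) (subtopology (topol E) (characters s B)) V.exp_chart"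
  using log_IC exp_chr by (auto simp: continuous_map_in_subtopology intro: continuous_map_from_subtopology)
 then show "homeomorphic_maps (mtop M) (topol (model M)) V.log_chart V.exp_chart"
  by (simp add: homeomorphic_maps_def mtop_M model_M log_exp exp_log)
 have surj: "V.log_chart ` pts E = pts E"
 proof
  show "pts E \<subseteq> V.log_chart ` pts E" using log_exp exp_pts by (metis image_eqI subsetI)
 qed (use log_pts in auto)
 have inj: "inj_on V.log_chart (pts E)" by (rule inj_on_inverseI[of _ V.exp_chart]) (rule exp_log)
 have inv: "inv_into (pts E) V.log_chart \<phi> = V.exp_chart \<phi>" if "\<phi> \<in> pts E" for \<phi>
  using inv_into_f_f[OF inj exp_pts[OF that]] log_exp[OF that] by simp
 have "K_analytic_on E E (pts E) (inv_into (pts E) V.log_chart)"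
  by (rule K_analytic_on_cong[OF lcs_E lcs_E analytic_exp]) (simp add: inv)
 moreover have "V.log_chart ` (pts E \<inter> characters s B) = pts E \<inter> IC"
  using log_image characters_sub IC_sub by (simp add: Int_absorb1)
 ultimately have "(pts E \<inter> characters s B, V.log_chart) \<in> atlas M"
  unfolding character_mfd_def submanifold_def using inj analytic_log surj by (auto intro!: exI[of _ "pts E"])
 then show "(topspace (mtop M), V.log_chart) \<in> atlas M"
  using characters_sub by (simp add: topspace_M Int_absorb1)
 fix W \<kappa> assume "(W, \<kappa>) \<in> atlas M"
 then obtain U where W: "W = U \<inter> characters s B" and inj: "inj_on \<kappa> U" and \<kappa>: "K_analytic_on E E U \<kappa>"
   and \<kappa>i: "K_analytic_on E E (\<kappa> ` U) (inv_into U \<kappa>)" and im: "\<kappa> ` (U \<inter> characters s B) = \<kappa> ` U \<inter> IC"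
  unfolding character_mfd_def submanifold_def by auto
 have U: "topen E U" "U \<subseteq> pts E" using K_analytic_on_open[OF \<kappa>] openin_subset by blast+
 have injW: "inj_on \<kappa> W" using inj W by (auto intro: inj_on_subset)
 let ?U = "{\<phi> \<in> pts E. V.exp_chart \<phi> \<in> U}"
 have "K_analytic_on E E ?U (\<lambda>\<phi>. \<kappa> (V.exp_chart \<phi>))"
  by (rule K_analytic_on_compose[OF lcs_E lcs_E lcs_E K_analytic_on_subset[OF analytic_exp smooth_on_preimage_open[OF lcs_E lcs_E smooth_exp U(1)]] \<kappa>]) auto
 from analytic_from_Fs[OF lcs_E this]
 have "K_analytic_on Fs Fs (?U \<inter> IC) (\<lambda>\<phi>. \<kappa> (V.exp_chart \<phi>))"
  by (rule analytic_into_Fs[OF lcs_Fs]) (use im exp_chr in blast)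
 moreover have "V.log_chart ` W = ?U \<inter> IC"
 proof
  show "V.log_chart ` W \<subseteq> ?U \<inter> IC" using W U(2) log_IC log_pts exp_log by auto
  show "?U \<inter> IC \<subseteq> V.log_chart ` W"
  proof
   fix \<phi> assume \<phi>: "\<phi> \<in> ?U \<inter> IC"
   then have "V.exp_chart \<phi> \<in> W" using W exp_chr by blast
   then show "\<phi> \<in> V.log_chart ` W" using log_exp[of \<phi>] \<phi> by (metis (lifting) IntD1 image_eqI mem_Collect_eq)
  qed
 qed
 \<comment> \<open>The inverse of the restricted chart is the restricted inverse, because
   \<open>\<kappa>\<close> takes \<open>W\<close> onto the part of its image inside
   \<open>IC\<close>.\<close>
 moreover have inv: "inv_into W \<kappa> y = inv_into U \<kappa> y" if "y \<in> \<kappa> ` U \<inter> IC" for y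
 proof -
  have "y \<in> \<kappa> ` W" unfolding W im by (rule that)
  then obtain z where z: "z \<in> W" "y = \<kappa> z" by blast
  then have "z \<in> U" using W by blast
  then show ?thesis unfolding z(2) inv_into_f_f[OF injW z(1)] by (simp add: inv_into_f_f[OF inj])
 qed
 have "K_analytic_on E E (\<kappa> ` U) (\<lambda>y. V.log_chart (inv_into U \<kappa> y))"
  by (rule K_analytic_on_compose[OF lcs_E lcs_E lcs_E \<kappa>i analytic_log]) (use U(2) inv_into_into[of _ \<kappa> U] in blast)
 then have "K_analytic_on Fs E (\<kappa> ` U \<inter> IC) (\<lambda>y. V.log_chart (inv_into U \<kappa> y))" by (rule analytic_from_Fs[OF lcs_E])
 then have "K_analytic_on Fs E (\<kappa> ` U \<inter> IC) (\<lambda>y. V.log_chart (inv_into W \<kappa> y))"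
  by (rule K_analytic_on_cong[OF lcs_Fs lcs_E]) (simp add: inv)
 then have "K_analytic_on Fs Fs (\<kappa> ` U \<inter> IC) (\<lambda>y. V.log_chart (inv_into W \<kappa> y))"
 proof (rule analytic_into_Fs[OF lcs_Fs])
  fix y assume "y \<in> \<kappa> ` U \<inter> IC"
  then have "inv_into W \<kappa> y \<in> W" using im W inv_into_into by metis
  then show "V.log_chart (inv_into W \<kappa> y) \<in> IC" using log_IC W by blast
 qed
 moreover have "\<kappa> ` W = \<kappa> ` U \<inter> IC" using im W by simp
 ultimately show "W \<subseteq> topspace (mtop M) \<and> inj_on \<kappa> W \<and> K_analytic_on (model M) (model M) (V.log_chart ` W) (\<lambda>x. \<kappa> (V.exp_chart x)) \<and>
   K_analytic_on (model M) (model M) (\<kappa> ` W) (\<lambda>y. V.log_chart (inv_into W \<kappa> y))"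
  using W injW by (simp add: model_M topspace_M)
qed

lemma G_simps: "carrier G = characters s B" "mult G = V.conv" "one G = V.unit"
 by (simp_all add: character_group_def convolution_def V.conv_def[abs_def] V.unit_def[abs_def] sw_def fun_eq_iff)

lemma group_G: "group G"
proof (rule groupI)
 fix \<phi> assume "\<phi> \<in> carrier G"
 then have "V.chr \<phi>" by (simp add: G_simps characters_eq)
 then show "\<exists>\<psi>\<in>carrier G. \<psi> \<otimes>\<^bsub>G\<^esub> \<phi> = \<one>\<^bsub>G\<^esub>"
  by (intro bexI[of _ "\<lambda>x. \<phi> (S x)"]) (simp_all add: G_simps characters_eq V.conv_antipode(1) V.chr_antipode)
qed (simp_all add: G_simps characters_eq V.chr_conv V.chr_unit V.conv_assoc V.conv_unit_left chr_lin)

lemma inv_G: "\<phi> \<in> characters s B \<Longrightarrow> inv\<^bsub>G\<^esub> \<phi> = (\<lambda>x. \<phi> (S x))"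
 using group.inv_equality[OF group_G, of "\<lambda>x. \<phi> (S x)" \<phi>] V.conv_antipode(1) V.chr_antipode
 by (simp add: G_simps characters_eq)

lemma global_group: "global_chart_group M V.log_chart V.exp_chart G"
proof (intro global_chart_group.intro global global_chart_group_axioms.intro)
 show "group G" by (rule group_G)
 show "carrier G = topspace (mtop M)" by (simp add: G_simps topspace_M)
 note l = lcs_prod[OF lcs_E lcs_E] lcs_prod[OF lcs_Fs lcs_Fs]
 have pI: "pts E \<inter> IC = IC" using IC_sub by blast
 have exp: "K_analytic_on Fs E IC V.exp_chart" using analytic_from_Fs[OF lcs_E analytic_exp] unfolding pI .
 have "K_analytic_on (prod_tvs Fs Fs) E (IC \<times> IC) (\<lambda>p. V.conv (V.exp_chart (fst p)) (V.exp_chart (snd p)))"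
  using K_analytic_on_compose[OF l(2,1) lcs_E K_analytic_on_map_prod[OF lcs_Fs lcs_Fs lcs_E lcs_E exp exp]
    K_entire_imp_analytic[OF l(1) K_entire_mult]] IC_sub exp_pts by fastforce
 from K_analytic_on_compose[OF l(2) lcs_E lcs_E this analytic_log]
 have "K_analytic_on (prod_tvs Fs Fs) E (IC \<times> IC) (\<lambda>p. V.log_chart (V.conv (V.exp_chart (fst p)) (V.exp_chart (snd p))))"
  using exp_chr V.chr_conv by (fastforce simp: characters_eq pts_E chr_lin)
 then have "K_analytic_on (prod_tvs Fs Fs) Fs (IC \<times> IC) (\<lambda>p. V.log_chart (V.conv (V.exp_chart (fst p)) (V.exp_chart (snd p))))"
  by (rule analytic_into_Fs[OF l(2)]) (use exp_chr V.chr_conv log_IC in "auto simp: characters_eq")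
 moreover have "pts (prod_tvs Fs Fs) = IC \<times> IC" using pts_Fs by simp
 ultimately show "K_analytic_on (prod_tvs (model M) (model M)) (model M) (pts (prod_tvs (model M) (model M)))
   (\<lambda>p. V.log_chart (V.exp_chart (fst p) \<otimes>\<^bsub>G\<^esub> V.exp_chart (snd p)))"
  by (simp only: model_M G_simps)
 have "cont_linear E E (\<lambda>\<phi> x. \<phi> (S x))"
  by (rule cont_linear_homI) (simp_all add: pts_E V.lin_antipode_comp eval_linear)
 then have "K_analytic_on E E (pts E) (\<lambda>\<phi> x. \<phi> (S x))" by (intro K_entire_imp_analytic K_entire_linear lcs_E)
 from K_analytic_on_compose[OF lcs_Fs lcs_E lcs_E exp this]
 have "K_analytic_on Fs E IC (\<lambda>\<phi> x. V.exp_chart \<phi> (S x))" using exp_pts IC_sub by blast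
 from K_analytic_on_compose[OF lcs_Fs lcs_E lcs_E this analytic_log]
 have "K_analytic_on Fs E IC (\<lambda>\<phi>. V.log_chart (\<lambda>x. V.exp_chart \<phi> (S x)))"
  using exp_chr V.chr_antipode by (fastforce simp: characters_eq pts_E chr_lin)
 then have "K_analytic_on Fs E IC (\<lambda>\<phi>. V.log_chart (inv\<^bsub>G\<^esub> (V.exp_chart \<phi>)))"
  by (rule K_analytic_on_cong[OF lcs_Fs lcs_E]) (simp add: inv_G exp_chr)
 then have "K_analytic_on Fs Fs IC (\<lambda>\<phi>. V.log_chart (inv\<^bsub>G\<^esub> (V.exp_chart \<phi>)))"
  by (rule analytic_into_Fs[OF lcs_Fs]) (use exp_chr log_IC V.chr_antipode in "auto simp: inv_G characters_eq")
 then show "K_analytic_on (model M) (model M) (pts (model M)) (\<lambda>x. V.log_chart (inv\<^bsub>G\<^esub> (V.exp_chart x)))"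
  by (simp only: model_M pts_Fs)
qed

sublocale L: global_chart_group M V.log_chart V.exp_chart G by (rule global_group)

lemma exp_chart_0: "V.exp_chart 0 = V.unit"
proof -
 have l: "lin s (smul B) (\<lambda>x. 0)" by (rule Bl.vs.lin_zero_fun)
 have "V.T_exp (\<lambda>x. 0) V.unit = V.unit"
  by (rule ext) (simp add: V.T_exp_def V.conv_unit_left[OF l])
 from V.fix_exp(3)[OF l V.lin_unit this] show ?thesis
  by (simp add: V.exp_chart_def fun_eq_iff zero_fun_def)
qed

lemma log_unit: "V.log_chart V.unit = 0"
 using log_exp[OF El.zero_pts] by (simp add: exp_chart_0)

text \<open>In the ambient space left translation is the continuous linear map
  \<open>conv \<phi>\<close>, and the inverse chart has the identity as differential at 0; so
  \<open>\<phi>.v\<close> is \<open>conv \<phi> v\<close> seen through the chart. The first formula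
  serves the existence of evolutions, the second their uniqueness.\<close>

lemma left_conv:
 assumes \<phi>: "V.chr \<phi>" and v: "v \<in> IC"
 shows "L.left \<phi> v = dir_deriv E E V.log_chart \<phi> (V.conv \<phi> v)"
  and "dir_deriv E E V.exp_chart (V.log_chart \<phi>) (L.left \<phi> v) = V.conv \<phi> v"
proof -
 interpret EE: lcs2 E E by (simp add: lcs2_def lcs_E)
 interpret FF: lcs2 Fs Fs by (simp add: lcs2_def lcs_Fs)
 have \<phi>l: "lin s (smul B) \<phi>" "\<phi> \<in> pts E" using chr_lin[OF \<phi>] by (simp_all add: pts_E)
 have vE: "v \<in> pts E" using v IC_sub by blast
 have "cont_linear E B (\<lambda>\<psi>. V.conv \<phi> \<psi> x)" for x
 proof (rule cont_linearI)
  fix \<psi> assume \<psi>: "\<psi> \<in> pts E"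
  show "tlim B (\<lambda>\<psi>. V.conv \<phi> \<psi> x) (V.conv \<phi> \<psi> x) (atin (topol E) \<psi>)"
   unfolding V.conv_def sw_def lin_ext_def case_prod_beta'
   using limitin_atin_id[OF \<psi>] unfolding lim_E
   by (intro Bl.lim_sum Bl.lim_smul tendsto_const cont_bilinear_lim[OF mult_B]) auto
 qed (simp_all add: smul_E V.conv_add_right V.conv_scale_right plus_fun_def)
 then have lin: "cont_linear E E (V.conv \<phi>)"
  by (intro cont_linear_homI) (simp_all add: pts_E V.lin_conv \<phi>l)
 have unit: "V.conv \<phi> (V.exp_chart 0) = \<phi>" by (simp add: exp_chart_0 V.conv_unit_right \<phi>l)
 have "has_dir_deriv E E (\<lambda>\<psi>. V.conv \<phi> (V.exp_chart \<psi>)) 0 v (dir_deriv E E (V.conv \<phi>) (V.exp_chart 0) v)"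
  by (rule EE.has_dir_deriv_compose[OF EE.smooth_on_linear[OF lin] exp_chart_deriv[OF vE]]) (rule exp_pts[OF El.zero_pts])
 then have h: "has_dir_deriv E E (\<lambda>\<psi>. V.conv \<phi> (V.exp_chart \<psi>)) 0 v (V.conv \<phi> v)"
  using EE.dir_deriv_eq[OF EE.has_dir_deriv_linear[OF lin exp_pts[OF El.zero_pts] vE]] by simp
 have k: "has_dir_deriv E E (\<lambda>\<psi>. V.log_chart (V.conv \<phi> (V.exp_chart \<psi>))) 0 v (dir_deriv E E V.log_chart \<phi> (V.conv \<phi> v))"
  using EE.has_dir_deriv_compose[OF smooth_log h] unfolding unit by (simp add: \<phi>l)
 have \<phi>N: "\<phi> \<in> topspace (mtop M)" using \<phi> by (simp add: topspace_M characters_eq)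
 have z: "0 \<in> IC" using El.vs.subspace_0[OF subspace_IC] .
 have "has_dir_deriv Fs Fs (\<lambda>\<psi>. V.log_chart (V.conv \<phi> (V.exp_chart \<psi>))) 0 v (L.left \<phi> v)"
  using FF.smooth_has_dir_deriv[OF L.left_mult_smooth[OF \<phi>N, unfolded model_M G_simps pts_Fs] z, of v] v IC_sub
  unfolding L.left_def model_M G_simps log_unit by auto
 \<comment> \<open>Convergence in the subspace implies convergence in the ambient space, where the
   two derivatives can be compared.\<close>
 then have k': "has_dir_deriv E E (\<lambda>\<psi>. V.log_chart (V.conv \<phi> (V.exp_chart \<psi>))) 0 v (L.left \<phi> v)"
  unfolding has_dir_deriv_def tvs_simps limitin_subtopology by blast
 show "L.left \<phi> v = dir_deriv E E V.log_chart \<phi> (V.conv \<phi> v)" by (rule EE.has_dir_deriv_unique[OF k' k])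
 have "has_dir_deriv E E (\<lambda>\<psi>. V.exp_chart (V.log_chart (V.conv \<phi> (V.exp_chart \<psi>)))) 0 v
   (dir_deriv E E V.exp_chart (V.log_chart \<phi>) (L.left \<phi> v))"
  using EE.has_dir_deriv_compose[OF smooth_exp k'] unfolding unit by (simp add: log_pts \<phi>l)
 then have "has_dir_deriv E E (\<lambda>\<psi>. V.conv \<phi> (V.exp_chart \<psi>)) 0 v
   (dir_deriv E E V.exp_chart (V.log_chart \<phi>) (L.left \<phi> v))"
  by (rule EE.has_dir_deriv_transform[OF openin_topspace El.zero_pts vE, rotated])
   (rule exp_log[OF cont_linear_pts[OF lin exp_pts]])
 from EE.has_dir_deriv_unique[OF this h]
 show "dir_deriv E E V.exp_chart (V.log_chart \<phi>) (L.left \<phi> v) = V.conv \<phi> v" .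
qed

text \<open>Convergence in the space of linear maps is pointwise; that the pointwise limit is again
  linear is \<open>lin_closed\<close>.\<close>

lemma has_curve_deriv_E:
 assumes l: "\<And>t. t \<in> {0..1} \<Longrightarrow> lin s (smul B) (c t)" and t: "t \<in> {0..1}"
  and d: "\<And>x. deriv01 B (\<lambda>s. c s x) t (y x)"
 shows "deriv01 E c t y"
proof -
 have "eventually (\<lambda>s. s \<in> {0..1}) (at t within {0..1})" by (simp add: eventually_at_filter)
 then have ev: "eventually (\<lambda>\<tau>. lin s (smul B) (smul E (of_real (inverse (\<tau> - t))) (c \<tau> - c t))) (at t within {0..1})"
 proof eventually_elim
  case (elim \<tau>)
  have "c \<tau> \<in> pts E" "c t \<in> pts E" using l elim t by (simp_all add: pts_E)
  then have "smul E (of_real (inverse (\<tau> - t))) (c \<tau> - c t) \<in> pts E" by (intro El.smul_pts El.diff_pts)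
  then show ?case by (simp add: pts_E)
 qed
 have lim: "tlim B (\<lambda>\<tau>. smul E (of_real (inverse (\<tau> - t))) (c \<tau> - c t) x) (y x) (at t within {0..1})" for x
  using d[of x] by (simp add: has_curve_deriv_def smul_E)
 have "at t within {0..1} \<noteq> bot" using curve_domain_Icc t unfolding curve_domain_def by blast
 from lin_closed[OF ev lim this] show ?thesis unfolding has_curve_deriv_def lim_E using ev lim by blast
qed

end

section \<open>Evolution of a curve in the Lie algebra\<close>

context char_int
begin

abbreviation "TS \<equiv> lie_algebra_space G M"
abbreviation "X \<equiv> Cr_curve_space TS r"

lemma lcs_TS: "lcs TS" by (rule L.lcs_tangent)

lemma lcs_X: "lcs X" by (rule lcs_curve_space[OF lcs_TS])

lemma pts_X: "pts X = Cr_curves TS r"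
 using lcs_TS by (simp add: lcs_def pts_Cr_curve_space)

text \<open>The tangent vectors are read in the global chart, where they are infinitesimal
  characters, and the curve is transposed to the shape used in \<open>admissible\<close>.\<close>

definition coords :: "(real \<Rightarrow> ('h \<Rightarrow> 'b, 'h \<Rightarrow> 'b) chart \<Rightarrow> 'h \<Rightarrow> 'b) \<Rightarrow> 'h \<Rightarrow> real \<Rightarrow> 'b" where
 "coords \<gamma> x t = \<gamma> t L.c0 x"

lemma coords_linear: "cont_linear X CB (\<lambda>\<gamma>. coords \<gamma> x)"
proof -
 have c: "cont_linear TS Fs (\<lambda>v. v L.c0)" using L.cont_linear_coord by (simp only: model_M)
 have "cont_linear TS B (\<lambda>v. v L.c0 x)"
 proof (rule cont_linearI)
  fix v assume "v \<in> pts TS"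
  from cont_linear_lim[OF eval_linear cont_linear_lim[OF incl_linear cont_linear_lim[OF c limitin_atin_id[OF this]]]]
  show "tlim B (\<lambda>v. v L.c0 x) (v L.c0 x) (atin (topol TS) v)" .
 qed (simp_all add: tangent_space_def model_M smul_E)
 from cont_linear_curves[OF lcs_TS Bl.lcs_axioms this, of r] show ?thesis unfolding coords_def[abs_def] .
qed

context
 fixes \<gamma> assumes \<gamma>: "\<gamma> \<in> pts X"
begin

lemma curve_tangent: "\<gamma> t \<in> tangent_vectors M \<one>\<^bsub>G\<^esub>"
proof -
 interpret T: lcs TS by (rule lcs_TS)
 show ?thesis using T.Cr_curves_pts[of \<gamma> r t] \<gamma> unfolding pts_X L.pts_tangent .
qed

lemma curve_coord: "\<gamma> t L.c0 \<in> IC"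
 using L.tangent_coord_pts[OF curve_tangent, of t L.c0] by (simp only: model_M pts_Fs)

lemma coords_admissible: "admissible (coords \<gamma>)"
 unfolding admissible_def
proof (intro conjI ballI)
 have "lin s (smul B) (\<gamma> t L.c0)" for t using curve_coord[of t] by (simp add: IC_eq infchr_lin)
 then show "lin s cs (coords \<gamma>)" by (simp add: lin_def coords_def fun_eq_iff)
 show "range (coords \<gamma>) \<subseteq> A" using cont_linear_pts[OF coords_linear \<gamma>] unfolding pts_CB by blast
 show "V.infchr (\<lambda>x. coords \<gamma> x t)" for t using curve_coord[of t] by (simp add: IC_eq coords_def)
qed

abbreviation "sl \<equiv> \<lambda>t x. sol (coords \<gamma>) x t"

lemma sl_chr: "t \<in> {0..1} \<Longrightarrow> V.chr (sl t)" by (rule sol_chr[OF coords_admissible])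

lemma sl_deriv: "t \<in> {0..1} \<Longrightarrow> deriv01 E sl t (V.conv (sl t) (\<gamma> t L.c0))"
 by (rule has_curve_deriv_E)
  (use lin_sol[OF coords_admissible] sol_deriv[OF coords_admissible] in "simp_all add: coords_def")

text \<open>Evaluated at \<open>x\<close>, the derivative of the solution is a convolution curve
  that lies in \<open>Cr_curves\<close>; it supplies the further derivatives up to order
  \<open>r\<close>.\<close>

lemma sl_Cr: "Cr_curve E (r + 1) {0..1} sl"
proof -
 let ?c = "\<lambda>x. W.conv (sol (coords \<gamma>)) (coords \<gamma>) x"
 have cA: "?c x \<in> A" for x by (rule conv_sol_A[OF coords_admissible])
 \<comment> \<open>The derivative of order \<open>Suc j\<close> of the solution is the one of order
   \<open>j\<close> of the convolution curve.\<close>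
 define C where "C k = (\<lambda>t x. if k = 0 then sol (coords \<gamma>) x t else iter_curve_deriv B {0..1} (k - 1) (?c x) t)" for k :: nat
 have suc: "enat (Suc k) \<le> r + 1 \<longleftrightarrow> enat k \<le> r" "enat (Suc k) < r + 1 \<longleftrightarrow> enat k < r" for k
  by (cases r; simp add: one_enat_def)+
 have d: "deriv01 B (\<lambda>s. C k s x) t (C (Suc k) t x)" if k: "enat k < r + 1" and t: "t \<in> {0..1}" for k t x
 proof (cases k)
  case 0
  then show ?thesis using sol_deriv[OF coords_admissible t, of x] by (simp add: C_def Bl.iter_curve_deriv_0 conv_eval)
 next
  case (Suc j)
  then show ?thesis using Bl.Cr_curves_deriv[OF cA, of j t x] k t suc(2) by (simp add: C_def)
 qed
 have l: "\<forall>t\<in>{0..1}. lin s (smul B) (C k t)" if "enat k \<le> r + 1" for k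
  using that
 proof (induction k)
  case 0 show ?case using lin_sol[OF coords_admissible] by (simp add: C_def)
 next
  case (Suc k)
  have k: "enat k < r + 1" "enat k \<le> r + 1" using Suc.prems by (simp_all add: Suc_ile_eq order_less_imp_le)
  show ?case
  proof
   fix t :: real assume t: "t \<in> {0..1}"
   have "deriv01 E (C k) t (C (Suc k) t)"
    by (rule has_curve_deriv_E[OF _ t d[OF k(1) t]]) (use Suc.IH[OF k(2)] in blast)
   then have "C (Suc k) t \<in> pts E" unfolding has_curve_deriv_def by (rule limitin_topspace)
   then show "lin s (smul B) (C (Suc k) t)" by (simp add: pts_E)
  qed
 qed
 show ?thesis
 proof (rule El.Cr_curve_family(1)[OF curve_domain_Icc, where C = C])
  show "C 0 t = sl t" for t by (simp add: C_def)
  show "deriv01 E (C k) t (C (Suc k) t)" if "enat k < r + 1" "t \<in> {0..1}" for k t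
   by (rule has_curve_deriv_E[OF _ that(2) d[OF that]]) (use l[of k] that(1) in "simp add: order_less_imp_le")
  show "cont01 E (C k)" if k: "enat k \<le> r + 1" for k
   unfolding continuous_map_top_of_set_iff lim_E
  proof (intro ballI conjI allI)
   fix t :: real and x assume t: "t \<in> {0..1}"
   show "lin s (smul B) (C k t)" using l[OF k] t by blast
   have "eventually (\<lambda>s. s \<in> {0..1}) (at t within {0..1})" by (simp add: eventually_at_filter)
   then show "eventually (\<lambda>u. lin s (smul B) (C k u)) (at t within {0..1})"
    by eventually_elim (use l[OF k] in blast)
   have "cont01 B (\<lambda>t. C k t x)"
   proof (cases k)
    case 0
    have "sol (coords \<gamma>) x \<in> A" using sol(2)[OF coords_admissible] by blast
    from Bl.Cr_curves_cont[OF this, of 0] show ?thesis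
     by (simp add: C_def 0 Bl.iter_curve_deriv_0 flip: zero_enat_def)
   next
    case (Suc j)
    then show ?thesis using Bl.Cr_curves_cont[OF cA, of j x] k suc(1) by (simp add: C_def)
   qed
   then show "tlim B (\<lambda>t. C k t x) (C k t x) (at t within {0..1})"
    unfolding continuous_map_top_of_set_iff using t by blast
  qed
 qed
qed

lemma r_le: "r + 1 \<le> enat 2"
 using I.r by (auto simp: one_enat_def zero_enat_def)

lemma evolution_exists: "is_evolution G M r \<gamma> (restrict sl {0..1})"
proof (rule L.evolution_intro[OF restrict_extensional r_le])
 obtain P where P: "cont_linear E Fs P" "\<And>\<phi>. \<phi> \<in> IC \<Longrightarrow> P \<phi> = \<phi>" by (rule projection) blast
 interpret EE: lcs2 E E by (simp add: lcs2_def lcs_E)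
 interpret EF: lcs2 E Fs by (simp add: lcs2_def lcs_E lcs_Fs)
 have chr: "sl t \<in> characters s B" if "t \<in> {0..1}" for t using sl_chr[OF that] by (simp add: characters_eq)
 have slE: "sl t \<in> pts E" for t using lin_sol[OF coords_admissible] by (simp add: pts_E)
 \<comment> \<open>The chart is smooth into the ambient space; the projection \<open>P\<close> does
   not change its values on characters and carries the curve and its derivatives into the model
   space.\<close>
 have eq: "P (V.log_chart (sl t)) = V.log_chart (restrict sl {0..1} t)" if "t \<in> {0..1}" for t
  using that P(2)[OF log_IC[OF chr[OF that]]] by simp
 note C1 = EE.Cr_curve_compose[OF smooth_log sl_Cr curve_domain_Icc slE r_le]
 note C2 = EF.Cr_curve_compose[OF EF.smooth_on_linear[OF P(1)] C1 curve_domain_Icc log_pts[OF slE] r_le]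
 show "Cr_curve (model M) (r + 1) {0..1} (\<lambda>t. V.log_chart (restrict sl {0..1} t))"
  unfolding model_M by (rule lcs.Cr_curve_cong[OF lcs_Fs curve_domain_Icc C2]) (rule eq)
 show "restrict sl {0..1} t \<in> topspace (mtop M)" if "t \<in> {0..1}" for t
  using chr[OF that] that by (simp add: topspace_M)
 show "restrict sl {0..1} 0 = \<one>\<^bsub>G\<^esub>" by (simp add: G_simps sol_0[OF coords_admissible] V.unit_def fun_eq_iff)
 show "\<gamma> t \<in> tangent_vectors M \<one>\<^bsub>G\<^esub>" for t by (rule curve_tangent)
 fix t :: real assume t: "t \<in> {0..1}"
 let ?w = "L.left (sl t) (\<gamma> t L.c0)"
 have w: "?w \<in> IC"
  using L.left_pts[of "sl t" "\<gamma> t L.c0"] chr[OF t] curve_coord[of t] unfolding topspace_M model_M pts_Fs by blast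
 have "deriv01 E (\<lambda>u. V.log_chart (sl u)) t ?w"
  unfolding left_conv(1)[OF sl_chr[OF t] curve_coord] by (rule EE.curve_compose_deriv[OF smooth_log sl_deriv[OF t] slE])
 from EF.curve_compose_deriv[OF EF.smooth_on_linear[OF P(1)] this log_pts[OF slE]]
 have "deriv01 Fs (\<lambda>u. P (V.log_chart (sl u))) t ?w"
  using EF.dir_deriv_eq[OF EF.has_dir_deriv_linear[OF P(1) log_pts[OF slE], of ?w t]] P(2)[OF w] w IC_sub by auto
 moreover have "deriv01 Fs (\<lambda>u. P (V.log_chart (sl u))) t ?w \<longleftrightarrow>
   deriv01 Fs (\<lambda>u. V.log_chart (restrict sl {0..1} u)) t ?w"
  by (rule has_curve_deriv_cong[OF _ t]) (rule eq)
 ultimately show "deriv01 (model M) (\<lambda>u. V.log_chart (restrict sl {0..1} u)) t (L.left (restrict sl {0..1} t) (\<gamma> t L.c0))"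
  using t by (simp only: model_M restrict_apply if_True)
qed

text \<open>The inverse chart turns a competing evolution into a curve of linear maps that satisfies
  \<open>\<eta>' = \<eta> \<star> \<gamma>\<close> in the ambient space, to which
  \<open>sol_unique\<close> applies.\<close>

lemma evolution_unique: "is_evolution G M r \<gamma> \<eta> \<Longrightarrow> \<eta> = restrict sl {0..1}"
proof -
 assume e: "is_evolution G M r \<gamma> \<eta>"
 interpret EE: lcs2 E E by (simp add: lcs2_def lcs_E)
 have chr: "V.chr (\<eta> t)" if "t \<in> {0..1}" for t
  using L.evolution_elim(1)[OF e curve_tangent that] by (simp add: topspace_M characters_eq)
 have lE: "\<eta> t \<in> pts E" if "t \<in> {0..1}" for t using chr_lin[OF chr[OF that]] by (simp add: pts_E)
 have d: "deriv01 E \<eta> t (V.conv (\<eta> t) (\<gamma> t L.c0))" if t: "t \<in> {0..1}" for t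
 proof -
  have "deriv01 Fs (\<lambda>u. V.log_chart (\<eta> u)) t (L.left (\<eta> t) (\<gamma> t L.c0))"
   using L.evolution_elim(2)[OF e curve_tangent t] by (simp only: model_M)
  then have "deriv01 E (\<lambda>u. V.log_chart (\<eta> u)) t (L.left (\<eta> t) (\<gamma> t L.c0))"
   unfolding has_curve_deriv_def tvs_simps limitin_subtopology by blast
  from EE.curve_compose_deriv[OF smooth_exp this log_pts[OF lE[OF t]]]
  have "deriv01 E (\<lambda>u. V.exp_chart (V.log_chart (\<eta> u))) t (V.conv (\<eta> t) (\<gamma> t L.c0))"
   unfolding left_conv(2)[OF chr[OF t] curve_coord] .
  moreover have "deriv01 E (\<lambda>u. V.exp_chart (V.log_chart (\<eta> u))) t (V.conv (\<eta> t) (\<gamma> t L.c0)) \<longleftrightarrow>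
    deriv01 E \<eta> t (V.conv (\<eta> t) (\<gamma> t L.c0))"
   by (rule has_curve_deriv_cong[OF _ t]) (rule exp_log[OF lE])
  ultimately show ?thesis by (simp only:)
 qed
 have sol: "\<eta> t x = sol (coords \<gamma>) x t" if t: "t \<in> {0..1}" for t x
 proof (rule sol_unique[OF coords_admissible])
  show "lin s (smul B) (\<eta> t)" if "t \<in> {0..1}" for t by (rule chr_lin[OF chr[OF that]])
  have "\<eta> 0 = V.unit" using e by (simp add: is_evolution_def G_simps)
  then show "\<eta> 0 x = smul B (\<epsilon> x) 1" for x by (simp add: V.unit_def)
  show "deriv01 B (\<lambda>t. \<eta> t x) t (V.conv (\<eta> t) (\<lambda>b. coords \<gamma> b t) x)" if "t \<in> {0..1}" for t x
   using d[OF that] unfolding has_curve_deriv_def lim_E coords_def by (simp add: smul_E)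
 qed (rule t)
 have "\<eta> \<in> extensional {0..1}" using e by (simp add: is_evolution_def)
 then show ?thesis by (rule extensionalityI[OF _ restrict_extensional]) (simp add: sol fun_eq_iff)
qed

lemma evolution_ex1: "\<exists>!\<eta>. is_evolution G M r \<gamma> \<eta>"
 using evolution_exists evolution_unique by blast

lemma evol_eq: "evol G M r \<gamma> = (\<lambda>x. sol (coords \<gamma>) x 1)"
proof -
 have "Evol G M r \<gamma> = restrict sl {0..1}"
  unfolding Evol_def by (rule the_equality) (rule evolution_exists, erule evolution_unique)
 then show ?thesis by (simp add: evol_def)
qed

end

theorem regular: "Cr_regular_lie_group G M r \<and> K_analytic_evol G M r"
proof -
 have sol: "K_entire X E (\<lambda>\<gamma> x. sol (coords \<gamma>) x 1)"
  by (rule K_entire_sol[OF lcs_X coords_linear coords_admissible])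
 have "K_analytic_on X E (pts X) (\<lambda>\<gamma>. V.log_chart (\<lambda>x. sol (coords \<gamma>) x 1))"
  by (rule K_entire_imp_analytic[OF lcs_X K_entire_compose[OF lcs_X lcs_E lcs_E sol K_entire_log_chart]])
 then have "K_analytic_on X E (pts X) (\<lambda>\<gamma>. V.log_chart (evol G M r (id \<gamma>)))"
  by (rule K_analytic_on_cong[OF lcs_X lcs_E]) (simp add: evol_eq)
 then have an: "K_analytic_on X Fs (pts X) (\<lambda>\<gamma>. V.log_chart (evol G M r (id \<gamma>)))"
  by (rule analytic_into_Fs[OF lcs_X]) (simp add: evol_eq log_IC characters_eq sl_chr)
 have an': "K_analytic_on (model (tvs_mfd X)) (model M) (pts (model (tvs_mfd X))) (\<lambda>\<gamma>. V.log_chart (evol G M r (id \<gamma>)))"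
  using an by (simp only: tvs_mfd_def mfd.simps model_M)
 have N: "evol G M r \<gamma> \<in> topspace (mtop M)" if "\<gamma> \<in> topspace (mtop (tvs_mfd X))" for \<gamma>
  using that by (simp add: tvs_mfd_def evol_eq topspace_M characters_eq sl_chr)
 note maps = global_chart_maps[OF global_chart_tvs[OF lcs_X] global an' N]
 show ?thesis
  unfolding Cr_regular_lie_group_def K_analytic_evol_def
  using L.lie_group evolution_ex1 maps by blast
qed

end

theorem theorem2p10:
  fixes s :: "'k::real_or_complex_field \<Rightarrow> 'h::{ring, monoid_mult} \<Rightarrow> 'h"
    and \<Delta> :: "'h \<Rightarrow> ('h \<times> 'h \<Rightarrow>\<^sub>0 'k)"
    and \<epsilon> :: "'h \<Rightarrow> 'k"
    and S :: "'h \<Rightarrow> 'h"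
    and gr :: "nat \<Rightarrow> 'h set"
    and B :: "('k, 'b::{comm_ring, comm_monoid_mult}) tvs"
  assumes "graded_connected_hopf_algebra s \<Delta> \<epsilon> S gr"
    and "locally_convex_algebra B"
    and "mackey_complete B"
  shows "(Cr_regular_lie_group (character_group s \<Delta> \<epsilon> B) (character_mfd s \<epsilon> B) 1 \<and>
          K_analytic_evol (character_group s \<Delta> \<epsilon> B) (character_mfd s \<epsilon> B) 1) \<and>
         (sequentially_complete B \<longrightarrow>
          Cr_regular_lie_group (character_group s \<Delta> \<epsilon> B) (character_mfd s \<epsilon> B) 0 \<and>
          K_analytic_evol (character_group s \<Delta> \<epsilon> B) (character_mfd s \<epsilon> B) 0)"
proof -
  interpret char_setting s \<Delta> \<epsilon> S gr B
    by (intro char_setting.intro char_setting_axioms.intro assms)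
  \<comment> \<open>Elements of \<open>Cr_curves B 1\<close> have a continuous derivative, whose
    bounded hull controls the Mackey-Cauchy estimate.\<close>
  have 1: "int_space B 1"
  proof (intro int_space.intro int_space_axioms.intro Bl.lcs_axioms)
    fix c assume c: "c \<in> Cr_curves B 1"
    have 0: "continuous_map (top_of_set {0..1}) (topol B) c"
      using Bl.Cr_curves_cont[OF c, of 0] by (simp add: enat_le_01 Bl.iter_curve_deriv_0)
    have 1: "continuous_map (top_of_set {0..1}) (topol B) (iter_curve_deriv B {0..1} 1 c)"
      by (rule Bl.Cr_curves_cont[OF c]) (simp add: enat_le_01)
    have d: "has_curve_deriv B {0..1} c t (iter_curve_deriv B {0..1} 1 c t)" if "t \<in> {0..1}" for t
      using Bl.Cr_curves_deriv[OF c _ that, of 0] by (simp add: enat_le_01 Bl.iter_curve_deriv_0)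
    show "\<exists>P. \<forall>t\<in>{0..1}. has_curve_deriv B {0..1} P t (c t) \<and> P t \<in> pts B"
      by (rule Bl.primitive_mackey_complete[OF assms(3) 0 1 d])
  qed simp
  have 0: "int_space B 0" if sc: "sequentially_complete B"
  proof (intro int_space.intro int_space_axioms.intro Bl.lcs_axioms)
    fix c assume c: "c \<in> Cr_curves B 0"
    have "continuous_map (top_of_set {0..1}) (topol B) c"
      using Bl.Cr_curves_cont[OF c, of 0] by (simp add: enat_le_01 Bl.iter_curve_deriv_0)
    then show "\<exists>P. \<forall>t\<in>{0..1}. has_curve_deriv B {0..1} P t (c t) \<and> P t \<in> pts B"
      by (rule Bl.primitive_sequentially_complete[OF sc])
  qed simp
  show ?thesis
    using char_int.regular[OF char_int.intro[OF char_setting_axioms char_int_axioms.intro[OF 1]]]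
      char_int.regular[OF char_int.intro[OF char_setting_axioms char_int_axioms.intro[OF 0]]] by blast
qed

end
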